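(* Let $f,g_1,\dots,g_l\in\mathbb{R}[x]$, $x=(x_1,\dots,x_n)$, $l\le n-1$, let $S=\{x\in\mathbb{R}^n: g_1(x)=\dots=g_l(x)=0\}$, and let $x^*\in S$ be an isolated KKT point of $f$ on $S$ that is not an isolated point of $S$ and at which (LICQ) holds. Then the algorithm Type$(f,g_1,\dots,g_l,x^* )$ described in the context runs successfully and is correct, i.e.: (a) there is a nonempty Zariski open set $\mathcal{E}\subset\mathbb{C}^{n\times n}$ of invertible matrices such that, for every $A\in\mathcal{E}\cap\mathbb{R}^{n\times n}$, after the linear change of coordinates by $A$ in Step 1 the new data satisfy $\dim(\mathcal{I}_\Gamma)=1$ or $\dim(\mathcal{G})=1$, so that Step 1 terminates for a generic change of coordinates; (b) numbers $R_1>0$ and $R_2>0$ as required in Steps 2 and 3 exist; (c) for every admissible choice of $R_1,R_2$ and $r$ in Steps 2–4, one of the three alternatives of Step 5 holds and the value returned in Step 5 is the type of $x^*$ as a KKT point of $f$ over $S$. In particular, any positive real number $r<\min\{R_1,R_2\}$ is a faithful radius of $x^*$ and satisfies Condition C (stated in the context) with $\mathscr{R}=r$, for the data obtained after Step 1.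
   Context: Notation. $\mathbb{B}_R(x^* )$: closed Euclidean ball with center $x^*$ and radius $R$; ${\sf int}$ denotes interior; $\mathbb{S}_R(x^* )=\{x\in\mathbb{R}^n:\|x-x^*\|^2=R^2\}$. (LICQ) at $x\in S$: $\nabla g_1(x),\dots,\nabla g_l(x)$ are linearly independent. $\Sigma(f,S)=\{x\in S:\exists\lambda_i\in\mathbb{R},\ \nabla f(x)=\sum_i\lambda_i\nabla g_i(x)\}$ is the set of KKT points; $x^*$ is an isolated KKT point if it is an isolated point of $\Sigma(f,S)$. $\Gamma(f,S,x^* )$ is the set of $x\in S$ for which there are real $\kappa,\lambda_i,\mu$, not all zero, with $\kappa\nabla f(x)-\sum_{i=1}^l\lambda_i\nabla g_i(x)-\mu(x-x^* )=0$. The type of $x^*$ is: local minimizer of $f$ on $S$; local maximizer of $f$ on $S$; or not an extremum point (every neighborhood $U$ of $x^*$ contains $u,v\in S\cap U$ with $f(u)<f(x^* )<f(v)$). For an ideal $I\subseteq\mathbb{R}[x]$, $\mathbf{V}_{\mathbb{C}}(I)$ and $\mathbf{V}_{\mathbb{R}}(I)$ are its zero sets in $\mathbb{C}^n$ and $\mathbb{R}^n$, and $\dim(I)$ is its Hilbert dimension (degree of the affine Hilbert polynomial). For $V\subseteq\mathbb{C}^n$, $\mathbf{I}(V)\subseteq\mathbb{R}[x]$ is the ideal of polynomials in $\mathbb{R}[x]$ vanishing on $V$, and $\overline{V}^{\mathcal{Z}}=\mathbf{V}_{\mathbb{C}}(\mathbf{I}(V))$ is the Zariski closure. Ideals. $\mathcal{I}_\Sigma$: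 generated by $g_1,\dots,g_l$ and the maximal minors of $[\nabla f(x)\ \nabla g_1(x)\ \cdots\ \nabla g_l(x)]$. $\mathcal{I}_\Gamma$: if $l=n-1$, $\mathcal{I}_\Gamma=\langle g_1,\dots,g_l\rangle$; otherwise generated by $g_1,\dots,g_l$ and the maximal minors of $[\nabla f(x)\ \nabla g_1(x)\ \cdots\ \nabla g_l(x)\ \ x-x^*]$. $\mathcal{I}_L$: generated by $g_1,\dots,g_l$ and the maximal minors of $[\nabla g_1(x)\ \cdots\ \nabla g_l(x)\ \ x-x^*]$. $\mathcal{G}=\mathbf{I}\big(\overline{\mathbf{V}_{\mathbb{C}}(\mathcal{I}_\Gamma)\setminus\mathbf{V}_{\mathbb{C}}(\mathcal{I}_\Sigma)}^{\mathcal{Z}}\big)$. A linear change of coordinates by an invertible real matrix $A$ replaces $f,g_i,x^*$ by $f^A(x)=f(Ax)$, $g_i^A(x)=g_i(Ax)$, $A^{-1}x^*$ (and $S$ and all the ideals accordingly); it does not change the type of the KKT point. Algorithm Type$(f,g_1,\dots,g_l,x^* )$. Step 1. If $\dim(\mathcal{I}_\Gamma)=1$, let $\mathcal{I}=\mathcal{I}_\Gamma$; else if $\dim(\mathcal{G})=1$, let $\mathcal{I}=\mathcal{G}$; otherwise make a generic linear change of coordinates and repeat Step 1. Step 2. Compute $R_1>0$ such that $\mathbf{V}_{\mathbb{R}}(\mathcal{I}_\Sigma)\cap\mathbb{B}_{R_1}(x^* )=\{x^*\}$ and $\mathbf{V}_{\mathbb{R}}(\mathcal{I}_L)\cap\mathbb{B}_{R_1}(x^*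 )=\{x^*\}$. Step 3. Compute $R_2>0$ such that $\mathbf{V}_{\mathbb{R}}(\mathcal{I})\cap\mathbb{B}_{R_2}(x^* )\setminus\{x^*\}$ is a one-dimensional smooth manifold (boundary points on the sphere of radius $R_2$ being allowed) and the map $\mathbf{V}_{\mathbb{R}}(\mathcal{I})\cap\mathbb{B}_{R_2}(x^* )\setminus\{x^*\}\to\mathbb{R}$, $x\mapsto\|x-x^*\|^2$, has no critical point. Step 4. Fix a positive real $r<\min\{R_1,R_2\}$ and compare $f_r^-=\min\{f(x):x\in\Gamma(f,S,x^* )\cap\mathbb{S}_r(x^* )\}$ and $f_r^+=\max\{f(x):x\in\Gamma(f,S,x^* )\cap\mathbb{S}_r(x^* )\}$ with $f(x^* )$. Step 5. If $f_r^->f(x^* )$ return "local minimizer"; if $f_r^+<f(x^* )$ return "local maximizer"; if $f_r^-<f(x^* )<f_r^+$ return "not an extremum point". Faithful radius. $R>0$ is a faithful radius of $f$ on $S$ at $x^*$ if (i) $\Sigma(f,S)\cap\mathbb{B}_R(x^* )=\{x^*\}$; (ii) $\Gamma(f,S,x^* )\cap\mathbb{B}_R(x^* )$ is connected; (iii) $\Gamma(f,S,x^* )\cap\{x: f(x)=f(x^* )\}\cap\mathbb{B}_R(x^* )=\{x^*\}$. Condition C for $\mathscr{R}>0$. (i) $\Sigma(f,S)\cap\mathbb{B}_{\mathscr{R}}(x^* )=\{x^*\}$. (ii) For all $x\in S\cap\mathbb{B}_{\mathscr{R}}(x^* )\setminus\{x^*\}$ the vectors $\nabla g_1(x),\dots,\nabla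 g_l(x),\,x-x^*$ are linearly independent. (iii) For any $u\in\Gamma(f,S,x^* )\cap{\sf int}(\mathbb{B}_{\mathscr{R}}(x^* ))$ with $u\ne x^*$ there exist a neighborhood $\mathcal{O}_u\subset\mathbb{B}_{\mathscr{R}}(x^* )$ of $u$ and a differentiable map $\phi:(-\varepsilon,\varepsilon)\to\mathbb{R}^n$ with $\phi((-\varepsilon,\varepsilon))=\Gamma(f,S,x^* )\cap\mathcal{O}_u$, $\phi(0)=u$ and $\frac{d\|\phi-x^*\|^2}{dt}(0)\ne0$. *)

theory Defs
  imports
    "HOL-Library.Poly_Mapping"
    "HOL-Computational_Algebra.Polynomial"
    "HOL-Analysis.Analysis"
    "Jordan_Normal_Form.Determinant"
begin

no_notation Matrix.vec_index (infixl \<open>$\<close> 100)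

section \<open>Multivariate polynomials\<close>

text \<open>A polynomial is a finitely supported map from exponent vectors to coefficients; the ring
  structure is the convolution product of \<^theory>\<open>HOL-Library.Poly_Mapping\<close>.\<close>

type_synonym ('v, 'a) mpoly = "('v \<Rightarrow>\<^sub>0 nat) \<Rightarrow>\<^sub>0 'a"

definition Const :: "'a::zero \<Rightarrow> ('v, 'a) mpoly" where
  "Const c = Poly_Mapping.single 0 c"

definition Var :: "'v \<Rightarrow> ('v, 'a::zero_neq_one) mpoly" where
  "Var i = Poly_Mapping.single (Poly_Mapping.single i 1) 1"

text \<open>Evaluation at \<open>v\<close>, the coefficients being mapped by \<open>h\<close> into the target ring.\<close>

definition eval_with ::
    "('a::zero \<Rightarrow> 'b) \<Rightarrow> ('v::finite, 'a) mpoly \<Rightarrow> ('v \<Rightarrow> 'b) \<Rightarrow> 'b::comm_semiring_1" where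
  "eval_with h p v =
     (\<Sum>m\<in>Poly_Mapping.keys p. h (Poly_Mapping.lookup p m) * (\<Prod>i\<in>UNIV. v i ^ Poly_Mapping.lookup m i))"

text \<open>Used with \<open>'a = real\<close> and \<open>'a = complex\<close>.\<close>

definition peval :: "('n::finite, real) mpoly \<Rightarrow> 'a::real_field ^ 'n \<Rightarrow> 'a" where
  "peval p x = eval_with of_real p (\<lambda>i. x $ i)"

definition linear_subst :: "real ^ 'n ^ 'n \<Rightarrow> ('n::finite, real) mpoly \<Rightarrow> ('n, real) mpoly" where
  "linear_subst A p = eval_with Const p (\<lambda>i. \<Sum>j\<in>UNIV. Const (A $ i $ j) * Var j)"

definition partial_deriv :: "'n \<Rightarrow> ('n::finite, real) mpoly \<Rightarrow> ('n, real) mpoly" where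
  "partial_deriv i p = (\<Sum>m\<in>Poly_Mapping.keys p.
     Poly_Mapping.single (m - Poly_Mapping.single i 1)
       (of_nat (Poly_Mapping.lookup m i) * Poly_Mapping.lookup p m))"

definition pgrad :: "('n::finite, real) mpoly \<Rightarrow> ('n, real) mpoly ^ 'n" where
  "pgrad p = (\<chi> i. partial_deriv i p)"

definition grad :: "('n::finite, real) mpoly \<Rightarrow> real ^ 'n \<Rightarrow> real ^ 'n" where
  "grad p x = (\<chi> i. peval (pgrad p $ i) x)"

definition polys_upto :: "nat \<Rightarrow> ('n::finite, real) mpoly set" where
  "polys_upto s = {p. \<forall>m\<in>Poly_Mapping.keys p. (\<Sum>i\<in>UNIV. Poly_Mapping.lookup m i) \<le> s}"


section \<open>Ideals, varieties and dimension\<close>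

definition ideal_gen :: "('n::finite, real) mpoly set \<Rightarrow> ('n, real) mpoly set" where
  "ideal_gen B = Modules.module.span (*) B"

definition zero_set :: "('n::finite, real) mpoly set \<Rightarrow> ('a::real_field ^ 'n) set" where
  "zero_set I = {z. \<forall>p\<in>I. peval p z = 0}"

abbreviation V_C :: "('n::finite, real) mpoly set \<Rightarrow> (complex ^ 'n) set" where
  "V_C \<equiv> zero_set"

abbreviation V_R :: "('n::finite, real) mpoly set \<Rightarrow> (real ^ 'n) set" where
  "V_R \<equiv> zero_set"

definition vanishing_ideal :: "(complex ^ 'n) set \<Rightarrow> ('n::finite, real) mpoly set" where
  "vanishing_ideal V = {p. \<forall>z\<in>V. peval p z = 0}"

definition zariski_closure :: "(complex ^ 'n) set \<Rightarrow> (complex ^ 'n::finite) set" where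
  "zariski_closure V = V_C (vanishing_ideal V)"

definition real_dim :: "('n::finite, real) mpoly set \<Rightarrow> nat" where
  "real_dim W = Vector_Spaces.vector_space.dim (\<lambda>c p. Const c * p) W"

text \<open>The dimension of \<open>\<real>[x]\<^bsub>\<le>s\<^esub> / I\<^bsub>\<le>s\<^esub>\<close>.\<close>

definition affine_hilbert_function :: "('n::finite, real) mpoly set \<Rightarrow> nat \<Rightarrow> int" where
  "affine_hilbert_function I s =
     int (real_dim (polys_upto s :: ('n, real) mpoly set)) - int (real_dim (I \<inter> polys_upto s))"

definition is_affine_hilbert_poly :: "('n::finite, real) mpoly set \<Rightarrow> real poly \<Rightarrow> bool" where
  "is_affine_hilbert_poly I h \<longleftrightarrow>
     (\<forall>\<^sub>F s in sequentially. poly h (real s) = real_of_int (affine_hilbert_function I s))"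

text \<open>Stated as a relation, since the existence of the Hilbert polynomial is a theorem. The unit
  ideal, whose Hilbert polynomial is \<open>0\<close>, has no dimension.\<close>

definition has_hilbert_dim :: "('n::finite, real) mpoly set \<Rightarrow> nat \<Rightarrow> bool" where
  "has_hilbert_dim I d \<longleftrightarrow> (\<exists>h. is_affine_hilbert_poly I h \<and> h \<noteq> 0 \<and> degree h = d)"

text \<open>Maximal minors of the matrix whose columns are listed in \<open>C\<close>. Since the index type \<open>'n\<close>
  carries no order, a choice of rows is any duplicate-free list \<open>rs\<close>; reordering the rows changes
  a minor only by its sign.\<close>

definition maximal_minors :: "(('n::finite, real) mpoly ^ 'n) list \<Rightarrow> ('n, real) mpoly set" where
  "maximal_minors C =
     {Determinant.det (Matrix.mat (length C) (length C) (\<lambda>(i, j). (C ! j) $ (rs ! i))) | rs.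
        distinct rs \<and> length rs = length C}"

definition complex_zariski_open :: "(complex ^ 'n ^ 'n) set \<Rightarrow> bool" where
  "complex_zariski_open E \<longleftrightarrow>
     (\<exists>P :: ('n::finite \<times> 'n, complex) mpoly set.
        E = {M. \<exists>p\<in>P. eval_with id p (\<lambda>(i, j). M $ i $ j) \<noteq> 0})"

definition complexify :: "real ^ 'n ^ 'n \<Rightarrow> complex ^ 'n ^ 'n" where
  "complexify A = (\<chi> i j. complex_of_real (A $ i $ j))"


section \<open>The optimization problem\<close>

text \<open>The constraints \<open>g\<^sub>1, \<dots>, g\<^sub>l\<close> form the list \<open>gs\<close>, so \<open>l = length gs\<close>.\<close>

definition feasible_set :: "('n::finite, real) mpoly list \<Rightarrow> (real ^ 'n) set" where
  "feasible_set gs = {x. \<forall>g\<in>set gs. peval g x = 0}"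

text \<open>Linear independence of a family: repeated vectors count as dependent.\<close>

definition lin_indep_list :: "'a::real_vector list \<Rightarrow> bool" where
  "lin_indep_list vs \<longleftrightarrow> distinct vs \<and> independent (set vs)"

definition LICQ :: "('n::finite, real) mpoly list \<Rightarrow> real ^ 'n \<Rightarrow> bool" where
  "LICQ gs x \<longleftrightarrow> lin_indep_list (map (\<lambda>g. grad g x) gs)"

definition kkt_set :: "('n::finite, real) mpoly \<Rightarrow> ('n, real) mpoly list \<Rightarrow> (real ^ 'n) set" where
  "kkt_set f gs = {x \<in> feasible_set gs.
     \<exists>lam :: nat \<Rightarrow> real. grad f x = (\<Sum>i<length gs. lam i *\<^sub>R grad (gs ! i) x)}"

definition tangency_set ::
    "('n::finite, real) mpoly \<Rightarrow> ('n, real) mpoly list \<Rightarrow> real ^ 'n \<Rightarrow> (real ^ 'n) set" where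
  "tangency_set f gs xs = {x \<in> feasible_set gs.
     \<exists>kappa (lam :: nat \<Rightarrow> real) mu.
       (kappa \<noteq> 0 \<or> (\<exists>i<length gs. lam i \<noteq> 0) \<or> mu \<noteq> 0) \<and>
       kappa *\<^sub>R grad f x - (\<Sum>i<length gs. lam i *\<^sub>R grad (gs ! i) x) - mu *\<^sub>R (x - xs) = 0}"

datatype kkt_type = Local_Minimizer | Local_Maximizer | Not_Extremum

fun has_type ::
    "('n::finite, real) mpoly \<Rightarrow> ('n, real) mpoly list \<Rightarrow> real ^ 'n \<Rightarrow> kkt_type \<Rightarrow> bool" where
  "has_type f gs xs Local_Minimizer \<longleftrightarrow>
     (\<exists>U. open U \<and> xs \<in> U \<and> (\<forall>x\<in>feasible_set gs \<inter> U. peval f xs \<le> peval f x))"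
| "has_type f gs xs Local_Maximizer \<longleftrightarrow>
     (\<exists>U. open U \<and> xs \<in> U \<and> (\<forall>x\<in>feasible_set gs \<inter> U. peval f x \<le> peval f xs))"
| "has_type f gs xs Not_Extremum \<longleftrightarrow>
     (\<forall>U. open U \<and> xs \<in> U \<longrightarrow>
        (\<exists>u\<in>feasible_set gs \<inter> U. \<exists>v\<in>feasible_set gs \<inter> U.
           peval f u < peval f xs \<and> peval f xs < peval f v))"

definition pdiff :: "real ^ 'n \<Rightarrow> ('n::finite, real) mpoly ^ 'n" where
  "pdiff xs = (\<chi> i. Var i - Const (xs $ i))"

definition ideal_Sigma ::
    "('n::finite, real) mpoly \<Rightarrow> ('n, real) mpoly list \<Rightarrow> ('n, real) mpoly set" where
  "ideal_Sigma f gs = ideal_gen (set gs \<union> maximal_minors (pgrad f # map pgrad gs))"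

definition ideal_Gamma ::
    "('n::finite, real) mpoly \<Rightarrow> ('n, real) mpoly list \<Rightarrow> real ^ 'n \<Rightarrow> ('n, real) mpoly set" where
  "ideal_Gamma f gs xs =
     (if length gs = CARD('n) - 1 then ideal_gen (set gs)
      else ideal_gen (set gs \<union> maximal_minors (pgrad f # map pgrad gs @ [pdiff xs])))"

definition ideal_L ::
    "('n::finite, real) mpoly list \<Rightarrow> real ^ 'n \<Rightarrow> ('n, real) mpoly set" where
  "ideal_L gs xs = ideal_gen (set gs \<union> maximal_minors (map pgrad gs @ [pdiff xs]))"

definition ideal_G ::
    "('n::finite, real) mpoly \<Rightarrow> ('n, real) mpoly list \<Rightarrow> real ^ 'n \<Rightarrow> ('n, real) mpoly set" where
  "ideal_G f gs xs =
     vanishing_ideal (zariski_closure (V_C (ideal_Gamma f gs xs) - V_C (ideal_Sigma f gs)))"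


section \<open>Smooth curves\<close>

text \<open>A chart of \<open>M\<close> at \<open>x\<close>: a regular \<open>C\<^sup>\<infinity>\<close> parametrization of a neighbourhood of \<open>x\<close> in \<open>M\<close>
  which is a homeomorphism onto it and maps \<open>0\<close> to \<open>x\<close>. The functions \<open>D k\<close> are the derivatives of
  \<open>\<phi>\<close> on \<open>J\<close>, one-sided at an end point that belongs to \<open>J\<close>.\<close>

definition curve_chart ::
    "(real ^ 'n) set \<Rightarrow> real ^ 'n \<Rightarrow> real set \<Rightarrow> (real \<Rightarrow> real ^ 'n::finite) \<Rightarrow> bool" where
  "curve_chart M x J \<phi> \<longleftrightarrow>
     0 \<in> J \<and> \<phi> 0 = x \<and>
     (\<exists>U \<psi>. open U \<and> homeomorphism J (M \<inter> U) \<phi> \<psi>) \<and>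
     (\<exists>D :: nat \<Rightarrow> real \<Rightarrow> real ^ 'n. D 0 = \<phi> \<and>
        (\<forall>k. \<forall>t\<in>J. (D k has_vector_derivative D (Suc k) t) (at t within J)) \<and>
        (\<forall>t\<in>J. D 1 t \<noteq> 0))"

text \<open>\<open>M\<close> is a one-dimensional smooth (embedded) manifold all of whose boundary points lie in \<open>B\<close>.\<close>

definition smooth_curve :: "(real ^ 'n::finite) set \<Rightarrow> (real ^ 'n) set \<Rightarrow> bool" where
  "smooth_curve M B \<longleftrightarrow>
     (\<forall>x\<in>M. (\<exists>\<phi>. curve_chart M x {-1<..<1} \<phi>) \<or> (x \<in> B \<and> (\<exists>\<phi>. curve_chart M x {0..<1} \<phi>)))"

definition critical_point :: "(real ^ 'n::finite) set \<Rightarrow> (real ^ 'n \<Rightarrow> real) \<Rightarrow> real ^ 'n \<Rightarrow> bool" where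
  "critical_point M h x \<longleftrightarrow>
     (\<exists>J \<phi>. (J = {-1<..<1} \<or> J = {0..<1}) \<and> curve_chart M x J \<phi> \<and>
        ((\<lambda>t. h (\<phi> t)) has_real_derivative 0) (at 0 within J))"


section \<open>The algorithm\<close>

definition step1_success ::
    "('n::finite, real) mpoly \<Rightarrow> ('n, real) mpoly list \<Rightarrow> real ^ 'n \<Rightarrow> bool" where
  "step1_success f gs xs \<longleftrightarrow>
     has_hilbert_dim (ideal_Gamma f gs xs) 1 \<or> has_hilbert_dim (ideal_G f gs xs) 1"

definition step1_ideal ::
    "('n::finite, real) mpoly \<Rightarrow> ('n, real) mpoly list \<Rightarrow> real ^ 'n \<Rightarrow> ('n, real) mpoly set" where
  "step1_ideal f gs xs =
     (if has_hilbert_dim (ideal_Gamma f gs xs) 1 then ideal_Gamma f gs xs else ideal_G f gs xs)"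

definition step2_radius ::
    "('n::finite, real) mpoly \<Rightarrow> ('n, real) mpoly list \<Rightarrow> real ^ 'n \<Rightarrow> real \<Rightarrow> bool" where
  "step2_radius f gs xs R \<longleftrightarrow> R > 0 \<and>
     V_R (ideal_Sigma f gs) \<inter> cball xs R = {xs} \<and>
     V_R (ideal_L gs xs) \<inter> cball xs R = {xs}"

definition step3_radius :: "('n::finite, real) mpoly set \<Rightarrow> real ^ 'n \<Rightarrow> real \<Rightarrow> bool" where
  "step3_radius I xs R \<longleftrightarrow> R > 0 \<and>
     smooth_curve (V_R I \<inter> cball xs R - {xs}) (sphere xs R) \<and>
     (\<forall>x \<in> V_R I \<inter> cball xs R - {xs}.
        \<not> critical_point (V_R I \<inter> cball xs R - {xs}) (\<lambda>y. (norm (y - xs))\<^sup>2) x)"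

definition is_min_value :: "('a \<Rightarrow> real) \<Rightarrow> 'a set \<Rightarrow> real \<Rightarrow> bool" where
  "is_min_value h X m \<longleftrightarrow> (\<exists>x\<in>X. h x = m) \<and> (\<forall>x\<in>X. m \<le> h x)"

definition is_max_value :: "('a \<Rightarrow> real) \<Rightarrow> 'a set \<Rightarrow> real \<Rightarrow> bool" where
  "is_max_value h X m \<longleftrightarrow> (\<exists>x\<in>X. h x = m) \<and> (\<forall>x\<in>X. h x \<le> m)"

definition step5 :: "real \<Rightarrow> real \<Rightarrow> real \<Rightarrow> kkt_type option" where
  "step5 fmin fmax fx =
     (if fx < fmin then Some Local_Minimizer
      else if fmax < fx then Some Local_Maximizer
      else if fmin < fx \<and> fx < fmax then Some Not_Extremum
      else None)"


section \<open>Faithful radius and Condition C\<close>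

definition faithful_radius ::
    "('n::finite, real) mpoly \<Rightarrow> ('n, real) mpoly list \<Rightarrow> real ^ 'n \<Rightarrow> real \<Rightarrow> bool" where
  "faithful_radius f gs xs R \<longleftrightarrow> R > 0 \<and>
     kkt_set f gs \<inter> cball xs R = {xs} \<and>
     connected (tangency_set f gs xs \<inter> cball xs R) \<and>
     tangency_set f gs xs \<inter> {x. peval f x = peval f xs} \<inter> cball xs R = {xs}"

definition condition_C ::
    "('n::finite, real) mpoly \<Rightarrow> ('n, real) mpoly list \<Rightarrow> real ^ 'n \<Rightarrow> real \<Rightarrow> bool" where
  "condition_C f gs xs R \<longleftrightarrow> R > 0 \<and>
     kkt_set f gs \<inter> cball xs R = {xs} \<and>
     (\<forall>x \<in> feasible_set gs \<inter> cball xs R - {xs}.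
        lin_indep_list (map (\<lambda>g. grad g x) gs @ [x - xs])) \<and>
     (\<forall>u \<in> tangency_set f gs xs \<inter> interior (cball xs R). u \<noteq> xs \<longrightarrow>
        (\<exists>U \<epsilon> \<phi>. open U \<and> u \<in> U \<and> U \<subseteq> cball xs R \<and> \<epsilon> > 0 \<and>
           \<phi> differentiable_on {-\<epsilon><..<\<epsilon>} \<and>
           \<phi> ` {-\<epsilon><..<\<epsilon>} = tangency_set f gs xs \<inter> U \<and>
           \<phi> 0 = u \<and>
           (\<exists>d. d \<noteq> 0 \<and> ((\<lambda>t. (norm (\<phi> t - xs))\<^sup>2) has_real_derivative d) (at 0))))"

end

theory Submission
  imports Defs "Jordan_Normal_Form.Char_Poly"
begin

no_notation Matrix.vec_index (infixl \<open>$\<close> 100)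

text \<open>After a generic change of coordinates \<open>A\<close>, Perron's theorem gives a polynomial relation
  between any two coordinates on \<open>V(I\<^sub>\<Gamma>) - V(I\<^sub>\<Sigma>)\<close>: there \<open>x - x\<^sup>*\<close> is a combination of the
  gradients, and since the resulting equations in \<open>x\<close>, the coefficients and \<open>A\<close> are submersive,
  the part of lowest degree in the equations of a Perron relation vanishes on their solutions. Hence the standard
  monomials of \<open>G\<close> lie near finitely many coordinate rays and the Hilbert polynomial has degree \<open>1\<close>.

  Conversely, dimension \<open>1\<close> yields relations between \<open>t = |x - x\<^sup>*|\<^sup>2\<close> and each \<open>x\<^sub>i\<close>. Made squarefree,
  they present the variety near \<open>x\<^sup>*\<close> as a subset of smooth branches over the \<open>t\<close>-axis. Along a branch a
  polynomial is a root of a characteristic polynomial over \<open>\<real>[t]\<close>, so for small \<open>t\<close> it vanishes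
  identically or nowhere; thus the variety is a union of branches.

  Finally, the sign of the multiplier \<open>\<mu>\<close> splits \<open>\<Gamma> - {x\<^sup>*}\<close> within the radius \<open>r\<close> into two relatively
  clopen sides, along which \<open>f\<close> increases and decreases, respectively, with \<open>|x - x\<^sup>*|\<close>; a nonempty side
  reaches from \<open>x\<^sup>*\<close> to the sphere, where the extrema of \<open>f\<close> on \<open>S\<close> are attained on \<open>\<Gamma>\<close>.\<close>

subsection \<open>Evaluation and derivatives of polynomials\<close>

text \<open>The dimension claim is a count. The variables \<open>x\<close>, \<open>c\<close>,
  \<open>A\<close> number 2n + n^2; there are 2n - 1 equations, n^2 entries of \<open>A\<close> and
  two coordinates of \<open>x\<close>, one function too many to be algebraically independent.
  Setting the equations to 0 in a relation could make it vanish identically; its part of lowest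
  degree in them is nonzero and removes this obstacle. A point \<open>w0\<close> off the zeros of
  the finitely many polynomials involved supplies both the generic condition on \<open>A\<close> and
  the constants put in place of the equations. That the dimension is not 0 is a real fact:
  \<open>xs\<close> is not isolated in S, so every small sphere carries an extremum of f on S, a
  point of Gamma off Sigma. Conversely, an ideal of dimension 1 need not be radical, and generators
  of \<open>ideal_G\<close> are not at hand. So dimension 1 is used only through a linear bound on
  the number of standard monomials, and near \<open>xs\<close> the real zero set of either ideal is
  described by the finitely many generators of \<open>ideal_Gamma\<close>, with which it agrees
  inside the radius of Step 2.\<close>

abbreviation coef :: "('v, 'a::zero) mpoly \<Rightarrow> ('v \<Rightarrow>\<^sub>0 nat) \<Rightarrow> 'a" where
  "coef \<equiv> Poly_Mapping.lookup"

abbreviation expo :: "('v \<Rightarrow>\<^sub>0 nat) \<Rightarrow> 'v \<Rightarrow> nat" where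
  "expo \<equiv> Poly_Mapping.lookup"

text \<open>Values in an arbitrary commutative semiring: monomials are evaluated at points and, for
  substitutions, at tuples of polynomials.\<close>

definition monom_val :: "('v::finite \<Rightarrow>\<^sub>0 nat) \<Rightarrow> ('v \<Rightarrow> 'b::comm_semiring_1) \<Rightarrow> 'b" where
  "monom_val m v = (\<Prod>i\<in>UNIV. v i ^ expo m i)"

lemma monom_val_0 [simp]: "monom_val 0 v = 1"
  by (simp add: monom_val_def)

lemma monom_val_add: "monom_val (a + b) v = monom_val a v * monom_val b v"
  by (simp add: monom_val_def lookup_add power_add prod.distrib)

lemma monom_val_single [simp]: "monom_val (Poly_Mapping.single i k) v = v i ^ k"
proof -
  have "monom_val (Poly_Mapping.single i k) v = (\<Prod>j\<in>UNIV. if j = i then v i ^ k else 1)"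
    unfolding monom_val_def by (rule prod.cong) (auto simp: lookup_single when_def)
  then show ?thesis by simp
qed

lemma eval_with_superset:
  assumes "finite K" "Poly_Mapping.keys p \<subseteq> K" "h 0 = 0"
  shows "eval_with h p v = (\<Sum>m\<in>K. h (coef p m) * monom_val m v)"
  unfolding eval_with_def monom_val_def using assms
  by (intro sum.mono_neutral_left) (auto simp: in_keys_iff)

lemma mpoly_eq_sum_single:
  "p = (\<Sum>m\<in>Poly_Mapping.keys p. Poly_Mapping.single m (coef p m))"
proof (rule poly_mapping_eqI)
  fix k
  have "(\<Sum>m\<in>Poly_Mapping.keys p. coef (Poly_Mapping.single m (coef p m)) k)
      = (\<Sum>m\<in>Poly_Mapping.keys p. if m = k then coef p k else 0)"
    by (rule sum.cong) (auto simp: lookup_single when_def)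
  then show "coef p k = coef (\<Sum>m\<in>Poly_Mapping.keys p. Poly_Mapping.single m (coef p m)) k"
    by (simp add: lookup_sum in_keys_iff)
qed

context comm_semiring_hom
begin

lemma eval_with_0 [simp]: "eval_with hom 0 v = 0"
  by (simp add: eval_with_def)

lemma eval_with_add: "eval_with hom (p + q) v = eval_with hom p v + eval_with hom q v"
proof -
  let ?K = "Poly_Mapping.keys p \<union> Poly_Mapping.keys q"
  have K: "finite ?K" "Poly_Mapping.keys (p + q) \<subseteq> ?K" using keys_add[of p q] by auto
  show ?thesis
    using eval_with_superset[OF K(1), of p hom v] eval_with_superset[OF K(1), of q hom v]
      eval_with_superset[OF K, of hom v]
    by (simp add: lookup_add hom_add distrib_right sum.distrib)
qed

lemma eval_with_sum: "eval_with hom (sum F I) v = (\<Sum>i\<in>I. eval_with hom (F i) v)"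
  by (induction I rule: infinite_finite_induct) (auto simp: eval_with_add)

lemma eval_with_single: "eval_with hom (Poly_Mapping.single m c) v = hom c * monom_val m v"
  using eval_with_superset[of "{m}" "Poly_Mapping.single m c" hom v] by simp

lemma eval_with_mult: "eval_with hom (p * q) v = eval_with hom p v * eval_with hom q v"
proof -
  let ?S = "\<lambda>r. \<Sum>m\<in>Poly_Mapping.keys r. Poly_Mapping.single m (coef r m)"
  have "eval_with hom (?S p * ?S q) v = eval_with hom (?S p) v * eval_with hom (?S q) v"
    by (simp add: sum_product eval_with_sum mult_single eval_with_single monom_val_add hom_mult ac_simps)
  then show ?thesis by (simp flip: mpoly_eq_sum_single)
qed

lemma eval_with_Const [simp]: "eval_with hom (Const c) v = hom c"
  by (simp add: Const_def eval_with_single)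

lemma eval_with_Var [simp]: "eval_with hom (Var i) v = v i"
  by (simp add: Var_def eval_with_single)

lemma eval_with_1 [simp]: "eval_with hom 1 v = 1"
  using eval_with_Const[of 1 v] by (simp add: Const_def)

lemma eval_with_power: "eval_with hom (p ^ k) v = eval_with hom p v ^ k"
  by (induction k) (auto simp: eval_with_mult)

lemma eval_with_prod: "eval_with hom (prod F I) v = (\<Prod>i\<in>I. eval_with hom (F i) v)"
  by (induction I rule: infinite_finite_induct) (auto simp: eval_with_mult)

end

lemma Const_0 [simp]: "Const 0 = 0" and Const_1 [simp]: "Const 1 = 1"
  by (simp_all add: Const_def)

lemma Const_add: "Const (a + b) = Const a + Const b"
  by (simp add: Const_def single_add)

lemma Const_mult: "Const (a * b) = Const a * Const (b::'a::semiring_0)"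
  by (simp add: Const_def mult_single)

lemma Const_uminus: "Const (- a) = - Const (a::'a::ab_group_add)"
  by (simp add: Const_def single_uminus)

lemma coef_Const_mult: "coef (Const c * p) m = c * coef p (m::'v \<Rightarrow>\<^sub>0 nat)" for p :: "('v, real) mpoly"
  unfolding Const_def by (simp add: mult_map_scale_conv_mult[symmetric] map.rep_eq when_def)

interpretation Const_hom: comm_ring_hom "Const :: 'a::comm_ring_1 \<Rightarrow> ('v, 'a) mpoly"
  by unfold_locales (auto simp: Const_add Const_mult Const_uminus)

lemma peval_0 [simp]: "peval 0 x = 0" and peval_1 [simp]: "peval 1 x = 1"
  and peval_add: "peval (p + q) x = peval p x + peval q x"
  and peval_mult: "peval (p * q) x = peval p x * peval q x"
  and peval_Const [simp]: "peval (Const c) x = of_real c"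
  and peval_Var [simp]: "peval (Var i) x = x $ i"
  and peval_power: "peval (p ^ k) x = peval p x ^ k"
  and peval_sum: "peval (sum F I) x = (\<Sum>i\<in>I. peval (F i) x)"
  and peval_prod: "peval (prod F I) x = (\<Prod>i\<in>I. peval (F i) x)"
  by (simp_all add: peval_def of_real_hom.eval_with_add of_real_hom.eval_with_mult
      of_real_hom.eval_with_power of_real_hom.eval_with_sum of_real_hom.eval_with_prod)

lemma peval_uminus: "peval (- p) x = - peval p x"
  using peval_add[of p "- p" x] by (simp add: eq_neg_iff_add_eq_0 add.commute)

lemma peval_diff: "peval (p - q) x = peval p x - peval q x"
  using peval_add[of p "- q" x] by (simp add: peval_uminus)

lemma peval_single: "peval (Poly_Mapping.single m c) x = of_real c * monom_val m (\<lambda>i. x $ i)"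
  by (simp add: peval_def of_real_hom.eval_with_single)

lemma Const_single_mult: "Poly_Mapping.single m c = Const c * Poly_Mapping.single m (1::'a::semiring_1)"
  by (simp add: Const_def mult_single)

lemma single_eq_monom_val:
  "Poly_Mapping.single m c = Const c * monom_val m (Var :: 'v::finite \<Rightarrow> ('v, 'a::comm_ring_1) mpoly)"
proof -
  have pow: "(Var i ^ k :: ('v, 'a) mpoly) = Poly_Mapping.single (Poly_Mapping.single i k) 1" for i k
    by (induction k) (auto simp: Var_def mult_single simp flip: single_add)
  have fin: "(\<Prod>i\<in>A. Var i ^ expo m i :: ('v, 'a) mpoly)
      = Poly_Mapping.single (\<Sum>i\<in>A. Poly_Mapping.single i (expo m i)) 1" if "finite A" for A
    using that by induction (auto simp: pow mult_single)
  have "(\<Sum>i\<in>UNIV. Poly_Mapping.single i (expo m i)) = m"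
  proof (rule poly_mapping_eqI)
    fix k
    have "(\<Sum>i\<in>UNIV. expo (Poly_Mapping.single i (expo m i)) k) = (\<Sum>i\<in>UNIV. if i = k then expo m k else 0)"
      by (rule sum.cong) (auto simp: lookup_single when_def)
    then show "expo (\<Sum>i\<in>UNIV. Poly_Mapping.single i (expo m i)) k = expo m k"
      by (simp add: lookup_sum)
  qed
  with fin[of UNIV] show ?thesis
    by (simp add: monom_val_def Const_single_mult[of m c])
qed

text \<open>Constants and variables generate the polynomial ring, so identities between evaluations
  can be checked on generators.\<close>

lemma mpoly_induct [case_names Const Var add mult]:
  fixes p :: "('v::finite, 'a::comm_ring_1) mpoly"
  assumes C: "\<And>c. P (Const c)" and V: "\<And>i. P (Var i)"
    and A: "\<And>p q. P p \<Longrightarrow> P q \<Longrightarrow> P (p + q)" and M: "\<And>p q. P p \<Longrightarrow> P q \<Longrightarrow> P (p * q)"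
  shows "P p"
proof -
  have P0: "P 0" and P1: "P 1" using C[of 0] C[of 1] by simp_all
  have pow: "P (Var i ^ k)" for i k by (induction k) (auto intro: M V P1)
  have prd: "P (\<Prod>i\<in>A. Var i ^ e i)" for A and e :: "'v \<Rightarrow> nat"
    by (induction A rule: infinite_finite_induct) (auto intro: M P1 pow)
  have "P (Poly_Mapping.single m c)" for m c
    unfolding single_eq_monom_val monom_val_def by (intro M C prd)
  then have "P (\<Sum>m\<in>A. Poly_Mapping.single m (coef p m))" for A
    by (induction A rule: infinite_finite_induct) (auto intro: A P0)
  then show ?thesis by (metis mpoly_eq_sum_single)
qed

lemma peval_subst:
  fixes p :: "('n::finite, real) mpoly" and q :: "'n \<Rightarrow> ('v::finite, real) mpoly"
  shows "peval (eval_with Const p q) x = peval p (\<chi> i. peval (q i) x)"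
  by (induction p rule: mpoly_induct)
    (auto simp: Const_hom.eval_with_add Const_hom.eval_with_mult peval_add peval_mult)

lemma peval_linear_subst:
  "peval (linear_subst A p) x = peval p (\<chi> i. \<Sum>j\<in>UNIV. of_real (A $ i $ j) * x $ j)"
  unfolding linear_subst_def by (simp add: peval_subst peval_sum peval_mult)

lemma peval_linear_subst_real: "peval (linear_subst A p) (x::real^'n::finite) = peval p (A *v x)"
  by (simp add: peval_linear_subst matrix_vector_mult_def)

lemma peval_linear_subst_complex:
  "peval (linear_subst A p) (x::complex^'n::finite) = peval p (complexify A *v x)"
  by (simp add: peval_linear_subst matrix_vector_mult_def complexify_def)

lemma partial_deriv_eq_sum:
  assumes "finite K" "Poly_Mapping.keys p \<subseteq> K"
  shows "partial_deriv i p = (\<Sum>m\<in>K. Poly_Mapping.single (m - Poly_Mapping.single i 1)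
       (of_nat (expo m i) * coef p m))"
  unfolding partial_deriv_def using assms
  by (intro sum.mono_neutral_left) (auto simp: in_keys_iff)

lemma partial_deriv_add: "partial_deriv i (p + q) = partial_deriv i p + partial_deriv i q"
proof -
  let ?K = "Poly_Mapping.keys p \<union> Poly_Mapping.keys q"
  have K: "finite ?K" "Poly_Mapping.keys (p + q) \<subseteq> ?K" using keys_add[of p q] by auto
  show ?thesis
    using partial_deriv_eq_sum[OF K(1), of p i] partial_deriv_eq_sum[OF K(1), of q i]
      partial_deriv_eq_sum[OF K, of i]
    by (simp add: lookup_add distrib_left sum.distrib single_add)
qed

lemma partial_deriv_single:
  "partial_deriv i (Poly_Mapping.single m c)
    = Poly_Mapping.single (m - Poly_Mapping.single i 1) (of_nat (expo m i) * c)"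
  using partial_deriv_eq_sum[of "{m}" "Poly_Mapping.single m c" i] by simp

text \<open>Where \<open>x $ i\<close> does not occur in the monomial, the truncated difference
  leaves \<open>m\<close> unchanged, and the factor \<open>expo m i\<close> is 0.\<close>

lemma has_derivative_monom_val:
  fixes x :: "'a::real_normed_field ^ 'n::finite"
  shows "((\<lambda>x. monom_val m (\<lambda>i. x $ i)) has_derivative
    (\<lambda>h. \<Sum>i\<in>UNIV. of_nat (expo m i) * monom_val (m - Poly_Mapping.single i 1) (\<lambda>i. x $ i) * h $ i)) (at x)"
proof -
  have nth: "((\<lambda>x. x $ i) has_derivative (\<lambda>h. h $ i)) (at x)" for i and x :: "'a ^ 'n"
    by (rule bounded_linear_imp_has_derivative) (rule bounded_linear_vec_nth)
  have "((\<lambda>x. \<Prod>i\<in>UNIV. (x $ i) ^ expo m i) has_derivative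
     (\<lambda>h. \<Sum>i\<in>UNIV. (of_nat (expo m i) * (h $ i) * (x $ i) ^ (expo m i - 1)) *
        (\<Prod>j\<in>UNIV - {i}. (x $ j) ^ expo m j))) (at x)"
    by (rule has_derivative_prod) (rule has_derivative_power[OF nth])
  moreover have "of_nat (expo m i) * h $ i * (x $ i) ^ (expo m i - 1) * (\<Prod>j\<in>UNIV - {i}. (x $ j) ^ expo m j)
     = of_nat (expo m i) * monom_val (m - Poly_Mapping.single i 1) (\<lambda>i. x $ i) * h $ i" for i h
  proof -
    have "monom_val (m - Poly_Mapping.single i 1) (\<lambda>i. x $ i)
       = x $ i ^ (expo m i - 1) * (\<Prod>j\<in>UNIV - {i}. (x $ j) ^ expo m j)"
      unfolding monom_val_def
      by (subst prod.remove[of UNIV i]) (auto simp: lookup_minus lookup_single when_def intro!: prod.cong)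
    then show ?thesis by simp
  qed
  ultimately show ?thesis by (simp only: monom_val_def)
qed

lemma has_derivative_peval:
  fixes x :: "'a::{real_normed_field} ^ 'n::finite"
  shows "(peval p has_derivative (\<lambda>h. \<Sum>i\<in>UNIV. peval (partial_deriv i p) x * h $ i)) (at x)"
proof -
  have sing: "(peval (Poly_Mapping.single m c) has_derivative
     (\<lambda>h. \<Sum>i\<in>UNIV. peval (partial_deriv i (Poly_Mapping.single m c)) x * h $ i)) (at x)" for m c
    unfolding peval_single[abs_def] partial_deriv_single
    by (rule has_derivative_eq_rhs[OF has_derivative_mult_right[OF has_derivative_monom_val]])
      (simp add: sum_distrib_left ac_simps)
  have p0: "partial_deriv i 0 = 0" for i :: 'n by (simp add: partial_deriv_def)
  have "finite K \<Longrightarrow> (peval (\<Sum>m\<in>K. Poly_Mapping.single m (c m)) has_derivative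
     (\<lambda>h. \<Sum>i\<in>UNIV. peval (partial_deriv i (\<Sum>m\<in>K. Poly_Mapping.single m (c m))) x * h $ i)) (at x)" for K c
  proof (induction K rule: finite_induct)
    case empty
    then show ?case by (simp add: p0 peval_0[abs_def])
  next
    case (insert m K)
    then show ?case
      by (simp add: peval_add[abs_def] partial_deriv_add)
        (rule has_derivative_eq_rhs[OF has_derivative_add[OF sing insert.IH]],
         simp add: peval_add distrib_right sum.distrib)
  qed
  from this[of "Poly_Mapping.keys p" "coef p"] show ?thesis
    by (simp flip: mpoly_eq_sum_single)
qed

lemma continuous_peval [continuous_intros]:
  fixes g :: "'b::t2_space \<Rightarrow> 'a::real_normed_field ^ 'n::finite"
  assumes "continuous_on S g" shows "continuous_on S (\<lambda>y. peval p (g y))"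
proof -
  have "continuous_on UNIV (peval p :: 'a ^ 'n \<Rightarrow> 'a)"
    using has_derivative_continuous[OF has_derivative_peval] continuous_at_imp_continuous_on by blast
  from continuous_on_compose2[OF this assms] show ?thesis by simp
qed

lemma peval_of_real:
  "peval p (\<chi> i. of_real (x $ i)) = (of_real (peval p (x::real^'n::finite)) :: 'a::real_field)"
  by (induction p rule: mpoly_induct) (auto simp: peval_add peval_mult)

lemma bounded_linear_vec_lambda:
  fixes f :: "'n::finite \<Rightarrow> 'a::real_normed_vector \<Rightarrow> 'b::real_normed_vector"
  assumes "\<And>i. bounded_linear (f i)"
  shows "bounded_linear (\<lambda>x. \<chi> i. f i x)"
proof -
  obtain K where K: "\<And>i x. norm (f i x) \<le> norm x * K i"
    using bounded_linear.bounded[OF assms] by metis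
  show ?thesis
  proof (rule bounded_linear_intro)
    fix x
    have "norm (\<chi> i. f i x) \<le> (\<Sum>i\<in>UNIV. norm (f i x))"
      unfolding norm_vec_def by (rule order_trans[OF L2_set_le_sum]) auto
    also have "\<dots> \<le> norm x * (\<Sum>i\<in>UNIV. K i)"
      unfolding sum_distrib_left by (rule sum_mono) (rule K)
    finally show "norm (\<chi> i. f i x) \<le> norm x * (\<Sum>i\<in>UNIV. K i)" .
  qed (auto simp: Finite_Cartesian_Product.vec_eq_iff linear_add linear_scale bounded_linear.linear[OF assms])
qed

text \<open>The chain rule for formal derivatives is read off from the uniqueness of the analytic
  derivative, evaluated at a basis vector.\<close>

lemma partial_deriv_linear_subst:
  fixes x :: "'a::real_normed_field ^ 'n::finite"
  shows "peval (partial_deriv j (linear_subst A p)) x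
    = (\<Sum>i\<in>UNIV. of_real (A $ i $ j) * peval (partial_deriv i p) (\<chi> i. \<Sum>j\<in>UNIV. of_real (A $ i $ j) * x $ j))"
proof -
  let ?L = "\<lambda>x::'a^'n. \<chi> i. \<Sum>j\<in>UNIV. of_real (A $ i $ j) * x $ j"
  have lin: "bounded_linear ?L"
    by (intro bounded_linear_vec_lambda bounded_linear_sum bounded_linear_compose[OF bounded_linear_mult_right bounded_linear_vec_nth])
  have "((\<lambda>x. peval p (?L x)) has_derivative
      (\<lambda>h. \<Sum>i\<in>UNIV. peval (partial_deriv i p) (?L x) * ?L h $ i)) (at x)"
    by (rule has_derivative_compose[OF bounded_linear_imp_has_derivative[OF lin] has_derivative_peval])
  moreover have "((\<lambda>x. peval p (?L x)) has_derivative
      (\<lambda>h. \<Sum>i\<in>UNIV. peval (partial_deriv i (linear_subst A p)) x * h $ i)) (at x)"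
    using has_derivative_peval[of "linear_subst A p" x] unfolding peval_linear_subst[abs_def] .
  ultimately have "(\<lambda>h. \<Sum>i\<in>UNIV. peval (partial_deriv i p) (?L x) * ?L h $ i)
     = (\<lambda>h. \<Sum>i\<in>UNIV. peval (partial_deriv i (linear_subst A p)) x * h $ i)"
    by (rule has_derivative_unique)
  from fun_cong[OF this, of "axis j 1"] show ?thesis
    by (simp add: axis_def if_distrib mult.commute cong: if_cong)
qed

subsection \<open>Minors\<close>

text \<open>A relation among the first \<open>k\<close> members of a family, so equal columns count
  as dependent, as they do for minors. Columns are plain functions, which lets them vary in limits
  and lets the rows be indexed by a type without an order.\<close>

definition col_dep :: "(nat \<Rightarrow> 'n \<Rightarrow> 'a::field) \<Rightarrow> nat \<Rightarrow> bool" where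
  "col_dep C k \<longleftrightarrow> (\<exists>c. (\<exists>j<k. c j \<noteq> 0) \<and> (\<forall>i. (\<Sum>j<k. c j * C j i) = 0))"

definition row_minor :: "(nat \<Rightarrow> 'n \<Rightarrow> 'a::comm_ring_1) \<Rightarrow> 'n list \<Rightarrow> 'a" where
  "row_minor C rs = Determinant.det (Matrix.mat (length rs) (length rs) (\<lambda>(i, j). C j (rs ! i)))"

lemma col_dep_imp_minor_0:
  assumes "col_dep C k" "length rs = k" shows "row_minor C rs = 0"
proof -
  obtain c j where c: "j < k" "c j \<noteq> 0" "\<And>i. (\<Sum>j<k. c j * C j i) = 0"
    using assms(1) unfolding col_dep_def by auto
  let ?A = "Matrix.mat k k (\<lambda>(i, j). C j (rs ! i))" and ?v = "Matrix.vec k c"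
  have "?A *\<^sub>v ?v = 0\<^sub>v k"
    using c(3) by (intro eq_vecI) (auto simp: scalar_prod_def mult.commute lessThan_atLeast0)
  moreover have "?v \<noteq> 0\<^sub>v k" using c(1,2) by (metis index_vec index_zero_vec(1))
  ultimately show ?thesis
    unfolding row_minor_def assms(2)
    by (subst det_0_iff_vec_prod_zero[of _ k]) (simp, intro exI[of _ ?v], simp)
qed

text \<open>If a minor with rows \<open>rs\<close> of the first \<open>k\<close> columns does not vanish but all its bordered
  minors do, then expanding these along the added row gives a dependence relation whose coefficients,
  the cofactors, do not depend on the added row.\<close>

lemma exists_minor_nonzero:
  assumes "\<not> col_dep C k" shows "\<exists>rs. distinct rs \<and> length rs = k \<and> row_minor C rs \<noteq> 0"
  using assms
proof (induction k)
  case 0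
  show ?case by (rule exI[of _ "[]"]) (simp add: row_minor_def)
next
  case (Suc k)
  have "\<not> col_dep C k"
  proof
    assume "col_dep C k"
    then obtain c j where c: "j < k" "c j \<noteq> 0" "\<And>i. (\<Sum>j<k. c j * C j i) = 0"
      unfolding col_dep_def by auto
    have "col_dep C (Suc k)" unfolding col_dep_def
      by (rule exI[of _ "c(k := 0)"]) (use c in \<open>auto intro!: exI[of _ j]\<close>)
    with Suc.prems show False ..
  qed
  with Suc.IH obtain rs where rs: "distinct rs" "length rs = k" "row_minor C rs \<noteq> 0" by blast
  define B where "B r = Matrix.mat (Suc k) (Suc k) (\<lambda>(i, j). C j ((rs @ [r]) ! i))" for r
  define c where "c j = cofactor (B undefined) k j" for j
  have cof: "cofactor (B r) k j = c j" if "j < Suc k" for r j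
  proof -
    have "mat_delete (B r) k j = mat_delete (B undefined) k j"
      unfolding mat_delete_def B_def using rs(2) by (intro eq_matI) (auto simp: nth_append)
    then show ?thesis by (simp add: c_def cofactor_def)
  qed
  have ck: "c k = row_minor C rs"
  proof -
    have "mat_delete (B undefined) k k = Matrix.mat k k (\<lambda>(i, j). C j (rs ! i))"
      unfolding mat_delete_def B_def using rs(2) by (intro eq_matI) (auto simp: nth_append)
    then show ?thesis by (simp add: c_def cofactor_def row_minor_def rs(2))
  qed
  have expand: "row_minor C (rs @ [r]) = (\<Sum>j<Suc k. c j * C j r)" for r
  proof -
    have "row_minor C (rs @ [r]) = Determinant.det (B r)" by (simp add: row_minor_def B_def rs(2))
    also have "\<dots> = (\<Sum>j<Suc k. B r $$ (k, j) * cofactor (B r) k j)"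
      by (rule laplace_expansion_row) (auto simp: B_def)
    also have "\<dots> = (\<Sum>j<Suc k. c j * C j r)"
      using rs(2) by (intro sum.cong) (auto simp: cof, auto simp: B_def nth_append)
    finally show ?thesis .
  qed
  have "\<exists>r. row_minor C (rs @ [r]) \<noteq> 0"
  proof (rule ccontr)
    assume "\<not> ?thesis"
    then have "\<forall>r. (\<Sum>j<Suc k. c j * C j r) = 0" using expand by metis
    with ck rs(3) have "col_dep C (Suc k)" unfolding col_dep_def by (intro exI[of _ c]) auto
    with Suc.prems show False ..
  qed
  then obtain r where r: "row_minor C (rs @ [r]) \<noteq> 0" by blast
  have "r \<notin> set rs"
  proof
    assume "r \<in> set rs"
    then obtain i where i: "i < k" "rs ! i = r" using rs(2) by (metis in_set_conv_nth)
    have "Determinant.det (B r) = 0"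
      by (rule det_identical_rows[of _ "Suc k" i k])
        (use i rs(2) in \<open>auto simp: B_def nth_append intro!: eq_vecI\<close>)
    with r show False by (simp add: row_minor_def B_def rs(2))
  qed
  with r rs show ?case by (intro exI[of _ "rs @ [r]"]) auto
qed

definition col_vals :: "(('n::finite, real) mpoly ^ 'n) list \<Rightarrow> 'a::real_field ^ 'n \<Rightarrow> nat \<Rightarrow> 'n \<Rightarrow> 'a" where
  "col_vals C x j i = peval (C ! j $ i) x"

text \<open>Evaluation is a ring homomorphism and commutes with determinants; over either field the
  minors therefore detect exactly whether the evaluated columns are dependent.\<close>

lemma maximal_minors_vanish_iff:
  "(\<forall>p\<in>maximal_minors C. peval p x = 0) \<longleftrightarrow> col_dep (col_vals C x) (length C)"
proof -
  interpret ev: comm_ring_hom "\<lambda>p. peval p x"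
    by unfold_locales (auto simp: peval_add peval_mult peval_uminus)
  have "peval (Determinant.det (Matrix.mat (length C) (length C) (\<lambda>(i, j). (C ! j) $ (rs ! i)))) x
     = row_minor (col_vals C x) rs" if "length rs = length C" for rs
  proof -
    have "map_mat (\<lambda>p. peval p x) (Matrix.mat (length C) (length C) (\<lambda>(i, j). (C ! j) $ (rs ! i)))
       = Matrix.mat (length rs) (length rs) (\<lambda>(i, j). col_vals C x j (rs ! i))"
      by (intro eq_matI) (auto simp: col_vals_def that)
    then show ?thesis unfolding row_minor_def by (metis ev.hom_det)
  qed
  then show ?thesis
    using exists_minor_nonzero[of "col_vals C x" "length C"] col_dep_imp_minor_0[of "col_vals C x" "length C"]
    unfolding maximal_minors_def by fastforce
qed

text \<open>The equations of Gamma form a finite system; a radius that works for all of them is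
  later taken as a minimum over this system.\<close>

lemma finite_maximal_minors: "finite (maximal_minors C)"
proof -
  have "finite {rs :: 'a list. set rs \<subseteq> UNIV \<and> length rs = length C}"
    by (rule finite_lists_length_eq) simp
  then have "finite {rs :: 'a list. distinct rs \<and> length rs = length C}"
    by (rule finite_subset[rotated]) auto
  then show ?thesis unfolding maximal_minors_def by (rule finite_image_set)
qed

section \<open>Zero sets of the ideals as rank conditions\<close>

interpretation mpoly_module: Modules.module "(*) :: ('v, real) mpoly \<Rightarrow> _"
  by unfold_locales (auto simp: algebra_simps)

lemma zero_set_ideal_gen:
  "zero_set (ideal_gen B) = (zero_set B :: ('a::real_field ^ 'n::finite) set)"
proof -
  have "peval p x = 0" if "p \<in> ideal_gen B" "\<forall>p\<in>B. peval p x = 0" for p and x :: "'a ^ 'n"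
    using that unfolding ideal_gen_def
    by (induction rule: mpoly_module.span_induct_alt) (auto simp: peval_add peval_mult)
  then show ?thesis
    unfolding zero_set_def ideal_gen_def using mpoly_module.span_base by blast
qed

text \<open>\<open>feasible_set\<close> is real; the ideals of Step 1 are also studied at complex
  points.\<close>

definition feasible_in :: "('n::finite, real) mpoly list \<Rightarrow> 'a::real_field ^ 'n \<Rightarrow> bool" where
  "feasible_in gs x \<longleftrightarrow> (\<forall>g\<in>set gs. peval g x = 0)"

lemma zero_set_Un_minors:
  "zero_set (ideal_gen (set gs \<union> maximal_minors C))
    = {x. feasible_in gs x \<and> col_dep (col_vals C x) (length C)}"
  unfolding zero_set_ideal_gen by (auto simp: zero_set_def feasible_in_def simp flip: maximal_minors_vanish_iff)

text \<open>A nonvanishing minor would need \<open>k\<close> distinct rows.\<close>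

lemma col_dep_if_many_cols:
  fixes C :: "nat \<Rightarrow> 'n::finite \<Rightarrow> 'a::field"
  assumes "CARD('n) < k" shows "col_dep C k"
proof (rule ccontr)
  assume "\<not> ?thesis"
  from exists_minor_nonzero[OF this] obtain rs :: "'n list" where "distinct rs" "length rs = k" by blast
  with assms show False by (metis card_mono distinct_card finite leD subset_UNIV)
qed

lemma zero_set_ideal_Sigma:
  "zero_set (ideal_Sigma f gs) = {x. feasible_in gs x \<and>
     col_dep (col_vals (pgrad f # map pgrad gs) x) (Suc (length gs))}"
  unfolding ideal_Sigma_def zero_set_Un_minors by simp

lemma zero_set_ideal_L:
  "zero_set (ideal_L gs xs) = {x. feasible_in gs x \<and>
     col_dep (col_vals (map pgrad gs @ [pdiff xs]) x) (Suc (length gs))}"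
  unfolding ideal_L_def zero_set_Un_minors by simp

text \<open>For \<open>length gs = CARD('n) - 1\<close> the matrix has more columns than rows, so its columns are always
  dependent; this is why the definition can omit the minors.\<close>

lemma zero_set_ideal_Gamma:
  "zero_set (ideal_Gamma f gs xs) = {x :: 'a::real_field ^ 'n::finite. feasible_in gs x \<and>
     col_dep (col_vals (pgrad f # map pgrad gs @ [pdiff xs]) x) (length gs + 2)}"
proof (cases "length gs = CARD('n) - 1")
  case True
  then have "CARD('n) < length gs + 2" by linarith
  then have "col_dep C (length gs + 2)" for C :: "nat \<Rightarrow> 'n \<Rightarrow> 'a" by (rule col_dep_if_many_cols)
  with True show ?thesis
    unfolding ideal_Gamma_def zero_set_ideal_gen if_P[OF True] by (auto simp: zero_set_def feasible_in_def)
next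
  case False
  then show ?thesis unfolding ideal_Gamma_def by (simp add: zero_set_Un_minors)
qed

lemma lin_indep_list_iff_not_col_dep:
  "lin_indep_list vs \<longleftrightarrow> \<not> col_dep (\<lambda>j i. (vs ! j) $ i) (length vs)" for vs :: "(real ^ 'n::finite) list"
proof
  assume li: "lin_indep_list vs"
  show "\<not> col_dep (\<lambda>j i. (vs ! j) $ i) (length vs)"
  proof
    assume "col_dep (\<lambda>j i. (vs ! j) $ i) (length vs)"
    then obtain c j where c: "j < length vs" "c j \<noteq> 0" "\<And>i. (\<Sum>j<length vs. c j * vs ! j $ i) = 0"
      unfolding col_dep_def by auto
    have bij: "bij_betw ((!) vs) {..<length vs} (set vs)"
      using li by (intro bij_betw_nth) (auto simp: lin_indep_list_def)
    define u where "u = c \<circ> the_inv_into {..<length vs} ((!) vs)"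
    have u: "u (vs ! j) = c j" if "j < length vs" for j
      using the_inv_into_f_f[of "(!) vs" "{..<length vs}" j] bij that by (auto simp: u_def bij_betw_def)
    have "(\<Sum>v\<in>set vs. u v *\<^sub>R v) = (\<Sum>j<length vs. u (vs ! j) *\<^sub>R vs ! j)"
      by (rule sum.reindex_bij_betw[OF bij, symmetric])
    also have "\<dots> = 0" using c(3) by (simp add: Finite_Cartesian_Product.vec_eq_iff u)
    finally have sum0: "(\<Sum>v\<in>set vs. u v *\<^sub>R v) = 0" .
    have "u (vs ! j) \<noteq> 0" using c(2) u[OF c(1)] by simp
    with nth_mem[OF c(1)] have "\<exists>v\<in>set vs. u v \<noteq> 0" by (rule bexI[rotated])
    with sum0 have "dependent (set vs)" unfolding dependent_finite[OF finite_set] by blast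
    with li show False by (simp add: lin_indep_list_def)
  qed
next
  assume nd: "\<not> col_dep (\<lambda>j i. (vs ! j) $ i) (length vs)"
  have "distinct vs"
  proof (rule ccontr)
    assume "\<not> distinct vs"
    then obtain a b where ab: "a < length vs" "b < length vs" "a \<noteq> b" "vs ! a = vs ! b"
      by (auto simp: distinct_conv_nth)
    define c :: "nat \<Rightarrow> real" where "c j = (if j = a then 1 else if j = b then -1 else 0)" for j
    have "(\<Sum>j<length vs. c j * vs ! j $ i) = 0" for i
    proof -
      have "(\<Sum>j<length vs. c j * vs ! j $ i) = (\<Sum>j\<in>{a, b}. c j * vs ! j $ i)"
        using ab(1,2) by (intro sum.mono_neutral_right) (auto simp: c_def)
      then show ?thesis using ab(3,4) by (simp add: c_def)
    qed
    moreover have "c a \<noteq> 0" by (simp add: c_def)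
    ultimately have "col_dep (\<lambda>j i. (vs ! j) $ i) (length vs)"
      unfolding col_dep_def using ab(1) by blast
    with nd show False ..
  qed
  moreover have "independent (set vs)"
  proof
    assume "dependent (set vs)"
    then obtain u v where u: "v \<in> set vs" "u v \<noteq> 0" "(\<Sum>v\<in>set vs. u v *\<^sub>R v) = 0"
      by (auto simp: dependent_finite)
    have "(\<Sum>j<length vs. u (vs ! j) *\<^sub>R vs ! j) = 0"
      using u(3) sum.reindex_bij_betw[OF bij_betw_nth[OF \<open>distinct vs\<close> refl refl], of "\<lambda>v. u v *\<^sub>R v"] by simp
    then have "(\<Sum>j<length vs. u (vs ! j) * vs ! j $ i) = 0" for i
      by (simp add: Finite_Cartesian_Product.vec_eq_iff)
    moreover obtain j where "j < length vs" "vs ! j = v" using u(1) by (metis in_set_conv_nth)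
    ultimately have "col_dep (\<lambda>j i. (vs ! j) $ i) (length vs)"
      unfolding col_dep_def by (intro exI[of _ "\<lambda>j. u (vs ! j)"] conjI exI[of _ j]) (auto simp: u(2))
    with nd show False ..
  qed
  ultimately show "lin_indep_list vs" by (simp add: lin_indep_list_def)
qed

section \<open>Degrees and the vector space structure\<close>

interpretation mpoly_vs: vector_space "\<lambda>c (p::('v, real) mpoly). Const c * p"
  by unfold_locales (simp_all only: distrib_left distrib_right Const_add Const_mult mult.assoc Const_1 mult_1)

lemma real_dim_eq: "real_dim W = mpoly_vs.dim W"
  by (simp add: real_dim_def)

definition mdeg :: "('v::finite \<Rightarrow>\<^sub>0 nat) \<Rightarrow> nat" where
  "mdeg m = (\<Sum>i\<in>UNIV. expo m i)"

lemma mdeg_add: "mdeg (a + b) = mdeg a + mdeg b"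
  by (simp add: mdeg_def lookup_add sum.distrib)

lemma mdeg_single [simp]: "mdeg (Poly_Mapping.single i k) = k"
proof -
  have "mdeg (Poly_Mapping.single i k) = (\<Sum>j\<in>UNIV. if j = i then k else 0)"
    unfolding mdeg_def by (rule sum.cong) (auto simp: lookup_single when_def)
  then show ?thesis by simp
qed

lemma polys_upto_alt: "polys_upto s = {p. \<forall>m\<in>Poly_Mapping.keys p. mdeg m \<le> s}"
  by (simp add: polys_upto_def mdeg_def)

lemma finite_expo_le: "finite {m :: 'v::finite \<Rightarrow>\<^sub>0 nat. \<forall>i. expo m i \<le> s}"
  and card_expo_le: "card {m :: 'v::finite \<Rightarrow>\<^sub>0 nat. \<forall>i. expo m i \<le> s} = (s + 1) ^ CARD('v)"
proof -
  have bij: "bij_betw Poly_Mapping.lookup {m :: 'v \<Rightarrow>\<^sub>0 nat. \<forall>i. expo m i \<le> s} (UNIV \<rightarrow>\<^sub>E {..s})"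
    by (rule bij_betwI[where g = "Abs_poly_mapping"])
      (auto intro!: poly_mapping_eqI simp: lookup_Abs_poly_mapping)
  have fin: "finite ((UNIV :: 'v set) \<rightarrow>\<^sub>E {..s})" by (intro finite_PiE) auto
  show "finite {m :: 'v \<Rightarrow>\<^sub>0 nat. \<forall>i. expo m i \<le> s}" using bij fin bij_betw_finite by blast
  show "card {m :: 'v \<Rightarrow>\<^sub>0 nat. \<forall>i. expo m i \<le> s} = (s + 1) ^ CARD('v)"
    using bij_betw_same_card[OF bij] by (simp add: card_PiE)
qed

lemma expo_le_mdeg: "expo m i \<le> mdeg m"
  unfolding mdeg_def by (rule member_le_sum) auto

lemma finite_mdeg_le: "finite {m :: 'v::finite \<Rightarrow>\<^sub>0 nat. mdeg m \<le> s}"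
  by (rule finite_subset[OF _ finite_expo_le[of s]]) (simp add: subset_iff le_trans[OF expo_le_mdeg])

subsection \<open>A graded monomial order\<close>

text \<open>The variable type carries no order. An arbitrary injective numbering breaks ties between
  monomials of equal degree.\<close>

definition var_index :: "'v::finite \<Rightarrow> nat" where
  "var_index = (SOME f. inj f)"

lemma inj_var_index: "inj (var_index :: 'v::finite \<Rightarrow> nat)"
proof -
  obtain f :: "'v \<Rightarrow> nat" where "inj f" using finite_imp_inj_to_nat_seg[of "UNIV :: 'v set"] by auto
  then show ?thesis unfolding var_index_def by (metis someI)
qed

text \<open>Compared lexicographically, these codes give the graded lexicographic order: position \<open>0\<close>
  holds the degree.\<close>

definition code :: "('v::finite \<Rightarrow>\<^sub>0 nat) \<Rightarrow> (nat \<Rightarrow>\<^sub>0 nat)" where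
  "code m = Poly_Mapping.single 0 (mdeg m) + (\<Sum>i\<in>UNIV. Poly_Mapping.single (Suc (var_index i)) (expo m i))"

lemma code_add: "code (a + b) = code a + code b"
  by (simp add: code_def mdeg_add single_add lookup_add sum.distrib algebra_simps)

lemma code_0: "expo (code m) 0 = mdeg m"
  by (simp add: code_def lookup_add lookup_sum lookup_single)

lemma code_Suc: "expo (code m) (Suc (var_index i)) = expo m i"
proof -
  have "(\<Sum>j\<in>UNIV. expo (Poly_Mapping.single (Suc (var_index j)) (expo m j)) (Suc (var_index i)))
     = (\<Sum>j\<in>UNIV. if j = i then expo m i else 0)"
    by (rule sum.cong) (auto simp: lookup_single when_def dest: injD[OF inj_var_index])
  then show ?thesis by (simp add: code_def lookup_add lookup_sum lookup_single)
qed

lemma inj_code: "inj code"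
  by (rule injI, rule poly_mapping_eqI) (metis code_Suc)

lemma code_eq_iff [simp]: "code a = code b \<longleftrightarrow> a = b"
  by (rule inj_eq[OF inj_code])

lemma code_less_if_mdeg_less: "mdeg a < mdeg b \<Longrightarrow> code a < code b"
  unfolding less_poly_mapping.rep_eq less_fun_def by (rule exI[of _ 0]) (simp add: code_0)

text \<open>The order lives on the codes, so the exponent is recovered from the largest code. For
  the zero polynomial the value is arbitrary.\<close>

definition lead :: "('v::finite, 'a::zero) mpoly \<Rightarrow> ('v \<Rightarrow>\<^sub>0 nat)" where
  "lead p = inv_into (Poly_Mapping.keys p) code (Max (code ` Poly_Mapping.keys p))"

lemma lead_in_keys: "p \<noteq> 0 \<Longrightarrow> lead p \<in> Poly_Mapping.keys p"
  and code_le_lead: "m \<in> Poly_Mapping.keys p \<Longrightarrow> code m \<le> code (lead p)"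
proof -
  have M: "Max (code ` Poly_Mapping.keys p) \<in> code ` Poly_Mapping.keys p" if "p \<noteq> 0"
    using that by (intro Max_in) auto
  show "p \<noteq> 0 \<Longrightarrow> lead p \<in> Poly_Mapping.keys p" unfolding lead_def by (rule inv_into_into[OF M])
  assume m: "m \<in> Poly_Mapping.keys p"
  then have "p \<noteq> 0" by auto
  then have "code (lead p) = Max (code ` Poly_Mapping.keys p)" unfolding lead_def by (rule f_inv_into_f[OF M])
  with m show "code m \<le> code (lead p)" by simp
qed

lemma lead_eqI: "m \<in> Poly_Mapping.keys p \<Longrightarrow> (\<And>k. k \<in> Poly_Mapping.keys p \<Longrightarrow> code k \<le> code m) \<Longrightarrow> lead p = m"
proof -
  assume m: "m \<in> Poly_Mapping.keys p" and le: "\<And>k. k \<in> Poly_Mapping.keys p \<Longrightarrow> code k \<le> code m"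
  then have "lead p \<in> Poly_Mapping.keys p" by (intro lead_in_keys) auto
  from le[OF this] code_le_lead[OF m] have "code (lead p) = code m" by (rule order_antisym)
  then show ?thesis by simp
qed

lemma mdeg_le_lead: "m \<in> Poly_Mapping.keys p \<Longrightarrow> mdeg m \<le> mdeg (lead p)"
  using code_le_lead[of m p] code_less_if_mdeg_less[of "lead p" m] by (metis not_less)

lemma polys_upto_iff_lead: "p \<noteq> 0 \<Longrightarrow> p \<in> polys_upto s \<longleftrightarrow> mdeg (lead p) \<le> s"
  unfolding polys_upto_alt mem_Collect_eq
  using lead_in_keys[of p] mdeg_le_lead[of _ p] le_trans[of _ "mdeg (lead p)" s] by blast

lemma coef_single_mult: "coef (Poly_Mapping.single a c * p) (a + m) = c * coef p m"
  for p :: "('v, real) mpoly"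
proof -
  have "Poly_Mapping.single a c * p
      = Poly_Mapping.single a c * (\<Sum>k\<in>Poly_Mapping.keys p. Poly_Mapping.single k (coef p k))"
    by (simp flip: mpoly_eq_sum_single)
  also have "coef \<dots> (a + m) = (\<Sum>k\<in>Poly_Mapping.keys p. if k = m then c * coef p m else 0)"
    unfolding sum_distrib_left mult_single lookup_sum
    by (rule sum.cong) (auto simp: lookup_single when_def)
  finally show ?thesis by (simp add: in_keys_iff)
qed

lemma lead_single_mult:
  fixes p :: "('v::finite, real) mpoly"
  assumes "p \<noteq> 0" shows "lead (Poly_Mapping.single a 1 * p) = a + lead p"
proof (rule lead_eqI)
  show "a + lead p \<in> Poly_Mapping.keys (Poly_Mapping.single a 1 * p)"
    using lead_in_keys[OF assms] by (simp add: in_keys_iff coef_single_mult)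
  fix k assume "k \<in> Poly_Mapping.keys (Poly_Mapping.single a 1 * p)"
  then obtain m where "k = a + m" "m \<in> Poly_Mapping.keys p"
    using keys_mult[of "Poly_Mapping.single a 1" p] by auto
  then show "code k \<le> code (a + lead p)" by (simp add: code_add add_left_mono code_le_lead)
qed

text \<open>Gaussian elimination. Members of \<open>W\<close> with different leading exponents are
  independent, and subtracting a multiple of the chosen member with the same leading exponent makes
  that exponent smaller; the degree bound leaves only finitely many exponents below, so this
  stops.\<close>

lemma dim_eq_card_lead:
  fixes W :: "('v::finite, real) mpoly set"
  assumes sub: "mpoly_vs.subspace W" and W: "W \<subseteq> polys_upto s"
  shows "mpoly_vs.dim W = card (lead ` (W - {0}))"
proof -
  let ?L = "lead ` (W - {0})"
  \<comment> \<open>One member of \<open>W\<close> for each leading exponent that occurs.\<close>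
  define b where "b m = (SOME p. p \<in> W - {0} \<and> lead p = m)" for m
  have b: "b m \<in> W" "b m \<noteq> 0" "lead (b m) = m" if "m \<in> ?L" for m
    using someI_ex[of "\<lambda>p. p \<in> W - {0} \<and> lead p = m"] that unfolding b_def by auto
  have inj: "inj_on b ?L" using b(3) by (metis inj_onI)
  have ind: "mpoly_vs.independent (b ` ?L)"
    unfolding mpoly_vs.independent_explicit_module
  proof (intro allI impI)
    fix T u v
    assume T: "finite T" "T \<subseteq> b ` ?L" and u0: "(\<Sum>v\<in>T. Const (u v) * v) = 0" and v: "v \<in> T"
    show "u v = 0"
    proof (rule ccontr)
      assume "u v \<noteq> 0"
      \<comment> \<open>Of the terms with nonzero coefficient, the one with the largest leading
        exponent cannot be cancelled by the others.\<close>
      let ?T = "{v\<in>T. u v \<noteq> 0}"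
      have T': "finite ?T" "?T \<noteq> {}" using T v \<open>u v \<noteq> 0\<close> by auto
      have "Max ((code \<circ> lead) ` ?T) \<in> (code \<circ> lead) ` ?T" using T' by (intro Max_in) auto
      then obtain w where w: "w \<in> ?T" "code (lead w) = Max ((code \<circ> lead) ` ?T)" by auto
      have mx: "code (lead x) \<le> code (lead w)" if "x \<in> ?T" for x
        unfolding w(2) using that T' by (intro Max_ge) auto
      have bl: "b (lead x) = x" "x \<noteq> 0" if xT: "x \<in> T" for x
      proof -
        obtain m where m: "m \<in> ?L" "x = b m" using T(2) xT by (meson imageE subsetD)
        from b[OF m(1)] m(2) show "b (lead x) = x" "x \<noteq> 0" by simp_all
      qed
      have "coef (Const (u x) * x) (lead w) = (if x = w then u w * coef w (lead w) else 0)" if "x \<in> T" for x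
      proof (cases "x = w \<or> u x = 0")
        case True then show ?thesis using w by (auto simp: coef_Const_mult)
      next
        case False
        then have "lead x \<noteq> lead w" using bl that w by (metis (lifting) mem_Collect_eq)
        moreover have "code (lead x) \<le> code (lead w)" using mx[of x] that False by simp
        ultimately have "lead w \<notin> Poly_Mapping.keys x" by (metis code_le_lead code_eq_iff order_antisym)
        then show ?thesis using False by (simp add: coef_Const_mult in_keys_iff)
      qed
      then have "coef (\<Sum>v\<in>T. Const (u v) * v) (lead w) = (\<Sum>x\<in>T. if x = w then u w * coef w (lead w) else 0)"
        unfolding lookup_sum by (rule sum.cong[OF refl])
      also have "\<dots> = u w * coef w (lead w)" using T(1) w(1) by simp
      finally show False using u0 w(1) lead_in_keys[of w] bl(2)[of w] by (auto simp: in_keys_iff)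
    qed
  qed
  have "p \<in> mpoly_vs.span (b ` ?L)" if "p \<in> W" for p
    using that
  proof (induction "card {m :: 'v \<Rightarrow>\<^sub>0 nat. mdeg m \<le> s \<and> code m < code (lead p)}" arbitrary: p rule: less_induct)
    case less
    show ?case
    proof (cases "p = 0")
      case True then show ?thesis by (simp add: mpoly_vs.span_zero)
    next
      case False
      let ?m = "lead p"
      let ?b = "b ?m"
      have mL: "?m \<in> ?L" using False less.prems by auto
      let ?c = "coef p ?m / coef ?b ?m"
      let ?q = "p - Const ?c * ?b"
      have bm: "coef ?b ?m \<noteq> 0" using lead_in_keys[OF b(2)[OF mL]] b(3)[OF mL] by (simp add: in_keys_iff)
      have qW: "?q \<in> W" using sub less.prems b(1)[OF mL]
        by (intro mpoly_vs.subspace_diff mpoly_vs.subspace_scale)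
      have "?q \<in> mpoly_vs.span (b ` ?L)"
      proof (cases "?q = 0")
        case True then show ?thesis by (metis mpoly_vs.span_zero)
      next
        case q0: False
        have "lead ?q \<in> Poly_Mapping.keys ?q" by (rule lead_in_keys[OF q0])
        moreover have "?m \<notin> Poly_Mapping.keys ?q" using bm by (simp add: in_keys_iff lookup_minus coef_Const_mult)
        moreover have "code k \<le> code ?m" if "k \<in> Poly_Mapping.keys ?q" for k
        proof (cases "k \<in> Poly_Mapping.keys p")
          case False
          with that have "k \<in> Poly_Mapping.keys ?b" by (auto simp: in_keys_iff lookup_minus coef_Const_mult)
          then show ?thesis using code_le_lead[of k ?b] b(3)[OF mL] by simp
        qed (rule code_le_lead)
        ultimately have lt: "code (lead ?q) < code ?m" by (metis code_eq_iff order_less_le)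
        have "mdeg (lead ?q) \<le> s" using W qW polys_upto_iff_lead[OF q0, of s] by blast
        with lt have "lead ?q \<in> {m :: 'v \<Rightarrow>\<^sub>0 nat. mdeg m \<le> s \<and> code m < code ?m}" by blast
        have "card {m :: 'v \<Rightarrow>\<^sub>0 nat. mdeg m \<le> s \<and> code m < code (lead ?q)} < card {m :: 'v \<Rightarrow>\<^sub>0 nat. mdeg m \<le> s \<and> code m < code ?m}"
        proof (rule psubset_card_mono)
          show "finite {m :: 'v \<Rightarrow>\<^sub>0 nat. mdeg m \<le> s \<and> code m < code ?m}"
            using finite_mdeg_le[of s] by (rule rev_finite_subset) auto
          have "{m :: 'v \<Rightarrow>\<^sub>0 nat. mdeg m \<le> s \<and> code m < code (lead ?q)} \<subseteq> {m :: 'v \<Rightarrow>\<^sub>0 nat. mdeg m \<le> s \<and> code m < code ?m}"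
            using lt by (auto intro: less_trans)
          moreover have "lead ?q \<notin> {m :: 'v \<Rightarrow>\<^sub>0 nat. mdeg m \<le> s \<and> code m < code (lead ?q)}" by simp
          ultimately show "{m :: 'v \<Rightarrow>\<^sub>0 nat. mdeg m \<le> s \<and> code m < code (lead ?q)} \<subset> {m :: 'v \<Rightarrow>\<^sub>0 nat. mdeg m \<le> s \<and> code m < code ?m}"
            using \<open>lead ?q \<in> {m :: 'v \<Rightarrow>\<^sub>0 nat. mdeg m \<le> s \<and> code m < code ?m}\<close> by blast
        qed
        from less.hyps[OF this qW] show ?thesis .
      qed
      moreover have "Const ?c * ?b \<in> mpoly_vs.span (b ` ?L)"
        using mL by (intro mpoly_vs.span_scale mpoly_vs.span_base) auto
      ultimately have "?q + Const ?c * ?b \<in> mpoly_vs.span (b ` ?L)" by (rule mpoly_vs.span_add)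
      then show ?thesis by simp
    qed
  qed
  moreover have "b ` ?L \<subseteq> W" using b(1) by auto
  ultimately have "mpoly_vs.span (b ` ?L) = mpoly_vs.span W"
    by (metis mpoly_vs.span_eq_iff mpoly_vs.span_minimal sub subsetI subset_antisym)
  from mpoly_vs.dim_eq_card[OF this ind] show ?thesis using card_image[OF inj] by simp
qed

subsection \<open>Standard monomials\<close>

text \<open>The staircase of Groebner theory: for an ideal \<open>I\<close>, the monomials outside
  the initial ideal, whose classes form a basis of the quotient ring.\<close>

definition std_monoms :: "('v::finite, real) mpoly set \<Rightarrow> ('v \<Rightarrow>\<^sub>0 nat) set" where
  "std_monoms I = - lead ` (I - {0})"

definition std_upto :: "('v::finite, real) mpoly set \<Rightarrow> nat \<Rightarrow> ('v \<Rightarrow>\<^sub>0 nat) set" where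
  "std_upto I s = {m \<in> std_monoms I. mdeg m \<le> s}"

lemma subspace_polys_upto: "mpoly_vs.subspace (polys_upto s :: ('v::finite, real) mpoly set)"
  unfolding mpoly_vs.subspace_def polys_upto_alt using keys_add
  by (auto simp: in_keys_iff coef_Const_mult lookup_add)

lemma subspace_if_ideal: "mpoly_module.subspace I \<Longrightarrow> mpoly_vs.subspace I"
  by (auto simp: mpoly_vs.subspace_def mpoly_module.subspace_def)

lemma lead_single [simp]: "lead (Poly_Mapping.single m (1::real)) = m"
  by (rule lead_eqI) auto

text \<open>In a graded order the degree of the leading monomial is the degree of the polynomial.
  Hence among the monomials of degree at most \<open>s\<close> the nonstandard ones are the leading
  monomials of \<open>I \<inter> polys_upto s\<close>, and the Hilbert function counts the
  rest.\<close>

lemma std_upto_card: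
  fixes I :: "('v::finite, real) mpoly set"
  assumes "mpoly_module.subspace I"
  shows "affine_hilbert_function I s = int (card (std_upto I s))"
    and "mpoly_vs.dim (polys_upto s :: ('v, real) mpoly set)
      = card (std_upto I s) + mpoly_vs.dim (I \<inter> polys_upto s)"
proof -
  let ?A = "{m :: 'v \<Rightarrow>\<^sub>0 nat. mdeg m \<le> s}"
  have "lead ` (polys_upto s - {0 :: ('v, real) mpoly}) = ?A"
  proof
    show "?A \<subseteq> lead ` (polys_upto s - {0 :: ('v, real) mpoly})"
    proof
      fix m :: "'v \<Rightarrow>\<^sub>0 nat" assume "m \<in> ?A"
      moreover have "Poly_Mapping.single m (1::real) \<noteq> 0"
        by (metis lookup_single_eq lookup_zero zero_neq_one)
      ultimately have "Poly_Mapping.single m (1::real) \<in> polys_upto s - {0}"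
        by (simp add: polys_upto_alt)
      then show "m \<in> lead ` (polys_upto s - {0 :: ('v, real) mpoly})" by (metis lead_single rev_image_eqI)
    qed
  qed (auto simp: polys_upto_iff_lead)
  then have d1: "mpoly_vs.dim (polys_upto s :: ('v, real) mpoly set) = card ?A"
    using dim_eq_card_lead[OF subspace_polys_upto order_refl, where ?'v = 'v and s = s] by simp
  have "lead ` (I \<inter> polys_upto s - {0}) = ?A - std_monoms I"
    by (auto simp: std_monoms_def polys_upto_iff_lead)
  then have d2: "mpoly_vs.dim (I \<inter> polys_upto s) = card (?A - std_monoms I)"
    using dim_eq_card_lead[OF mpoly_vs.subspace_inter[OF subspace_if_ideal[OF assms] subspace_polys_upto] Int_lower2]
    by simp
  have "card ?A = card (?A \<inter> std_monoms I) + card (?A - std_monoms I)"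
    using finite_mdeg_le[of s] by (metis Int_Diff_disjoint Int_Diff_Un card_Un_disjoint finite_Diff finite_Int)
  moreover have "?A \<inter> std_monoms I = std_upto I s" by (auto simp: std_upto_def)
  ultimately show *: "mpoly_vs.dim (polys_upto s :: ('v, real) mpoly set)
      = card (std_upto I s) + mpoly_vs.dim (I \<inter> polys_upto s)" using d1 d2 by simp
  then show "affine_hilbert_function I s = int (card (std_upto I s))"
    by (simp add: affine_hilbert_function_def real_dim_eq)
qed

lemma std_monoms_down_closed:
  assumes "mpoly_module.subspace I" "a + m \<in> std_monoms I" shows "m \<in> std_monoms I"
proof (rule ccontr)
  assume "m \<notin> std_monoms I"
  then obtain p where p: "p \<in> I" "p \<noteq> 0" "lead p = m" by (auto simp: std_monoms_def)
  then have "Poly_Mapping.single a 1 * p \<in> I" using assms(1) by (simp add: mpoly_module.subspace_scale)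
  moreover have "Poly_Mapping.single a 1 * p \<noteq> 0"
  proof
    assume "Poly_Mapping.single a 1 * p = 0"
    then have "coef p (lead p) = 0" by (metis coef_single_mult lookup_zero mult_1)
    then show False using lead_in_keys[OF p(2)] by (simp add: in_keys_iff)
  qed
  ultimately have "lead (Poly_Mapping.single a 1 * p) \<in> lead ` (I - {0})" by blast
  with assms(2) p(3) show False by (simp add: std_monoms_def lead_single_mult[OF p(2)])
qed

text \<open>The pigeonhole principle behind Perron's theorem and behind the relations on a variety:
  without such a combination, the family together with a basis of
  \<open>I \<inter> polys_upto s\<close> would be independent and exceed the dimension of
  \<open>polys_upto s\<close>.\<close>

lemma exists_combination_in_ideal:
  fixes I :: "('v::finite, real) mpoly set" and q :: "'b \<Rightarrow> ('v, real) mpoly"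
  assumes I: "mpoly_module.subspace I" and S: "finite S" "\<And>a. a \<in> S \<Longrightarrow> q a \<in> polys_upto s"
    and card: "card (std_upto I s) < card S"
  shows "\<exists>c. (\<exists>a\<in>S. c a \<noteq> 0) \<and> (\<Sum>a\<in>S. Const (c a) * q a) \<in> I"
proof (rule ccontr)
  assume no: "\<not> ?thesis"
  have triv: "c a = 0" if "(\<Sum>a\<in>S. Const (c a) * q a) \<in> I" "a \<in> S" for c a using no that by blast
  have I0: "0 \<in> I" using I by (rule mpoly_module.subspace_0)
  have inj: "inj_on q S"
  proof (rule inj_onI, rule ccontr)
    fix a b assume ab: "a \<in> S" "b \<in> S" "q a = q b" "a \<noteq> b"
    define c :: "'b \<Rightarrow> real" where "c x = (if x = a then 1 else if x = b then -1 else 0)" for x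
    have "(\<Sum>x\<in>S. Const (c x) * q x) = (\<Sum>x\<in>{a, b}. Const (c x) * q x)"
      using ab S(1) by (intro sum.mono_neutral_right) (auto simp: c_def)
    also have "\<dots> = 0" using ab(3,4) by (simp add: c_def Const_uminus)
    finally have "(\<Sum>x\<in>S. Const (c x) * q x) \<in> I" using I0 by simp
    from triv[OF this ab(1)] show False by (simp add: c_def)
  qed
  obtain B where B: "B \<subseteq> I \<inter> polys_upto s" "mpoly_vs.independent B"
    "I \<inter> polys_upto s \<subseteq> mpoly_vs.span B" "card B = mpoly_vs.dim (I \<inter> polys_upto s)"
    by (rule mpoly_vs.basis_exists)
  obtain M :: "('v, real) mpoly set" where M: "M \<subseteq> polys_upto s" "mpoly_vs.independent M" "polys_upto s \<subseteq> mpoly_vs.span M"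
    "card M = mpoly_vs.dim (polys_upto s :: ('v, real) mpoly set)"
    by (rule mpoly_vs.basis_exists)
  have finM: "finite M"
  proof -
    let ?X = "(\<lambda>m. Poly_Mapping.single m (1::real)) ` {m :: 'v \<Rightarrow>\<^sub>0 nat. mdeg m \<le> s}"
    have "p \<in> mpoly_vs.span ?X" if "p \<in> polys_upto s" for p
    proof -
      have "(\<Sum>m\<in>Poly_Mapping.keys p. Const (coef p m) * Poly_Mapping.single m 1) \<in> mpoly_vs.span ?X"
        using that by (intro mpoly_vs.span_sum mpoly_vs.span_scale mpoly_vs.span_base) (auto simp: polys_upto_alt)
      then show ?thesis by (simp flip: Const_single_mult mpoly_eq_sum_single)
    qed
    with M(1) have "M \<subseteq> mpoly_vs.span ?X" by blast
    then show ?thesis using mpoly_vs.independent_span_bound[OF _ M(2), of ?X] finite_mdeg_le[of s] by blast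
  qed
  have finB: "finite B"
    using mpoly_vs.independent_span_bound[OF finM B(2)] B(1) M(3) by blast
  have disj: "q ` S \<inter> B = {}"
  proof (rule ccontr)
    assume "q ` S \<inter> B \<noteq> {}"
    then obtain a where a: "a \<in> S" "q a \<in> I" using B(1) by blast
    define c :: "'b \<Rightarrow> real" where "c x = (if x = a then 1 else 0)" for x
    have "(\<Sum>x\<in>S. Const (c x) * q x) = (\<Sum>x\<in>{a}. Const (c x) * q x)"
      using a S(1) by (intro sum.mono_neutral_right) (auto simp: c_def)
    then have "(\<Sum>x\<in>S. Const (c x) * q x) \<in> I" using a by (simp add: c_def)
    from triv[OF this a(1)] show False by (simp add: c_def)
  qed
  have "mpoly_vs.independent (q ` S \<union> B)"
  proof
    assume "mpoly_vs.dependent (q ` S \<union> B)"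
    then obtain u v where u: "v \<in> q ` S \<union> B" "u v \<noteq> 0" "(\<Sum>v\<in>q ` S \<union> B. Const (u v) * v) = 0"
      using S(1) finB by (subst (asm) mpoly_vs.dependent_finite) auto
    have split: "(\<Sum>a\<in>S. Const (u (q a)) * q a) = - (\<Sum>v\<in>B. Const (u v) * v)"
      using u(3) S(1) finB disj inj
      by (simp add: sum.union_disjoint sum.reindex eq_neg_iff_add_eq_0)
    also have "\<dots> \<in> I" using B(1) I
      by (intro mpoly_module.subspace_neg mpoly_module.subspace_sum mpoly_module.subspace_scale) auto
    finally have ua: "u (q a) = 0" if "a \<in> S" for a by (rule triv[OF _ that])
    with split have "(\<Sum>v\<in>B. Const (u v) * v) = 0" by simp
    with B(2) finB have "u v = 0" if "v \<in> B" for v using that by (auto simp: mpoly_vs.dependent_finite)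
    with ua u show False by auto
  qed
  from mpoly_vs.independent_span_bound[OF finM this]
  have "card (q ` S \<union> B) \<le> card M" using M(3) S(2) B(1) by blast
  moreover have "card (q ` S \<union> B) = card S + card B"
    using disj S(1) finB by (simp add: card_Un_disjoint card_image[OF inj])
  ultimately show False using card B(4) M(4) std_upto_card(2)[OF I, of s] by simp
qed

lemma exists_mdeg_bound: "finite X \<Longrightarrow> \<exists>s0. \<forall>m\<in>X. mdeg m \<le> s0"
  by (rule exI[of _ "Max (mdeg ` X)"]) auto

text \<open>The slope is a natural number, so slopes cannot cancel in sums; the offset may be
  negative, as for the points of a ray that starts in high degree.\<close>

definition eventually_linear :: "(nat \<Rightarrow> nat) \<Rightarrow> bool" where
  "eventually_linear h \<longleftrightarrow> (\<exists>c d. \<forall>\<^sub>F s in sequentially. int (h s) = int c * int s + d)"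

lemma eventually_linear_add:
  assumes "eventually_linear g" "eventually_linear h" shows "eventually_linear (\<lambda>s. g s + h s)"
proof -
  obtain c d c' d' where
    "\<forall>\<^sub>F s in sequentially. int (g s) = int c * int s + d" "\<forall>\<^sub>F s in sequentially. int (h s) = int c' * int s + d'"
    using assms by (auto simp: eventually_linear_def)
  then have "\<forall>\<^sub>F s in sequentially. int (g s + h s) = int (c + c') * int s + (d + d')"
    by eventually_elim (simp add: algebra_simps)
  then show ?thesis unfolding eventually_linear_def by blast
qed

lemma eventually_linear_const: "eventually_linear (\<lambda>s. k)"
  unfolding eventually_linear_def by (intro exI[of _ 0] exI[of _ "int k"]) simp

lemma eventually_linear_sum:
  "(\<And>x. x \<in> X \<Longrightarrow> eventually_linear (h x)) \<Longrightarrow> eventually_linear (\<lambda>s. \<Sum>x\<in>X. h x s)"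
  by (induction X rule: infinite_finite_induct)
    (simp_all add: eventually_linear_add eventually_linear_const)

lemma eventually_linear_cong:
  assumes "eventually_linear g" "\<forall>\<^sub>F s in sequentially. h s = g s" shows "eventually_linear h"
proof -
  obtain c d where "\<forall>\<^sub>F s in sequentially. int (g s) = int c * int s + d"
    using assms(1) by (auto simp: eventually_linear_def)
  with assms(2) have "\<forall>\<^sub>F s in sequentially. int (h s) = int c * int s + d"
    by eventually_elim simp
  then show ?thesis unfolding eventually_linear_def by blast
qed

lemma eventually_linear_finite:
  assumes "finite X" shows "eventually_linear (\<lambda>s. card {m\<in>X. mdeg m \<le> s})"
proof (rule eventually_linear_cong[OF eventually_linear_const])
  obtain s0 where s0: "\<forall>m\<in>X. mdeg m \<le> s0" using exists_mdeg_bound[OF assms] by blast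
  have "{m\<in>X. mdeg m \<le> s} = X" if "s \<ge> s0" for s using s0 that le_trans by blast
  then show "\<forall>\<^sub>F s in sequentially. card {m\<in>X. mdeg m \<le> s} = card X"
    unfolding eventually_sequentially by metis
qed

lemma finite_expo_less: "finite {m :: 'v::finite \<Rightarrow>\<^sub>0 nat. \<forall>i. expo m i < K}"
  using finite_expo_le[of K] by (rule rev_finite_subset) (simp add: subset_iff less_imp_le_nat)

text \<open>If no element of \<open>D\<close> has two large exponents, then \<open>D\<close> consists of finitely many points and
  of finitely many rays in coordinate directions.\<close>

lemma eventually_linear_card_down_closed:
  fixes D :: "('v::finite \<Rightarrow>\<^sub>0 nat) set"
  assumes dc: "\<And>a m. a + m \<in> D \<Longrightarrow> m \<in> D"
    and small: "\<And>m i j. m \<in> D \<Longrightarrow> i \<noteq> j \<Longrightarrow> expo m i < K0 \<or> expo m j < K0"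
    and inf: "infinite D"
  shows "\<exists>c d. c > 0 \<and> (\<forall>\<^sub>F s in sequentially. int (card {m\<in>D. mdeg m \<le> s}) = int c * int s + d)"
proof -
  \<comment> \<open>One more than \<open>K0\<close>, so that \<open>K\<close> is positive: the base
    of a ray has exponent 0 in the direction of the ray and must lie in the box
    \<open>B\<close>.\<close>
  define K where "K = Suc K0"
  have K: "expo m i < K \<or> expo m j < K" if "m \<in> D" "i \<noteq> j" for m i j
    using small[OF that] by (auto simp: K_def)
  define B where "B = {b :: 'v \<Rightarrow>\<^sub>0 nat. \<forall>i. expo b i < K}"
  define R where "R = {(i, b). b \<in> B \<and> expo b i = 0}"
  \<comment> \<open>Only the part of a ray with \<open>k \<ge> K\<close> is taken, which keeps the
    rays apart from the box \<open>B\<close> and from each other.\<close>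
  define ray where "ray = (\<lambda>(i, b). {m \<in> D. \<exists>k\<ge>K. m = b + Poly_Mapping.single i k})"
  have finB: "finite B" unfolding B_def by (rule finite_expo_less)
  then have finR: "finite R"
    unfolding R_def by (intro finite_subset[OF _ finite_cartesian_product[of UNIV B]]) auto
  have finD: "finite {m\<in>X. mdeg m \<le> s}" for X :: "('v \<Rightarrow>\<^sub>0 nat) set" and s
    using finite_mdeg_le[of s] by (rule rev_finite_subset) auto
  have ray_eq: "expo (b + Poly_Mapping.single i k) j = (if j = i then expo b i + k else expo b j)" for b i j k
    by (simp add: lookup_add lookup_single when_def)
  have cover: "D = (D \<inter> B) \<union> (\<Union>x\<in>R. ray x)"
  proof (intro equalityI subsetI)
    fix m assume m: "m \<in> D"
    show "m \<in> (D \<inter> B) \<union> (\<Union>x\<in>R. ray x)"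
    proof (cases "m \<in> B")
      case False
      then obtain i where i: "expo m i \<ge> K" unfolding B_def using not_less by blast
      define b where "b = m - Poly_Mapping.single i (expo m i)"
      have b: "expo b j = (if j = i then 0 else expo m j)" for j
        by (simp add: b_def lookup_minus lookup_single when_def)
      have "expo m j < K" if "j \<noteq> i" for j using K[OF m that] i by auto
      moreover have "m = b + Poly_Mapping.single i (expo m i)"
        by (rule poly_mapping_eqI) (simp add: b ray_eq)
      moreover have "0 < K" by (simp add: K_def)
      ultimately have "(i, b) \<in> R" "m \<in> ray (i, b)"
        using m i by (simp_all add: R_def B_def b ray_def) blast
      then show ?thesis by blast
    qed (use m in blast)
  qed (auto simp: ray_def)
  have disjB: "(D \<inter> B) \<inter> (\<Union>x\<in>R. ray x) = {}"
  proof -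
    have False if "b + Poly_Mapping.single i k \<in> B" "k \<ge> K" for b i k
      using that(1)[unfolded B_def, simplified, rule_format, of i] that(2) by (simp add: ray_eq)
    then show ?thesis by (auto simp: ray_def)
  qed
  have disjR: "ray x \<inter> ray y = {}" if xy: "x \<in> R" "y \<in> R" "x \<noteq> y" for x y
  proof (rule ccontr)
    assume "ray x \<inter> ray y \<noteq> {}"
    then obtain i b k j b' k' where x: "x = (i, b)" "y = (j, b')" "k \<ge> K" "k' \<ge> K"
      and eq: "b + Poly_Mapping.single i k = b' + Poly_Mapping.single j k'"
      by (cases x, cases y) (auto simp: ray_def)
    have lk: "(if l = i then expo b i + k else expo b l) = (if l = j then expo b' j + k' else expo b' l)" for l
      using arg_cong[OF eq, of "\<lambda>m. expo m l"] by (simp only: ray_eq)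
    have small: "expo b l < K" "expo b' l < K" "expo b i = 0" "expo b' j = 0" for l
      using xy x by (auto simp: R_def B_def)
    have "i = j" using lk[of i] small(2)[of i] x(3) by (auto split: if_splits)
    moreover have "b = b'"
    proof (rule poly_mapping_eqI)
      fix l show "expo b l = expo b' l"
        using lk[of l] small(3,4) \<open>i = j\<close> by (cases "l = i") simp_all
    qed
    ultimately show False using x xy(3) by simp
  qed
  have count: "card {m\<in>D. mdeg m \<le> s} = card {m\<in>D \<inter> B. mdeg m \<le> s} + (\<Sum>x\<in>R. card {m\<in>ray x. mdeg m \<le> s})" for s
  proof -
    have "{m\<in>D. mdeg m \<le> s} = {m\<in>D \<inter> B. mdeg m \<le> s} \<union> (\<Union>x\<in>R. {m\<in>ray x. mdeg m \<le> s})"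
      by (subst cover) blast
    moreover have "card ({m\<in>D \<inter> B. mdeg m \<le> s} \<union> (\<Union>x\<in>R. {m\<in>ray x. mdeg m \<le> s}))
        = card {m\<in>D \<inter> B. mdeg m \<le> s} + card (\<Union>x\<in>R. {m\<in>ray x. mdeg m \<le> s})"
      using finD finR disjB by (intro card_Un_disjoint) auto
    moreover have "card (\<Union>x\<in>R. {m\<in>ray x. mdeg m \<le> s}) = (\<Sum>x\<in>R. card {m\<in>ray x. mdeg m \<le> s})"
    proof (intro card_UN_disjoint ballI impI)
      show "{m\<in>ray x. mdeg m \<le> s} \<inter> {m\<in>ray y. mdeg m \<le> s} = {}" if "x \<in> R" "y \<in> R" "x \<noteq> y" for x y
        using disjR[OF that] by blast
    qed (use finD finR in auto)
    ultimately show ?thesis by simp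
  qed
  have ray_lin: "eventually_linear (\<lambda>s. card {m\<in>ray x. mdeg m \<le> s})" for x
  proof -
    obtain i b where x: "x = (i, b)" by (cases x)
    have inj: "inj (\<lambda>k. b + Poly_Mapping.single i k)" by (rule injI) (metis add_left_cancel lookup_single_eq)
    show ?thesis
    proof (cases "\<forall>k\<ge>K. b + Poly_Mapping.single i k \<in> D")
      case True
      have "card {m\<in>ray x. mdeg m \<le> s} = Suc s - (mdeg b + K)" for s
      proof -
        have "{m\<in>ray x. mdeg m \<le> s} = (\<lambda>k. b + Poly_Mapping.single i k) ` {k. K \<le> k \<and> mdeg b + k \<le> s}"
          using True by (auto simp: ray_def x mdeg_add)
        also have "card \<dots> = card {k. K \<le> k \<and> mdeg b + k \<le> s}"
          by (rule card_image) (rule inj_on_subset[OF inj], simp)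
        also have "{k. K \<le> k \<and> mdeg b + k \<le> s} = {K..<Suc s - mdeg b}" by auto
        finally show ?thesis by simp
      qed
      moreover have "\<forall>\<^sub>F s in sequentially. int (Suc s - (mdeg b + K)) = int 1 * int s + (1 - int (mdeg b + K))"
        using eventually_ge_at_top[of "mdeg b + K"] by eventually_elim simp
      ultimately show ?thesis
        unfolding eventually_linear_def by (intro exI[of _ 1] exI[of _ "1 - int (mdeg b + K)"]) simp
    next
      case False
      then obtain k0 where k0: "b + Poly_Mapping.single i k0 \<notin> D" by blast
      \<comment> \<open>\<open>D\<close> is closed under divisors, so one missing point cuts the ray
        off there.\<close>
      have "k < k0" if "b + Poly_Mapping.single i k \<in> D" for k
      proof (rule ccontr)
        assume "\<not> k < k0"
        then have "b + Poly_Mapping.single i k = Poly_Mapping.single i (k - k0) + (b + Poly_Mapping.single i k0)"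
          by (intro poly_mapping_eqI) (simp add: lookup_add lookup_single when_def)
        with dc that k0 show False by metis
      qed
      then have "ray x \<subseteq> (\<lambda>k. b + Poly_Mapping.single i k) ` {..<k0}" by (auto simp: ray_def x)
      then have "finite (ray x)" by (rule finite_subset) simp
      then show ?thesis by (rule eventually_linear_finite)
    qed
  qed
  have "eventually_linear (\<lambda>s. card {m\<in>D. mdeg m \<le> s})"
    unfolding count using finB
    by (intro eventually_linear_add eventually_linear_finite eventually_linear_sum ray_lin) auto
  then obtain c d where cd: "\<forall>\<^sub>F s in sequentially. int (card {m\<in>D. mdeg m \<le> s}) = int c * int s + d"
    unfolding eventually_linear_def by blast
  have "c > 0"
  proof (rule ccontr)
    assume "\<not> c > 0"
    with cd have ev: "\<forall>\<^sub>F s in sequentially. int (card {m\<in>D. mdeg m \<le> s}) = d" by simp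
    obtain X where X: "X \<subseteq> D" "finite X" "card X = Suc (nat d)"
      using infinite_arbitrarily_large[OF inf] by blast
    obtain s0 where s0: "\<forall>m\<in>X. mdeg m \<le> s0" using exists_mdeg_bound[OF X(2)] by blast
    obtain s where s: "s \<ge> s0" "int (card {m\<in>D. mdeg m \<le> s}) = d"
      using eventually_conj[OF ev eventually_ge_at_top[of s0]] eventually_happens by force
    have "card X \<le> card {m\<in>D. mdeg m \<le> s}"
      using X(1) s0 s(1) by (intro card_mono finD) force
    with s(2) X(3) show False by simp
  qed
  with cd show ?thesis by blast
qed

text \<open>The leading exponent of a relation between two variables involves only these two. A
  monomial with both exponents large is divisible by it and hence not standard, so the standard
  monomials lie near coordinate rays; being infinite in number, they give a positive slope.\<close>

lemma has_hilbert_dim_1I: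
  fixes I :: "('v::finite, real) mpoly set"
  assumes I: "mpoly_module.subspace I"
    and pairs: "\<And>i j. i \<noteq> j \<Longrightarrow>
      \<exists>p\<in>I. p \<noteq> 0 \<and> (\<forall>m\<in>Poly_Mapping.keys p. \<forall>k. k \<noteq> i \<longrightarrow> k \<noteq> j \<longrightarrow> expo m k = 0)"
    and inf: "infinite (std_monoms I)"
  shows "has_hilbert_dim I 1"
proof -
  obtain p where p: "\<And>i j. i \<noteq> j \<Longrightarrow> p i j \<in> I \<and> p i j \<noteq> 0 \<and>
      (\<forall>m\<in>Poly_Mapping.keys (p i j). \<forall>k. k \<noteq> i \<longrightarrow> k \<noteq> j \<longrightarrow> expo m k = 0)"
    using pairs by metis
  \<comment> \<open>A sum serves as a common bound for all pairs; the unspecified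
    \<open>p i i\<close> only enlarge it.\<close>
  define K where "K = (\<Sum>i\<in>UNIV. \<Sum>j\<in>UNIV. mdeg (lead (p i j)))"
  have K: "mdeg (lead (p i j)) \<le> K" for i j
  proof -
    have "mdeg (lead (p i j)) \<le> (\<Sum>j\<in>UNIV. mdeg (lead (p i j)))" by (rule member_le_sum) auto
    also have "\<dots> \<le> K" unfolding K_def by (rule member_le_sum) auto
    finally show ?thesis .
  qed
  have "expo m i < K \<or> expo m j < K" if m: "m \<in> std_monoms I" and ij: "i \<noteq> j" for m i j
  proof (rule ccontr)
    assume "\<not> ?thesis"
    then have big: "expo m i \<ge> K" "expo m j \<ge> K" by auto
    let ?l = "lead (p i j)"
    have le: "expo ?l k \<le> expo m k" for k
    proof (cases "k = i \<or> k = j")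
      case True
      then show ?thesis using big K[of i j] expo_le_mdeg[of ?l k] by (metis le_trans)
    next
      case False
      then show ?thesis using p[OF ij] lead_in_keys[of "p i j"] by auto
    qed
    have "(m - ?l) + ?l = m"
      by (rule poly_mapping_eqI) (simp add: lookup_add lookup_minus le)
    with m have "?l \<in> std_monoms I" using std_monoms_down_closed[OF I, of "m - ?l" ?l] by simp
    with p[OF ij] show False by (auto simp: std_monoms_def)
  qed
  from eventually_linear_card_down_closed[OF std_monoms_down_closed[OF I] this inf]
  have "\<exists>c d. c > 0 \<and> (\<forall>\<^sub>F s in sequentially. int (card (std_upto I s)) = int c * int s + d)"
    unfolding std_upto_def .
  then obtain c d where c: "c > 0" "\<forall>\<^sub>F s in sequentially. int (card (std_upto I s)) = int c * int s + d"
    by (elim exE conjE) (rule that)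
  define h where "h = [:real_of_int d, real c:]"
  have "is_affine_hilbert_poly I h"
    unfolding is_affine_hilbert_poly_def std_upto_card(1)[OF I]
    using c(2)
  proof eventually_elim
    case (elim s)
    then have "real_of_int (int (card (std_upto I s))) = real_of_int (int c * int s + d)" by simp
    then show ?case by (simp add: h_def algebra_simps)
  qed
  moreover have "h \<noteq> 0" "degree h = 1" using c(1) by (auto simp: h_def)
  ultimately show ?thesis unfolding has_hilbert_dim_def by blast
qed

text \<open>For a given ideal, dimension 1 enters the later arguments as this bound, valid for all
  \<open>s\<close>: they compare it with quadratically many products.\<close>

lemma hilbert_dim_1_imp_linear_bound:
  fixes I :: "('v::finite, real) mpoly set"
  assumes I: "mpoly_module.subspace I" and dim: "has_hilbert_dim I 1"
  shows "\<exists>C. \<forall>s. card (std_upto I s) \<le> C * (s + 1)"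
proof -
  obtain h where h: "is_affine_hilbert_poly I h" "degree h = 1"
    using dim unfolding has_hilbert_dim_def by blast
  obtain a b where ab: "h = [:a, b:]" using degree1_coeffs[of h] h(2) by metis
  obtain s0 where s0: "\<And>s. s \<ge> s0 \<Longrightarrow> poly h (real s) = real (card (std_upto I s))"
    using h(1) unfolding is_affine_hilbert_poly_def std_upto_card(1)[OF I] eventually_sequentially by auto
  \<comment> \<open>The first summand covers \<open>s < s0\<close>, where the Hilbert polynomial
    gives no information; the second dominates the linear polynomial with coefficients
    \<open>a\<close> and \<open>b\<close>.\<close>
  define C where "C = card (std_upto I s0) + nat \<lceil>\<bar>a\<bar> + \<bar>b\<bar>\<rceil>"
  have "card (std_upto I s) \<le> C * (s + 1)" for s
  proof (cases "s \<ge> s0")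
    case True
    have "real (card (std_upto I s)) = a + b * real s" using s0[OF True] by (simp add: ab mult.commute)
    also have "\<dots> \<le> (\<bar>a\<bar> + \<bar>b\<bar>) * (real s + 1)"
    proof -
      have "b * real s \<le> \<bar>b\<bar> * real s" by (intro mult_right_mono) auto
      moreover have "0 \<le> \<bar>a\<bar> * real s" by simp
      ultimately show ?thesis unfolding ring_distribs by linarith
    qed
    also have "\<dots> \<le> real (nat \<lceil>\<bar>a\<bar> + \<bar>b\<bar>\<rceil>) * (real s + 1)"
      by (intro mult_right_mono real_nat_ceiling_ge) auto
    also have "\<dots> \<le> real C * (real s + 1)" by (intro mult_right_mono) (auto simp: C_def)
    also have "\<dots> = real (C * (s + 1))" by (simp only: of_nat_mult of_nat_add of_nat_1)
    finally show ?thesis by (simp only: of_nat_le_iff)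
  next
    case False
    have "finite (std_upto I s0)" unfolding std_upto_def using finite_mdeg_le[of s0] by (rule rev_finite_subset) auto
    then have "card (std_upto I s) \<le> card (std_upto I s0)"
      using False by (intro card_mono) (auto simp: std_upto_def)
    also have "\<dots> \<le> C * (s + 1)" unfolding C_def by simp
    finally show ?thesis .
  qed
  then show ?thesis by blast
qed

lemma polys_upto_mono: "p \<in> polys_upto s \<Longrightarrow> s \<le> t \<Longrightarrow> p \<in> polys_upto t"
  unfolding polys_upto_alt by force

lemma polys_upto_mult:
  assumes "p \<in> polys_upto s" "q \<in> polys_upto t" shows "p * q \<in> polys_upto (s + t)"
proof -
  have "mdeg m \<le> s + t" if m: "m \<in> Poly_Mapping.keys (p * q)" for m
  proof -
    obtain a b where "m = a + b" "a \<in> Poly_Mapping.keys p" "b \<in> Poly_Mapping.keys q"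
      using subsetD[OF keys_mult m] by blast
    moreover from this have "mdeg a \<le> s" "mdeg b \<le> t" using assms by (simp_all add: polys_upto_alt)
    ultimately show ?thesis by (simp add: mdeg_add)
  qed
  then show ?thesis by (simp add: polys_upto_alt)
qed

lemma polys_upto_1: "1 \<in> polys_upto s"
  by (simp add: polys_upto_alt mdeg_def)

lemma polys_upto_power: "p \<in> polys_upto s \<Longrightarrow> p ^ k \<in> polys_upto (k * s)"
  by (induction k) (auto intro: polys_upto_mult polys_upto_1)

lemma polys_upto_prod:
  "finite A \<Longrightarrow> (\<And>i. i \<in> A \<Longrightarrow> F i \<in> polys_upto (d i)) \<Longrightarrow> prod F A \<in> polys_upto (sum d A)"
  by (induction A rule: finite_induct) (auto intro: polys_upto_mult polys_upto_1)

lemma exists_degree_bound: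
  fixes p :: "'w::finite \<Rightarrow> ('v::finite, real) mpoly"
  shows "\<exists>d. \<forall>w. p w \<in> polys_upto d"
proof -
  obtain d where d: "mdeg m \<le> d" if "m \<in> (\<Union>w. Poly_Mapping.keys (p w))" for m
    using exists_mdeg_bound[of "\<Union>w. Poly_Mapping.keys (p w)"] by auto
  then show ?thesis unfolding polys_upto_alt by blast
qed

lemma coef_sum_single:
  assumes "finite X" shows "coef (\<Sum>m\<in>X. Poly_Mapping.single m (c m)) k = (if k \<in> X then c k else 0)"
proof -
  have "coef (\<Sum>m\<in>X. Poly_Mapping.single m (c m)) k = (\<Sum>m\<in>X. if m = k then c k else 0)"
    unfolding lookup_sum by (rule sum.cong) (auto simp: lookup_single when_def)
  then show ?thesis using assms by simp
qed

text \<open>Perron's theorem.\<close>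

lemma algebraically_dependent:
  fixes p :: "'w::finite \<Rightarrow> ('v::finite, real) mpoly"
  assumes "CARD('v) < CARD('w)"
  shows "\<exists>F :: ('w, real) mpoly. F \<noteq> 0 \<and> eval_with Const F p = 0"
proof -
  obtain d where d: "p w \<in> polys_upto d" for w using exists_degree_bound by blast
  let ?v = "CARD('v)" and ?w = "CARD('w)"
  \<comment> \<open>Chosen to win the count: with v variables and \<open>S\<close> as bound for the
    exponents, the substituted monomials lie in a space of dimension at most
    \<open>(S + 1) ^ ?v * S\<close>, while there are at least \<open>(S + 1) ^ Suc ?v\<close> of
    them.\<close>
  define S where "S = (?w * d + 1) ^ ?v"
  define X where "X = {m :: 'w \<Rightarrow>\<^sub>0 nat. \<forall>i. expo m i \<le> S}"
  let ?q = "\<lambda>m. monom_val m p"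
  have finX: "finite X" unfolding X_def by (rule finite_expo_le)
  have q: "?q m \<in> polys_upto (?w * (S * d))" if "m \<in> X" for m
  proof -
    have "?q m \<in> polys_upto (\<Sum>i::'w\<in>UNIV. S * d)"
      unfolding monom_val_def
    proof (rule polys_upto_prod)
      fix i show "p i ^ expo m i \<in> polys_upto (S * d)"
        using that by (intro polys_upto_mono[OF polys_upto_power[OF d]] mult_right_mono) (auto simp: X_def)
    qed simp
    then show ?thesis by simp
  qed
  have I: "mpoly_module.subspace {0 :: ('v, real) mpoly}" by (rule mpoly_module.subspace_single_0)
  have "card (std_upto {0 :: ('v, real) mpoly} (?w * (S * d))) \<le> card {m :: 'v \<Rightarrow>\<^sub>0 nat. \<forall>i. expo m i \<le> ?w * (S * d)}"
    by (intro card_mono finite_expo_le) (auto simp: std_upto_def intro: le_trans[OF expo_le_mdeg])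
  also have "\<dots> = (?w * (S * d) + 1) ^ ?v" by (rule card_expo_le)
  also have "\<dots> \<le> ((S + 1) * (?w * d + 1)) ^ ?v" by (intro power_mono) (auto simp: algebra_simps)
  also have "\<dots> = (S + 1) ^ ?v * S" by (simp only: power_mult_distrib S_def)
  also have "\<dots> < (S + 1) ^ Suc ?v" by simp
  also have "\<dots> \<le> (S + 1) ^ ?w" using assms by (intro power_increasing) auto
  also have "\<dots> = card X" unfolding X_def by (rule card_expo_le[symmetric])
  finally obtain c a where c: "a \<in> X" "c a \<noteq> 0" "(\<Sum>m\<in>X. Const (c m) * ?q m) = 0"
    using exists_combination_in_ideal[OF I finX q, of "\<lambda>m. m"] by auto
  define F where "F = (\<Sum>m\<in>X. Poly_Mapping.single m (c m))"
  have "coef F a \<noteq> 0" using c finX by (simp add: F_def coef_sum_single)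
  then have "F \<noteq> 0" by auto
  moreover have "eval_with Const F p = (\<Sum>m\<in>X. Const (c m) * ?q m)"
    unfolding F_def Const_hom.eval_with_sum by (simp add: Const_hom.eval_with_single)
  ultimately show ?thesis using c(3) by auto
qed

subsection \<open>Bivariate polynomials\<close>

text \<open>The inner variable is \<open>t\<close>, the outer one y: bivariate polynomials are
  treated as polynomials in y with parameter \<open>t\<close>.\<close>

definition poly2 :: "real poly poly \<Rightarrow> real \<Rightarrow> real poly" where
  "poly2 P t = map_poly (\<lambda>c. poly c t) P"

lemma poly2_add: "poly2 (P + Q) t = poly2 P t + poly2 Q t"
  by (rule poly_eqI) (simp add: poly2_def coeff_map_poly)

lemma poly2_mult: "poly2 (P * Q) t = poly2 P t * poly2 Q t"
  by (rule poly_eqI) (simp add: poly2_def coeff_map_poly coeff_mult poly_sum)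

lemma poly2_0 [simp]: "poly2 0 t = 0" and poly2_1 [simp]: "poly2 1 t = 1"
  by (simp_all add: poly2_def)

interpretation poly2_hom: comm_ring_hom "\<lambda>P. poly2 P t"
  by unfold_locales (rule poly2_0 poly2_1 poly2_add poly2_mult)+

lemma coeff_poly2: "coeff (poly2 P t) k = poly (coeff P k) t"
  by (simp add: poly2_def coeff_map_poly)

lemma poly2_monom: "poly2 (monom c k) t = monom (poly c t) k"
  by (simp add: poly2_def map_poly_monom)

text \<open>Quadratically many products of powers of \<open>u\<close> and \<open>w\<close> compete
  with linearly many standard monomials.\<close>

lemma exists_relation:
  fixes I :: "('v::finite, real) mpoly set"
  assumes I: "mpoly_module.subspace I" and C: "\<And>s. card (std_upto I s) \<le> C * (s + 1)"
  shows "\<exists>P. P \<noteq> 0 \<and> (\<forall>x \<in> V_R I. poly (poly2 P (peval u x)) (peval w x) = 0)"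
proof -
  obtain d where d: "u \<in> polys_upto d" "w \<in> polys_upto d"
    using exists_degree_bound[of "\<lambda>b. if b then u else w"] by (auto simp: all_bool_eq)
  \<comment> \<open>Makes \<open>C * (2 * d * N + 1)\<close> at most \<open>N * (N + 1)\<close>,
    while there are (N + 1)^2 products.\<close>
  define N where "N = C * (2 * d + 1)"
  let ?S = "{..N} \<times> {..N}"
  have "u ^ a * w ^ b \<in> polys_upto (2 * d * N)" if "(a, b) \<in> ?S" for a b
  proof (rule polys_upto_mono[OF polys_upto_mult[OF polys_upto_power[OF d(1)] polys_upto_power[OF d(2)]]])
    show "a * d + b * d \<le> 2 * d * N"
    proof -
      have "a * d + b * d \<le> N * d + N * d" using that by (intro add_mono mult_right_mono) auto
      then show ?thesis by (simp add: algebra_simps)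
    qed
  qed
  moreover have "card (std_upto I (2 * d * N)) < card ?S"
  proof -
    have "card (std_upto I (2 * d * N)) \<le> C * (2 * d * N + 1)" by (rule C)
    also have "\<dots> \<le> C * ((2 * d + 1) * (N + 1))" by (intro mult_left_mono) (auto simp: algebra_simps)
    also have "\<dots> = N * (N + 1)" unfolding N_def by (simp only: mult.assoc)
    also have "\<dots> < (N + 1) * (N + 1)" by simp
    finally show ?thesis by (simp add: card_cartesian_product)
  qed
  ultimately have "\<exists>c. (\<exists>x\<in>?S. c x \<noteq> 0) \<and> (\<Sum>x\<in>?S. Const (c x) * (u ^ fst x * w ^ snd x)) \<in> I"
    by (intro exists_combination_in_ideal[OF I, of ?S _ "2 * d * N"]) auto
  then obtain c where c: "\<exists>x\<in>?S. c x \<noteq> 0"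
    "(\<Sum>x\<in>?S. Const (c x) * (u ^ fst x * w ^ snd x)) \<in> I"
    by blast
  define P where "P = (\<Sum>b\<le>N. monom (\<Sum>a\<le>N. monom (c (a, b)) a) b)"
  obtain a b where ab: "a \<le> N" "b \<le> N" "c (a, b) \<noteq> 0" using c(1) by auto
  have "coeff (coeff P b) a = c (a, b)"
    using ab by (simp add: P_def coeff_sum)
  then have "P \<noteq> 0" using ab(3) by auto
  moreover have "poly (poly2 P (peval u x)) (peval w x) = 0" if x: "x \<in> V_R I" for x
  proof -
    have "poly (poly2 P (peval u x)) (peval w x)
      = (\<Sum>b\<le>N. \<Sum>a\<le>N. c (a, b) * (peval u x ^ a * peval w x ^ b))"
      by (simp add: P_def poly2_hom.hom_sum poly2_monom poly_sum poly_monom sum_distrib_right mult.assoc)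
    also have "\<dots> = (\<Sum>x'\<in>?S. c x' * (peval u x ^ fst x' * peval w x ^ snd x'))"
      by (subst sum.swap) (simp add: sum.cartesian_product case_prod_beta)
    also have "\<dots> = peval (\<Sum>x\<in>?S. Const (c x) * (u ^ fst x * w ^ snd x)) x"
      by (simp only: peval_sum peval_mult peval_power peval_Const of_real_eq_id id_apply)
    also have "\<dots> = 0" using c(2) x by (auto simp: zero_set_def)
    finally show ?thesis .
  qed
  ultimately show ?thesis by blast
qed

text \<open>With finitely many standard monomials the powers of each coordinate are dependent modulo
  the ideal, so each coordinate takes only finitely many values on the zero set.\<close>

lemma infinite_std_monoms:
  fixes I :: "('v::finite, real) mpoly set"
  assumes I: "mpoly_module.subspace I" and inf: "infinite (V_R I :: (real ^ 'v) set)"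
  shows "infinite (std_monoms I)"
proof
  assume fin: "finite (std_monoms I)"
  define N where "N = card (std_monoms I)"
  have "\<exists>p. p \<noteq> 0 \<and> (\<forall>x\<in>V_R I. poly p (x $ i) = 0)" for i :: 'v
  proof -
    have "card (std_upto I N) < card {..N}"
      using card_mono[OF fin, of "std_upto I N"] by (auto simp: std_upto_def N_def)
    moreover have "Var i ^ a \<in> polys_upto N" if "a \<in> {..N}" for a
    proof (rule polys_upto_mono[OF polys_upto_power])
      show "Var i \<in> polys_upto 1" by (simp add: Var_def polys_upto_alt)
    qed (use that in simp)
    ultimately obtain c where c: "\<exists>a\<in>{..N}. c a \<noteq> 0" "(\<Sum>a\<in>{..N}. Const (c a) * Var i ^ a) \<in> I"
      using exists_combination_in_ideal[OF I, of "{..N}" "\<lambda>a. Var i ^ a" N] by auto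
    define p where "p = (\<Sum>a\<le>N. monom (c a) a)"
    have "poly p (x $ i) = 0" if "x \<in> V_R I" for x
    proof -
      have "poly p (x $ i) = peval (\<Sum>a\<in>{..N}. Const (c a) * Var i ^ a) x"
        by (simp add: p_def poly_sum poly_monom peval_sum peval_mult peval_power)
      also have "\<dots> = 0" using c(2) that by (auto simp: zero_set_def)
      finally show ?thesis .
    qed
    moreover obtain a where a: "a \<le> N" "c a \<noteq> 0" using c(1) by auto
    then have "coeff p a \<noteq> 0" by (simp add: p_def coeff_sum)
    then have "p \<noteq> 0" by auto
    ultimately show ?thesis by blast
  qed
  then obtain p where p: "\<And>i. p i \<noteq> 0" "\<And>i x. x \<in> V_R I \<Longrightarrow> poly (p i) (x $ i) = 0" by metis
  have "(\<lambda>x. ($) x) ` (V_R I :: (real ^ 'v) set) \<subseteq> UNIV \<rightarrow>\<^sub>E (\<Union>i. {y. poly (p i) y = 0})"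
    using p(2) by auto
  moreover have "finite (UNIV \<rightarrow>\<^sub>E (\<Union>i. {y. poly (p i) y = 0}) :: ('v \<Rightarrow> real) set)"
    using p(1) by (intro finite_PiE finite_UN_I poly_roots_finite) auto
  ultimately have "finite ((\<lambda>x. ($) x) ` (V_R I :: (real ^ 'v) set))" by (rule finite_subset)
  then have "finite (V_R I :: (real ^ 'v) set)"
    by (rule finite_imageD) (auto simp: inj_on_def Finite_Cartesian_Product.vec_eq_iff)
  with inf show False ..
qed

subsection \<open>Open mappings\<close>

text \<open>Solve the transposed square system of a nonvanishing minor and put 0 in the remaining
  coordinates.\<close>

lemma solvable_if_not_col_dep:
  fixes C :: "nat \<Rightarrow> 'n::finite \<Rightarrow> 'a::field"
  assumes "\<not> col_dep C k"
  shows "\<exists>v. \<forall>j<k. (\<Sum>i\<in>UNIV. C j i * v i) = b j"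
proof -
  obtain rs where rs: "distinct rs" "length rs = k" "row_minor C rs \<noteq> 0"
    using exists_minor_nonzero[OF assms] by blast
  define N where "N = Matrix.mat k k (\<lambda>(i, j). C j (rs ! i))"
  have N: "N \<in> carrier_mat k k" by (simp add: N_def)
  then have NT: "transpose_mat N \<in> carrier_mat k k" by simp
  have "Determinant.det (transpose_mat N) \<noteq> 0"
    using rs(3) det_transpose[OF N] by (simp add: row_minor_def N_def rs(2))
  from det_non_zero_imp_unit[OF NT this, of "()"] obtain B where
    B: "B \<in> carrier_mat k k" "transpose_mat N * B = 1\<^sub>m k"
    by (auto simp: Units_def ring_mat_def)
  define w where "w = B *\<^sub>v Matrix.vec k b"
  have w: "w \<in> carrier_vec k" using B(1) by (simp add: w_def)
  have "transpose_mat N *\<^sub>v w = Matrix.vec k b"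
    unfolding w_def by (subst assoc_mult_mat_vec[OF NT B(1), symmetric]) (auto simp: B(2))
  then have eq: "(\<Sum>r<k. C j (rs ! r) * Matrix.vec_index w r) = b j" if "j < k" for j
  proof -
    assume eq: "transpose_mat N *\<^sub>v w = Matrix.vec k b"
    have "b j = Matrix.vec_index (transpose_mat N *\<^sub>v w) j" by (simp add: eq that)
    also have "\<dots> = (\<Sum>r<k. C j (rs ! r) * Matrix.vec_index w r)"
      using w that N by (simp add: scalar_prod_def lessThan_atLeast0 N_def)
    finally show ?thesis by simp
  qed
  have bij: "bij_betw ((!) rs) {..<k} (set rs)" using rs by (metis bij_betw_nth)
  define v where "v i = (if i \<in> set rs then Matrix.vec_index w (the_inv_into {..<k} ((!) rs) i) else 0)" for i
  have v: "v (rs ! r) = Matrix.vec_index w r" if "r < k" for r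
    using the_inv_into_f_f[of "(!) rs" "{..<k}" r] bij that rs(2) by (auto simp: v_def bij_betw_def)
  have "(\<Sum>i\<in>UNIV. C j i * v i) = b j" if "j < k" for j
  proof -
    have "(\<Sum>i\<in>UNIV. C j i * v i) = (\<Sum>i\<in>set rs. C j i * v i)"
      by (rule sum.mono_neutral_right) (auto simp: v_def)
    also have "\<dots> = (\<Sum>r<k. C j (rs ! r) * v (rs ! r))" by (rule sum.reindex_bij_betw[OF bij, symmetric])
    also have "\<dots> = b j" using eq[OF that] v by simp
    finally show ?thesis .
  qed
  then show ?thesis by blast
qed

lemma has_derivative_vecI:
  fixes f :: "'a::real_normed_vector \<Rightarrow> 'b::real_normed_vector ^ 'n::finite"
  assumes "\<And>i. ((\<lambda>x. f x $ i) has_derivative (\<lambda>h. f' h $ i)) F"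
  shows "(f has_derivative f') F"
proof -
  have lin: "bounded_linear (axis i :: 'b \<Rightarrow> 'b ^ 'n)" for i
  proof (rule bounded_linear_intro)
    show "norm (axis i x :: 'b ^ 'n) \<le> norm x * 1" for x :: 'b
    proof -
      have "norm (axis i x :: 'b ^ 'n) \<le> (\<Sum>j\<in>UNIV. norm ((axis i x :: 'b ^ 'n) $ j))"
        unfolding norm_vec_def by (rule L2_set_le_sum) auto
      also have "\<dots> = (\<Sum>j\<in>UNIV. if j = i then norm x else 0)"
        by (rule sum.cong) (auto simp: axis_def)
      finally show ?thesis by simp
    qed
  qed (auto simp: axis_def Finite_Cartesian_Product.vec_eq_iff)
  have sum_axis: "(\<Sum>i\<in>UNIV. axis i (v $ i)) = v" for v :: "'b ^ 'n"
  proof -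
    have "(\<Sum>i\<in>UNIV. (axis i (v $ i) :: 'b ^ 'n) $ j) = (\<Sum>i\<in>UNIV. if i = j then v $ j else 0)" for j
      by (rule sum.cong) (auto simp: axis_def)
    then show ?thesis by (simp add: Finite_Cartesian_Product.vec_eq_iff)
  qed
  have "((\<lambda>x. \<Sum>i\<in>UNIV. axis i (f x $ i)) has_derivative (\<lambda>h. \<Sum>i\<in>UNIV. axis i (f' h $ i))) F"
    by (intro has_derivative_sum bounded_linear.has_derivative[OF lin] assms)
  then show ?thesis by (simp only: sum_axis)
qed

text \<open>Sussmann's open mapping theorem, with a linear right inverse of the derivative:
  continuity and a surjective derivative at the single point \<open>x\<close> are enough.\<close>

lemma open_mapping_surj:
  fixes F :: "'a::euclidean_space \<Rightarrow> 'b::euclidean_space"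
  assumes cont: "continuous_on UNIV F" and der: "(F has_derivative F') (at x)" and surj: "surj F'"
    and U: "open U" "x \<in> U"
  shows "\<exists>\<delta>>0. ball (F x) \<delta> \<subseteq> F ` U"
proof -
  have "linear F'" using der by (rule has_derivative_linear)
  then obtain g where g: "linear g" "F' \<circ> g = id" using linear_surjective_right_inverse surj by blast
  have "F x \<in> interior (F ` U)"
    by (rule sussmann_open_mapping[OF open_UNIV cont _ der _ g(2)])
      (use U g(1) in \<open>auto simp: linear_linear interior_open\<close>)
  then show ?thesis by (simp add: mem_interior)
qed

text \<open>The dummy vector \<open>z\<close> fills up the coordinates of the target that no \<open>h k\<close> uses, so that
  the derivative becomes surjective onto a space of fixed dimension.\<close>

lemma open_if_gradients_independent:
  fixes h :: "nat \<Rightarrow> real ^ 'n::finite \<Rightarrow> real"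
  assumes der: "\<And>k. k < m \<Longrightarrow> (h k has_derivative (\<lambda>v. \<Sum>i\<in>UNIV. G k i * v $ i)) (at x)"
    and cont: "\<And>k. k < m \<Longrightarrow> continuous_on UNIV (h k)"
    and ind: "\<not> col_dep G m" and U: "open U" "x \<in> U"
  shows "\<exists>\<delta>>0. \<forall>b. (\<forall>k<m. \<bar>b k\<bar> < \<delta>) \<longrightarrow> (\<exists>y\<in>U. \<forall>k<m. h k y = h k x + b k)"
proof -
  have "m \<le> CARD('n)" using ind col_dep_if_many_cols[where C = G and k = m] by force
  then obtain e :: "nat \<Rightarrow> 'n" where e: "inj_on e {..<m}"
    using card_le_inj[of "{..<m}" "UNIV :: 'n set"] by auto
  define r where "r = the_inv_into {..<m} e"
  have r: "r (e k) = k" if "k < m" for k using that e by (simp add: r_def the_inv_into_f_f)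
  define H :: "(real ^ 'n) \<times> (real ^ 'n) \<Rightarrow> real ^ 'n"
    where "H p = (\<chi> a. if a \<in> e ` {..<m} then h (r a) (fst p) else snd p $ a)" for p
  define H' :: "(real ^ 'n) \<times> (real ^ 'n) \<Rightarrow> real ^ 'n"
    where "H' p = (\<chi> a. if a \<in> e ` {..<m} then \<Sum>i\<in>UNIV. G (r a) i * fst p $ i else snd p $ a)" for p
  have contH: "continuous_on UNIV H"
    unfolding H_def
  proof (rule continuous_on_vec_lambda)
    fix a show "continuous_on UNIV (\<lambda>p :: (real ^ 'n) \<times> (real ^ 'n). if a \<in> e ` {..<m} then h (r a) (fst p) else snd p $ a)"
    proof (cases "a \<in> e ` {..<m}")
      case True
      then have "r a < m" by (auto simp: r)
      with True show ?thesis
        using continuous_on_compose2[OF cont[of "r a"] continuous_on_fst[OF continuous_on_id]] by simp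
    qed (auto intro!: continuous_intros)
  qed
  have derH: "(H has_derivative H') (at (x, z))" for z
  proof (rule has_derivative_vecI)
    fix a
    show "((\<lambda>p. H p $ a) has_derivative (\<lambda>p. H' p $ a)) (at (x, z))"
    proof (cases "a \<in> e ` {..<m}")
      case True
      then have "r a < m" by (auto simp: r)
      have "((\<lambda>p. h (r a) (fst p)) has_derivative (\<lambda>p. \<Sum>i\<in>UNIV. G (r a) i * fst p $ i)) (at (x, z))"
        using der[OF \<open>r a < m\<close>]
        by (intro has_derivative_compose[OF has_derivative_fst[OF has_derivative_ident]]) simp
      with True show ?thesis by (simp add: H_def H'_def)
    next
      case False
      have "((\<lambda>p. snd p $ a) has_derivative (\<lambda>p. snd p $ a)) (at (x, z))"
        by (intro bounded_linear_imp_has_derivative bounded_linear_compose[OF bounded_linear_vec_nth bounded_linear_snd])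
      with False show ?thesis by (simp add: H_def H'_def)
    qed
  qed
  have "\<exists>p. H' p = b" for b
  proof -
    obtain v where v: "\<And>k. k < m \<Longrightarrow> (\<Sum>i\<in>UNIV. G k i * v i) = b $ e k"
      using solvable_if_not_col_dep[OF ind, of "\<lambda>k. b $ e k"] by blast
    then have "H' (\<chi> i. v i, b) = b"
      by (auto simp: H'_def Finite_Cartesian_Product.vec_eq_iff r)
    then show ?thesis ..
  qed
  then have "surj H'" by (metis surjI)
  from open_mapping_surj[OF contH derH[of 0] this, of "U \<times> UNIV"] U
  obtain \<delta> where \<delta>: "\<delta> > 0" "ball (H (x, 0)) \<delta> \<subseteq> H ` (U \<times> UNIV)" by (auto simp: open_Times)
  \<comment> \<open>A vector with n entries bounded by \<delta>' has norm at most n \<delta>', which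
    is below \<delta>.\<close>
  define \<delta>' where "\<delta>' = \<delta> / real (Suc CARD('n))"
  have "\<delta>' > 0" using \<delta>(1) by (simp add: \<delta>'_def)
  moreover have "\<exists>y\<in>U. \<forall>k<m. h k y = h k x + b k" if b: "\<forall>k<m. \<bar>b k\<bar> < \<delta>'" for b
  proof -
    define B :: "real ^ 'n" where "B = (\<chi> a. if a \<in> e ` {..<m} then b (r a) else 0)"
    have "norm B \<le> (\<Sum>a\<in>UNIV. norm (B $ a))" unfolding norm_vec_def by (rule L2_set_le_sum) auto
    also have "\<dots> \<le> (\<Sum>a::'n\<in>UNIV. \<delta>')"
    proof (rule sum_mono)
      fix a show "norm (B $ a) \<le> \<delta>'"
        using b r \<open>\<delta>' > 0\<close> by (auto simp: B_def less_imp_le)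
    qed
    also have "\<dots> = real CARD('n) * \<delta>'" by simp
    also have "\<dots> < \<delta>" using \<delta>(1) by (simp add: \<delta>'_def field_simps)
    finally have "H (x, 0) + B \<in> ball (H (x, 0)) \<delta>" by (simp add: dist_norm)
    then obtain y z where y: "y \<in> U" "H (y, z) = H (x, 0) + B" using \<delta>(2) by (auto simp: image_iff)
    have "h k y = h k x + b k" if "k < m" for k
    proof -
      have "H (y, z) $ e k = H (x, 0) $ e k + B $ e k" using y(2) by simp
      with that r show ?thesis by (simp add: H_def B_def)
    qed
    with y(1) show ?thesis by blast
  qed
  ultimately show ?thesis by blast
qed

subsection \<open>Points where polynomials do not vanish\<close>

lemma coef_partial_deriv:
  assumes "expo m i > 0"
  shows "coef (partial_deriv i p) (m - Poly_Mapping.single i 1) = of_nat (expo m i) * coef p m"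
proof -
  have "coef (Poly_Mapping.single (k - Poly_Mapping.single i 1) (of_nat (expo k i) * coef p k)) (m - Poly_Mapping.single i 1)
      = (if k = m then of_nat (expo m i) * coef p m else 0)" for k
  proof (cases "expo k i = 0 \<or> k = m")
    case False
    have "k - Poly_Mapping.single i 1 \<noteq> m - Poly_Mapping.single i 1"
    proof
      assume eq: "k - Poly_Mapping.single i 1 = m - Poly_Mapping.single i 1"
      have "expo k j = expo m j" for j
      proof -
        have "expo (k - Poly_Mapping.single i 1) j = expo (m - Poly_Mapping.single i 1) j" by (simp only: eq)
        then show ?thesis using False assms by (cases "j = i") (auto simp: lookup_minus lookup_single)
      qed
      then have "k = m" by (rule poly_mapping_eqI)
      with False show False by simp
    qed
    with False show ?thesis by (simp add: lookup_single)
  qed auto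
  then have "coef (partial_deriv i p) (m - Poly_Mapping.single i 1)
     = (\<Sum>k\<in>Poly_Mapping.keys p. if k = m then of_nat (expo m i) * coef p m else 0)"
    unfolding partial_deriv_def lookup_sum by (rule sum.cong[OF refl])
  then show ?thesis by (auto simp: in_keys_iff)
qed

lemma partial_deriv_polys_upto:
  assumes "p \<in> polys_upto (Suc s)" shows "partial_deriv i p \<in> polys_upto s"
proof -
  have "mdeg k \<le> s" if k: "k \<in> Poly_Mapping.keys (partial_deriv i p)" for k
  proof -
    have "k \<in> (\<Union>m\<in>Poly_Mapping.keys p. Poly_Mapping.keys (Poly_Mapping.single (m - Poly_Mapping.single i 1) (of_nat (expo m i) * coef p m)))"
      using k keys_sum unfolding partial_deriv_def by (rule subsetD[rotated])
    then obtain m where m: "m \<in> Poly_Mapping.keys p" "k = m - Poly_Mapping.single i 1" "expo m i > 0"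
      by (auto split: if_splits)
    then have "m = k + Poly_Mapping.single i 1"
      by (intro poly_mapping_eqI) (auto simp: lookup_add lookup_minus lookup_single when_def)
    then have "mdeg m = Suc (mdeg k)" by (simp add: mdeg_add)
    then show ?thesis using assms m(1) by (auto simp: polys_upto_alt)
  qed
  then show ?thesis by (simp add: polys_upto_alt)
qed

text \<open>Induction on the degree: if \<open>p\<close> vanished on \<open>U\<close>, so would its
  partial derivatives, and a nonconstant polynomial has one that is nonzero and of smaller
  degree.\<close>

lemma exists_nonvanishing_in_open:
  fixes p :: "('v::finite, real) mpoly" and U :: "(real ^ 'v) set"
  assumes "p \<noteq> 0" "open U" "U \<noteq> {}"
  shows "\<exists>x\<in>U. peval p x \<noteq> 0"
proof -
  have "p \<in> polys_upto s \<Longrightarrow> p \<noteq> 0 \<Longrightarrow> \<exists>x\<in>U. peval p x \<noteq> 0" for s p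
  proof (induction s arbitrary: p)
    case 0
    have "m = 0" if "m \<in> Poly_Mapping.keys p" for m
      using 0(1) that by (intro poly_mapping_eqI) (auto simp: polys_upto_alt mdeg_def)
    then have "Poly_Mapping.keys p = {0}" using 0(2) by (metis keys_eq_empty subsetI subset_singletonD singletonI)
    then have "p = Const (coef p 0)" "coef p 0 \<noteq> 0"
      using mpoly_eq_sum_single[of p] by (auto simp: Const_def in_keys_iff)
    then have "peval p x \<noteq> 0" for x :: "real ^ 'v" by (metis of_real_eq_0_iff peval_Const)
    with assms(3) show ?case by blast
  next
    case (Suc s)
    show ?case
    proof (cases "p \<in> polys_upto 0")
      case True
      then have "p \<in> polys_upto s" by (rule polys_upto_mono) simp
      then show ?thesis using Suc by blast
    next
      case False
      then obtain m where m: "m \<in> Poly_Mapping.keys p" "mdeg m \<noteq> 0" by (auto simp: polys_upto_alt)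
      then obtain i where i: "expo m i > 0" by (auto simp: mdeg_def)
      have "coef (partial_deriv i p) (m - Poly_Mapping.single i 1) \<noteq> 0"
        using i m(1) by (subst coef_partial_deriv) (auto simp: in_keys_iff)
      then have "partial_deriv i p \<noteq> 0" by auto
      from Suc.IH[OF partial_deriv_polys_upto[OF Suc.prems(1)] this]
      obtain x where x: "x \<in> U" "peval (partial_deriv i p) x \<noteq> 0" by blast
      show ?thesis
      proof (rule ccontr)
        assume "\<not> ?thesis"
        then have z: "peval p y = 0" if "y \<in> U" for y using that by blast
        have "(peval p has_derivative (\<lambda>h. 0)) (at x)"
          by (rule has_derivative_transform_within_open[OF has_derivative_const[of 0] assms(2) x(1)]) (simp add: z)
        then have "(\<lambda>h. \<Sum>i\<in>UNIV. peval (partial_deriv i p) x * h $ i) = (\<lambda>h. 0)"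
          by (rule has_derivative_unique[OF has_derivative_peval])
        from fun_cong[OF this, of "axis i 1"] show False
          using x(2) by (simp add: axis_def if_distrib cong: if_cong)
      qed
    qed
  qed
  moreover obtain d where "p \<in> polys_upto d" using exists_degree_bound[of "\<lambda>_ :: unit. p"] by auto
  ultimately show ?thesis using assms(1) by blast
qed

text \<open>The open set is shrunk once for each polynomial.\<close>

lemma exists_common_nonvanishing:
  fixes Q :: "('v::finite, real) mpoly set"
  assumes "finite Q" "0 \<notin> Q" shows "\<exists>x. \<forall>p\<in>Q. peval p (x :: real ^ 'v) \<noteq> 0"
proof -
  have "open U \<Longrightarrow> U \<noteq> {} \<Longrightarrow> \<exists>x\<in>U. \<forall>p\<in>Q. peval p x \<noteq> 0" for U :: "(real ^ 'v) set"
    using assms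
  proof (induction Q arbitrary: U rule: finite_induct)
    case (insert p Q)
    let ?U = "U \<inter> {x. peval p x \<noteq> 0}"
    have "open {x :: real ^ 'v. peval p x \<noteq> 0}"
      by (intro open_Collect_neq continuous_peval continuous_on_id continuous_on_const)
    then have "open ?U" using insert.prems(1) by (rule open_Int[rotated])
    moreover have "?U \<noteq> {}" using exists_nonvanishing_in_open[of p U] insert.prems by auto
    ultimately obtain x where "x \<in> ?U" "\<forall>p\<in>Q. peval p x \<noteq> 0" using insert.IH[of ?U] insert.prems by auto
    then show ?case by auto
  qed auto
  from this[of UNIV] show ?thesis by simp
qed

text \<open>The initial form of \<open>F\<close> with respect to the variables in \<open>S\<close>:
  its terms of least degree in them.\<close>

definition low_part :: "'w::finite set \<Rightarrow> ('w, real) mpoly \<Rightarrow> ('w, real) mpoly" where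
  "low_part S F = (let sdeg = \<lambda>m. \<Sum>w\<in>S. expo m w in
     \<Sum>m\<in>{m \<in> Poly_Mapping.keys F. sdeg m = Min (sdeg ` Poly_Mapping.keys F)}. Poly_Mapping.single m (coef F m))"

lemma low_part_nonzero: assumes "F \<noteq> 0" shows "low_part S F \<noteq> 0"
proof -
  define sdeg where "sdeg m = (\<Sum>w\<in>S. expo m w)" for m
  let ?M = "{m \<in> Poly_Mapping.keys F. sdeg m = Min (sdeg ` Poly_Mapping.keys F)}"
  have "Min (sdeg ` Poly_Mapping.keys F) \<in> sdeg ` Poly_Mapping.keys F" using assms by (intro Min_in) auto
  then obtain m where m: "m \<in> ?M" by auto
  have "coef (low_part S F) m = coef F m"
    unfolding low_part_def Let_def sdeg_def[symmetric] using m by (subst coef_sum_single) auto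
  then show ?thesis using m by (auto simp: in_keys_iff)
qed

lemma monom_val_vec_lambda: "monom_val m (($) (vec_lambda y)) = monom_val m y"
  by (simp add: monom_val_def)

text \<open>Divide the vanishing value of \<open>F\<close> by the power of \<epsilon> that belongs
  to the least degree; the other terms keep a positive power of \<epsilon> and disappear in the
  limit.\<close>

lemma low_part_limit:
  fixes z :: "complex ^ 'w::finite"
  assumes \<epsilon>: "\<epsilon> \<longlonglongrightarrow> 0" "\<And>k. \<epsilon> k \<noteq> 0" and Z: "Z \<longlonglongrightarrow> z"
    and van: "\<And>k. peval F (\<chi> w. if w \<in> S then complex_of_real (\<epsilon> k) * Z k $ w else Z k $ w) = 0"
  shows "peval (low_part S F) z = 0"
proof -
  define sdeg where "sdeg m = (\<Sum>w\<in>S. expo m w)" for m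
  define k0 where "k0 = Min (sdeg ` Poly_Mapping.keys F)"
  have k0: "k0 \<le> sdeg m" if "m \<in> Poly_Mapping.keys F" for m using that by (simp add: k0_def)
  define T where "T k = (\<Sum>m\<in>Poly_Mapping.keys F. of_real (coef F m) *
      (complex_of_real (\<epsilon> k) ^ (sdeg m - k0) * monom_val m (\<lambda>w. Z k $ w)))" for k
  have scale: "monom_val m (\<lambda>w. if w \<in> S then e * y w else y w) = e ^ sdeg m * monom_val m y" for m and e :: complex and y
  proof -
    have "monom_val m (\<lambda>w. if w \<in> S then e * y w else y w)
        = (\<Prod>w\<in>UNIV. (if w \<in> S then e ^ expo m w else 1) * y w ^ expo m w)"
      unfolding monom_val_def by (rule prod.cong) (auto simp: power_mult_distrib)
    also have "\<dots> = (\<Prod>w\<in>S. e ^ expo m w) * monom_val m y"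
      unfolding prod.distrib monom_val_def by (subst prod.inter_restrict[symmetric]) auto
    finally show ?thesis by (simp add: sdeg_def power_sum)
  qed
  have "T k = 0" for k
  proof -
    have "complex_of_real (\<epsilon> k) ^ k0 * T k = peval F (\<chi> w. if w \<in> S then complex_of_real (\<epsilon> k) * Z k $ w else Z k $ w)"
    proof -
      have "complex_of_real (\<epsilon> k) ^ k0 * T k = (\<Sum>m\<in>Poly_Mapping.keys F. of_real (coef F m) *
          (complex_of_real (\<epsilon> k) ^ sdeg m * monom_val m (\<lambda>w. Z k $ w)))"
        unfolding T_def sum_distrib_left
      proof (rule sum.cong)
        fix m assume "m \<in> Poly_Mapping.keys F"
        then have "complex_of_real (\<epsilon> k) ^ sdeg m
            = complex_of_real (\<epsilon> k) ^ k0 * complex_of_real (\<epsilon> k) ^ (sdeg m - k0)"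
          using k0 by (simp flip: power_add)
        then show "complex_of_real (\<epsilon> k) ^ k0 * (of_real (coef F m) *
            (complex_of_real (\<epsilon> k) ^ (sdeg m - k0) * monom_val m (\<lambda>w. Z k $ w)))
          = of_real (coef F m) * (complex_of_real (\<epsilon> k) ^ sdeg m * monom_val m (\<lambda>w. Z k $ w))"
          by simp
      qed simp
      then show ?thesis
        unfolding peval_def by (subst eval_with_superset[OF finite_keys order_refl]) (simp_all add: scale monom_val_vec_lambda)
    qed
    with van \<epsilon>(2) show ?thesis by simp
  qed
  then have T0: "T = (\<lambda>k. 0)" by blast
  have "T \<longlonglongrightarrow> (\<Sum>m\<in>Poly_Mapping.keys F. of_real (coef F m) * ((if sdeg m = k0 then 1 else 0) * monom_val m (\<lambda>w. z $ w)))"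
    unfolding T_def
  proof (intro tendsto_sum tendsto_mult tendsto_const)
    fix m assume m: "m \<in> Poly_Mapping.keys F"
    show "(\<lambda>k. complex_of_real (\<epsilon> k) ^ (sdeg m - k0)) \<longlonglongrightarrow> (if sdeg m = k0 then 1 else 0)"
    proof (cases "sdeg m = k0")
      case False
      then have "sdeg m - k0 \<noteq> 0" using k0[OF m] by simp
      moreover have "(\<lambda>k. complex_of_real (\<epsilon> k) ^ (sdeg m - k0)) \<longlonglongrightarrow> complex_of_real 0 ^ (sdeg m - k0)"
        by (intro tendsto_intros \<epsilon>(1))
      ultimately show ?thesis using False by (simp add: power_0_left)
    qed simp
    show "(\<lambda>k. monom_val m (\<lambda>w. Z k $ w)) \<longlonglongrightarrow> monom_val m (\<lambda>w. z $ w)"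
      unfolding monom_val_def by (intro tendsto_intros tendsto_vec_nth Z)
  qed
  then have "0 = (\<Sum>m\<in>Poly_Mapping.keys F. of_real (coef F m) * ((if sdeg m = k0 then 1 else 0) * monom_val m (\<lambda>w. z $ w)))"
    unfolding T0 by (intro LIMSEQ_unique[OF tendsto_const])
  also have "\<dots> = (\<Sum>m\<in>{m \<in> Poly_Mapping.keys F. sdeg m = k0}. of_real (coef F m) * monom_val m (\<lambda>w. z $ w))"
    by (rule sum.mono_neutral_cong_right) auto
  also have "\<dots> = peval (low_part S F) z"
    unfolding low_part_def Let_def sdeg_def[symmetric] k0_def[symmetric] peval_sum peval_single ..
  finally show ?thesis by simp
qed

subsection \<open>The KKT equations after a change of coordinates\<close>

text \<open>The gradient at points over either field; \<open>grad\<close> is its real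
  instance.\<close>

definition pgrad_at :: "('n::finite, real) mpoly \<Rightarrow> 'a::real_field ^ 'n \<Rightarrow> 'a ^ 'n" where
  "pgrad_at p x = (\<chi> i. peval (partial_deriv i p) x)"

lemma grad_eq_pgrad_at: "grad p x = pgrad_at p x"
  by (simp add: grad_def pgrad_at_def pgrad_def)

lemma has_derivative_vec_nth:
  "(f has_derivative f') F \<Longrightarrow> ((\<lambda>x. f x $ i) has_derivative (\<lambda>h. f' h $ i)) F"
  by (rule bounded_linear.has_derivative[OF bounded_linear_vec_nth])

lemma has_derivative_peval_compose:
  fixes g :: "'b::real_normed_vector \<Rightarrow> 'a::real_normed_field ^ 'n::finite"
  assumes "(g has_derivative g') (at z within S)"
  shows "((\<lambda>z. peval p (g z)) has_derivative (\<lambda>h. \<Sum>i\<in>UNIV. peval (partial_deriv i p) (g z) * g' h $ i)) (at z within S)"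
  by (rule has_derivative_compose[OF assms has_derivative_peval])

lemma has_derivative_matrix_vector_mult:
  fixes A :: "'b::real_normed_vector \<Rightarrow> 'a::real_normed_field ^ 'm::finite ^ 'n::finite"
  assumes "(A has_derivative A') (at z)" "(x has_derivative x') (at z)"
  shows "((\<lambda>z. A z *v x z) has_derivative (\<lambda>h. A z *v x' h + A' h *v x z)) (at z)"
proof (rule has_derivative_vecI)
  fix i
  have "((\<lambda>z. \<Sum>j\<in>UNIV. A z $ i $ j * x z $ j) has_derivative
      (\<lambda>h. \<Sum>j\<in>UNIV. A z $ i $ j * x' h $ j + A' h $ i $ j * x z $ j)) (at z)"
    by (intro has_derivative_sum has_derivative_mult has_derivative_vec_nth assms)
  then show "((\<lambda>z. (A z *v x z) $ i) has_derivative (\<lambda>h. (A z *v x' h + A' h *v x z) $ i)) (at z)"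
    by (simp add: matrix_vector_mult_def sum.distrib)
qed

lemma has_derivative_transpose:
  fixes A :: "'b::real_normed_vector \<Rightarrow> 'a::real_normed_field ^ 'm::finite ^ 'n::finite"
  assumes "(A has_derivative A') (at z)"
  shows "((\<lambda>z. transpose (A z)) has_derivative (\<lambda>h. transpose (A' h))) (at z)"
  by (intro has_derivative_vecI) (simp add: transpose_def has_derivative_vec_nth assms)

text \<open>Symmetric matrices are what variations of \<open>A\<close> produce in
  \<open>A ** transpose A\<close>. One row and one column through an index with \<open>q $ i\<close>
  nonzero suffice; the diagonal entry \<open>t\<close> corrects component \<open>i\<close>.\<close>

lemma exists_symmetric_matrix:
  fixes q r :: "'a::field ^ 'n::finite"
  assumes "q \<noteq> 0" shows "\<exists>S. transpose S = S \<and> S *v q = r"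
proof -
  obtain i where i: "q $ i \<noteq> 0" using assms by (auto simp: Finite_Cartesian_Product.vec_eq_iff)
  define t where "t = (r $ i - (\<Sum>j\<in>UNIV - {i}. r $ j / q $ i * q $ j)) / q $ i"
  define S :: "'a ^ 'n ^ 'n" where
    "S = (\<chi> a b. if a = i \<and> b = i then t else if a = i then r $ b / q $ i else if b = i then r $ a / q $ i else 0)"
  have "transpose S = S" by (auto simp: S_def transpose_def Finite_Cartesian_Product.vec_eq_iff)
  moreover have "(S *v q) $ a = r $ a" for a
  proof (cases "a = i")
    case True
    have "(\<Sum>b\<in>UNIV. S $ i $ b * q $ b) = t * q $ i + (\<Sum>b\<in>UNIV - {i}. r $ b / q $ i * q $ b)"
      by (subst sum.remove[of UNIV i]) (auto simp: S_def)
    then show ?thesis using i True by (simp add: matrix_vector_mult_def t_def)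
  next
    case False
    then have "(\<Sum>b\<in>UNIV. S $ a $ b * q $ b) = (\<Sum>b\<in>UNIV. if b = i then r $ a else 0)"
      using i by (intro sum.cong) (auto simp: S_def)
    then show ?thesis by (simp add: matrix_vector_mult_def)
  qed
  ultimately show ?thesis by (auto simp: Finite_Cartesian_Product.vec_eq_iff)
qed

text \<open>The coefficients sit in a vector indexed by the coordinates, at the places
  \<open>e k\<close>, so that the number of variables depends on n alone and not on the number of
  constraints.\<close>

definition grad_comb ::
    "('n::finite, real) mpoly list \<Rightarrow> (nat \<Rightarrow> 'n) \<Rightarrow> 'a::real_field ^ 'n \<Rightarrow> 'a ^ 'n \<Rightarrow> 'a ^ 'n" where
  "grad_comb ps e y c = (\<Sum>k<length ps. (c $ e k) *s pgrad_at (ps ! k) y)"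

lemma grad_comb_nth: "grad_comb ps e y c $ d = (\<Sum>k<length ps. c $ e k * peval (partial_deriv d (ps ! k)) y)"
  by (simp add: grad_comb_def pgrad_at_def)

text \<open>With \<open>ps = f # gs\<close> and \<open>e\<close> injective, the zeros of the first component are the points \<open>y\<close> for
  which \<open>(A A\<^sup>T)\<^sup>-\<^sup>1 (y - x\<^sup>*)\<close> is the combination of the gradients with the coefficients \<open>c\<close>. The
  second component collects the constraints and the coefficients that are not used.\<close>

definition kkt_map ::
    "('n::finite, real) mpoly list \<Rightarrow> (nat \<Rightarrow> 'n) \<Rightarrow> real ^ 'n \<Rightarrow>
     (complex ^ 'n) \<times> (complex ^ 'n) \<times> (complex ^ 'n ^ 'n) \<Rightarrow> (complex ^ 'n) \<times> (complex ^ 'n)" where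
  "kkt_map ps e xs = (\<lambda>(y, c, A).
     (y - (\<chi> i. of_real (xs $ i)) - A *v (transpose A *v grad_comb ps e y c),
      \<chi> a. if a \<in> e ` {1..<length ps} then peval (ps ! the_inv_into {..<length ps} e a) y else c $ a))"

text \<open>Surjectivity comes in two stages. The constraint gradients are independent, so a
  direction in \<open>y\<close> together with one in \<open>c\<close> meets any value of the second
  component; the direction in \<open>A\<close> then corrects the first, where it enters through
  symmetric matrices applied to the nonzero vector \<open>grad_comb ps e y c\<close>.\<close>

lemma kkt_map_derivative:
  fixes y c :: "complex ^ 'n::finite" and A :: "complex ^ 'n ^ 'n"
  assumes e: "inj_on e {..<length ps}"
  shows "\<exists>D. (kkt_map ps e xs has_derivative D) (at (y, c, A)) \<and>
    (invertible A \<and> \<not> col_dep (\<lambda>j i. peval (partial_deriv i (ps ! Suc j)) y) (length ps - 1) \<and>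
     grad_comb ps e y c \<noteq> 0 \<longrightarrow> surj D)"
proof -
  define r where "r = the_inv_into {..<length ps} e"
  have r: "r (e k) = k" if "k < length ps" for k using that e by (simp add: r_def the_inv_into_f_f)
  define q where "q = grad_comb ps e y c"
  define G :: "'n set" where "G = e ` {1..<length ps}"
  define J' where "J' v z = (\<chi> d. \<Sum>k<length ps. c $ e k * (\<Sum>i\<in>UNIV. peval (partial_deriv i (partial_deriv d (ps ! k))) y * v $ i)
      + z $ e k * peval (partial_deriv d (ps ! k)) y)" for v z :: "complex ^ 'n"
  define D :: "(complex ^ 'n) \<times> (complex ^ 'n) \<times> (complex ^ 'n ^ 'n) \<Rightarrow> (complex ^ 'n) \<times> (complex ^ 'n)"
    where "D p = (fst p - (A *v (transpose A *v J' (fst p) (fst (snd p)) + transpose (snd (snd p)) *v q)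
        + snd (snd p) *v (transpose A *v q)),
      \<chi> a. if a \<in> G then \<Sum>i\<in>UNIV. peval (partial_deriv i (ps ! r a)) y * fst p $ i else fst (snd p) $ a)" for p
  have d1: "(fst has_derivative fst) (at (y, c, A))"
    and d2: "((\<lambda>p. fst (snd p)) has_derivative (\<lambda>p. fst (snd p))) (at (y, c, A))"
    and d3: "((\<lambda>p. snd (snd p)) has_derivative (\<lambda>p. snd (snd p))) (at (y, c, A))"
    by (intro has_derivative_fst has_derivative_snd has_derivative_ident)+
  have dJ: "((\<lambda>p. grad_comb ps e (fst p) (fst (snd p))) has_derivative (\<lambda>p. J' (fst p) (fst (snd p)))) (at (y, c, A))"
  proof (rule has_derivative_vecI)
    fix d
    have "((\<lambda>p. \<Sum>k<length ps. fst (snd p) $ e k * peval (partial_deriv d (ps ! k)) (fst p)) has_derivative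
       (\<lambda>p. \<Sum>k<length ps. fst (snd (y, c, A)) $ e k *
            (\<Sum>i\<in>UNIV. peval (partial_deriv i (partial_deriv d (ps ! k))) (fst (y, c, A)) * fst p $ i)
          + fst (snd p) $ e k * peval (partial_deriv d (ps ! k)) (fst (y, c, A)))) (at (y, c, A))"
      by (intro has_derivative_sum has_derivative_mult has_derivative_vec_nth has_derivative_peval_compose d1 d2)
    then show "((\<lambda>p. grad_comb ps e (fst p) (fst (snd p)) $ d) has_derivative
        (\<lambda>p. J' (fst p) (fst (snd p)) $ d)) (at (y, c, A))"
      by (simp add: grad_comb_nth J'_def)
  qed
  have "(kkt_map ps e xs has_derivative D) (at (y, c, A))"
    unfolding kkt_map_def case_prod_beta
  proof (rule has_derivative_eq_rhs)
    have "((\<lambda>p. fst p - (\<chi> i. of_real (xs $ i)) - snd (snd p) *v (transpose (snd (snd p)) *v grad_comb ps e (fst p) (fst (snd p))))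
      has_derivative (\<lambda>p. fst p - 0 - (snd (snd (y, c, A)) *v (transpose (snd (snd (y, c, A))) *v J' (fst p) (fst (snd p))
        + transpose (snd (snd p)) *v grad_comb ps e (fst (y, c, A)) (fst (snd (y, c, A))))
        + snd (snd p) *v (transpose (snd (snd (y, c, A))) *v grad_comb ps e (fst (y, c, A)) (fst (snd (y, c, A))))))) (at (y, c, A))"
      by (intro has_derivative_diff has_derivative_matrix_vector_mult has_derivative_transpose
          has_derivative_const d1 d3 dJ)
    moreover have "((\<lambda>p. \<chi> a. if a \<in> G then peval (ps ! r a) (fst p) else fst (snd p) $ a) has_derivative
      (\<lambda>p. \<chi> a. if a \<in> G then \<Sum>i\<in>UNIV. peval (partial_deriv i (ps ! r a)) (fst (y, c, A)) * fst p $ i else fst (snd p) $ a)) (at (y, c, A))"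
    proof (rule has_derivative_vecI)
      fix a
      show "((\<lambda>p. (\<chi> a. if a \<in> G then peval (ps ! r a) (fst p) else fst (snd p) $ a) $ a) has_derivative
        (\<lambda>p. (\<chi> a. if a \<in> G then \<Sum>i\<in>UNIV. peval (partial_deriv i (ps ! r a)) (fst (y, c, A)) * fst p $ i else fst (snd p) $ a) $ a)) (at (y, c, A))"
        using has_derivative_peval_compose[OF d1, of "ps ! r a"] has_derivative_vec_nth[OF d2, of a]
        by (cases "a \<in> G") auto
    qed
    ultimately show "((\<lambda>p. (fst p - (\<chi> i. of_real (xs $ i)) - snd (snd p) *v (transpose (snd (snd p)) *v grad_comb ps e (fst p) (fst (snd p))),
       \<chi> a. if a \<in> e ` {1..<length ps} then peval (ps ! the_inv_into {..<length ps} e a) (fst p) else fst (snd p) $ a)) has_derivative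
      (\<lambda>p. (fst p - 0 - (snd (snd (y, c, A)) *v (transpose (snd (snd (y, c, A))) *v J' (fst p) (fst (snd p))
        + transpose (snd (snd p)) *v grad_comb ps e (fst (y, c, A)) (fst (snd (y, c, A))))
        + snd (snd p) *v (transpose (snd (snd (y, c, A))) *v grad_comb ps e (fst (y, c, A)) (fst (snd (y, c, A))))),
       \<chi> a. if a \<in> G then \<Sum>i\<in>UNIV. peval (partial_deriv i (ps ! r a)) (fst (y, c, A)) * fst p $ i else fst (snd p) $ a))) (at (y, c, A))"
      unfolding G_def r_def by (rule has_derivative_Pair)
  qed (simp add: D_def q_def fun_eq_iff)
  moreover have "surj D"
    if inv: "invertible A" and ind: "\<not> col_dep (\<lambda>j i. peval (partial_deriv i (ps ! Suc j)) y) (length ps - 1)"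
      and q0: "grad_comb ps e y c \<noteq> 0"
  proof -
    have "\<exists>p. D p = b" for b
    proof -
      obtain v where v: "\<And>j. j < length ps - 1 \<Longrightarrow>
          (\<Sum>i\<in>UNIV. peval (partial_deriv i (ps ! Suc j)) y * v i) = snd b $ e (Suc j)"
        using solvable_if_not_col_dep[OF ind, of "\<lambda>j. snd b $ e (Suc j)"] by blast
      define V where "V = (\<chi> i. v i)"
      define s where "s = V - A *v (transpose A *v J' V (snd b)) - fst b"
      have "q \<noteq> 0" using q0 by (simp add: q_def)
      from exists_symmetric_matrix[OF this, of s] obtain S where S: "transpose S = S" "S *v q = s" by blast
      obtain Ai where Ai: "A ** Ai = Finite_Cartesian_Product.mat 1" using inv unfolding invertible_def by blast
      \<comment> \<open>Each term of the product rule contributes half of \<open>S\<close>: with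
        this \<open>B\<close>, \<open>A ** transpose B + B ** transpose A\<close> equals
        \<open>S\<close>.\<close>
      define B where "B = (\<chi> a b. (S ** transpose Ai) $ a $ b / 2)"
      have TA: "transpose Ai ** transpose A = Finite_Cartesian_Product.mat 1" by (metis Ai matrix_transpose_mul Finite_Cartesian_Product.transpose_mat)
      have half: "(\<chi> a b. M $ a $ b / 2) *v z = (\<chi> a. (M *v z) $ a / 2)" for M :: "complex ^ 'n ^ 'n" and z
        by (simp add: matrix_vector_mult_def sum_divide_distrib Finite_Cartesian_Product.vec_eq_iff)
      have "B *v (transpose A *v q) = (\<chi> a. s $ a / 2)"
      proof -
        have "(S ** transpose Ai) *v (transpose A *v q) = s"
          by (metis S(2) TA matrix_mul_assoc matrix_mul_rid matrix_vector_mul_assoc)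
        then show ?thesis unfolding B_def half by simp
      qed
      moreover have "A *v (transpose B *v q) = (\<chi> a. s $ a / 2)"
      proof -
        have "transpose B = (\<chi> a b. (Ai ** S) $ a $ b / 2)"
          using matrix_transpose_mul[of S "transpose Ai"] S(1) unfolding B_def
          by (simp add: transpose_def Finite_Cartesian_Product.vec_eq_iff)
        then have "transpose B *v q = (\<chi> a. ((Ai ** S) *v q) $ a / 2)" by (simp only: half)
        then have "A *v (transpose B *v q) = (\<chi> a. (A *v ((Ai ** S) *v q)) $ a / 2)"
          by (simp only:) (simp add: matrix_vector_mult_def[of A] sum_divide_distrib Finite_Cartesian_Product.vec_eq_iff)
        also have "A *v ((Ai ** S) *v q) = s"
          by (metis Ai S(2) matrix_mul_assoc matrix_mul_lid matrix_vector_mul_assoc)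
        finally show ?thesis .
      qed
      ultimately have "A *v (transpose B *v q) + B *v (transpose A *v q) = (\<chi> a. s $ a / 2) + (\<chi> a. s $ a / 2)"
        by (simp only:)
      also have "\<dots> = s" by (simp add: Finite_Cartesian_Product.vec_eq_iff)
      finally have "A *v (transpose B *v q) + B *v (transpose A *v q) = s" .
      then have "fst (D (V, snd b, B)) = fst b"
        by (simp add: D_def matrix_vector_right_distrib s_def algebra_simps)
      moreover have "snd (D (V, snd b, B)) = snd b"
      proof -
        have "(\<Sum>i\<in>UNIV. peval (partial_deriv i (ps ! r a)) y * V $ i) = snd b $ a" if a: "a \<in> G" for a
        proof -
          obtain k where k: "a = e k" "1 \<le> k" "k < length ps" using a by (auto simp: G_def)
          then show ?thesis using v[of "k - 1"] r[of k] by (simp add: V_def)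
        qed
        then show ?thesis by (simp add: D_def Finite_Cartesian_Product.vec_eq_iff)
      qed
      ultimately show ?thesis by (metis prod.collapse)
    qed
    then show ?thesis by (metis surjI)
  qed
  ultimately show ?thesis by blast
qed

section \<open>A polynomial relation on the family of KKT equations\<close>

type_synonym 'n triple = "(complex ^ 'n) \<times> (complex ^ 'n) \<times> (complex ^ 'n ^ 'n)"

text \<open>Flattening to the 2n + n^2 variables to which Perron's theorem is applied.\<close>

definition coords :: "'n triple \<Rightarrow> complex ^ (('n + 'n) + ('n \<times> 'n :: finite))" where
  "coords = (\<lambda>(x, c, A). \<chi> v. case v of Inl (Inl a) \<Rightarrow> x $ a | Inl (Inr a) \<Rightarrow> c $ a | Inr (a, b) \<Rightarrow> A $ a $ b)"

text \<open>The coefficients are real although the points are complex, so that the relation obtained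
  has real coefficients as well.\<close>

definition is_poly :: "('n::finite triple \<Rightarrow> complex) \<Rightarrow> bool" where
  "is_poly h \<longleftrightarrow> (\<exists>p. \<forall>t. h t = peval p (coords t))"

lemma is_poly_x: "is_poly (\<lambda>t. fst t $ a)"
  and is_poly_c: "is_poly (\<lambda>t. fst (snd t) $ a)"
  and is_poly_A: "is_poly (\<lambda>t. snd (snd t) $ a $ b)"
  unfolding is_poly_def
  by (rule exI[of _ "Var (Inl (Inl a))"] exI[of _ "Var (Inl (Inr a))"] exI[of _ "Var (Inr (a, b))"],
      simp add: coords_def case_prod_beta)+

lemma is_poly_of_real: "is_poly (\<lambda>t. of_real r)"
  unfolding is_poly_def by (rule exI[of _ "Const r"]) simp

lemma is_poly_add: "is_poly g \<Longrightarrow> is_poly h \<Longrightarrow> is_poly (\<lambda>t. g t + h t)"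
  and is_poly_mult: "is_poly g \<Longrightarrow> is_poly h \<Longrightarrow> is_poly (\<lambda>t. g t * h t)"
  and is_poly_diff: "is_poly g \<Longrightarrow> is_poly h \<Longrightarrow> is_poly (\<lambda>t. g t - h t)"
  unfolding is_poly_def by (metis peval_add, metis peval_mult, metis peval_diff)

lemma is_poly_sum: "(\<And>i. i \<in> I \<Longrightarrow> is_poly (h i)) \<Longrightarrow> is_poly (\<lambda>t. \<Sum>i\<in>I. h i t)"
  using is_poly_of_real[of 0] by (induction I rule: infinite_finite_induct) (auto intro!: is_poly_add)

lemma is_poly_peval:
  assumes "\<And>i. is_poly (\<lambda>t. v t $ i)" shows "is_poly (\<lambda>t. peval p (v t))"
proof -
  obtain q where q: "\<And>i t. v t $ i = peval (q i) (coords t)" using assms unfolding is_poly_def by metis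
  then have "v t = (\<chi> i. peval (q i) (coords t))" for t by (simp add: Finite_Cartesian_Product.vec_eq_iff)
  then have "peval p (v t) = peval (eval_with Const p q) (coords t)" for t by (simp add: peval_subst)
  then show ?thesis unfolding is_poly_def by blast
qed

lemma is_poly_mv:
  "(\<And>i j. is_poly (\<lambda>t. M t $ i $ j)) \<Longrightarrow> (\<And>i. is_poly (\<lambda>t. v t $ i)) \<Longrightarrow> is_poly (\<lambda>t. (M t *v v t) $ i)"
  unfolding matrix_vector_mult_def by (simp add: is_poly_sum is_poly_mult)

text \<open>The equations in the new coordinates, since the relation sought is one between
  coordinates of \<open>x\<close> and not of \<open>A *v x\<close>.\<close>

definition kkt_map_x ::
    "('n::finite, real) mpoly list \<Rightarrow> (nat \<Rightarrow> 'n) \<Rightarrow> real ^ 'n \<Rightarrow> 'n triple \<Rightarrow> (complex ^ 'n) \<times> (complex ^ 'n)" where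
  "kkt_map_x ps e xs t = kkt_map ps e xs (snd (snd t) *v fst t, fst (snd t), snd (snd t))"

lemma is_poly_kkt_map_x:
  "is_poly (\<lambda>t. fst (kkt_map_x ps e xs t) $ a)" "is_poly (\<lambda>t. snd (kkt_map_x ps e xs t) $ a)"
proof -
  have y: "is_poly (\<lambda>t. (snd (snd t) *v fst t) $ i)" for i
    by (intro is_poly_mv is_poly_A is_poly_x)
  have g: "is_poly (\<lambda>t. grad_comb ps e (snd (snd t) *v fst t) (fst (snd t)) $ d)" for d
    unfolding grad_comb_nth by (intro is_poly_sum is_poly_mult is_poly_c is_poly_peval y)
  have tr: "is_poly (\<lambda>t. transpose (snd (snd t)) $ i $ j)" for i j
    by (simp add: transpose_def is_poly_A)
  have "is_poly (\<lambda>t. (snd (snd t) *v fst t) $ a - of_real (xs $ a)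
     - (snd (snd t) *v (transpose (snd (snd t)) *v grad_comb ps e (snd (snd t) *v fst t) (fst (snd t)))) $ a)"
    by (intro is_poly_diff y is_poly_of_real is_poly_mv is_poly_A tr g)
  then show "is_poly (\<lambda>t. fst (kkt_map_x ps e xs t) $ a)" by (simp add: kkt_map_x_def kkt_map_def case_prod_beta)
  show "is_poly (\<lambda>t. snd (kkt_map_x ps e xs t) $ a)"
    by (cases "a \<in> e ` {1..<length ps}") (simp_all add: kkt_map_x_def kkt_map_def case_prod_beta is_poly_c is_poly_peval y)
qed

text \<open>The passage from \<open>x\<close> to \<open>A *v x\<close> has a surjective derivative:
  for given increments of \<open>c\<close> and \<open>A\<close>, invertibility of \<open>A\<close>
  allows to solve for that of \<open>x\<close>.\<close>

lemma kkt_map_x_derivative: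
  fixes x c :: "complex ^ 'n::finite" and A :: "complex ^ 'n ^ 'n"
  assumes e: "inj_on e {..<length ps}"
  shows "\<exists>D. (kkt_map_x ps e xs has_derivative D) (at (x, c, A)) \<and>
    (invertible A \<and> \<not> col_dep (\<lambda>j i. peval (partial_deriv i (ps ! Suc j)) (A *v x)) (length ps - 1) \<and>
     grad_comb ps e (A *v x) c \<noteq> 0 \<longrightarrow> surj D)"
proof -
  obtain D where D: "(kkt_map ps e xs has_derivative D) (at (A *v x, c, A))"
    "invertible A \<and> \<not> col_dep (\<lambda>j i. peval (partial_deriv i (ps ! Suc j)) (A *v x)) (length ps - 1) \<and>
     grad_comb ps e (A *v x) c \<noteq> 0 \<longrightarrow> surj D"
    using kkt_map_derivative[OF e, of xs "A *v x" c A] by blast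
  define T where "T p = (A *v fst p + snd (snd p) *v x, fst (snd p), snd (snd p))" for p :: "'n triple"
  have d: "(fst has_derivative fst) (at (x, c, A))"
    "((\<lambda>p. fst (snd p)) has_derivative (\<lambda>p. fst (snd p))) (at (x, c, A))"
    "((\<lambda>p. snd (snd p)) has_derivative (\<lambda>p. snd (snd p))) (at (x, c, A))"
    by (intro has_derivative_fst has_derivative_snd has_derivative_ident)+
  have "((\<lambda>p. (snd (snd p) *v fst p, fst (snd p), snd (snd p))) has_derivative T) (at (x, c, A))"
    using has_derivative_Pair[OF has_derivative_matrix_vector_mult[OF d(3,1)] has_derivative_Pair[OF d(2,3)]]
    by (simp add: T_def[abs_def])
  from has_derivative_compose[OF this, of "kkt_map ps e xs" D] D(1)
  have "(kkt_map_x ps e xs has_derivative (\<lambda>p. D (T p))) (at (x, c, A))"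
    by (simp add: kkt_map_x_def[abs_def])
  moreover have "surj (\<lambda>p. D (T p))" if inv: "invertible A" and sD: "surj D"
  proof -
    obtain Ai where Ai: "A ** Ai = Finite_Cartesian_Product.mat 1" using inv unfolding invertible_def by blast
    have "T (Ai *v (fst q - snd (snd q) *v x), snd q) = q" for q
      by (cases q) (simp add: T_def matrix_vector_mul_assoc Ai)
    then have "surj T" by (rule surjI)
    with sD show ?thesis using comp_surj[of T D] by (simp add: o_def)
  qed
  ultimately show ?thesis using D(2) by blast
qed

text \<open>The values of the \<open>2 n + n\<^sup>2 + 1\<close> functions to which Perron's theorem is applied: the equations,
  with two coordinates of \<open>x\<close> and the entries of \<open>A\<close> in addition.\<close>

definition kkt_vals :: "'n \<Rightarrow> 'n \<Rightarrow> 'n \<Rightarrow> ((complex ^ 'n) \<times> (complex ^ 'n)) \<Rightarrow> 'n triple \<Rightarrow>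
    complex ^ (('n + 'n) + ('n \<times> 'n :: finite)) option" where
  "kkt_vals i j a0 b t = (\<chi> w. case w of None \<Rightarrow> fst t $ j | Some (Inl (Inl a)) \<Rightarrow> fst b $ a
     | Some (Inl (Inr a)) \<Rightarrow> if a = a0 then fst t $ i else snd b $ a
     | Some (Inr (a, b)) \<Rightarrow> snd (snd t) $ a $ b)"

text \<open>Slot \<open>e 0\<close> belongs to the coefficient of the first gradient, on which no
  equation is imposed, so it is free to carry \<open>x $ i\<close>. The relation from Perron's
  theorem is replaced by its initial form in the equation slots. Near a solution there are, by
  surjectivity of the derivative, points where the equations take the values \<epsilon> b for
  arbitrary \<open>b\<close>; letting \<epsilon> tend to 0 makes the initial form vanish at
  \<open>b\<close>.\<close>

lemma relation_on_kkt_family: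
  fixes ps :: "('n::finite, real) mpoly list"
  assumes e: "inj_on e {..<length ps}" and ps: "ps \<noteq> []"
  shows "\<exists>F. F \<noteq> 0 \<and> (\<forall>x c A b.
     invertible A \<and> \<not> col_dep (\<lambda>j i. peval (partial_deriv i (ps ! Suc j)) (A *v x)) (length ps - 1) \<and>
     grad_comb ps e (A *v x) c \<noteq> 0 \<and> fst (kkt_map_x ps e xs (x, c, A)) = 0 \<and>
     (\<forall>a. a \<noteq> e 0 \<longrightarrow> snd (kkt_map_x ps e xs (x, c, A)) $ a = 0) \<longrightarrow>
     peval F (kkt_vals i j (e 0) b (x, c, A)) = 0)"
proof -
  have "\<exists>p. \<forall>t. kkt_vals i j (e 0) (kkt_map_x ps e xs t) t $ w = peval p (coords t)" for w
  proof -
    have "is_poly (\<lambda>t. kkt_vals i j (e 0) (kkt_map_x ps e xs t) t $ w)"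
    proof (cases w)
      case (Some u)
      show ?thesis
      proof (cases u)
        case (Inl v)
        then show ?thesis
          by (cases v; cases "projr v = e 0") (simp_all add: Some kkt_vals_def is_poly_x is_poly_kkt_map_x)
      next
        case (Inr v)
        then show ?thesis by (cases v) (simp add: Some kkt_vals_def is_poly_A)
      qed
    qed (simp add: kkt_vals_def is_poly_x)
    then show ?thesis unfolding is_poly_def .
  qed
  then obtain \<phi> where \<phi>: "\<And>w t. kkt_vals i j (e 0) (kkt_map_x ps e xs t) t $ w = peval (\<phi> w) (coords t)"
    by metis
  obtain F where F: "F \<noteq> 0" "eval_with Const F \<phi> = 0"
    using algebraically_dependent[of \<phi>] by auto
  have F0: "peval F (kkt_vals i j (e 0) (kkt_map_x ps e xs t) t) = 0" for t
  proof -
    have "peval F (\<chi> w. peval (\<phi> w) (coords t)) = 0" using F(2) by (metis peval_subst peval_0)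
    then show ?thesis by (simp flip: \<phi>)
  qed
  \<comment> \<open>The slots of the equations, in which the initial form is taken.\<close>
  define S :: "(('n + 'n) + ('n \<times> 'n)) option set"
    where "S = range (\<lambda>a. Some (Inl (Inl a))) \<union> {Some (Inl (Inr a)) | a. a \<noteq> e 0}"
  have "peval (low_part S F) (kkt_vals i j (e 0) b (x, c, A)) = 0"
    if inv: "invertible A" and ind: "\<not> col_dep (\<lambda>j i. peval (partial_deriv i (ps ! Suc j)) (A *v x)) (length ps - 1)"
     and q: "grad_comb ps e (A *v x) c \<noteq> 0" and z1: "fst (kkt_map_x ps e xs (x, c, A)) = 0"
     and z2: "\<And>a. a \<noteq> e 0 \<Longrightarrow> snd (kkt_map_x ps e xs (x, c, A)) $ a = 0" for x c A b
  proof -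
    let ?t = "(x, c, A)" and ?\<Theta> = "kkt_map_x ps e xs"
    \<comment> \<open>Slot \<open>e 0\<close> is not an equation; the displacement leaves it
      unchanged.\<close>
    define b' where "b' = (fst b, \<chi> a. if a = e 0 then 0 else snd b $ a)"
    have "continuous (at p) ?\<Theta>" for p
      using kkt_map_x_derivative[OF e, of xs "fst p" "fst (snd p)" "snd (snd p)"]
      by (auto intro: has_derivative_continuous)
    then have cont: "continuous_on UNIV ?\<Theta>" by (simp add: continuous_at_imp_continuous_on)
    obtain D where D: "(?\<Theta> has_derivative D) (at ?t)" "surj D"
      using kkt_map_x_derivative[OF e, of xs x c A] inv ind q by blast
    have "\<exists>\<epsilon> t'. 0 < \<epsilon> \<and> \<epsilon> < \<eta> \<and> dist t' ?t < \<eta> \<and> ?\<Theta> t' = ?\<Theta> ?t + \<epsilon> *\<^sub>R b'" if \<eta>: "\<eta> > 0" for \<eta>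
    proof -
      obtain \<delta> where \<delta>: "\<delta> > 0" "ball (?\<Theta> ?t) \<delta> \<subseteq> ?\<Theta> ` ball ?t \<eta>"
        using open_mapping_surj[OF cont D, of "ball ?t \<eta>"] \<eta> by auto
      define \<epsilon> where "\<epsilon> = min (\<eta> / 2) (\<delta> / (2 * (norm b' + 1)))"
      have nb: "norm b' + 1 > 0" using norm_ge_zero[of b'] by linarith
      have "\<epsilon> > 0" using \<eta> \<delta>(1) nb by (simp add: \<epsilon>_def)
      have "\<epsilon> * norm b' \<le> \<delta> / (2 * (norm b' + 1)) * (norm b' + 1)"
        using \<open>\<epsilon> > 0\<close> by (intro mult_mono) (auto simp: \<epsilon>_def)
      also have "\<dots> = \<delta> / 2" using nb by (simp add: field_simps)
      also have "\<dots> < \<delta>" using \<delta>(1) by simp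
      finally have "?\<Theta> ?t + \<epsilon> *\<^sub>R b' \<in> ball (?\<Theta> ?t) \<delta>" using \<open>\<epsilon> > 0\<close> by (simp add: dist_norm)
      with \<delta>(2) have "?\<Theta> ?t + \<epsilon> *\<^sub>R b' \<in> ?\<Theta> ` ball ?t \<eta>" by (rule subsetD)
      then obtain t' where "?\<Theta> ?t + \<epsilon> *\<^sub>R b' = ?\<Theta> t'" "t' \<in> ball ?t \<eta>" by (rule imageE)
      then have "t' \<in> ball ?t \<eta>" "?\<Theta> t' = ?\<Theta> ?t + \<epsilon> *\<^sub>R b'" by simp_all
      moreover have "\<epsilon> < \<eta>" using \<eta> by (simp add: \<epsilon>_def min_less_iff_disj)
      ultimately show ?thesis using \<open>\<epsilon> > 0\<close> by (intro exI[of _ \<epsilon>] exI[of _ t']) (simp add: dist_commute)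
    qed
    from this[of "inverse (real (Suc _))"]
    have "\<exists>\<epsilon> t'. 0 < \<epsilon> \<and> \<epsilon> < inverse (real (Suc k)) \<and> dist t' ?t < inverse (real (Suc k)) \<and> ?\<Theta> t' = ?\<Theta> ?t + \<epsilon> *\<^sub>R b'" for k
      by simp
    then obtain \<epsilon> T where \<epsilon>: "\<And>k. 0 < \<epsilon> k" "\<And>k. \<epsilon> k < inverse (real (Suc k))"
      and T: "\<And>k. dist (T k) ?t < inverse (real (Suc k))" "\<And>k. ?\<Theta> (T k) = ?\<Theta> ?t + \<epsilon> k *\<^sub>R b'" by metis
    have "T \<longlonglongrightarrow> ?t"
      by (rule metric_tendsto_imp_tendsto[OF LIMSEQ_inverse_real_of_nat])
        (use T(1) in \<open>auto intro!: eventuallyI less_imp_le simp: dist_real_def\<close>)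
    from tendsto_fst[OF this] tendsto_snd[OF tendsto_snd[OF this]]
    have "(\<lambda>k. fst (T k)) \<longlonglongrightarrow> x" "(\<lambda>k. snd (snd (T k))) \<longlonglongrightarrow> A" by simp_all
    then have lim: "(\<lambda>k. kkt_vals i j (e 0) b (T k)) \<longlonglongrightarrow> kkt_vals i j (e 0) b ?t"
      unfolding kkt_vals_def
      by (intro tendsto_vec_lambda) (auto split: option.splits sum.splits prod.splits intro!: tendsto_vec_nth)
    have \<epsilon>0: "\<epsilon> \<longlonglongrightarrow> 0"
      by (rule tendsto_sandwich[OF _ _ tendsto_const LIMSEQ_inverse_real_of_nat])
        (use \<epsilon> in \<open>auto intro!: eventuallyI less_imp_le\<close>)
    show ?thesis
    proof (rule low_part_limit[OF \<epsilon>0 _ lim])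
      fix k
      show "\<epsilon> k \<noteq> 0" using \<epsilon>(1)[of k] by simp
      \<comment> \<open>At \<open>T k\<close> the equations have exactly the values
        \<open>\<epsilon> k\<close> times \<open>b\<close>.\<close>
      have "(\<chi> w. if w \<in> S then complex_of_real (\<epsilon> k) * kkt_vals i j (e 0) b (T k) $ w else kkt_vals i j (e 0) b (T k) $ w)
         = kkt_vals i j (e 0) (?\<Theta> (T k)) (T k)"
        unfolding T(2)
        by (auto simp: Finite_Cartesian_Product.vec_eq_iff kkt_vals_def S_def z1 z2 b'_def scaleR_conv_of_real[where ?'a = complex]
            split: option.splits sum.splits prod.splits)
      then show "peval F (\<chi> w. if w \<in> S then complex_of_real (\<epsilon> k) * kkt_vals i j (e 0) b (T k) $ w else kkt_vals i j (e 0) b (T k) $ w) = 0"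
        by (simp add: F0)
    qed
  qed
  with low_part_nonzero[OF F(1)] show ?thesis by blast
qed

subsection \<open>Tangency near a KKT point\<close>

lemma col_dep_cong:
  assumes "\<And>j i. j < k \<Longrightarrow> C j i = C' j i" shows "col_dep C k \<longleftrightarrow> col_dep C' k"
proof -
  have "(\<Sum>j<k. c j * C j i) = (\<Sum>j<k. c j * C' j i)" for c i using assms by (intro sum.cong) auto
  then show ?thesis unfolding col_dep_def by simp
qed

lemma peval_pgrad: "peval (pgrad p $ i) x = pgrad_at p x $ i"
  by (simp add: pgrad_def pgrad_at_def)

lemma peval_pdiff: "peval (pdiff xs $ i) x = x $ i - of_real (xs $ i)"
  by (simp add: pdiff_def peval_diff)

lemma col_vals_nth:
  "j < length C \<Longrightarrow> col_vals C x j i = map (\<lambda>q. \<chi> i. peval (q $ i) x) C ! j $ i"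
  by (simp add: col_vals_def)

definition vec_dep :: "('a::field ^ 'n::finite) list \<Rightarrow> bool" where
  "vec_dep vs \<longleftrightarrow> col_dep (\<lambda>j i. vs ! j $ i) (length vs)"

lemma col_dep_col_vals:
  "length C = k \<Longrightarrow> col_dep (col_vals C x) k \<longleftrightarrow> vec_dep (map (\<lambda>q. \<chi> i. peval (q $ i) x) C)"
  unfolding vec_dep_def by (simp, rule col_dep_cong) (simp add: col_vals_nth)

lemma vec_of_pgrad: "(\<chi> i. peval (pgrad p $ i) x) = pgrad_at p x"
  and vec_of_pdiff: "(\<chi> i. peval (pdiff xs $ i) x) = x - (\<chi> i. of_real (xs $ i))"
  by (simp_all add: peval_pgrad peval_pdiff Finite_Cartesian_Product.vec_eq_iff)

lemma zero_set_ideals: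
  fixes f :: "('n::finite, real) mpoly" and gs xs
  defines "V \<equiv> \<lambda>x :: 'a::real_field ^ 'n. map (\<lambda>g. pgrad_at g x) gs"
    and "d \<equiv> \<lambda>x :: 'a ^ 'n. x - (\<chi> i. of_real (xs $ i))"
  shows "zero_set (ideal_Sigma f gs) = {x. feasible_in gs x \<and> vec_dep (pgrad_at f x # V x)}"
    "zero_set (ideal_L gs xs) = {x. feasible_in gs x \<and> vec_dep (V x @ [d x])}"
    "zero_set (ideal_Gamma f gs xs) = {x. feasible_in gs x \<and> vec_dep (pgrad_at f x # V x @ [d x])}"
proof -
  have "col_dep (col_vals (pgrad f # map pgrad gs) x) (Suc (length gs)) \<longleftrightarrow> vec_dep (pgrad_at f x # V x)"
    "col_dep (col_vals (map pgrad gs @ [pdiff xs]) x) (Suc (length gs)) \<longleftrightarrow> vec_dep (V x @ [d x])"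
    "col_dep (col_vals (pgrad f # map pgrad gs @ [pdiff xs]) x) (length gs + 2)
      \<longleftrightarrow> vec_dep (pgrad_at f x # V x @ [d x])" for x
    by (subst col_dep_col_vals; simp add: vec_of_pgrad vec_of_pdiff o_def V_def d_def)+
  then show "zero_set (ideal_Sigma f gs) = {x. feasible_in gs x \<and> vec_dep (pgrad_at f x # V x)}"
    "zero_set (ideal_L gs xs) = {x. feasible_in gs x \<and> vec_dep (V x @ [d x])}"
    "zero_set (ideal_Gamma f gs xs) = {x. feasible_in gs x \<and> vec_dep (pgrad_at f x # V x @ [d x])}"
    by (simp_all only: zero_set_ideal_Sigma zero_set_ideal_L zero_set_ideal_Gamma)
qed

lemma vec_of_real_real: "(\<chi> i. of_real (xs $ i)) = (xs :: real ^ 'n)"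
  by (simp add: Finite_Cartesian_Product.vec_eq_iff)

lemma feasible_in_real: "feasible_in gs x \<longleftrightarrow> x \<in> feasible_set gs"
  by (simp add: feasible_in_def feasible_set_def)

lemma zero_set_ideals_real:
  "V_R (ideal_Sigma f gs) = {x \<in> feasible_set gs. vec_dep (grad f x # map (\<lambda>g. grad g x) gs)}"
  "V_R (ideal_L gs xs) = {x \<in> feasible_set gs. vec_dep (map (\<lambda>g. grad g x) gs @ [x - xs])}"
  "V_R (ideal_Gamma f gs xs) = {x \<in> feasible_set gs. vec_dep (grad f x # map (\<lambda>g. grad g x) gs @ [x - xs])}"
  by (simp_all only: zero_set_ideals vec_of_real_real feasible_in_real grad_eq_pgrad_at Collect_conj_eq Collect_mem_eq)

lemma sum_list_Cons_index:
  "(\<Sum>j<length (v # vs). c j * (v # vs) ! j $ i) = c 0 * v $ i + (\<Sum>j<length vs. c (Suc j) * vs ! j $ i)"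
  for vs :: "('a::field ^ 'n) list"
  by (simp only: length_Cons sum.lessThan_Suc_shift nth_Cons_0 nth_Cons_Suc)

lemma sum_list_snoc_index:
  "(\<Sum>j<length (vs @ [v]). c j * (vs @ [v]) ! j $ i) = (\<Sum>j<length vs. c j * vs ! j $ i) + c (length vs) * v $ i"
  for vs :: "('a::field ^ 'n) list"
  by (simp add: nth_append)

lemma vec_dep_Cons:
  fixes vs :: "('a::field ^ 'n::finite) list"
  assumes "\<not> vec_dep vs"
  shows "vec_dep (v # vs) \<longleftrightarrow> (\<exists>c. \<forall>i. v $ i = (\<Sum>j<length vs. c j * vs ! j $ i))"
proof
  assume "vec_dep (v # vs)"
  then obtain c where c: "\<exists>j<length (v # vs). c j \<noteq> 0"
    "\<And>i. c 0 * v $ i + (\<Sum>j<length vs. c (Suc j) * vs ! j $ i) = 0"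
    unfolding vec_dep_def col_dep_def sum_list_Cons_index by blast
  have "c 0 \<noteq> 0"
  proof
    assume "c 0 = 0"
    with c have "\<exists>j<length vs. c (Suc j) \<noteq> 0" "\<And>i. (\<Sum>j<length vs. c (Suc j) * vs ! j $ i) = 0"
      by (auto simp: less_Suc_eq_0_disj)
    then have "vec_dep vs" unfolding vec_dep_def col_dep_def by (intro exI[of _ "\<lambda>j. c (Suc j)"] conjI allI)
    with assms show False ..
  qed
  have "v $ i = (\<Sum>j<length vs. (- c (Suc j) / c 0) * vs ! j $ i)" for i
  proof -
    have "(\<Sum>j<length vs. (- c (Suc j) / c 0) * vs ! j $ i) = - (\<Sum>j<length vs. c (Suc j) * vs ! j $ i) / c 0"
      by (simp add: sum_negf sum_divide_distrib)
    also have "(\<Sum>j<length vs. c (Suc j) * vs ! j $ i) = - (c 0 * v $ i)"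
      using c(2)[of i] by (simp add: eq_neg_iff_add_eq_0 add.commute)
    finally show ?thesis using \<open>c 0 \<noteq> 0\<close> by simp
  qed
  then show "\<exists>c. \<forall>i. v $ i = (\<Sum>j<length vs. c j * vs ! j $ i)"
    by (intro exI[of _ "\<lambda>j. - c (Suc j) / c 0"] allI)
next
  assume "\<exists>c. \<forall>i. v $ i = (\<Sum>j<length vs. c j * vs ! j $ i)"
  then obtain c where c: "\<And>i. v $ i = (\<Sum>j<length vs. c j * vs ! j $ i)" by blast
  define c' where "c' j = (case j of 0 \<Rightarrow> -1 | Suc j \<Rightarrow> c j)" for j
  show "vec_dep (v # vs)" unfolding vec_dep_def col_dep_def sum_list_Cons_index
  proof (intro exI[of _ c'] conjI allI)
    show "\<exists>j<length (v # vs). c' j \<noteq> 0" by (intro exI[of _ 0]) (simp add: c'_def)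
    show "c' 0 * v $ i + (\<Sum>j<length vs. c' (Suc j) * vs ! j $ i) = 0" for i
      by (simp add: c'_def c)
  qed
qed

lemma vec_dep_rotate1: "vec_dep (vs @ [v]) \<longleftrightarrow> vec_dep (v # vs)" for vs :: "('a::field ^ 'n::finite) list"
proof
  assume "vec_dep (vs @ [v])"
  then obtain c j where c: "j < length (vs @ [v])" "c j \<noteq> 0"
    "\<And>i. (\<Sum>j<length vs. c j * vs ! j $ i) + c (length vs) * v $ i = 0"
    unfolding vec_dep_def col_dep_def sum_list_snoc_index by blast
  define c' where "c' k = (case k of 0 \<Rightarrow> c (length vs) | Suc k \<Rightarrow> c k)" for k
  show "vec_dep (v # vs)" unfolding vec_dep_def col_dep_def sum_list_Cons_index
  proof (intro exI[of _ c'] conjI allI)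
    show "\<exists>j<length (v # vs). c' j \<noteq> 0"
      using c(1,2) by (intro exI[of _ "if j = length vs then 0 else Suc j"]) (auto simp: c'_def)
    show "c' 0 * v $ i + (\<Sum>j<length vs. c' (Suc j) * vs ! j $ i) = 0" for i
      using c(3)[of i] by (simp add: c'_def add.commute)
  qed
next
  assume "vec_dep (v # vs)"
  then obtain c j where c: "j < length (v # vs)" "c j \<noteq> 0"
    "\<And>i. c 0 * v $ i + (\<Sum>j<length vs. c (Suc j) * vs ! j $ i) = 0"
    unfolding vec_dep_def col_dep_def sum_list_Cons_index by blast
  define c' where "c' k = (if k = length vs then c 0 else c (Suc k))" for k
  show "vec_dep (vs @ [v])" unfolding vec_dep_def col_dep_def sum_list_snoc_index
  proof (intro exI[of _ c'] conjI allI)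
    show "\<exists>j<length (vs @ [v]). c' j \<noteq> 0"
      using c(1,2) by (intro exI[of _ "if j = 0 then length vs else j - 1"]) (auto simp: c'_def)
    show "(\<Sum>j<length vs. c' j * vs ! j $ i) + c' (length vs) * v $ i = 0" for i
      using c(3)[of i] by (simp add: c'_def add.commute)
  qed
qed

lemma vec_dep_ConsI:
  fixes vs :: "('a::field ^ 'n::finite) list"
  assumes "vec_dep vs" shows "vec_dep (v # vs)"
proof -
  obtain c j where c: "j < length vs" "c j \<noteq> 0" "\<And>i. (\<Sum>j<length vs. c j * vs ! j $ i) = 0"
    using assms unfolding vec_dep_def col_dep_def by blast
  define c' where "c' k = (case k of 0 \<Rightarrow> 0 | Suc k \<Rightarrow> c k)" for k
  show ?thesis unfolding vec_dep_def col_dep_def sum_list_Cons_index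
  proof (intro exI[of _ c'] conjI allI)
    show "\<exists>j<length (v # vs). c' j \<noteq> 0" using c(1,2) by (intro exI[of _ "Suc j"]) (auto simp: c'_def)
    show "c' 0 * v $ i + (\<Sum>j<length vs. c' (Suc j) * vs ! j $ i) = 0" for i
      using c(3) by (simp add: c'_def)
  qed
qed

text \<open>Multipliers are the coefficients of a dependence relation among the columns, with the
  signs of \<open>lam\<close> and \<open>mu\<close> reversed.\<close>

lemma tangency_set_eq: "tangency_set f gs xs = V_R (ideal_Gamma f gs xs)"
proof -
  have "(\<exists>kappa lam mu. (kappa \<noteq> 0 \<or> (\<exists>i<length gs. lam i \<noteq> 0) \<or> mu \<noteq> 0) \<and>
       kappa *\<^sub>R grad f x - (\<Sum>i<length gs. lam i *\<^sub>R grad (gs ! i) x) - mu *\<^sub>R (x - xs) = 0)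
    \<longleftrightarrow> vec_dep (grad f x # map (\<lambda>g. grad g x) gs @ [x - xs])" (is "?L \<longleftrightarrow> ?R") for x
  proof
    assume ?L
    then obtain kappa lam mu where k: "kappa \<noteq> 0 \<or> (\<exists>i<length gs. lam i \<noteq> 0) \<or> mu \<noteq> 0"
      "kappa *\<^sub>R grad f x - (\<Sum>i<length gs. lam i *\<^sub>R grad (gs ! i) x) - mu *\<^sub>R (x - xs) = 0" by blast
    define c where "c j = (case j of 0 \<Rightarrow> kappa | Suc j \<Rightarrow> if j = length gs then - mu else - lam j)" for j
    have "kappa * grad f x $ i - (\<Sum>j<length gs. lam j * grad (gs ! j) x $ i) - mu * (x - xs) $ i = 0" for i
      using arg_cong[OF k(2), of "\<lambda>v. v $ i"] by simp
    then have "c 0 * grad f x $ i + (\<Sum>j<length (map (\<lambda>g. grad g x) gs @ [x - xs]).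
        c (Suc j) * (map (\<lambda>g. grad g x) gs @ [x - xs]) ! j $ i) = 0" for i
      unfolding sum_list_snoc_index by (simp add: c_def sum_negf algebra_simps)
    moreover have "\<exists>j<length (grad f x # map (\<lambda>g. grad g x) gs @ [x - xs]). c j \<noteq> 0"
    proof -
      consider "kappa \<noteq> 0" | j where "j < length gs" "lam j \<noteq> 0" | "mu \<noteq> 0" using k(1) by blast
      then show ?thesis
      proof cases
        case 1 then show ?thesis by (intro exI[of _ 0]) (simp add: c_def)
      next
        case (2 j) then show ?thesis by (intro exI[of _ "Suc j"]) (simp add: c_def)
      next
        case 3 then show ?thesis by (intro exI[of _ "Suc (length gs)"]) (simp add: c_def)
      qed
    qed
    ultimately show ?R unfolding vec_dep_def col_dep_def sum_list_Cons_index by (intro exI[of _ c] conjI allI)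
  next
    assume ?R
    then obtain c j where c: "j < length (grad f x # map (\<lambda>g. grad g x) gs @ [x - xs])" "c j \<noteq> 0"
      "\<And>i. c 0 * grad f x $ i + ((\<Sum>j<length gs. c (Suc j) * grad (gs ! j) x $ i) + c (Suc (length gs)) * (x - xs) $ i) = 0"
      unfolding vec_dep_def col_dep_def sum_list_Cons_index sum_list_snoc_index by auto
    show ?L
    proof (rule exI[of _ "c 0"], rule exI[of _ "\<lambda>j. - c (Suc j)"], rule exI[of _ "- c (Suc (length gs))"], rule conjI)
      show "c 0 \<noteq> 0 \<or> (\<exists>i<length gs. - c (Suc i) \<noteq> 0) \<or> - c (Suc (length gs)) \<noteq> 0"
      proof (cases j)
        case (Suc k)
        with c(1,2) show ?thesis by (cases "k = length gs") auto
      qed (use c(2) in simp)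
      show "c 0 *\<^sub>R grad f x - (\<Sum>i<length gs. - c (Suc i) *\<^sub>R grad (gs ! i) x) - - c (Suc (length gs)) *\<^sub>R (x - xs) = 0"
        using c(3) by (simp add: Finite_Cartesian_Product.vec_eq_iff sum_negf add.assoc)
    qed
  qed
  then show ?thesis unfolding tangency_set_def zero_set_ideals_real by simp
qed

lemma LICQ_iff: "LICQ gs x \<longleftrightarrow> \<not> vec_dep (map (\<lambda>g. grad g x) gs)"
  by (simp add: LICQ_def lin_indep_list_iff_not_col_dep vec_dep_def)

text \<open>Where LICQ fails, the minors of \<open>ideal_Sigma\<close> vanish although there may be
  no multipliers for \<open>f\<close>; hence the two sets are compared under LICQ.\<close>

lemma kkt_set_eq_if_LICQ:
  assumes "LICQ gs x" shows "x \<in> kkt_set f gs \<longleftrightarrow> x \<in> V_R (ideal_Sigma f gs)"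
  using vec_dep_Cons[of "map (\<lambda>g. grad g x) gs" "grad f x"] assms
  by (simp add: zero_set_ideals_real LICQ_iff kkt_set_def Finite_Cartesian_Product.vec_eq_iff)

lemma kkt_set_subset_Sigma: "kkt_set f gs \<subseteq> V_R (ideal_Sigma f gs)"
proof
  fix x assume x: "x \<in> kkt_set f gs"
  show "x \<in> V_R (ideal_Sigma f gs)"
  proof (cases "LICQ gs x")
    case False
    then have "vec_dep (grad f x # map (\<lambda>g. grad g x) gs)" by (intro vec_dep_ConsI) (simp add: LICQ_iff)
    with x show ?thesis by (simp add: zero_set_ideals_real kkt_set_def)
  qed (use x kkt_set_eq_if_LICQ in blast)
qed

lemma tendsto_row_minor:
  fixes C :: "'b \<Rightarrow> nat \<Rightarrow> 'n \<Rightarrow> 'a::real_normed_field"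
  assumes "\<And>j i. j < length rs \<Longrightarrow> ((\<lambda>x. C x j i) \<longlongrightarrow> L j i) F"
  shows "((\<lambda>x. row_minor (C x) rs) \<longlongrightarrow> row_minor L rs) F"
proof -
  have eq: "row_minor C rs = (\<Sum>p\<in>{p. p permutes {0..<length rs}}. signof p * (\<Prod>i = 0..<length rs. C (p i) (rs ! i)))"
    for C :: "nat \<Rightarrow> 'n \<Rightarrow> 'a"
    unfolding row_minor_def by (subst det_def'[of _ "length rs"]) (auto intro!: sum.cong prod.cong simp: permutes_def)
  show ?thesis unfolding eq
  proof (intro tendsto_sum tendsto_mult tendsto_const tendsto_prod)
    fix p i assume "p \<in> {p. p permutes {0..<length rs}}" "i \<in> {0..<length rs}"
    then have "p i < length rs" using permutes_in_image by fastforce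
    then show "((\<lambda>x. C x (p i) (rs ! i)) \<longlongrightarrow> L (p i) (rs ! i)) F" by (rule assms)
  qed
qed

text \<open>A minor that does not vanish at the limit does not vanish nearby.\<close>

lemma eventually_not_col_dep:
  fixes C :: "'b \<Rightarrow> nat \<Rightarrow> 'n::finite \<Rightarrow> 'a::real_normed_field"
  assumes "\<And>j i. j < k \<Longrightarrow> ((\<lambda>x. C x j i) \<longlongrightarrow> L j i) F" "\<not> col_dep L k"
  shows "eventually (\<lambda>x. \<not> col_dep (C x) k) F"
proof -
  obtain rs where rs: "length rs = k" "row_minor L rs \<noteq> 0" using exists_minor_nonzero[OF assms(2)] by blast
  have "((\<lambda>x. row_minor (C x) rs) \<longlongrightarrow> row_minor L rs) F" using assms(1) rs(1) by (intro tendsto_row_minor) auto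
  from tendsto_imp_eventually_ne[OF this rs(2)] show ?thesis
    by eventually_elim (use col_dep_imp_minor_0 rs(1) in blast)
qed

section \<open>Moving along the constraints and the spheres\<close>

lemma has_derivative_peval_grad:
  "(peval p has_derivative (\<lambda>v. \<Sum>i\<in>UNIV. grad p x $ i * v $ i)) (at x)" for x :: "real ^ 'n::finite"
  using has_derivative_peval[of p x] by (simp add: grad_eq_pgrad_at pgrad_at_def)

lemma tendsto_grad: "((\<lambda>x. grad p x $ i) \<longlongrightarrow> grad p x0 $ i) (at x0 within U)"
  unfolding grad_eq_pgrad_at pgrad_at_def vec_lambda_beta
  using has_derivative_continuous[OF has_derivative_peval] by (metis continuous_within tendsto_within_subset subset_UNIV)

text \<open>The factor 1/2 makes \<open>x - xs\<close> the gradient, which is the last column of the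
  matrices in question.\<close>

definition half_sq :: "real ^ 'n::finite \<Rightarrow> real ^ 'n \<Rightarrow> real" where
  "half_sq xs x = (norm (x - xs))\<^sup>2 / 2"

lemma has_derivative_half_sq:
  "(half_sq xs has_derivative (\<lambda>v. \<Sum>i\<in>UNIV. (x - xs) $ i * v $ i)) (at x)"
proof -
  have "((\<lambda>x. (x - xs) \<bullet> (x - xs) / 2) has_derivative (\<lambda>v. ((x - xs) \<bullet> v + v \<bullet> (x - xs)) / 2)) (at x)"
    by (auto intro!: derivative_eq_intros)
  then show ?thesis
    by (simp add: half_sq_def[abs_def] power2_norm_eq_inner inner_commute) (simp add: inner_vec_def mult.commute)
qed

lemma continuous_on_half_sq: "continuous_on U (half_sq xs)"
  unfolding half_sq_def by (intro continuous_intros) simp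

lemma half_sq_eq_iff: "half_sq xs x = half_sq xs y \<longleftrightarrow> norm (x - xs) = norm (y - xs)"
  by (simp add: half_sq_def)

text \<open>Applied with \<open>ps = f # gs\<close> to move f within S along a sphere, and with
  \<open>ps = gs\<close> to change the distance within S.\<close>

lemma open_at_constraints:
  fixes gs :: "('n::finite, real) mpoly list" and ps :: "('n, real) mpoly list"
  assumes "\<not> vec_dep (map (\<lambda>p. grad p x) ps @ [x - xs])" and U: "open U" "x \<in> U"
  shows "\<exists>\<delta>>0. \<forall>b d. (\<forall>k<length ps. \<bar>b k\<bar> < \<delta>) \<and> \<bar>d\<bar> < \<delta> \<longrightarrow>
    (\<exists>y\<in>U. (\<forall>k<length ps. peval (ps ! k) y = peval (ps ! k) x + b k) \<and> half_sq xs y = half_sq xs x + d)"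
proof -
  let ?l = "length ps" and ?vs = "map (\<lambda>p. grad p x) ps @ [x - xs]"
  define h where "h k = (if k < ?l then peval (ps ! k) else half_sq xs)" for k
  have "(h k has_derivative (\<lambda>v. \<Sum>i\<in>UNIV. ?vs ! k $ i * v $ i)) (at x)" if "k < Suc ?l" for k
    using that has_derivative_half_sq[of xs x]
    by (auto simp: h_def nth_append less_Suc_eq has_derivative_peval_grad)
  moreover have "continuous_on UNIV (h k)" for k
    by (auto simp: h_def continuous_on_half_sq continuous_peval)
  ultimately obtain \<delta> where \<delta>: "\<delta> > 0" "\<And>b. (\<forall>k<Suc ?l. \<bar>b k\<bar> < \<delta>) \<Longrightarrow> \<exists>y\<in>U. \<forall>k<Suc ?l. h k y = h k x + b k"
    using open_if_gradients_independent[of "Suc ?l" h "\<lambda>k i. ?vs ! k $ i" x U] assms by (auto simp: vec_dep_def)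
  have "\<exists>y\<in>U. (\<forall>k<?l. peval (ps ! k) y = peval (ps ! k) x + b k) \<and> half_sq xs y = half_sq xs x + d"
    if "\<forall>k<?l. \<bar>b k\<bar> < \<delta>" "\<bar>d\<bar> < \<delta>" for b d
  proof -
    have "\<forall>k<Suc ?l. \<bar>if k < ?l then b k else d\<bar> < \<delta>" using that by simp
    from \<delta>(2)[OF this] obtain y where y: "y \<in> U" "\<forall>k<Suc ?l. h k y = h k x + (if k < ?l then b k else d)"
      by blast
    from y(2) have "\<forall>k<?l. peval (ps ! k) y = peval (ps ! k) x + b k"
      by (auto simp: h_def dest!: spec split: if_splits)
    moreover from y(2)[rule_format, of ?l] have "half_sq xs y = half_sq xs x + d" by (simp add: h_def)
    ultimately show ?thesis using y(1) by blast
  qed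
  with \<delta>(1) show ?thesis by blast
qed

lemma feasible_setI: "(\<And>k. k < length gs \<Longrightarrow> peval (gs ! k) x = 0) \<Longrightarrow> x \<in> feasible_set gs"
  by (auto simp: feasible_set_def in_set_conv_nth)

lemma feasible_setD: "x \<in> feasible_set gs \<Longrightarrow> k < length gs \<Longrightarrow> peval (gs ! k) x = 0"
  by (auto simp: feasible_set_def)

lemma closed_feasible_set: "closed (feasible_set gs)"
proof -
  have "feasible_set gs = (\<Inter>g\<in>set gs. {x. peval g x = 0})" by (auto simp: feasible_set_def)
  then show ?thesis by (auto intro!: closed_Collect_eq continuous_peval continuous_on_id continuous_on_const)
qed

lemma sphere_eq: "x \<in> sphere xs r \<longleftrightarrow> norm (x - xs) = r"
  by (simp add: dist_norm norm_minus_commute)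

lemma cball_eq: "x \<in> cball xs r \<longleftrightarrow> norm (x - xs) \<le> r"
  by (simp add: dist_norm norm_minus_commute)

text \<open>Otherwise the gradients of f, of the constraints and of the squared distance would be
  independent, and f could be changed by small amounts of either sign while staying on S and on the
  sphere. This excludes a minimum and a maximum at once.\<close>

lemma extremal_on_sphere_imp_tangency:
  assumes x: "x \<in> feasible_set gs" "norm (x - xs) = \<rho>"
    and ext: "(\<forall>y\<in>feasible_set gs \<inter> sphere xs \<rho>. peval f x \<le> peval f y) \<or>
      (\<forall>y\<in>feasible_set gs \<inter> sphere xs \<rho>. peval f y \<le> peval f x)"
  shows "x \<in> tangency_set f gs xs"
proof (rule ccontr)
  assume "x \<notin> tangency_set f gs xs"
  then have "\<not> vec_dep (map (\<lambda>p. grad p x) (f # gs) @ [x - xs])"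
    using x(1) by (simp add: tangency_set_eq zero_set_ideals_real)
  from open_at_constraints[OF this, of UNIV] obtain \<delta> where \<delta>: "\<delta> > 0"
    "\<And>b d. (\<forall>k<length (f # gs). \<bar>b k\<bar> < \<delta>) \<and> \<bar>d\<bar> < \<delta> \<Longrightarrow>
    (\<exists>y. (\<forall>k<length (f # gs). peval ((f # gs) ! k) y = peval ((f # gs) ! k) x + b k) \<and> half_sq xs y = half_sq xs x + d)"
    by auto
  have ex: "\<exists>y\<in>feasible_set gs \<inter> sphere xs \<rho>. peval f y = peval f x + e" if "\<bar>e\<bar> < \<delta>" for e
  proof -
    define b where "b k = (if k = 0 then e else 0)" for k :: nat
    have "\<forall>k<length (f # gs). \<bar>b k\<bar> < \<delta>" using that \<delta>(1) by (simp add: b_def)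
    with \<delta>(2)[of b 0] \<delta>(1) obtain y where
      y: "\<And>k. k < length (f # gs) \<Longrightarrow> peval ((f # gs) ! k) y = peval ((f # gs) ! k) x + b k" "half_sq xs y = half_sq xs x + 0"
      by auto
    have "peval f y = peval f x + e" using y(1)[of 0] by (simp add: b_def)
    moreover have "y \<in> feasible_set gs"
      by (rule feasible_setI) (use y(1)[of "Suc _"] x(1) in \<open>simp add: b_def feasible_setD\<close>)
    moreover have "norm (y - xs) = \<rho>" using y(2) x(2) half_sq_eq_iff[of xs y x] by simp
    ultimately show ?thesis using sphere_eq by blast
  qed
  from ex[of "\<delta> / 2"] ex[of "- \<delta> / 2"] ext \<delta>(1) show False by force
qed

text \<open>The hypotheses of the theorem as a locale, since they are instantiated a second time
  with the data after the change of coordinates.\<close>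

locale kkt_point =
  fixes f :: "('n::finite, real) mpoly" and gs :: "('n, real) mpoly list" and xs :: "real ^ 'n"
  assumes few: "length gs \<le> CARD('n) - 1"
    and feasible: "xs \<in> feasible_set gs"
    and isolated: "xs isolated_in (kkt_set f gs)"
    and not_isolated: "\<not> xs isolated_in (feasible_set gs)"
    and licq: "LICQ gs xs"
begin

lemma eventually_LICQ: "eventually (\<lambda>x. LICQ gs x) (nhds xs)"
proof -
  have "eventually (\<lambda>x. \<not> col_dep (\<lambda>j i. map (\<lambda>g. grad g x) gs ! j $ i) (length gs)) (at xs)"
  proof (rule eventually_not_col_dep[where L = "\<lambda>j i. map (\<lambda>g. grad g xs) gs ! j $ i"])
    show "((\<lambda>x. map (\<lambda>g. grad g x) gs ! j $ i) \<longlongrightarrow> map (\<lambda>g. grad g xs) gs ! j $ i) (at xs)"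
      if "j < length gs" for j i using that by (simp add: tendsto_grad)
    show "\<not> col_dep (\<lambda>j i. map (\<lambda>g. grad g xs) gs ! j $ i) (length gs)" using licq by (simp add: LICQ_iff vec_dep_def)
  qed
  then show ?thesis using licq by (simp add: LICQ_iff vec_dep_def eventually_at_filter eventually_mono) (auto elim!: eventually_mono)
qed

text \<open>Unit secants from \<open>xs\<close> to exceptional points of S have a limit direction
  that is tangent to S and, the dependence passing to the limit, also a combination of the
  constraint gradients. A unit vector cannot be both.\<close>

lemma eventually_transversal:
  "eventually (\<lambda>x. x \<in> feasible_set gs \<and> x \<noteq> xs \<longrightarrow> \<not> vec_dep (map (\<lambda>g. grad g x) gs @ [x - xs])) (nhds xs)"
proof (rule ccontr)
  assume neg: "\<not> ?thesis"
  \<comment> \<open>LICQ is part of the condition so that dependence expresses \<open>x - xs\<close>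
    through the constraint gradients.\<close>
  define bad where "bad x \<longleftrightarrow> LICQ gs x \<and> x \<in> feasible_set gs \<and> x \<noteq> xs \<and> vec_dep (map (\<lambda>g. grad g x) gs @ [x - xs])" for x
  have fr: "frequently bad (nhds xs)"
    unfolding frequently_def
  proof
    assume "eventually (\<lambda>x. \<not> bad x) (nhds xs)"
    with eventually_LICQ have "eventually (\<lambda>x. x \<in> feasible_set gs \<and> x \<noteq> xs \<longrightarrow>
        \<not> vec_dep (map (\<lambda>g. grad g x) gs @ [x - xs])) (nhds xs)"
    proof eventually_elim
      case (elim x)
      then show ?case unfolding bad_def by blast
    qed
    with neg show False ..
  qed
  have "\<exists>x. bad x \<and> dist x xs < inverse (real (Suc k))" for k
  proof -
    have "eventually (\<lambda>x. dist x xs < inverse (real (Suc k))) (nhds xs)"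
      unfolding eventually_nhds_metric by (rule exI[of _ "inverse (real (Suc k))"]) simp
    from frequently_ex[OF frequently_eventually_frequently[OF fr this]] show ?thesis .
  qed
  then obtain X where X: "\<And>k. bad (X k)" "\<And>k. dist (X k) xs < inverse (real (Suc k))" by metis
  have Xlim: "X \<longlonglongrightarrow> xs"
  proof (rule metric_tendsto_imp_tendsto[OF LIMSEQ_inverse_real_of_nat], rule eventuallyI)
    fix k show "dist (X k) xs \<le> dist (inverse (real (Suc k))) 0"
      using X(2)[of k] by (simp add: dist_real_def)
  qed
  define u where "u k = (X k - xs) /\<^sub>R norm (X k - xs)" for k
  have u: "u k \<in> sphere 0 1" for k using X(1)[of k] by (simp add: u_def bad_def)
  obtain v r where v: "v \<in> sphere 0 1" "strict_mono r" "(u \<circ> r) \<longlonglongrightarrow> v"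
    using compact_sphere[of 0 1] u unfolding compact_def by blast
  have Xr: "(X \<circ> r) \<longlonglongrightarrow> xs" by (rule LIMSEQ_subseq_LIMSEQ[OF Xlim v(2)])
  have Xat: "filterlim (X \<circ> r) (at xs) sequentially"
    using Xr X(1) by (auto simp: filterlim_at bad_def)
  \<comment> \<open>Differentiability of \<open>g\<close> at \<open>xs\<close> along the secants:
    both values of \<open>g\<close> are 0, so the secant directions become orthogonal to the
    gradient.\<close>
  have orth: "(\<Sum>i\<in>UNIV. grad g xs $ i * v $ i) = 0" if g: "g \<in> set gs" for g
  proof -
    let ?D = "\<lambda>v. \<Sum>i\<in>UNIV. grad g xs $ i * v $ i"
    have lin: "bounded_linear ?D" by (rule has_derivative_bounded_linear[OF has_derivative_peval_grad])
    have scale: "?D (c *\<^sub>R w) = c * ?D w" for c w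
      by (simp add: sum_distrib_left mult.left_commute)
    have "((\<lambda>y. norm ((peval g y - peval g xs) - ?D (y - xs)) / norm (y - xs)) \<longlongrightarrow> 0) (at xs)"
      using has_derivative_peval_grad[of g xs] by (simp add: has_derivative_iff_norm)
    from filterlim_compose[OF this Xat]
    have "(\<lambda>k. norm ((peval g (X (r k)) - peval g xs) - ?D (X (r k) - xs)) / norm (X (r k) - xs)) \<longlonglongrightarrow> 0"
      by (simp add: o_def)
    moreover have "norm ((peval g (X (r k)) - peval g xs) - ?D (X (r k) - xs)) / norm (X (r k) - xs) = \<bar>?D (u (r k))\<bar>" for k
    proof -
      have "peval g (X (r k)) = 0" "peval g xs = 0"
        using X(1)[of "r k"] feasible g by (auto simp: bad_def feasible_set_def)
      moreover have "?D (u (r k)) = ?D (X (r k) - xs) / norm (X (r k) - xs)"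
        unfolding u_def scale divide_inverse_commute ..
      ultimately show ?thesis by simp
    qed
    ultimately have "(\<lambda>k. \<bar>?D (u (r k))\<bar>) \<longlonglongrightarrow> 0" by simp
    then have "(\<lambda>k. ?D (u (r k))) \<longlonglongrightarrow> 0" by (simp add: tendsto_rabs_zero_iff)
    moreover have "(\<lambda>k. ?D (u (r k))) \<longlonglongrightarrow> ?D v"
      using bounded_linear.tendsto[OF lin v(3)] by (simp add: o_def)
    ultimately show ?thesis using LIMSEQ_unique by blast
  qed
  \<comment> \<open>Independence is an open condition, so it would hold for the secants
    themselves.\<close>
  have "vec_dep (map (\<lambda>g. grad g xs) gs @ [v])"
  proof (rule ccontr)
    assume "\<not> ?thesis"
    then have nd: "\<not> col_dep (\<lambda>j i. (map (\<lambda>g. grad g xs) gs @ [v]) ! j $ i) (Suc (length gs))" by (simp add: vec_dep_def)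
    have "eventually (\<lambda>k. \<not> col_dep (\<lambda>j i. (map (\<lambda>g. grad g (X (r k))) gs @ [u (r k)]) ! j $ i) (Suc (length gs))) sequentially"
    proof (rule eventually_not_col_dep[OF _ nd])
      fix j i assume j: "j < Suc (length gs)"
      show "(\<lambda>k. (map (\<lambda>g. grad g (X (r k))) gs @ [u (r k)]) ! j $ i) \<longlonglongrightarrow> (map (\<lambda>g. grad g xs) gs @ [v]) ! j $ i"
      proof (cases "j < length gs")
        case True
        with filterlim_compose[OF tendsto_grad Xat] show ?thesis by (simp add: nth_append o_def)
      next
        case False
        with j tendsto_vec_nth[OF v(3)] show ?thesis by (simp add: nth_append o_def)
      qed
    qed
    then obtain k where k: "\<not> vec_dep (map (\<lambda>g. grad g (X (r k))) gs @ [u (r k)])"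
      using eventually_happens[of _ sequentially] by (auto simp: vec_dep_def)
    let ?x = "X (r k)"
    have nl: "\<not> vec_dep (map (\<lambda>g. grad g ?x) gs)" using X(1)[of "r k"] by (simp add: bad_def LICQ_iff)
    have "vec_dep ((?x - xs) # map (\<lambda>g. grad g ?x) gs)"
      using X(1)[of "r k"] by (simp only: bad_def vec_dep_rotate1)
    then obtain c where c: "\<And>i. (?x - xs) $ i = (\<Sum>j<length (map (\<lambda>g. grad g ?x) gs). c j * map (\<lambda>g. grad g ?x) gs ! j $ i)"
      using vec_dep_Cons[OF nl] by blast
    have "u (r k) $ i = (\<Sum>j<length (map (\<lambda>g. grad g ?x) gs). (c j / norm (?x - xs)) * map (\<lambda>g. grad g ?x) gs ! j $ i)" for i
    proof -
      have "u (r k) $ i = (?x - xs) $ i / norm (?x - xs)" by (simp add: u_def divide_inverse_commute)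
      then show ?thesis unfolding c by (simp add: sum_divide_distrib)
    qed
    then have "vec_dep (u (r k) # map (\<lambda>g. grad g ?x) gs)"
      unfolding vec_dep_Cons[OF nl] by (intro exI[of _ "\<lambda>j. c j / norm (?x - xs)"] allI)
    with k show False unfolding vec_dep_rotate1 by blast
  qed
  then obtain c where c: "\<And>i. v $ i = (\<Sum>j<length gs. c j * grad (gs ! j) xs $ i)"
    using vec_dep_Cons[of "map (\<lambda>g. grad g xs) gs" v] licq by (auto simp: vec_dep_rotate1 LICQ_iff)
  have "v \<bullet> v = (\<Sum>i\<in>UNIV. (\<Sum>j<length gs. c j * grad (gs ! j) xs $ i) * v $ i)"
    by (simp add: inner_vec_def c[symmetric])
  also have "\<dots> = (\<Sum>j<length gs. c j * (\<Sum>i\<in>UNIV. grad (gs ! j) xs $ i * v $ i))"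
    by (simp add: sum_distrib_right sum_distrib_left mult.assoc) (rule sum.swap)
  also have "\<dots> = 0" using orth by simp
  finally show False using v(1) by simp
qed

lemma ideal_set_members:
  "xs \<in> V_R (ideal_Sigma f gs)" "xs \<in> V_R (ideal_L gs xs)" "xs \<in> tangency_set f gs xs"
proof -
  show "xs \<in> V_R (ideal_Sigma f gs)" using isolated kkt_set_subset_Sigma by (auto simp: isolated_in_def)
  have "vec_dep ((0 :: real ^ 'n) # vs)" for vs
  proof (cases "vec_dep vs")
    case False
    then show ?thesis by (subst vec_dep_Cons) (auto intro!: exI[of _ "\<lambda>_. 0"])
  qed (rule vec_dep_ConsI)
  then show L: "xs \<in> V_R (ideal_L gs xs)"
    using feasible by (simp add: zero_set_ideals_real vec_dep_rotate1 del: length_append)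
  then show "xs \<in> tangency_set f gs xs"
    by (simp add: tangency_set_eq zero_set_ideals_real vec_dep_ConsI)
qed

lemma step2_radius_exists: "\<exists>R. step2_radius f gs xs R"
proof -
  obtain T where T: "open T" "T \<inter> kkt_set f gs = {xs}" using isolated unfolding isolated_in_def by auto
  have "eventually (\<lambda>x. x \<in> T) (nhds xs)" using T by (auto simp: eventually_nhds)
  with eventually_LICQ eventually_transversal
  have "eventually (\<lambda>x. x \<in> T \<and> LICQ gs x \<and> (x \<in> feasible_set gs \<and> x \<noteq> xs \<longrightarrow> \<not> vec_dep (map (\<lambda>g. grad g x) gs @ [x - xs]))) (nhds xs)"
    by eventually_elim blast
  then obtain d where d: "d > 0" "\<And>x. dist x xs < d \<Longrightarrow> x \<in> T \<and> LICQ gs x \<and> (x \<in> feasible_set gs \<and> x \<noteq> xs \<longrightarrow> \<not> vec_dep (map (\<lambda>g. grad g x) gs @ [x - xs]))"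
    unfolding eventually_nhds_metric by blast
  have "step2_radius f gs xs (d / 2)"
    unfolding step2_radius_def
  proof (intro conjI equalityI subsetI)
    fix x assume x: "x \<in> V_R (ideal_Sigma f gs) \<inter> cball xs (d / 2)"
    with d have "x \<in> T" "LICQ gs x" by (auto simp: dist_commute)
    then show "x \<in> {xs}" using x T(2) kkt_set_eq_if_LICQ by blast
  next
    fix x assume x: "x \<in> V_R (ideal_L gs xs) \<inter> cball xs (d / 2)"
    then have "dist x xs < d" using d(1) by (simp add: dist_commute)
    from d(2)[OF this] x show "x \<in> {xs}" by (auto simp: zero_set_ideals_real)
  qed (use d(1) ideal_set_members in auto)
  then show ?thesis ..
qed

end

lemma step2_radiusD:
  assumes "step2_radius f gs xs R" "x \<in> feasible_set gs" "x \<noteq> xs" "norm (x - xs) \<le> R"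
  shows "\<not> vec_dep (grad f x # map (\<lambda>g. grad g x) gs)" "\<not> vec_dep (map (\<lambda>g. grad g x) gs @ [x - xs])"
proof -
  have "x \<in> cball xs R" using assms(4) by (simp only: cball_eq)
  with assms(1,3) have "x \<notin> V_R (ideal_Sigma f gs)" "x \<notin> V_R (ideal_L gs xs)"
    unfolding step2_radius_def by blast+
  with assms(2) show "\<not> vec_dep (grad f x # map (\<lambda>g. grad g x) gs)" "\<not> vec_dep (map (\<lambda>g. grad g x) gs @ [x - xs])"
    by (simp_all add: zero_set_ideals_real)
qed

context kkt_point
begin

text \<open>The point of S in the ball farthest from \<open>xs\<close> lies on the sphere: at an
  interior point other than \<open>xs\<close>, transversality would allow to go farther within S. It
  is not \<open>xs\<close>, which is not isolated in S.\<close>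

lemma sphere_nonempty:
  assumes R: "step2_radius f gs xs R" and \<rho>: "0 < \<rho>" "\<rho> < R"
  shows "\<exists>x\<in>feasible_set gs. norm (x - xs) = \<rho>"
proof -
  let ?K = "feasible_set gs \<inter> cball xs \<rho>"
  have "compact ?K" by (intro closed_Int_compact closed_feasible_set compact_cball)
  moreover have "xs \<in> ?K" using feasible \<rho> by simp
  moreover have "continuous_on ?K (\<lambda>x. norm (x - xs))" by (intro continuous_intros)
  ultimately obtain x where x: "x \<in> ?K" "\<And>y. y \<in> ?K \<Longrightarrow> norm (y - xs) \<le> norm (x - xs)"
    using continuous_attains_sup[of ?K "\<lambda>x. norm (x - xs)"] by blast
  have xK: "x \<in> feasible_set gs" "norm (x - xs) \<le> \<rho>" using x(1) by (simp_all only: Int_iff cball_eq)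
  have "ball xs \<rho> \<inter> feasible_set gs \<noteq> {xs}"
    using not_isolated feasible open_ball unfolding isolated_in_def by blast
  moreover have "xs \<in> ball xs \<rho> \<inter> feasible_set gs" using feasible \<rho> by simp
  ultimately obtain y where "y \<in> ball xs \<rho> \<inter> feasible_set gs" "y \<noteq> xs" by blast
  then have "y \<in> ?K" "y \<noteq> xs" using ball_subset_cball by blast+
  then have "x \<noteq> xs" using x(2)[of y] by auto
  show ?thesis
  proof (cases "norm (x - xs) < \<rho>")
    case True
    have "\<not> vec_dep (map (\<lambda>g. grad g x) gs @ [x - xs])"
      using step2_radiusD(2)[OF R xK(1) \<open>x \<noteq> xs\<close>] xK(2) \<rho> by simp
    from open_at_constraints[OF this open_ball, of xs \<rho>] True obtain \<delta> where \<delta>: "\<delta> > 0"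
      "\<And>b d. (\<forall>k<length gs. \<bar>b k\<bar> < \<delta>) \<and> \<bar>d\<bar> < \<delta> \<Longrightarrow>
       (\<exists>y\<in>ball xs \<rho>. (\<forall>k<length gs. peval (gs ! k) y = peval (gs ! k) x + b k) \<and> half_sq xs y = half_sq xs x + d)"
      by (auto simp: dist_norm norm_minus_commute)
    from \<delta>(2)[of "\<lambda>_. 0" "\<delta> / 2"] \<delta>(1) obtain y where y: "y \<in> ball xs \<rho>"
      "\<And>k. k < length gs \<Longrightarrow> peval (gs ! k) y = peval (gs ! k) x" "half_sq xs y = half_sq xs x + \<delta> / 2" by auto
    have "y \<in> ?K" using y(1,2) x(1) by (auto intro!: feasible_setI simp: feasible_setD)
    from x(2)[OF this] have "half_sq xs y \<le> half_sq xs x" by (simp add: half_sq_def power_mono)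
    with y(3) \<delta>(1) show ?thesis by simp
  next
    case False
    with xK show ?thesis by (intro bexI[of _ x]) simp_all
  qed
qed

lemma extrema_on_sphere:
  assumes R: "step2_radius f gs xs R" and \<rho>: "0 < \<rho>" "\<rho> < R"
  shows "\<exists>x\<in>tangency_set f gs xs \<inter> sphere xs \<rho>. \<forall>y\<in>feasible_set gs \<inter> sphere xs \<rho>. peval f x \<le> peval f y"
    and "\<exists>x\<in>tangency_set f gs xs \<inter> sphere xs \<rho>. \<forall>y\<in>feasible_set gs \<inter> sphere xs \<rho>. peval f y \<le> peval f x"
proof -
  let ?K = "feasible_set gs \<inter> sphere xs \<rho>"
  have K: "compact ?K" by (intro closed_Int_compact closed_feasible_set compact_sphere)
  obtain z where "z \<in> feasible_set gs" "norm (z - xs) = \<rho>" using sphere_nonempty[OF R \<rho>] by blast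
  then have ne: "?K \<noteq> {}" using sphere_eq by blast
  have cont: "continuous_on ?K (peval f)" by (intro continuous_peval continuous_on_id)
  from continuous_attains_inf[OF K ne cont] obtain x where x: "x \<in> ?K" "\<forall>y\<in>?K. peval f x \<le> peval f y" by blast
  then have "x \<in> feasible_set gs" "norm (x - xs) = \<rho>" by (simp_all only: Int_iff sphere_eq)
  then have "x \<in> tangency_set f gs xs"
    using x(2) by (intro extremal_on_sphere_imp_tangency[of x gs xs \<rho> f]) blast+
  with x show "\<exists>x\<in>tangency_set f gs xs \<inter> sphere xs \<rho>. \<forall>y\<in>?K. peval f x \<le> peval f y" by blast
  from continuous_attains_sup[OF K ne cont] obtain x where x: "x \<in> ?K" "\<forall>y\<in>?K. peval f y \<le> peval f x" by blast
  then have "x \<in> feasible_set gs" "norm (x - xs) = \<rho>" by (simp_all only: Int_iff sphere_eq)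
  then have "x \<in> tangency_set f gs xs"
    using x(2) by (intro extremal_on_sphere_imp_tangency[of x gs xs \<rho> f]) blast+
  with x show "\<exists>x\<in>tangency_set f gs xs \<inter> sphere xs \<rho>. \<forall>y\<in>?K. peval f y \<le> peval f x" by blast
qed

end

subsection \<open>The two sides of the tangency set\<close>

lemma DERIV_peval_curve:
  assumes "(\<phi> has_vector_derivative v) (at s)"
  shows "((\<lambda>t. peval p (\<phi> t)) has_real_derivative (grad p (\<phi> s) \<bullet> v)) (at s)"
    and "((\<lambda>t. half_sq xs (\<phi> t)) has_real_derivative ((\<phi> s - xs) \<bullet> v)) (at s)"
proof -
  note \<phi> = assms[unfolded has_vector_derivative_def]
  show "((\<lambda>t. peval p (\<phi> t)) has_real_derivative (grad p (\<phi> s) \<bullet> v)) (at s)"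
    unfolding has_field_derivative_def
    by (rule has_derivative_eq_rhs[OF has_derivative_compose[OF \<phi> has_derivative_peval_grad]])
      (simp add: fun_eq_iff inner_vec_def sum_distrib_left mult_ac)
  show "((\<lambda>t. half_sq xs (\<phi> t)) has_real_derivative ((\<phi> s - xs) \<bullet> v)) (at s)"
    unfolding has_field_derivative_def
    by (rule has_derivative_eq_rhs[OF has_derivative_compose[OF \<phi> has_derivative_half_sq]])
      (simp add: fun_eq_iff inner_vec_def sum_distrib_left mult_ac)
qed

lemma continuous_on_grad:
  fixes \<phi> :: "'b::t2_space \<Rightarrow> real ^ 'n::finite"
  assumes "continuous_on X \<phi>" shows "continuous_on X (\<lambda>s. grad p (\<phi> s))"
  unfolding grad_def by (intro continuous_on_vec_lambda continuous_peval assms)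

text \<open>The inverse of the chart is continuous, so images of small parameter intervals are
  relatively open in \<open>M\<close>. All smaller \<delta> are covered, because the interval is
  shrunk again to where the derivative of the distance does not vanish.\<close>

lemma open_subchart:
  fixes \<phi> :: "real \<Rightarrow> 'b::topological_space"
  assumes M: "homeomorphism {-1<..<1} (M \<inter> U) \<phi> \<psi>" "open U" and W: "open W" "\<phi> 0 \<in> W"
  shows "\<exists>\<epsilon>>0. \<epsilon> \<le> 1 \<and> (\<forall>\<delta>. 0 < \<delta> \<and> \<delta> \<le> \<epsilon> \<longrightarrow>
    (\<exists>U'. open U' \<and> \<phi> 0 \<in> U' \<and> U' \<subseteq> W \<and> \<phi> ` {-\<delta><..<\<delta>} = M \<inter> U'))"
proof -
  have cont: "continuous_on {-1<..<1::real} \<phi>" "continuous_on (M \<inter> U) \<psi>"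
    and img: "\<phi> ` {-1<..<1} = M \<inter> U" and inv: "\<And>t. t \<in> {-1<..<1} \<Longrightarrow> \<psi> (\<phi> t) = t"
      "\<And>y. y \<in> M \<inter> U \<Longrightarrow> \<phi> (\<psi> y) = y" "\<psi> ` (M \<inter> U) = {-1<..<1}"
    using M(1) by (auto simp: homeomorphism_def)
  have "open ({-1<..<1} \<inter> \<phi> -` W)" using cont(1) W(1) by (simp add: continuous_on_open_vimage Int_commute)
  then obtain \<epsilon> where \<epsilon>: "\<epsilon> > 0" "ball 0 \<epsilon> \<subseteq> {-1<..<1} \<inter> \<phi> -` W" using W(2) by (force simp: open_contains_ball)
  have sub: "t \<in> {-1<..<1}" "\<phi> t \<in> W" if "t \<in> {-min \<epsilon> 1<..<min \<epsilon> 1}" for t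
    using \<epsilon>(2) that by (auto simp: dist_real_def subset_iff)
  have "\<exists>U'. open U' \<and> \<phi> 0 \<in> U' \<and> U' \<subseteq> W \<and> \<phi> ` {-\<delta><..<\<delta>} = M \<inter> U'" if \<delta>: "0 < \<delta>" "\<delta> \<le> min \<epsilon> 1" for \<delta>
  proof -
    have "openin (top_of_set (M \<inter> U)) (M \<inter> U \<inter> \<psi> -` {-\<delta><..<\<delta>})"
      by (rule continuous_openin_preimage_gen[OF cont(2)]) simp
    then obtain O' where O': "open O'" "M \<inter> U \<inter> \<psi> -` {-\<delta><..<\<delta>} = (M \<inter> U) \<inter> O'" by (auto simp: openin_open)
    have "\<phi> ` {-\<delta><..<\<delta>} = M \<inter> U \<inter> \<psi> -` {-\<delta><..<\<delta>}"
    proof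
      show "\<phi> ` {-\<delta><..<\<delta>} \<subseteq> M \<inter> U \<inter> \<psi> -` {-\<delta><..<\<delta>}"
      proof
        fix y assume "y \<in> \<phi> ` {-\<delta><..<\<delta>}"
        then obtain t where t: "t \<in> {-\<delta><..<\<delta>}" "y = \<phi> t" by blast
        then have "t \<in> {-1<..<1}" using \<delta>(2) by auto
        with t img inv(1) show "y \<in> M \<inter> U \<inter> \<psi> -` {-\<delta><..<\<delta>}" by auto
      qed
      show "M \<inter> U \<inter> \<psi> -` {-\<delta><..<\<delta>} \<subseteq> \<phi> ` {-\<delta><..<\<delta>}"
      proof
        fix y assume "y \<in> M \<inter> U \<inter> \<psi> -` {-\<delta><..<\<delta>}"
        with inv(2)[of y] show "y \<in> \<phi> ` {-\<delta><..<\<delta>}" by (metis IntD1 IntD2 imageI vimageD)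
      qed
    qed
    then have eq: "\<phi> ` {-\<delta><..<\<delta>} = M \<inter> (U \<inter> O' \<inter> W)"
      using O'(2) sub(2) \<delta>(2) by fastforce
    moreover have "\<phi> 0 \<in> \<phi> ` {-\<delta><..<\<delta>}" using \<delta>(1) by simp
    ultimately show ?thesis using M(2) O'(1) W(1) by (intro exI[of _ "U \<inter> O' \<inter> W"]) auto
  qed
  then show ?thesis using \<epsilon>(1) by (intro exI[of _ "min \<epsilon> 1"]) auto
qed

text \<open>Step 3 speaks about the zero set of the ideal chosen in Step 1, Step 4 about Gamma.
  \<open>agree\<close> is the link between them.\<close>

locale admissible_radii = kkt_point f gs xs
  for f :: "('n::finite, real) mpoly" and gs xs +
  fixes I :: "('n, real) mpoly set" and R1 R2 r :: real
  assumes R1: "step2_radius f gs xs R1" and R2: "step3_radius I xs R2"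
    and agree: "V_R I \<inter> cball xs R1 = tangency_set f gs xs \<inter> cball xs R1"
    and r: "0 < r" "r < min R1 R2"
begin

abbreviation "T \<equiv> tangency_set f gs xs"

text \<open>The sign of the multiplier \<open>\<mu>\<close> of a point of \<open>T\<close> decides whether \<open>f\<close> increases or decreases
  along \<open>T\<close> when one moves away from \<open>xs\<close>.\<close>

definition multiplier :: "real ^ 'n \<Rightarrow> real \<Rightarrow> bool" where
  "multiplier u \<mu> \<longleftrightarrow> (\<exists>c. grad f u = (\<Sum>j<length gs. c j *\<^sub>R grad (gs ! j) u) + \<mu> *\<^sub>R (u - xs))"

lemma T_feasible: "u \<in> T \<Longrightarrow> u \<in> feasible_set gs"
  by (simp add: tangency_set_def)

text \<open>The constraint gradients and \<open>u - xs\<close> are independent off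
  \<open>ideal_L\<close>, so \<open>grad f u\<close> is a combination of them; the coefficient of
  \<open>u - xs\<close> is nonzero because \<open>u\<close> is not a zero of
  \<open>ideal_Sigma\<close>.\<close>

lemma exists_multiplier:
  assumes u: "u \<in> T" "u \<noteq> xs" "norm (u - xs) \<le> R1"
  shows "\<exists>\<mu>. \<mu> \<noteq> 0 \<and> multiplier u \<mu>"
proof -
  note nd = step2_radiusD[OF R1 T_feasible[OF u(1)] u(2,3)]
  have "vec_dep (grad f u # map (\<lambda>g. grad g u) gs @ [u - xs])"
    using u(1) by (simp add: tangency_set_eq zero_set_ideals_real)
  then obtain c where c: "\<And>i. grad f u $ i = (\<Sum>j<length (map (\<lambda>g. grad g u) gs @ [u - xs]). c j * (map (\<lambda>g. grad g u) gs @ [u - xs]) ! j $ i)"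
    unfolding vec_dep_Cons[OF nd(2)] by blast
  then have eq: "grad f u = (\<Sum>j<length gs. c j *\<^sub>R grad (gs ! j) u) + c (length gs) *\<^sub>R (u - xs)"
    unfolding sum_list_snoc_index by (simp add: Finite_Cartesian_Product.vec_eq_iff)
  moreover have "c (length gs) \<noteq> 0"
  proof
    assume 0: "c (length gs) = 0"
    have "\<not> vec_dep (map (\<lambda>g. grad g u) gs)" using nd(1) vec_dep_ConsI by blast
    from vec_dep_Cons[OF this, of "grad f u"] have "vec_dep (grad f u # map (\<lambda>g. grad g u) gs)"
      unfolding eq 0 by (auto intro!: exI[of _ c])
    with nd(1) show False ..
  qed
  ultimately show ?thesis unfolding multiplier_def by blast
qed

text \<open>An open chart is available because \<open>r < R2\<close> keeps \<open>u\<close> off the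
  boundary sphere. Noncriticality makes the derivative of the distance nonzero at 0 and, by
  continuity, nearby. The velocity is orthogonal to the constraint gradients, so a multiplier is the
  ratio of the derivatives of \<open>f\<close> and of half the squared distance.\<close>

lemma local_curve:
  assumes u: "u \<in> T" "u \<noteq> xs" "norm (u - xs) \<le> r" and W: "open W" "u \<in> W"
  shows "\<exists>U \<epsilon> \<phi> v. open U \<and> u \<in> U \<and> U \<subseteq> W \<and> \<epsilon> > 0 \<and> \<phi> ` {-\<epsilon><..<\<epsilon>} = T \<inter> U \<and> \<phi> 0 = u \<and>
    (\<forall>s\<in>{-\<epsilon><..<\<epsilon>}. (\<phi> has_vector_derivative v s) (at s) \<and> (\<phi> s - xs) \<bullet> v s \<noteq> 0 \<and>
       (\<forall>\<mu>. multiplier (\<phi> s) \<mu> \<longrightarrow> grad f (\<phi> s) \<bullet> v s = \<mu> * ((\<phi> s - xs) \<bullet> v s))) \<and>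
    continuous_on {-\<epsilon><..<\<epsilon>} v \<and> continuous_on {-\<epsilon><..<\<epsilon>} \<phi>"
proof -
  define M where "M = V_R I \<inter> cball xs R2 - {xs}"
  define W' where "W' = W \<inter> ball xs (min R1 R2) - {xs}"
  have eqM: "y \<in> M \<longleftrightarrow> y \<in> T" if "y \<in> W'" for y
  proof -
    have "y \<in> cball xs R1" "y \<in> cball xs R2" "y \<noteq> xs" using that by (auto simp: W'_def)
    with agree show ?thesis unfolding M_def by blast
  qed
  have W': "open W'" "u \<in> W'"
    using W u r by (auto simp: W'_def dist_norm norm_minus_commute)
  have uM: "u \<in> M" using eqM[OF W'(2)] u(1) by blast
  have "u \<notin> sphere xs R2" using u(3) r by (auto simp: dist_norm norm_minus_commute)
  then obtain \<phi> where ch: "curve_chart M u {-1<..<1} \<phi>"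
    using R2 uM unfolding step3_radius_def smooth_curve_def M_def by blast
  have crit: "\<not> critical_point M (\<lambda>y. (norm (y - xs))\<^sup>2) u"
    using R2 uM unfolding step3_radius_def M_def by blast
  from ch obtain U \<psi> D where \<phi>0: "\<phi> 0 = u" and U: "open U" "homeomorphism {-1<..<1} (M \<inter> U) \<phi> \<psi>"
    and D: "D 0 = \<phi>" "\<And>k t. t \<in> {-1<..<1} \<Longrightarrow> (D k has_vector_derivative D (Suc k) t) (at t within {-1<..<1})"
    unfolding curve_chart_def by blast
  have der: "(D k has_vector_derivative D (Suc k) t) (at t)" if "t \<in> {-1<..<1}" for k t
    using D(2)[OF that, of k] that at_within_open[of t "{-1<..<1}"] by simp
  have d\<phi>: "(\<phi> has_vector_derivative D 1 t) (at t)" if "t \<in> {-1<..<1}" for t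
    using der[OF that, of 0] D(1) by simp
  have contD: "continuous_on {-1<..<1} (D k)" for k
    by (intro continuous_at_imp_continuous_on ballI) (rule has_vector_derivative_continuous[OF der])
  have dN: "((\<lambda>t. (norm (\<phi> t - xs))\<^sup>2) has_real_derivative 2 * ((\<phi> t - xs) \<bullet> D 1 t)) (at t)" if "t \<in> {-1<..<1}" for t
    using DERIV_cmult[OF DERIV_peval_curve(2)[OF d\<phi>[OF that], of xs], of 2] by (simp add: half_sq_def)
  have "(u - xs) \<bullet> D 1 0 \<noteq> 0"
  proof
    assume "(u - xs) \<bullet> D 1 0 = 0"
    then have "((\<lambda>t. (norm (\<phi> t - xs))\<^sup>2) has_real_derivative 0) (at 0 within {-1<..<1})"
      using dN[of 0] \<phi>0 by (auto intro: has_field_derivative_at_within)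
    with ch crit show False unfolding critical_point_def by blast
  qed
  moreover have cN: "continuous_on {-1<..<1} (\<lambda>t. (\<phi> t - xs) \<bullet> D 1 t)"
    using contD[of 0] contD[of 1] D(1) by (intro continuous_intros) auto
  have "open ({-1<..<1} \<inter> (\<lambda>t. (\<phi> t - xs) \<bullet> D 1 t) -` (- {0}))"
    using cN by (intro continuous_open_preimage) auto
  ultimately obtain \<delta> where \<delta>: "\<delta> > 0" "ball 0 \<delta> \<subseteq> {-1<..<1} \<inter> (\<lambda>t. (\<phi> t - xs) \<bullet> D 1 t) -` (- {0})"
    using \<phi>0 by (force simp: open_contains_ball)
  obtain \<epsilon>0 where \<epsilon>0: "\<epsilon>0 > 0" "\<epsilon>0 \<le> 1" "\<And>\<delta>. 0 < \<delta> \<Longrightarrow> \<delta> \<le> \<epsilon>0 \<Longrightarrow>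
      \<exists>U'. open U' \<and> \<phi> 0 \<in> U' \<and> U' \<subseteq> W' \<and> \<phi> ` {-\<delta><..<\<delta>} = M \<inter> U'"
    using open_subchart[OF U(2,1) W'(1)] W'(2) \<phi>0 by blast
  define \<epsilon> where "\<epsilon> = min \<epsilon>0 \<delta>"
  obtain U' where U': "open U'" "u \<in> U'" "U' \<subseteq> W'" "\<phi> ` {-\<epsilon><..<\<epsilon>} = M \<inter> U'"
    using \<epsilon>0(3)[of \<epsilon>] \<epsilon>0(1) \<delta>(1) \<phi>0 by (auto simp: \<epsilon>_def)
  have img: "\<phi> ` {-\<epsilon><..<\<epsilon>} = T \<inter> U'" unfolding U'(4) using eqM U'(3) by blast
  have in1: "s \<in> {-1<..<1}" "(\<phi> s - xs) \<bullet> D 1 s \<noteq> 0" if "s \<in> {-\<epsilon><..<\<epsilon>}" for s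
    using \<delta>(2) that by (auto simp: \<epsilon>_def subset_iff dist_real_def)
  have fin: "grad f (\<phi> s) \<bullet> D 1 s = \<mu> * ((\<phi> s - xs) \<bullet> D 1 s)" if s: "s \<in> {-\<epsilon><..<\<epsilon>}" and m: "multiplier (\<phi> s) \<mu>" for s \<mu>
  proof -
    obtain c where c: "grad f (\<phi> s) = (\<Sum>j<length gs. c j *\<^sub>R grad (gs ! j) (\<phi> s)) + \<mu> *\<^sub>R (\<phi> s - xs)"
      using m unfolding multiplier_def by blast
    have "grad (gs ! j) (\<phi> s) \<bullet> D 1 s = 0" if j: "j < length gs" for j
    proof -
      have "((\<lambda>t. 0 :: real) has_real_derivative (grad (gs ! j) (\<phi> s) \<bullet> D 1 s)) (at s)"
      proof (rule has_field_derivative_transform_within_open[OF DERIV_peval_curve(1)[OF d\<phi>[OF in1(1)[OF s]], of "gs ! j"]])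
        show "peval (gs ! j) (\<phi> t) = 0" if "t \<in> {-\<epsilon><..<\<epsilon>}" for t
        proof -
          have "\<phi> t \<in> T" using img that by blast
          then show ?thesis using T_feasible feasible_setD j by blast
        qed
      qed (use s in auto)
      then show ?thesis using DERIV_unique[OF _ DERIV_const] by blast
    qed
    then show ?thesis unfolding c by (simp add: inner_add_left inner_sum_left)
  qed
  have "continuous_on {-\<epsilon><..<\<epsilon>} (D k)" for k by (rule continuous_on_subset[OF contD]) (use in1 in blast)
  from this[of 0] this[of 1] D(1) have cont: "continuous_on {-\<epsilon><..<\<epsilon>} \<phi>" "continuous_on {-\<epsilon><..<\<epsilon>} (D 1)" by auto
  have "\<epsilon> > 0" using \<epsilon>0(1) \<delta>(1) by (simp add: \<epsilon>_def)
  show ?thesis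
    by (rule exI[of _ U'], rule exI[of _ \<epsilon>], rule exI[of _ \<phi>], rule exI[of _ "D 1"])
      (use U' img in1 fin cont \<open>\<epsilon> > 0\<close> \<phi>0 d\<phi> in \<open>auto simp: W'_def\<close>)
qed

end

lemma nonzero_constant_sign:
  fixes h :: "real \<Rightarrow> real"
  assumes "continuous_on {a<..<b} h" "\<And>s. s \<in> {a<..<b} \<Longrightarrow> h s \<noteq> 0"
    and "s \<in> {a<..<b}" "t \<in> {a<..<b}" "0 < h s"
  shows "0 < h t"
proof (rule ccontr)
  assume "\<not> 0 < h t"
  with assms(2)[OF assms(4)] have "h t < 0" by simp
  have "connected (h ` {a<..<b})" by (intro connected_continuous_image assms(1) connected_Ioo)
  moreover have "h t \<in> h ` {a<..<b}" "h s \<in> h ` {a<..<b}" using assms(3,4) by blast+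
  ultimately have "0 \<in> h ` {a<..<b}"
    using \<open>h t < 0\<close> assms(5) unfolding connected_iff_interval by (meson less_imp_le)
  then show False using assms(2) by fastforce
qed

context admissible_radii
begin

text \<open>A positive \<sigma> selects the side on which \<open>f\<close> grows with the distance
  to \<open>xs\<close>, a negative one the side on which it falls; with \<open>\<sigma> * f\<close>
  in place of \<open>f\<close> both are treated alike.\<close>

definition side :: "real \<Rightarrow> real ^ 'n \<Rightarrow> bool" where
  "side \<sigma> u \<longleftrightarrow> (\<exists>\<mu>. multiplier u \<mu> \<and> \<sigma> * \<mu> > 0)"

lemma side_cases:
  assumes "u \<in> T" "u \<noteq> xs" "norm (u - xs) \<le> R1" "\<sigma> \<noteq> 0"
  shows "side \<sigma> u \<or> side (- \<sigma>) u"
proof -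
  obtain \<mu> where \<mu>: "\<mu> \<noteq> 0" "multiplier u \<mu>" using exists_multiplier[OF assms(1-3)] by blast
  then have "\<sigma> * \<mu> > 0 \<or> - \<sigma> * \<mu> > 0" using assms(4) by (metis linorder_neqE_linordered_idom mult_eq_0_iff mult_minus_left neg_0_less_iff_less)
  with \<mu>(2) show ?thesis unfolding side_def by blast
qed

text \<open>A local curve determines the multiplier as a quotient of two derivatives, the
  denominator being nonzero.\<close>

lemma side_exclusive:
  assumes "u \<in> T" "u \<noteq> xs" "norm (u - xs) \<le> r" shows "\<not> (side \<sigma> u \<and> side (- \<sigma>) u)"
proof
  assume "side \<sigma> u \<and> side (- \<sigma>) u"
  then obtain \<mu> \<mu>' where m: "multiplier u \<mu>" "\<sigma> * \<mu> > 0" "multiplier u \<mu>'" "- \<sigma> * \<mu>' > 0" unfolding side_def by blast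
  obtain \<epsilon> :: real and \<phi> :: "real \<Rightarrow> real ^ 'n" and v where "\<epsilon> > 0" "\<phi> 0 = u" "\<forall>s\<in>{-\<epsilon><..<\<epsilon>}. (\<phi> s - xs) \<bullet> v s \<noteq> 0 \<and>
       (\<forall>\<mu>. multiplier (\<phi> s) \<mu> \<longrightarrow> grad f (\<phi> s) \<bullet> v s = \<mu> * ((\<phi> s - xs) \<bullet> v s))"
    using local_curve[OF assms open_UNIV UNIV_I] by blast
  then have v: "(u - xs) \<bullet> v 0 \<noteq> 0" "\<And>\<mu>. multiplier u \<mu> \<Longrightarrow> grad f u \<bullet> v 0 = \<mu> * ((u - xs) \<bullet> v 0)"
    by (auto dest!: bspec[of _ _ 0])
  have "\<mu> * ((u - xs) \<bullet> v 0) = \<mu>' * ((u - xs) \<bullet> v 0)" by (metis (no_types) v(2) m(1) m(3))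
  with v(1) have "\<mu> = \<mu>'" by simp
  with m(2,4) show False by simp
qed

text \<open>Along a local curve the derivatives of f and of the distance do not vanish, so the sign
  of their product, which is the sign of the multiplier, is constant: a neighbourhood of
  \<open>u\<close> in \<open>T\<close> lies on one side. Following the curve towards smaller
  distance lowers \<open>\<sigma> * f\<close>; the opposite direction increases the
  distance.\<close>

lemma local_sides:
  assumes u: "u \<in> T" "u \<noteq> xs" "norm (u - xs) \<le> r" and \<sigma>: "side \<sigma> u" and W: "open W" "u \<in> W"
  shows "\<exists>U. open U \<and> u \<in> U \<and> U \<subseteq> W \<and> (\<forall>v\<in>T \<inter> U. v \<noteq> xs \<and> side \<sigma> v) \<and>
    (\<exists>v\<in>T \<inter> U. norm (v - xs) < norm (u - xs) \<and> \<sigma> * peval f v < \<sigma> * peval f u) \<and>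
    (\<exists>w\<in>T \<inter> U. norm (u - xs) < norm (w - xs))"
proof -
  let ?W = "W \<inter> (ball xs R1 - {xs})"
  have "open ?W" "u \<in> ?W" using W u r by (auto simp: dist_norm norm_minus_commute)
  from local_curve[OF u this] obtain U \<epsilon> \<phi> v where U: "open U" "u \<in> U" "U \<subseteq> ?W" "\<phi> ` {-\<epsilon><..<\<epsilon>} = T \<inter> U"
    and \<epsilon>: "\<epsilon> > 0" "\<phi> 0 = u"
    and s: "\<forall>s\<in>{-\<epsilon><..<\<epsilon>}. (\<phi> has_vector_derivative v s) (at s) \<and> (\<phi> s - xs) \<bullet> v s \<noteq> 0 \<and>
       (\<forall>\<mu>. multiplier (\<phi> s) \<mu> \<longrightarrow> grad f (\<phi> s) \<bullet> v s = \<mu> * ((\<phi> s - xs) \<bullet> v s))"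
    and cont: "continuous_on {-\<epsilon><..<\<epsilon>} v" "continuous_on {-\<epsilon><..<\<epsilon>} \<phi>" by blast
  define N' where "N' s = (\<phi> s - xs) \<bullet> v s" for s
  define F' where "F' s = grad f (\<phi> s) \<bullet> v s" for s
  have cN: "continuous_on {-\<epsilon><..<\<epsilon>} N'" unfolding N'_def by (intro continuous_intros cont)
  have cF: "continuous_on {-\<epsilon><..<\<epsilon>} F'" unfolding F'_def by (intro continuous_intros continuous_on_grad cont)
  have N0: "N' s \<noteq> 0" if "s \<in> {-\<epsilon><..<\<epsilon>}" for s using s that by (auto simp: N'_def)
  have FN: "F' s = \<mu> * N' s" if "s \<in> {-\<epsilon><..<\<epsilon>}" "multiplier (\<phi> s) \<mu>" for s \<mu>
    using s that by (auto simp: N'_def F'_def)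
  have \<phi>T: "\<phi> s \<in> T" "\<phi> s \<noteq> xs" "norm (\<phi> s - xs) \<le> R1" if "s \<in> {-\<epsilon><..<\<epsilon>}" for s
  proof -
    have "\<phi> s \<in> T \<inter> U" using U(4) that by blast
    with U(3) show "\<phi> s \<in> T" "\<phi> s \<noteq> xs" "norm (\<phi> s - xs) \<le> R1"
      by (auto simp: dist_norm norm_minus_commute subset_iff less_imp_le)
  qed
  have F0: "F' s \<noteq> 0" if "s \<in> {-\<epsilon><..<\<epsilon>}" for s
    using exists_multiplier[OF \<phi>T[OF that]] FN[OF that] N0[OF that] by auto
  have z: "0 \<in> {-\<epsilon><..<\<epsilon>}" using \<epsilon>(1) by simp
  obtain \<mu>0 where \<mu>0: "multiplier u \<mu>0" "\<sigma> * \<mu>0 > 0" using \<sigma> unfolding side_def by blast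
  then have "\<sigma> \<noteq> 0" by auto
  have pos: "\<sigma> * F' s * N' s > 0" if "s \<in> {-\<epsilon><..<\<epsilon>}" for s
  proof (rule nonzero_constant_sign[of "-\<epsilon>" \<epsilon> "\<lambda>s. \<sigma> * F' s * N' s" 0 s])
    show "continuous_on {-\<epsilon><..<\<epsilon>} (\<lambda>s. \<sigma> * F' s * N' s)" by (intro continuous_intros cN cF)
    have "\<sigma> * F' 0 * N' 0 = (\<sigma> * \<mu>0) * (N' 0)\<^sup>2"
      using FN[OF z] \<mu>0(1) \<epsilon>(2) by (simp add: power2_eq_square)
    moreover have "0 < (\<sigma> * \<mu>0) * (N' 0)\<^sup>2" by (rule mult_pos_pos[OF \<mu>0(2)]) (simp add: N0[OF z])
    ultimately show "0 < \<sigma> * F' 0 * N' 0" by (simp only:)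
  qed (use that z F0 N0 \<open>\<sigma> \<noteq> 0\<close> in auto)
  have side: "side \<sigma> (\<phi> s)" if s: "s \<in> {-\<epsilon><..<\<epsilon>}" for s
  proof -
    obtain \<mu> where \<mu>: "multiplier (\<phi> s) \<mu>" using exists_multiplier[OF \<phi>T[OF s]] by blast
    have "\<sigma> * F' s * N' s = (\<sigma> * \<mu>) * (N' s)\<^sup>2" by (simp add: FN[OF s \<mu>] power2_eq_square)
    with pos[OF s] have "0 < (\<sigma> * \<mu>) * (N' s)\<^sup>2" by simp
    then have "0 < \<sigma> * \<mu>" using zero_less_mult_pos2[of "\<sigma> * \<mu>" "(N' s)\<^sup>2"] N0[OF s] by simp
    with \<mu> show ?thesis unfolding side_def by blast
  qed
  \<comment> \<open>\<tau> carries the sign of \<open>N' 0\<close>: multiplied by it, both the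
    squared distance and \<open>\<sigma> * f\<close> increase with the parameter.\<close>
  have mono: "\<tau> * half_sq xs (\<phi> a) < \<tau> * half_sq xs (\<phi> b)" "\<tau> * \<sigma> * peval f (\<phi> a) < \<tau> * \<sigma> * peval f (\<phi> b)"
    if \<tau>: "\<tau> * N' 0 > 0" and ab: "a < b" "-\<epsilon> < a" "b < \<epsilon>" for \<tau> a b
  proof -
    have \<tau>N: "\<tau> * N' s > 0" if "s \<in> {-\<epsilon><..<\<epsilon>}" for s
      by (rule nonzero_constant_sign[of "-\<epsilon>" \<epsilon> "\<lambda>s. \<tau> * N' s" 0 s])
        (use that z N0 \<tau> in \<open>auto intro!: continuous_intros cN\<close>)
    have \<tau>F: "\<tau> * \<sigma> * F' s > 0" if "s \<in> {-\<epsilon><..<\<epsilon>}" for s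
    proof -
      have "(\<tau> * \<sigma> * F' s) * (N' s)\<^sup>2 = (\<tau> * N' s) * (\<sigma> * F' s * N' s)" by (simp add: power2_eq_square)
      also have "\<dots> > 0" using pos[OF that] \<tau>N[OF that] by simp
      finally show ?thesis using zero_less_mult_pos2[of "\<tau> * \<sigma> * F' s" "(N' s)\<^sup>2"] N0[OF that] by simp
    qed
    have d: "((\<lambda>s. \<tau> * half_sq xs (\<phi> s)) has_real_derivative \<tau> * N' s) (at s)"
      "((\<lambda>s. \<tau> * \<sigma> * peval f (\<phi> s)) has_real_derivative \<tau> * \<sigma> * F' s) (at s)" if "s \<in> {-\<epsilon><..<\<epsilon>}" for s
      using s that unfolding N'_def F'_def by (auto intro!: DERIV_cmult DERIV_peval_curve)
    have inside: "s \<in> {-\<epsilon><..<\<epsilon>}" if "a \<le> s" "s \<le> b" for s using that ab by auto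
    show "\<tau> * half_sq xs (\<phi> a) < \<tau> * half_sq xs (\<phi> b)"
      by (rule DERIV_pos_imp_increasing[OF ab(1)]) (blast intro: d(1) \<tau>N inside)
    show "\<tau> * \<sigma> * peval f (\<phi> a) < \<tau> * \<sigma> * peval f (\<phi> b)"
      by (rule DERIV_pos_imp_increasing[OF ab(1)]) (blast intro: d(2) \<tau>F inside)
  qed
  have norm_less: "norm (a - xs) < norm (b - xs)" if "half_sq xs a < half_sq xs b" for a b
    using that power_less_imp_less_base[of "norm (a - xs)" 2 "norm (b - xs)"] by (simp add: half_sq_def)
  define e where "e = \<epsilon> / 2"
  have e: "- \<epsilon> < - e" "- e < 0" "0 < e" "e < \<epsilon>" using \<epsilon>(1) by (auto simp: e_def)
  have "\<exists>a b. a \<in> {-\<epsilon><..<\<epsilon>} \<and> b \<in> {-\<epsilon><..<\<epsilon>} \<and> half_sq xs (\<phi> a) < half_sq xs u \<and> \<sigma> * peval f (\<phi> a) < \<sigma> * peval f u \<and>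
     half_sq xs u < half_sq xs (\<phi> b)"
  proof (cases "N' 0 > 0")
    case True
    then show ?thesis using mono[of 1 "-e" 0] mono[of 1 0 e] e \<epsilon>(2) by (intro exI[of _ "-e"] exI[of _ e]) auto
  next
    case False
    then have "N' 0 < 0" using N0[OF z] by simp
    then show ?thesis using mono[of "-1" "-e" 0] mono[of "-1" 0 e] e \<epsilon>(2) by (intro exI[of _ e] exI[of _ "-e"]) auto
  qed
  then obtain a b where ab: "a \<in> {-\<epsilon><..<\<epsilon>}" "b \<in> {-\<epsilon><..<\<epsilon>}" "norm (\<phi> a - xs) < norm (u - xs)"
    "\<sigma> * peval f (\<phi> a) < \<sigma> * peval f u" "norm (u - xs) < norm (\<phi> b - xs)" using norm_less by blast
  have mem: "\<phi> a \<in> T \<inter> U" "\<phi> b \<in> T \<inter> U" using U(4) ab(1,2) by blast+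
  have all: "\<forall>v\<in>T \<inter> U. v \<noteq> xs \<and> side \<sigma> v" unfolding U(4)[symmetric] using side \<phi>T(2) by blast
  have "U \<subseteq> W" using U(3) by blast
  with U(1,2) all mem ab(3-5) show ?thesis by blast
qed

text \<open>\<open>xs\<close> is added to make the set closed: points of one side can accumulate
  outside that side only at \<open>xs\<close>.\<close>

definition branch :: "real \<Rightarrow> (real ^ 'n) set" where
  "branch \<sigma> = {v \<in> T \<inter> cball xs r. v = xs \<or> side \<sigma> v}"

lemma closed_T: "closed T"
proof -
  have "T = (\<Inter>p\<in>ideal_Gamma f gs xs. {x. peval p x = 0})" by (auto simp: tangency_set_eq zero_set_def)
  then show ?thesis by (auto intro!: closed_Collect_eq continuous_peval continuous_on_id continuous_on_const)
qed

text \<open>A limit point other than \<open>xs\<close> lies in \<open>T\<close> and on some side;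
  were it the opposite one, a whole neighbourhood in \<open>T\<close> would be on the opposite side,
  against exclusiveness.\<close>

lemma compact_branch: assumes \<sigma>: "\<sigma> \<noteq> 0" shows "compact (branch \<sigma>)"
proof -
  have "closed (branch \<sigma>)"
    unfolding closed_sequential_limits
  proof (intro allI impI)
    fix X v assume X: "(\<forall>k. X k \<in> branch \<sigma>) \<and> X \<longlonglongrightarrow> v"
    have "closed (T \<inter> cball xs r)" by (intro closed_Int closed_T closed_cball)
    then have v: "v \<in> T \<inter> cball xs r" by (rule closed_sequentially[of _ X]) (use X in \<open>auto simp: branch_def\<close>)
    show "v \<in> branch \<sigma>"
    proof (rule ccontr)
      assume "v \<notin> branch \<sigma>"
      then have nv: "v \<noteq> xs" "\<not> side \<sigma> v" using v by (auto simp: branch_def)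
      have vr: "norm (v - xs) \<le> r" using v cball_eq by blast
      then have "side (- \<sigma>) v" using side_cases[of v \<sigma>] nv v r \<sigma> by auto
      from local_sides[OF _ nv(1) vr this open_UNIV UNIV_I] v obtain U where
        U: "open U" "v \<in> U" "\<forall>w\<in>T \<inter> U. w \<noteq> xs \<and> side (- \<sigma>) w" by blast
      obtain k where k: "X k \<in> U" using topological_tendstoD[OF conjunct2[OF X] U(1,2)] eventually_happens by force
      have Xk: "X k \<in> T" "norm (X k - xs) \<le> r" "X k = xs \<or> side \<sigma> (X k)" using X cball_eq by (auto simp: branch_def)
      then show False using U(3) k side_exclusive[OF Xk(1) _ Xk(2), of \<sigma>] by blast
    qed
  qed
  then have "compact (cball xs r \<inter> branch \<sigma>)" by (intro compact_Int_closed compact_cball)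
  moreover have "cball xs r \<inter> branch \<sigma> = branch \<sigma>" by (auto simp: branch_def)
  ultimately show ?thesis by simp
qed

lemma branchI: "u \<in> T \<Longrightarrow> norm (u - xs) \<le> r \<Longrightarrow> u = xs \<or> side \<sigma> u \<Longrightarrow> u \<in> branch \<sigma>"
  using cball_eq by (auto simp: branch_def)

lemma branchD: "u \<in> branch \<sigma> \<Longrightarrow> u \<in> T \<and> norm (u - xs) \<le> r \<and> (u = xs \<or> side \<sigma> u)"
  using cball_eq by (auto simp: branch_def)

text \<open>\<open>\<sigma> * f\<close> attains a minimum on the compact branch; at a point other
  than \<open>xs\<close> it could be lowered by moving towards \<open>xs\<close> on the same
  branch.\<close>

lemma values_on_branch:
  assumes u: "u \<in> branch \<sigma>" "u \<noteq> xs" and \<sigma>: "\<sigma> \<noteq> 0"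
  shows "\<sigma> * peval f xs < \<sigma> * peval f u"
proof -
  have "continuous_on (branch \<sigma>) (\<lambda>x. \<sigma> * peval f x)" by (intro continuous_intros continuous_peval)
  then obtain m where m: "m \<in> branch \<sigma>" "\<forall>v\<in>branch \<sigma>. \<sigma> * peval f m \<le> \<sigma> * peval f v"
    using continuous_attains_inf[OF compact_branch[OF \<sigma>]] u(1) by blast
  have smaller: "\<exists>w\<in>branch \<sigma>. \<sigma> * peval f w < \<sigma> * peval f v" if v: "v \<in> branch \<sigma>" "v \<noteq> xs" for v
  proof -
    have v': "v \<in> T" "norm (v - xs) \<le> r" "side \<sigma> v" using branchD[OF v(1)] v(2) by auto
    obtain U w where "\<forall>v\<in>T \<inter> U. v \<noteq> xs \<and> side \<sigma> v" "w \<in> T \<inter> U" "norm (w - xs) < norm (v - xs)" "\<sigma> * peval f w < \<sigma> * peval f v"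
      using local_sides[OF v'(1) v(2) v'(2,3) open_UNIV UNIV_I] by blast
    then show ?thesis using v'(2) by (intro bexI[of _ w] branchI) auto
  qed
  have "m = xs" using smaller[OF m(1)] m(2) by force
  then show ?thesis using smaller[OF u] m(2) by force
qed

text \<open>Maximize the distance within the ball of radius \<rho> if \<open>u\<close> lies in it,
  otherwise minimize it outside. The optimum is on the sphere, since elsewhere the distance can be
  changed in both directions along the branch.\<close>

lemma branch_reaches_spheres:
  assumes u: "u \<in> branch \<sigma>" "u \<noteq> xs" and \<sigma>: "\<sigma> \<noteq> 0" and \<rho>: "0 < \<rho>" "\<rho> \<le> r"
  shows "\<exists>w\<in>branch \<sigma>. norm (w - xs) = \<rho>"
proof (cases "norm (u - xs) \<le> \<rho>")
  case True
  let ?K = "branch \<sigma> \<inter> cball xs \<rho>"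
  have "compact ?K" by (intro compact_Int_closed compact_branch \<sigma> closed_cball)
  moreover have "u \<in> ?K" using u(1) True cball_eq by blast
  moreover have "continuous_on ?K (\<lambda>x. norm (x - xs))" by (intro continuous_intros)
  ultimately obtain m where m: "m \<in> ?K" "\<forall>v\<in>?K. norm (v - xs) \<le> norm (m - xs)"
    using continuous_attains_sup[of ?K "\<lambda>x. norm (x - xs)"] by blast
  have "norm (u - xs) > 0" using u(2) by simp
  then have "m \<noteq> xs" using m(2) \<open>u \<in> ?K\<close> by force
  have mr: "m \<in> T" "norm (m - xs) \<le> r" "side \<sigma> m" "norm (m - xs) \<le> \<rho>"
    using branchD[of m \<sigma>] m(1) \<open>m \<noteq> xs\<close> cball_eq by blast+
  have "norm (m - xs) = \<rho>"
  proof (rule ccontr)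
    assume "norm (m - xs) \<noteq> \<rho>"
    with mr(4) have "m \<in> ball xs \<rho>" by (simp add: dist_norm norm_minus_commute)
    from local_sides[OF mr(1) \<open>m \<noteq> xs\<close> mr(2,3) open_ball this] obtain U w where
      w: "U \<subseteq> ball xs \<rho>" "\<forall>v\<in>T \<inter> U. v \<noteq> xs \<and> side \<sigma> v" "w \<in> T \<inter> U" "norm (m - xs) < norm (w - xs)" by blast
    then have "w \<in> ball xs \<rho>" by blast
    then have "norm (w - xs) < \<rho>" by (simp add: dist_norm norm_minus_commute)
    then have "w \<in> branch \<sigma>" "w \<in> cball xs \<rho>" using w \<rho>(2) by (auto intro!: branchI simp: dist_norm norm_minus_commute)
    with m(2) w(4) show False by force
  qed
  with m(1) show ?thesis by blast
next
  case False
  let ?K = "branch \<sigma> \<inter> {x. \<rho> \<le> norm (x - xs)}"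
  have cl: "closed {x. \<rho> \<le> norm (x - xs)}" and op: "open {x. \<rho> < norm (x - xs)}"
    by (intro closed_Collect_le open_Collect_less continuous_intros)+
  have "compact ?K" by (intro compact_Int_closed compact_branch \<sigma> cl)
  moreover have "u \<in> ?K" using u(1) False by simp
  moreover have "continuous_on ?K (\<lambda>x. norm (x - xs))" by (intro continuous_intros)
  ultimately obtain m where m: "m \<in> ?K" "\<forall>v\<in>?K. norm (m - xs) \<le> norm (v - xs)"
    using continuous_attains_inf[of ?K "\<lambda>x. norm (x - xs)"] by blast
  have "m \<noteq> xs" using m(1) \<rho> by auto
  have mr: "m \<in> T" "norm (m - xs) \<le> r" "side \<sigma> m" "\<rho> \<le> norm (m - xs)"
    using branchD[of m \<sigma>] m(1) \<open>m \<noteq> xs\<close> by auto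
  have "norm (m - xs) = \<rho>"
  proof (rule ccontr)
    assume "norm (m - xs) \<noteq> \<rho>"
    with mr(4) have "m \<in> {x. \<rho> < norm (x - xs)}" by simp
    from local_sides[OF mr(1) \<open>m \<noteq> xs\<close> mr(2,3) op this] obtain U w where
      w: "U \<subseteq> {x. \<rho> < norm (x - xs)}" "\<forall>v\<in>T \<inter> U. v \<noteq> xs \<and> side \<sigma> v" "w \<in> T \<inter> U" "norm (w - xs) < norm (m - xs)" by blast
    then have "\<rho> < norm (w - xs)" by blast
    then have "w \<in> ?K" using w mr(2) by (auto intro!: branchI)
    with m(2) w(4) show False by force
  qed
  with m(1) show ?thesis by blast
qed

lemma in_some_branch:
  assumes "u \<in> T" "norm (u - xs) \<le> r" shows "u \<in> branch 1 \<or> u \<in> branch (- 1)"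
proof (cases "u = xs")
  case False
  then have "side 1 u \<or> side (- 1) u" using side_cases[of u 1] assms r by simp
  then show ?thesis using assms by (auto intro: branchI)
qed (use assms in \<open>auto intro: branchI\<close>)

text \<open>A closed part without \<open>xs\<close> would have a point nearest to \<open>xs\<close>,
  yet from any point other than \<open>xs\<close> one can move closer without leaving the
  part.\<close>

lemma connected_T: "connected (T \<inter> cball xs r)"
proof (rule ccontr)
  assume "\<not> ?thesis"
  then obtain A B where AB: "closed A" "closed B" "T \<inter> cball xs r \<subseteq> A \<union> B" "A \<inter> B \<inter> (T \<inter> cball xs r) = {}"
    "A \<inter> (T \<inter> cball xs r) \<noteq> {}" "B \<inter> (T \<inter> cball xs r) \<noteq> {}" unfolding connected_closed by blast
  have no: False if AB: "closed A" "closed B" "T \<inter> cball xs r \<subseteq> A \<union> B" "A \<inter> B \<inter> (T \<inter> cball xs r) = {}"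
    "B \<inter> (T \<inter> cball xs r) \<noteq> {}" "xs \<notin> B" for A B
  proof -
    let ?K = "B \<inter> (T \<inter> cball xs r)"
    have "compact (cball xs r \<inter> (B \<inter> T))" by (intro compact_Int_closed compact_cball closed_Int AB closed_T)
    then have "compact ?K" by (simp add: Int_ac)
    moreover have "continuous_on ?K (\<lambda>x. norm (x - xs))" by (intro continuous_intros)
    ultimately obtain m where m: "m \<in> ?K" "\<forall>v\<in>?K. norm (m - xs) \<le> norm (v - xs)"
      using continuous_attains_inf[of ?K "\<lambda>x. norm (x - xs)"] AB(5) by blast
    have mr: "m \<in> T" "norm (m - xs) \<le> r" "m \<noteq> xs" using m(1) AB(6) cball_eq by blast+
    then obtain \<sigma> where \<sigma>: "side \<sigma> m" using side_cases[of m 1] r by auto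
    have mA: "m \<in> - A" "open (- A)" using m(1) AB(1,4) by auto
    obtain U w where w: "U \<subseteq> - A" "w \<in> T \<inter> U" "norm (w - xs) < norm (m - xs)"
      using local_sides[OF mr(1,3,2) \<sigma> mA(2,1)] by blast
    have "w \<in> cball xs r" using w(3) mr(2) cball_eq[of w xs r] by linarith
    then have "w \<in> ?K" using w(1,2) AB(3) by blast
    with m(2) w(3) show False by force
  qed
  have "xs \<in> T \<inter> cball xs r" using ideal_set_members(3) r by simp
  then have "xs \<notin> A \<or> xs \<notin> B" using AB(4) by blast
  then show False using no[of A B] no[of B A] AB by blast
qed

lemma kkt_set_cball: "kkt_set f gs \<inter> cball xs r = {xs}"
proof -
  have "V_R (ideal_Sigma f gs) \<inter> cball xs R1 = {xs}" using R1 by (simp add: step2_radius_def)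
  moreover have "cball xs r \<subseteq> cball xs R1" using r by (simp add: subset_cball)
  moreover have "xs \<in> kkt_set f gs" using isolated by (simp add: isolated_in_def)
  moreover have "xs \<in> cball xs r" using r(1) by simp
  ultimately show ?thesis using kkt_set_subset_Sigma[of f gs] by blast
qed

lemma faithful: "faithful_radius f gs xs r"
  unfolding faithful_radius_def
proof (intro conjI kkt_set_cball connected_T r(1) equalityI subsetI)
  fix u assume u: "u \<in> T \<inter> {x. peval f x = peval f xs} \<inter> cball xs r"
  have ur: "u \<in> T" "norm (u - xs) \<le> r" "peval f u = peval f xs" using u cball_eq by blast+
  show "u \<in> {xs}"
  proof (rule ccontr)
    assume "u \<notin> {xs}"
    then show False using in_some_branch[OF ur(1,2)] values_on_branch[of u 1] values_on_branch[of u "-1"] ur(3) by auto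
  qed
qed (use ideal_set_members(3) r in auto)

lemma condition_C_holds: "condition_C f gs xs r"
  unfolding condition_C_def
proof (intro conjI kkt_set_cball r(1) ballI impI)
  fix x assume "x \<in> feasible_set gs \<inter> cball xs r - {xs}"
  then have x: "x \<in> feasible_set gs" "x \<noteq> xs" "norm (x - xs) \<le> R1" using cball_eq[of x xs r] r by auto
  show "lin_indep_list (map (\<lambda>g. grad g x) gs @ [x - xs])"
    using step2_radiusD(2)[OF R1 x] by (simp add: lin_indep_list_iff_not_col_dep vec_dep_def)
next
  fix u assume u: "u \<in> T \<inter> interior (cball xs r)" "u \<noteq> xs"
  then have ub: "u \<in> ball xs r" "u \<in> T" by simp_all
  then have "norm (u - xs) \<le> r" by (simp add: dist_norm norm_minus_commute)
  from local_curve[OF ub(2) u(2) this open_ball ub(1)] obtain U \<epsilon> \<phi> v where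
    U: "open U" "u \<in> U" "U \<subseteq> ball xs r" "\<epsilon> > 0" "\<phi> ` {-\<epsilon><..<\<epsilon>} = T \<inter> U" "\<phi> 0 = u"
    and s: "\<forall>s\<in>{-\<epsilon><..<\<epsilon>}. (\<phi> has_vector_derivative v s) (at s) \<and> (\<phi> s - xs) \<bullet> v s \<noteq> 0" by blast
  have "\<phi> differentiable_on {-\<epsilon><..<\<epsilon>}"
    unfolding differentiable_on_def using s
    by (meson differentiableI differentiable_at_withinI has_vector_derivative_def)
  moreover have "((\<lambda>t. (norm (\<phi> t - xs))\<^sup>2) has_real_derivative 2 * ((\<phi> 0 - xs) \<bullet> v 0)) (at 0)"
    using DERIV_cmult[OF DERIV_peval_curve(2)[of \<phi> "v 0" 0 xs], of 2] s U(4) by (simp add: half_sq_def)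
  moreover have "2 * ((\<phi> 0 - xs) \<bullet> v 0) \<noteq> 0" using s U(4) by simp
  moreover have "U \<subseteq> cball xs r" using U(3) by auto
  ultimately show "\<exists>U \<epsilon> \<phi>. open U \<and> u \<in> U \<and> U \<subseteq> cball xs r \<and> \<epsilon> > 0 \<and> \<phi> differentiable_on {-\<epsilon><..<\<epsilon>} \<and>
      \<phi> ` {-\<epsilon><..<\<epsilon>} = T \<inter> U \<and> \<phi> 0 = u \<and> (\<exists>d. d \<noteq> 0 \<and> ((\<lambda>t. (norm (\<phi> t - xs))\<^sup>2) has_real_derivative d) (at 0))"
    using U by blast
qed

end

section \<open>Reading off the type from one sphere\<close>

context admissible_radii
begin

lemma small_sphere:
  assumes "open U" "xs \<in> U" shows "\<exists>\<rho>. 0 < \<rho> \<and> \<rho> < r \<and> sphere xs \<rho> \<subseteq> U"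
proof -
  obtain e where e: "e > 0" "ball xs e \<subseteq> U" using assms by (meson open_contains_ball)
  have "sphere xs (min e r / 2) \<subseteq> ball xs e" using e(1) r(1) by (auto simp: min_def)
  with e r(1) show ?thesis by (intro exI[of _ "min e r / 2"]) (auto simp: min_def)
qed

text \<open>The extremum of f on S over the sphere through \<open>y\<close> is a tangency point,
  hence lies on the remaining branch, where the comparison with the value at \<open>xs\<close> is
  known.\<close>

lemma strict_extremum_if_one_branch:
  assumes \<sigma>: "\<sigma> = 1 \<or> \<sigma> = -1" and br: "branch (- \<sigma>) \<subseteq> {xs}"
    and y: "y \<in> feasible_set gs" "y \<noteq> xs" "norm (y - xs) \<le> r"
  shows "\<sigma> * peval f xs < \<sigma> * peval f y"
proof -
  have \<rho>: "0 < norm (y - xs)" "norm (y - xs) < R1" using y r by auto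
  obtain x where x: "x \<in> T" "norm (x - xs) = norm (y - xs)" "\<sigma> * peval f x \<le> \<sigma> * peval f y"
  proof -
    obtain a where a: "a \<in> T \<inter> sphere xs (norm (y - xs))" "\<forall>z\<in>feasible_set gs \<inter> sphere xs (norm (y - xs)). peval f a \<le> peval f z"
      using extrema_on_sphere(1)[OF R1 \<rho>] by blast
    obtain b where b: "b \<in> T \<inter> sphere xs (norm (y - xs))" "\<forall>z\<in>feasible_set gs \<inter> sphere xs (norm (y - xs)). peval f z \<le> peval f b"
      using extrema_on_sphere(2)[OF R1 \<rho>] by blast
    have yS: "y \<in> feasible_set gs \<inter> sphere xs (norm (y - xs))" using y(1) sphere_eq by blast
    show ?thesis
    proof (cases "\<sigma> = 1")
      case True
      have "a \<in> T" "norm (a - xs) = norm (y - xs)" using a(1) sphere_eq by blast+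
      with that[of a] bspec[OF a(2) yS] True show ?thesis by simp
    next
      case False
      have "b \<in> T" "norm (b - xs) = norm (y - xs)" using b(1) sphere_eq by blast+
      with that[of b] bspec[OF b(2) yS] False \<sigma> show ?thesis by simp
    qed
  qed
  have "x \<noteq> xs" using x(2) \<rho>(1) by auto
  have "x \<in> branch \<sigma>"
    using in_some_branch[OF x(1)] x(2) y(3) br \<open>x \<noteq> xs\<close> \<sigma> by auto
  from values_on_branch[OF this \<open>x \<noteq> xs\<close>] \<sigma> x(3) show ?thesis by force
qed

text \<open>The type depends on which branches contain more than \<open>xs\<close>. If only one
  does, all nearby values on S lie strictly to one side of the value at \<open>xs\<close>; if both
  do, each meets the sphere of radius \<open>r\<close> and all smaller ones, so both signs occur
  arbitrarily close to \<open>xs\<close>.\<close>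

lemma type_from_sphere:
  "\<exists>fmin fmax t. is_min_value (peval f) (T \<inter> sphere xs r) fmin \<and> is_max_value (peval f) (T \<inter> sphere xs r) fmax \<and>
     step5 fmin fmax (peval f xs) = Some t \<and> (\<forall>t'. has_type f gs xs t' \<longleftrightarrow> t' = t)"
proof -
  have rR: "r < R1" using r by simp
  obtain a where a: "a \<in> T \<inter> sphere xs r" "\<forall>z\<in>feasible_set gs \<inter> sphere xs r. peval f a \<le> peval f z"
    using extrema_on_sphere(1)[OF R1 r(1) rR] by blast
  obtain b where b: "b \<in> T \<inter> sphere xs r" "\<forall>z\<in>feasible_set gs \<inter> sphere xs r. peval f z \<le> peval f b"
    using extrema_on_sphere(2)[OF R1 r(1) rR] by blast
  have mn: "is_min_value (peval f) (T \<inter> sphere xs r) (peval f a)"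
    and mx: "is_max_value (peval f) (T \<inter> sphere xs r) (peval f b)"
    using a b T_feasible unfolding is_min_value_def is_max_value_def by blast+
  have ab: "a \<in> T" "a \<noteq> xs" "norm (a - xs) \<le> r" "b \<in> T" "b \<noteq> xs" "norm (b - xs) \<le> r"
    using a(1) b(1) r(1) by (auto simp: dist_norm norm_minus_commute)
  have le: "peval f a \<le> peval f b" using a(2) b(1) T_feasible by blast
  have LMin: "\<not> has_type f gs xs Local_Minimizer" if "\<And>\<rho>. 0 < \<rho> \<Longrightarrow> \<rho> < r \<Longrightarrow> \<exists>y\<in>feasible_set gs \<inter> sphere xs \<rho>. peval f y < peval f xs"
    using small_sphere that by (auto simp: not_le[symmetric]) (meson IntI IntD1 IntD2 not_le subsetD)
  have LMax: "\<not> has_type f gs xs Local_Maximizer" if "\<And>\<rho>. 0 < \<rho> \<Longrightarrow> \<rho> < r \<Longrightarrow> \<exists>y\<in>feasible_set gs \<inter> sphere xs \<rho>. peval f xs < peval f y"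
    using small_sphere that by (auto simp: not_le[symmetric]) (meson IntI IntD1 IntD2 not_le subsetD)
  have sph: "\<exists>y. y \<in> feasible_set gs \<and> y \<in> sphere xs \<rho> \<and> y \<noteq> xs \<and> norm (y - xs) \<le> r" if "0 < \<rho>" "\<rho> < r" for \<rho>
  proof -
    have "\<rho> < R1" using that rR by simp
    from sphere_nonempty[OF R1 that(1) this] that sphere_eq[of _ xs \<rho>] show ?thesis by force
  qed
  consider (min) "branch (- 1) \<subseteq> {xs}" | (max) "branch 1 \<subseteq> {xs}" | (both) u v where "u \<in> branch 1" "u \<noteq> xs" "v \<in> branch (- 1)" "v \<noteq> xs"
    by blast
  then show ?thesis
  proof cases
    case min
    have st: "peval f xs < peval f y" if "y \<in> feasible_set gs" "y \<noteq> xs" "norm (y - xs) \<le> r" for y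
      using strict_extremum_if_one_branch[of 1 y] min that by simp
    have "has_type f gs xs Local_Minimizer"
      unfolding has_type.simps
    proof (intro exI[of _ "ball xs r"] conjI ballI)
      fix x assume x: "x \<in> feasible_set gs \<inter> ball xs r"
      then have "norm (x - xs) \<le> r" by (simp add: dist_norm norm_minus_commute)
      then show "peval f xs \<le> peval f x" using st[of x] x by (cases "x = xs") auto
    qed (use r(1) in auto)
    moreover have "\<not> has_type f gs xs Local_Maximizer"
      by (rule LMax) (use sph st in blast)
    moreover have "\<not> has_type f gs xs Not_Extremum"
    proof
      assume "has_type f gs xs Not_Extremum"
      then obtain u where u: "u \<in> feasible_set gs \<inter> ball xs r" "peval f u < peval f xs"
        unfolding has_type.simps using r(1) by (meson centre_in_ball open_ball)
      then have "norm (u - xs) \<le> r" by (simp add: dist_norm norm_minus_commute)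
      with st[of u] u show False by (cases "u = xs") auto
    qed
    ultimately have "\<forall>t'. has_type f gs xs t' \<longleftrightarrow> t' = Local_Minimizer" by (metis kkt_type.exhaust)
    moreover have "step5 (peval f a) (peval f b) (peval f xs) = Some Local_Minimizer"
      using st[OF T_feasible[OF ab(1)] ab(2,3)] by (simp add: step5_def)
    ultimately show ?thesis using mn mx by blast
  next
    case max
    have st: "peval f y < peval f xs" if "y \<in> feasible_set gs" "y \<noteq> xs" "norm (y - xs) \<le> r" for y
      using strict_extremum_if_one_branch[of "-1" y] max that by simp
    have "has_type f gs xs Local_Maximizer"
      unfolding has_type.simps
    proof (intro exI[of _ "ball xs r"] conjI ballI)
      fix x assume x: "x \<in> feasible_set gs \<inter> ball xs r"
      then have "norm (x - xs) \<le> r" by (simp add: dist_norm norm_minus_commute)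
      then show "peval f x \<le> peval f xs" using st[of x] x by (cases "x = xs") auto
    qed (use r(1) in auto)
    moreover have "\<not> has_type f gs xs Local_Minimizer"
      by (rule LMin) (use sph st in blast)
    moreover have "\<not> has_type f gs xs Not_Extremum"
    proof
      assume "has_type f gs xs Not_Extremum"
      then obtain u where u: "u \<in> feasible_set gs \<inter> ball xs r" "peval f xs < peval f u"
        unfolding has_type.simps using r(1) by (meson centre_in_ball open_ball)
      then have "norm (u - xs) \<le> r" by (simp add: dist_norm norm_minus_commute)
      with st[of u] u show False by (cases "u = xs") auto
    qed
    ultimately have "\<forall>t'. has_type f gs xs t' \<longleftrightarrow> t' = Local_Maximizer" by (metis kkt_type.exhaust)
    moreover have "step5 (peval f a) (peval f b) (peval f xs) = Some Local_Maximizer"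
      using st[OF T_feasible[OF ab(4)] ab(5,6)] le by (simp add: step5_def)
    ultimately show ?thesis using mn mx by blast
  next
    case (both u v)
    have reach: "\<exists>y\<in>feasible_set gs \<inter> sphere xs \<rho>. \<sigma> * peval f xs < \<sigma> * peval f y"
      if w: "w \<in> branch \<sigma>" "w \<noteq> xs" "\<sigma> \<noteq> 0" and \<rho>: "0 < \<rho>" "\<rho> \<le> r" for w \<sigma> \<rho>
    proof -
      obtain y where y: "y \<in> branch \<sigma>" "norm (y - xs) = \<rho>" using branch_reaches_spheres[OF w \<rho>] by blast
      have "y \<noteq> xs" using y(2) \<rho>(1) by auto
      from values_on_branch[OF y(1) this w(3)] have "\<sigma> * peval f xs < \<sigma> * peval f y" .
      moreover have "y \<in> sphere xs \<rho>" using y(2) by (simp only: sphere_eq)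
      moreover have "y \<in> feasible_set gs" using y(1) branchD T_feasible by blast
      ultimately show ?thesis by blast
    qed
    have up: "\<exists>y\<in>feasible_set gs \<inter> sphere xs \<rho>. peval f xs < peval f y" if "0 < \<rho>" "\<rho> \<le> r" for \<rho>
      using reach[OF both(1,2) _ that] by simp
    have down: "\<exists>y\<in>feasible_set gs \<inter> sphere xs \<rho>. peval f y < peval f xs" if "0 < \<rho>" "\<rho> \<le> r" for \<rho>
      using reach[OF both(3,4) _ that] by simp
    have "\<not> has_type f gs xs Local_Minimizer" by (rule LMin) (rule down, auto)
    moreover have "\<not> has_type f gs xs Local_Maximizer" by (rule LMax) (rule up, auto)
    moreover have "has_type f gs xs Not_Extremum"
      unfolding has_type.simps
    proof (intro allI impI)
      fix U assume "open U \<and> xs \<in> U"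
      then obtain \<rho> where \<rho>: "0 < \<rho>" "\<rho> < r" "sphere xs \<rho> \<subseteq> U" using small_sphere by blast
      then have "\<rho> \<le> r" by simp
      from up[OF \<rho>(1) this] down[OF \<rho>(1) this] \<rho>(3)
      show "\<exists>u\<in>feasible_set gs \<inter> U. \<exists>v\<in>feasible_set gs \<inter> U. peval f u < peval f xs \<and> peval f xs < peval f v"
        by blast
    qed
    ultimately have "\<forall>t'. has_type f gs xs t' \<longleftrightarrow> t' = Not_Extremum" by (metis kkt_type.exhaust)
    moreover have "peval f a < peval f xs" using down[OF r(1) order_refl] a(2) by force
    moreover have "peval f xs < peval f b" using up[OF r(1) order_refl] b(2) by force
    ultimately show ?thesis using mn mx by (intro exI[of _ "peval f a"] exI[of _ "peval f b"] exI[of _ Not_Extremum]) (simp add: step5_def)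
  qed
qed

end

subsection \<open>Smooth branches\<close>

lemma eventually_poly_nonzero: "c \<noteq> 0 \<Longrightarrow> eventually (\<lambda>t. poly c t \<noteq> 0) (at_right (0::real))"
proof -
  assume "c \<noteq> 0"
  then have "finite ({t. poly c t = 0} - {0})" using poly_roots_finite by blast
  then have "open (- ({t. poly c t = 0} - {0}))" by (intro open_Compl finite_imp_closed)
  moreover have "0 \<in> - ({t. poly c t = 0} - {0})" by simp
  ultimately have "eventually (\<lambda>t. t \<in> - ({t. poly c t = 0} - {0})) (nhds 0)" by (rule eventually_nhds_in_open)
  then show ?thesis unfolding eventually_at_filter by (rule eventually_mono) auto
qed

lemma pderiv_poly2: "poly2 (pderiv P) t = pderiv (poly2 P t)"
  by (rule poly_eqI) (simp add: coeff_poly2 coeff_pderiv)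

lemma poly2_smult: "poly2 (Polynomial.smult c P) t = Polynomial.smult (poly c t) (poly2 P t)"
  by (rule poly_eqI) (simp add: coeff_poly2)

lemma poly2_pCons: "poly2 (pCons c P) t = pCons (poly c t) (poly2 P t)"
  by (rule poly_eqI) (simp add: coeff_poly2 coeff_pCons split: nat.split)

lemma poly2_nonzero: "poly (lead_coeff P) t \<noteq> 0 \<Longrightarrow> poly2 P t \<noteq> 0 \<and> degree (poly2 P t) = degree P"
proof -
  assume *: "poly (lead_coeff P) t \<noteq> 0"
  then have "coeff (poly2 P t) (degree P) \<noteq> 0" by (simp add: coeff_poly2)
  moreover have "degree (poly2 P t) \<le> degree P" by (rule degree_le) (simp add: coeff_poly2 coeff_eq_0)
  ultimately show ?thesis by (metis coeff_0 le_antisym le_degree)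
qed

text \<open>An element \<open>D\<close> of least degree in the ideal generated by \<open>P\<close> and its derivative divides both up
  to factors that depend on \<open>t\<close> only; the quotient of \<open>P\<close> by \<open>D\<close> has the roots of \<open>P\<close>, all simple.\<close>

lemma exists_squarefree_part:
  fixes P :: "real poly poly"
  assumes "P \<noteq> 0"
  shows "\<exists>Q. Q \<noteq> 0 \<and> eventually (\<lambda>t. \<forall>y. (poly (poly2 P t) y = 0 \<longrightarrow> poly (poly2 Q t) y = 0) \<and>
    (poly (poly2 Q t) y = 0 \<longrightarrow> poly (poly2 (pderiv Q) t) y \<noteq> 0)) (at_right 0)"
proof (cases "pderiv P = 0")
  case True
  \<comment> \<open>\<open>P\<close> does not involve y, so for small t it has no roots and serves
    itself.\<close>
  then have d0: "degree P = 0" by (simp add: pderiv_eq_0_iff)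
  have "lead_coeff P \<noteq> 0" using assms by simp
  from eventually_poly_nonzero[OF this]
  have "eventually (\<lambda>t. \<forall>y. poly (poly2 P t) y \<noteq> 0) (at_right 0)"
  proof eventually_elim
    case (elim t)
    from poly2_nonzero[OF elim] d0 obtain c where "poly2 P t = [:c:]" "c \<noteq> 0" by (metis degree_0_id pCons_0_0)
    then show ?case by simp
  qed
  then have "eventually (\<lambda>t. \<forall>y. (poly (poly2 P t) y = 0 \<longrightarrow> poly (poly2 P t) y = 0) \<and>
    (poly (poly2 P t) y = 0 \<longrightarrow> poly (poly2 (pderiv P) t) y \<noteq> 0)) (at_right 0)" by eventually_elim simp
  with assms show ?thesis by blast
next
  case False
  define K where "K = {A * P + B * pderiv P | A B. True}"
  have K_diff: "c * x - d * z \<in> K" if xz: "x \<in> K" "z \<in> K" for x z c d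
  proof -
    obtain A B A' B' where "x = A * P + B * pderiv P" "z = A' * P + B' * pderiv P" using xz by (auto simp: K_def)
    then have "c * x - d * z = (c * A - d * A') * P + (c * B - d * B') * pderiv P" by (simp add: algebra_simps)
    then show ?thesis unfolding K_def by blast
  qed
  have PK: "P \<in> K" "pderiv P \<in> K" unfolding K_def by (force intro: exI[of _ 1] exI[of _ 0])+
  obtain D where D: "D \<in> K" "D \<noteq> 0" "\<And>z. z \<in> K \<Longrightarrow> z \<noteq> 0 \<Longrightarrow> degree D \<le> degree z"
    using ex_has_least_nat[of "\<lambda>z. z \<in> K \<and> z \<noteq> 0" P degree] PK(1) assms by blast
  \<comment> \<open>Over the polynomials in t, division is possible only up to powers of the leading
    coefficient. The remainder of the pseudo-division lies in \<open>K\<close> below the least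
    degree, so it is 0.\<close>
  have divides: "\<exists>c q. c \<noteq> 0 \<and> Polynomial.smult c x = D * q" if x: "x \<in> K" for x
  proof -
    obtain q r where qr: "pseudo_divmod x D = (q, r)" by fastforce
    define c where "c = coeff D (degree D) ^ (Suc (degree x) - degree D)"
    have e: "Polynomial.smult c x = D * q + r" "r = 0 \<or> degree r < degree D"
      using pseudo_divmod[OF D(2) qr] by (auto simp: c_def)
    have "r = [:c:] * x - q * D" using e(1) by (simp add: mult.commute)
    then have rK: "r \<in> K" using K_diff[OF x D(1), of "[:c:]" q] by simp
    have "r = 0"
    proof (rule ccontr)
      assume "r \<noteq> 0"
      then show False using e(2) D(3)[OF rK] by simp
    qed
    moreover have "c \<noteq> 0" using D(2) by (simp add: c_def)
    ultimately show ?thesis using e(1) by auto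
  qed
  obtain c Q where Q: "c \<noteq> 0" "Polynomial.smult c P = D * Q" using divides[OF PK(1)] by blast
  obtain c' E where E: "c' \<noteq> 0" "Polynomial.smult c' (pderiv P) = D * E" using divides[OF PK(2)] by blast
  obtain A B where AB: "D = A * P + B * pderiv P" using D(1) by (auto simp: K_def)
  have "Q \<noteq> 0" using Q assms by auto
  have "lead_coeff (pderiv P) \<noteq> 0" using False by simp
  from eventually_poly_nonzero[OF Q(1)] eventually_poly_nonzero[OF E(1)] eventually_poly_nonzero[OF this]
  have "eventually (\<lambda>t. \<forall>y. (poly (poly2 P t) y = 0 \<longrightarrow> poly (poly2 Q t) y = 0) \<and>
    (poly (poly2 Q t) y = 0 \<longrightarrow> poly (poly2 (pderiv Q) t) y \<noteq> 0)) (at_right 0)"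
  proof eventually_elim
    case (elim t)
    let ?p = "poly2 P t" and ?d = "poly2 D t" and ?q = "Polynomial.smult (1 / poly c t) (poly2 Q t)"
      and ?e = "Polynomial.smult (1 / poly c' t) (poly2 E t)"
    have p': "pderiv ?p \<noteq> 0" using poly2_nonzero[OF elim(3)] by (simp add: pderiv_poly2)
    have "Polynomial.smult (poly c t) ?p = ?d * poly2 Q t" by (simp only: poly2_smult[symmetric] Q(2) poly2_mult)
    then have p: "?p = ?q * ?d" using elim(1) by (auto dest: arg_cong[where f = "Polynomial.smult (1 / poly c t)"] simp: mult.commute)
    have "Polynomial.smult (poly c' t) (pderiv ?p) = ?d * poly2 E t" by (simp only: poly2_smult[symmetric] pderiv_poly2[symmetric] E(2) poly2_mult)
    then have p'e: "pderiv ?p = ?e * ?d" using elim(2) by (auto dest: arg_cong[where f = "Polynomial.smult (1 / poly c' t)"] simp: mult.commute)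
    have d: "?d = poly2 A t * ?p + poly2 B t * pderiv ?p"
      by (simp only: AB poly2_add poly2_mult pderiv_poly2)
    have ord: "order y ?q = (if order y ?p = 0 then 0 else 1)" for y
      using poly_squarefree_decomp_order[OF p' p p'e d] .
    have p0: "?p \<noteq> 0" using p' by auto
    then have q0: "?q \<noteq> 0" using p by auto
    have "rsquarefree ?q" unfolding rsquarefree_def using q0 ord by auto
    then have "\<not> (poly ?q y = 0 \<and> poly (pderiv ?q) y = 0)" for y using rsquarefree_roots by blast
    moreover have "poly ?q y = 0" if "poly ?p y = 0" for y
      using ord[of y] that p0 q0 order_root[of ?p y] order_root[of ?q y] by auto
    ultimately show ?case using elim(1) by (auto simp: pderiv_smult pderiv_poly2)
  qed
  with \<open>Q \<noteq> 0\<close> show ?thesis by blast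
qed

text \<open>\<open>pderiv\<close> differentiates in the outer variable y; this is the derivative in
  t.\<close>

definition dt :: "real poly poly \<Rightarrow> real poly poly" where
  "dt Q = map_poly pderiv Q"

lemma dt_0 [simp]: "dt 0 = 0" and dt_pCons: "dt (pCons c Q) = pCons (pderiv c) (dt Q)"
  by (simp_all add: dt_def Polynomial.map_poly_pCons)

lemma has_derivative_poly2:
  "((\<lambda>p. poly (poly2 Q (fst p)) (snd p)) has_derivative
    (\<lambda>h. poly (poly2 (dt Q) t) y * fst h + poly (poly2 (pderiv Q) t) y * snd h)) (at (t, y))"
proof (induction Q)
  case 0
  then show ?case by simp
next
  case (pCons c Q)
  have d1: "((\<lambda>p. poly c (fst p)) has_derivative (\<lambda>h. fst h * poly (pderiv c) t)) (at (t, y))"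
    using has_derivative_compose[OF has_derivative_fst[OF has_derivative_ident], of "poly c" "\<lambda>h. h * poly (pderiv c) t" "(t, y)" UNIV]
      poly_DERIV[of c t] by (simp add: has_field_derivative_def mult_commute_abs)
  have d2: "(snd has_derivative snd) (at (t, y))" by (intro has_derivative_snd has_derivative_ident)
  show ?case
    unfolding poly2_pCons poly_pCons
    by (rule has_derivative_eq_rhs[OF has_derivative_add[OF d1 has_derivative_mult[OF d2 pCons.IH]]])
      (simp add: fun_eq_iff dt_pCons poly2_pCons pderiv_pCons poly2_add algebra_simps)
qed

lemma continuous_on_poly2: "continuous_on U (\<lambda>p. poly (poly2 Q (fst p)) (snd p))"
  by (intro continuous_at_imp_continuous_on ballI)
    (metis has_derivative_continuous[OF has_derivative_poly2] prod.collapse)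

lemma DERIV_poly2_curve:
  assumes "(\<gamma> has_real_derivative g) (at t)"
  shows "((\<lambda>t. poly (poly2 Q t) (\<gamma> t)) has_real_derivative
    poly (poly2 (dt Q) t) (\<gamma> t) + poly (poly2 (pderiv Q) t) (\<gamma> t) * g) (at t)"
proof -
  have "((\<lambda>t. (t, \<gamma> t)) has_derivative (\<lambda>h. (h, g * h))) (at t)"
    using assms by (intro has_derivative_Pair has_derivative_ident) (simp add: has_field_derivative_def mult_commute_abs)
  from has_derivative_compose[OF this has_derivative_poly2[of Q t "\<gamma> t"]]
  show ?thesis unfolding has_field_derivative_def fst_conv snd_conv
    by (rule has_derivative_eq_rhs) (simp add: fun_eq_iff algebra_simps)
qed

text \<open>The functions obtained from \<open>\<gamma>\<close> and \<open>w\<close> (below, the reciprocal of the \<open>y\<close>-derivative along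
  \<open>\<gamma>\<close>) by polynomial operations are closed under differentiation.\<close>

inductive_set generated :: "(real \<Rightarrow> real) \<Rightarrow> (real \<Rightarrow> real) \<Rightarrow> (real \<Rightarrow> real) set" for \<gamma> w where
  gen_id: "(\<lambda>t. t) \<in> generated \<gamma> w"
| gen_const: "(\<lambda>t. c) \<in> generated \<gamma> w"
| gen_\<gamma>: "\<gamma> \<in> generated \<gamma> w"
| gen_w: "w \<in> generated \<gamma> w"
| gen_add: "g \<in> generated \<gamma> w \<Longrightarrow> h \<in> generated \<gamma> w \<Longrightarrow> (\<lambda>t. g t + h t) \<in> generated \<gamma> w"
| gen_mult: "g \<in> generated \<gamma> w \<Longrightarrow> h \<in> generated \<gamma> w \<Longrightarrow> (\<lambda>t. g t * h t) \<in> generated \<gamma> w"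

lemma gen_poly: "(\<lambda>t. poly c t) \<in> generated \<gamma> w"
proof (induction c)
  case (pCons a c)
  show ?case unfolding poly_pCons by (intro generated.gen_add generated.gen_const generated.gen_mult generated.gen_id pCons.IH)
qed (simp add: generated.gen_const)

lemma gen_poly2: "(\<lambda>t. poly (poly2 Q t) (\<gamma> t)) \<in> generated \<gamma> w"
proof (induction Q)
  case (pCons c Q)
  show ?case unfolding poly2_pCons poly_pCons by (intro generated.gen_add gen_poly generated.gen_mult generated.gen_\<gamma> pCons.IH)
qed (simp add: generated.gen_const)

lemma smooth_implicit_function:
  fixes \<gamma> :: "real \<Rightarrow> real"
  assumes root: "\<And>t. t \<in> J \<Longrightarrow> poly (poly2 (pderiv Q) t) (\<gamma> t) \<noteq> 0"
    and der: "\<And>t. t \<in> J \<Longrightarrow> (\<gamma> has_real_derivative - poly (poly2 (dt Q) t) (\<gamma> t) / poly (poly2 (pderiv Q) t) (\<gamma> t)) (at t)"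
  shows "\<exists>D. D 0 = \<gamma> \<and> (\<forall>k. \<forall>t\<in>J. (D k has_real_derivative D (Suc k) t) (at t))"
proof -
  define w where "w t = 1 / poly (poly2 (pderiv Q) t) (\<gamma> t)" for t
  define g where "g t = - 1 * poly (poly2 (dt Q) t) (\<gamma> t) * w t" for t
  let ?R = "generated \<gamma> w"
  have gR: "g \<in> ?R" unfolding g_def by (intro gen_mult gen_const gen_poly2 gen_w)
  have d\<gamma>: "(\<gamma> has_real_derivative g t) (at t)" if "t \<in> J" for t
    using der[OF that] by (simp add: g_def w_def)
  have step: "\<exists>h'\<in>?R. \<forall>t\<in>J. (h has_real_derivative h' t) (at t)" if "h \<in> ?R" for h
    using that
  proof induction
    case gen_id
    show ?case by (rule bexI[of _ "\<lambda>t. 1"]) (auto intro: generated.intros)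
  next
    case (gen_const c)
    show ?case by (rule bexI[of _ "\<lambda>t. 0"]) (auto intro: generated.intros)
  next
    case gen_\<gamma>
    show ?case using d\<gamma> gR by blast
  next
    case gen_w
    define h' where "h' t = - 1 * (poly (poly2 (dt (pderiv Q)) t) (\<gamma> t) + poly (poly2 (pderiv (pderiv Q)) t) (\<gamma> t) * g t) * (w t * w t)" for t
    have "h' \<in> ?R" unfolding h'_def by (intro generated.gen_mult generated.gen_add generated.gen_const gen_poly2 generated.gen_w gR)
    moreover have "(w has_real_derivative h' t) (at t)" if "t \<in> J" for t
    proof -
      have "((\<lambda>t. 1 / poly (poly2 (pderiv Q) t) (\<gamma> t)) has_real_derivative
          - (poly (poly2 (dt (pderiv Q)) t) (\<gamma> t) + poly (poly2 (pderiv (pderiv Q)) t) (\<gamma> t) * g t) * (w t * w t)) (at t)"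
        using DERIV_inverse'[OF DERIV_poly2_curve[OF d\<gamma>[OF that], of "pderiv Q"] root[OF that]]
        unfolding inverse_eq_divide by (rule DERIV_cong) (simp add: w_def minus_divide_left)
      then show ?thesis by (simp add: h'_def w_def[abs_def])
    qed
    ultimately show ?case by blast
  next
    case (gen_add g h)
    then obtain g' h' where "g' \<in> ?R" "h' \<in> ?R" "\<forall>t\<in>J. (g has_real_derivative g' t) (at t)" "\<forall>t\<in>J. (h has_real_derivative h' t) (at t)" by blast
    then show ?case by (intro bexI[of _ "\<lambda>t. g' t + h' t"]) (auto intro: generated.intros DERIV_add)
  next
    case (gen_mult g h)
    then obtain g' h' where *: "g' \<in> ?R" "h' \<in> ?R" "\<forall>t\<in>J. (g has_real_derivative g' t) (at t)" "\<forall>t\<in>J. (h has_real_derivative h' t) (at t)" by blast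
    have "(\<lambda>t. g' t * h t + h' t * g t) \<in> ?R" using * gen_mult.hyps by (intro generated.intros)
    with * show ?case by (intro bexI[of _ "\<lambda>t. g' t * h t + h' t * g t"]) (auto intro: DERIV_mult)
  qed
  then obtain F where F: "\<And>h. h \<in> ?R \<Longrightarrow> F h \<in> ?R \<and> (\<forall>t\<in>J. (h has_real_derivative F h t) (at t))" by metis
  \<comment> \<open>Iterating a choice of derivatives inside the generated ring gives derivatives of
    all orders.\<close>
  define D where "D k = (F ^^ k) \<gamma>" for k
  have "D k \<in> ?R" for k by (induction k) (auto simp: D_def F generated.gen_\<gamma>)
  then show ?thesis using F by (intro exI[of _ D]) (auto simp: D_def)
qed

text \<open>The inverse function theorem for the map from (t, y) to (t, Q(t, y)). The branch is the
  second component of the inverse on the line (t, 0), and injectivity on the neighbourhood gives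
  uniqueness.\<close>

lemma implicit_branch:
  assumes root: "poly (poly2 Q t0) y0 = 0" and simple: "poly (poly2 (pderiv Q) t0) y0 \<noteq> 0"
  shows "\<exists>\<eta> W \<gamma> D. \<eta> > 0 \<and> open W \<and> (t0, y0) \<in> W \<and> D 0 = \<gamma> \<and>
    (\<forall>t\<in>{t0 - \<eta><..<t0 + \<eta>}. (t, \<gamma> t) \<in> W \<and> poly (poly2 Q t) (\<gamma> t) = 0 \<and>
      (\<forall>k. (D k has_real_derivative D (Suc k) t) (at t)) \<and>
      (\<forall>y. (t, y) \<in> W \<longrightarrow> poly (poly2 Q t) y = 0 \<longrightarrow> y = \<gamma> t))"
proof -
  define q where "q = (\<lambda>p :: real \<times> real. poly (poly2 Q (fst p)) (snd p))"
  define qt where "qt = (\<lambda>p :: real \<times> real. poly (poly2 (dt Q) (fst p)) (snd p))"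
  define qy where "qy = (\<lambda>p :: real \<times> real. poly (poly2 (pderiv Q) (fst p)) (snd p))"
  define F where "F = (\<lambda>p. (fst p, q p))"
  define B0 :: "(real \<times> real) \<Rightarrow>\<^sub>L (real \<times> real)" where "B0 = Blinfun (\<lambda>h. (fst h, 0))"
  define B1 :: "(real \<times> real) \<Rightarrow>\<^sub>L (real \<times> real)" where "B1 = Blinfun (\<lambda>h. (0, fst h))"
  define B2 :: "(real \<times> real) \<Rightarrow>\<^sub>L (real \<times> real)" where "B2 = Blinfun (\<lambda>h. (0, snd h))"
  have B: "blinfun_apply B0 h = (fst h, 0)" "blinfun_apply B1 h = (0, fst h)" "blinfun_apply B2 h = (0, snd h)" for h
    unfolding B0_def B1_def B2_def
    by (auto intro!: bounded_linear_Blinfun_apply[THEN fun_cong] bounded_linear_Pair bounded_linear_fst bounded_linear_snd bounded_linear_zero)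
  define F' where "F' p = B0 + qt p *\<^sub>R B1 + qy p *\<^sub>R B2" for p
  have F': "blinfun_apply (F' p) h = (fst h, qt p * fst h + qy p * snd h)" for p h
    by (simp add: F'_def blinfun.bilinear_simps B)
  have cont: "continuous_on U qt" "continuous_on U qy" for U
    unfolding qt_def qy_def by (rule continuous_on_poly2)+
  define U where "U = {p. qy p \<noteq> 0}"
  have "open U" unfolding U_def using cont by (intro open_Collect_neq continuous_on_const) auto
  have dF: "(F has_derivative blinfun_apply (F' p)) (at p)" for p
  proof -
    have "(q has_derivative (\<lambda>h. qt p * fst h + qy p * snd h)) (at p)"
      using has_derivative_poly2[of Q "fst p" "snd p"] by (simp add: q_def qt_def qy_def)
    then have "(F has_derivative (\<lambda>h. (fst h, qt p * fst h + qy p * snd h))) (at p)"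
      unfolding F_def by (intro has_derivative_Pair has_derivative_fst has_derivative_ident)
    then show ?thesis by (rule has_derivative_eq_rhs) (simp add: fun_eq_iff F')
  qed
  have cF: "continuous_on U F'" unfolding F'_def[abs_def] by (intro continuous_intros cont)
  have x0: "(t0, y0) \<in> U" using simple by (simp add: U_def qy_def)
  \<comment> \<open>The derivative is triangular with diagonal entries 1 and the y-derivative of
    \<open>Q\<close>, so its inverse can be written down.\<close>
  have inv: "(B0 + (- qt (t0, y0) / qy (t0, y0)) *\<^sub>R B1 + (1 / qy (t0, y0)) *\<^sub>R B2) o\<^sub>L F' (t0, y0) = id_blinfun"
    by (rule blinfun_eqI) (use x0 in \<open>auto simp: blinfun.bilinear_simps B F' U_def field_simps\<close>)
  obtain U' V g g' where ift: "open U'" "U' \<subseteq> U" "(t0, y0) \<in> U'" "open V" "F (t0, y0) \<in> V" "homeomorphism U' V F g"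
    "\<And>z. z \<in> V \<Longrightarrow> (g has_derivative g' z) (at z)"
    by (rule inverse_function_theorem[OF \<open>open U\<close> dF cF x0 inv]) (rule that; (assumption | iprover))
  have "(t0, 0) \<in> V" using ift(5) root by (simp add: F_def q_def)
  then obtain \<eta> where \<eta>: "\<eta> > 0" "ball (t0, 0) \<eta> \<subseteq> V" using ift(4) open_contains_ball by blast
  define \<gamma> where "\<gamma> t = snd (g (t, 0))" for t
  let ?J = "{t0 - \<eta><..<t0 + \<eta>}"
  have V: "(t, 0) \<in> V" if "t \<in> ?J" for t
    using that \<eta>(2) by (auto simp: dist_Pair_Pair dist_real_def)
  have g: "g (t, 0) = (t, \<gamma> t)" "(t, \<gamma> t) \<in> U'" "poly (poly2 Q t) (\<gamma> t) = 0" if "t \<in> ?J" for t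
  proof -
    have "F (g (t, 0)) = (t, 0)" "g (t, 0) \<in> U'" using V[OF that] ift(6) unfolding homeomorphism_def by auto
    then show "g (t, 0) = (t, \<gamma> t)" "(t, \<gamma> t) \<in> U'" "poly (poly2 Q t) (\<gamma> t) = 0"
      by (auto simp: F_def \<gamma>_def q_def prod_eq_iff intro: back_subst[of "\<lambda>z. z \<in> U'"])
  qed
  have simple': "poly (poly2 (pderiv Q) t) (\<gamma> t) \<noteq> 0" if "t \<in> ?J" for t
    using g(2)[OF that] ift(2) by (auto simp: U_def qy_def)
  have der: "(\<gamma> has_real_derivative - poly (poly2 (dt Q) t) (\<gamma> t) / poly (poly2 (pderiv Q) t) (\<gamma> t)) (at t)" if t: "t \<in> ?J" for t
  proof -
    have "((\<lambda>t. (t, 0 :: real)) has_derivative (\<lambda>h. (h, 0))) (at t)"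
      by (intro has_derivative_Pair has_derivative_ident has_derivative_const)
    from has_derivative_compose[OF this ift(7)[OF V[OF t]]]
    have "(\<gamma> has_derivative (\<lambda>h. snd (g' (t, 0) (h, 0)))) (at t)"
      unfolding \<gamma>_def by (rule has_derivative_snd)
    then obtain d where d: "(\<gamma> has_real_derivative d) (at t)"
      using has_derivative_imp_has_field_derivative has_derivative_bounded_linear real_bounded_linear by metis
    have "((\<lambda>t. poly (poly2 Q t) (\<gamma> t)) has_real_derivative 0) (at t)"
      by (rule has_field_derivative_transform_within_open[OF DERIV_const[of 0] open_greaterThanLessThan t]) (use g(3) in auto)
    with DERIV_poly2_curve[OF d, of Q] have "poly (poly2 (dt Q) t) (\<gamma> t) + poly (poly2 (pderiv Q) t) (\<gamma> t) * d = 0"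
      by (rule DERIV_unique)
    then have "d = - poly (poly2 (dt Q) t) (\<gamma> t) / poly (poly2 (pderiv Q) t) (\<gamma> t)"
      using simple'[OF t] by (simp add: field_simps)
    with d show ?thesis by simp
  qed
  obtain D where D: "D 0 = \<gamma>" "\<forall>k. \<forall>t\<in>?J. (D k has_real_derivative D (Suc k) t) (at t)"
    using smooth_implicit_function[of ?J Q \<gamma>, OF simple' der] by auto
  have uniq: "y = \<gamma> t" if "t \<in> ?J" "(t, y) \<in> U'" "poly (poly2 Q t) y = 0" for t y
  proof -
    have "g (F (t, y)) = (t, y)" using that(2) ift(6) unfolding homeomorphism_def by auto
    then show ?thesis using that(3) by (auto simp: F_def q_def \<gamma>_def)
  qed
  show ?thesis
    by (rule exI[of _ \<eta>], rule exI[of _ U'], rule exI[of _ \<gamma>], rule exI[of _ D])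
      (use \<eta>(1) ift(1,3) D g uniq in auto)
qed

text \<open>The determinant trick: \<open>v\<close> is an eigenvector for \<open>k\<close> of a
  matrix with entries polynomial in \<open>t\<close>, whose characteristic polynomial is monic,
  hence nonzero, and independent of \<open>t\<close>, \<open>k\<close> and \<open>v\<close>.\<close>

lemma eigenvalue_relation:
  fixes a :: "'b \<Rightarrow> 'b \<Rightarrow> real poly"
  assumes fin: "finite B"
  shows "\<exists>R. R \<noteq> 0 \<and> (\<forall>t k v. (\<exists>m\<in>B. v m \<noteq> 0) \<longrightarrow>
    (\<forall>m\<in>B. k * v m = (\<Sum>m'\<in>B. poly (a m m') t * v m')) \<longrightarrow> poly (poly2 R t) k = 0)"
proof -
  define N where "N = card B"
  obtain e where e: "bij_betw e {0..<N} B" using ex_bij_betw_nat_finite[OF fin] N_def by blast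
  define A where "A = Matrix.mat N N (\<lambda>(i, j). a (e i) (e j))"
  have A: "A \<in> carrier_mat N N" by (simp add: A_def)
  have "char_poly A \<noteq> 0" using degree_monic_char_poly[OF A] by auto
  moreover have "poly (poly2 (char_poly A) t) k = 0"
    if v: "\<exists>m\<in>B. v m \<noteq> 0" "\<forall>m\<in>B. k * v m = (\<Sum>m'\<in>B. poly (a m m') t * v m')" for t k v
  proof -
    have ev: "comm_ring_hom (\<lambda>c :: real poly. poly c t)" by unfold_locales auto
    let ?M = "map_mat (\<lambda>c. poly c t) A"
    define u where "u = Matrix.vec N (\<lambda>i. v (e i))"
    have M: "?M \<in> carrier_mat N N" using A by simp
    have "u \<noteq> 0\<^sub>v N"
    proof
      assume u0: "u = 0\<^sub>v N"
      obtain m where "m \<in> B" "v m \<noteq> 0" using v(1) by blast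
      then obtain i where i: "i < N" "v (e i) \<noteq> 0" using e unfolding bij_betw_def by fastforce
      have "Matrix.vec_index u i = 0" using u0 i(1) by simp
      with i show False by (simp add: u_def)
    qed
    moreover have "?M *\<^sub>v u = k \<cdot>\<^sub>v u"
    proof (rule eq_vecI)
      fix i assume "i < dim_vec (k \<cdot>\<^sub>v u)"
      then have i: "i < N" by (simp add: u_def)
      then have "e i \<in> B" using e bij_betwE by fastforce
      then have "k * v (e i) = (\<Sum>m'\<in>B. poly (a (e i) m') t * v m')" using v(2) by blast
      also have "\<dots> = (\<Sum>j = 0..<N. poly (a (e i) (e j)) t * v (e j))"
        by (rule sum.reindex_bij_betw[OF e, symmetric])
      finally show "Matrix.vec_index (?M *\<^sub>v u) i = Matrix.vec_index (k \<cdot>\<^sub>v u) i"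
        using i by (simp add: u_def A_def scalar_prod_def)
    qed (simp add: u_def A_def)
    ultimately have "eigenvector ?M u k" using M by (simp add: eigenvector_def u_def)
    then have "poly (char_poly ?M) k = 0" using eigenvalue_root_char_poly[OF M] eigenvalue_def by blast
    then show ?thesis by (simp add: comm_ring_hom.char_poly_hom[OF ev A] poly2_def)
  qed
  ultimately show ?thesis by blast
qed

text \<open>Reduction modulo the \<open>Q i\<close> brings every polynomial in the coordinates, up
  to a denominator in t, into the span of the monomials with these exponents.\<close>

definition exponent_box :: "('n::finite \<Rightarrow> real poly poly) \<Rightarrow> ('n \<Rightarrow> nat) set" where
  "exponent_box Q = {m. \<forall>i. m i < degree (Q i)}"

lemma finite_exponent_box: "finite (exponent_box Q)"
proof -
  have "exponent_box Q = (\<Pi>\<^sub>E i\<in>UNIV. {..<degree (Q i)})" by (auto simp: exponent_box_def PiE_def extensional_def)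
  then show ?thesis by (simp add: finite_PiE)
qed

definition mono_fun :: "('n::finite \<Rightarrow> nat) \<Rightarrow> real ^ 'n \<Rightarrow> real" where
  "mono_fun m y = (\<Prod>i\<in>UNIV. y $ i ^ m i)"

text \<open>The functions \<open>h\<close> on the zero set of the polynomials \<open>Q\<^sub>i(t, y\<^sub>i)\<close> such that multiplication by
  some \<open>c(t) h\<close> maps the span of \<open>exponent_box Q\<close> over \<open>\<real>[t]\<close> into itself.\<close>

definition integral_over :: "('n::finite \<Rightarrow> real poly poly) \<Rightarrow> (real \<Rightarrow> real ^ 'n \<Rightarrow> real) \<Rightarrow> bool" where
  "integral_over Q h \<longleftrightarrow> (\<exists>c a. c \<noteq> 0 \<and> (\<forall>t y. (\<forall>i. poly (poly2 (Q i) t) (y $ i) = 0) \<longrightarrow>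
     (\<forall>m\<in>exponent_box Q. poly c t * h t y * mono_fun m y = (\<Sum>m'\<in>exponent_box Q. poly (a m m') t * mono_fun m' y))))"

lemma integral_overE:
  assumes "integral_over Q h"
  obtains c a where "c \<noteq> 0" "\<And>t y m. (\<forall>i. poly (poly2 (Q i) t) (y $ i) = 0) \<Longrightarrow> m \<in> exponent_box Q \<Longrightarrow>
    poly c t * h t y * mono_fun m y = (\<Sum>m'\<in>exponent_box Q. poly (a m m') t * mono_fun m' y)"
proof -
  obtain c a where c: "c \<noteq> 0" and a: "\<forall>t y. (\<forall>i. poly (poly2 (Q i) t) (y $ i) = 0) \<longrightarrow>
     (\<forall>m\<in>exponent_box Q. poly c t * h t y * mono_fun m y = (\<Sum>m'\<in>exponent_box Q. poly (a m m') t * mono_fun m' y))"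
    using assms unfolding integral_over_def by (elim exE conjE)
  show thesis by (rule that[OF c, of a]) (use a in blast)
qed

lemma integral_over_poly: "integral_over Q (\<lambda>t y. poly p t)"
  unfolding integral_over_def
proof (rule exI[of _ 1], rule exI[of _ "\<lambda>m m'. if m' = m then p else 0"], intro conjI allI impI ballI)
  fix t y m assume "m \<in> exponent_box Q"
  then show "poly 1 t * poly p t * mono_fun m y = (\<Sum>m'\<in>exponent_box Q. poly (if m' = m then p else 0) t * mono_fun m' y)"
    by (simp add: if_distrib[of "\<lambda>p. poly p t * _"] finite_exponent_box sum.delta cong: if_cong)
qed simp

text \<open>Sums and products of functions correspond to sums and products of their matrices, over
  the product of the denominators.\<close>

lemma integral_over_add_mult:
  assumes "integral_over Q h" "integral_over Q k"
  shows "integral_over Q (\<lambda>t y. h t y + k t y)" "integral_over Q (\<lambda>t y. h t y * k t y)"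
proof -
  obtain c a where h: "c \<noteq> 0" "\<And>t y m. (\<forall>i. poly (poly2 (Q i) t) (y $ i) = 0) \<Longrightarrow> m \<in> exponent_box Q \<Longrightarrow>
      poly c t * h t y * mono_fun m y = (\<Sum>m'\<in>exponent_box Q. poly (a m m') t * mono_fun m' y)"
    by (rule integral_overE[OF assms(1)]) (rule that; (assumption | iprover))
  obtain d b where k: "d \<noteq> 0" "\<And>t y m. (\<forall>i. poly (poly2 (Q i) t) (y $ i) = 0) \<Longrightarrow> m \<in> exponent_box Q \<Longrightarrow>
      poly d t * k t y * mono_fun m y = (\<Sum>m'\<in>exponent_box Q. poly (b m m') t * mono_fun m' y)"
    by (rule integral_overE[OF assms(2)]) (rule that; (assumption | iprover))
  show "integral_over Q (\<lambda>t y. h t y + k t y)"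
    unfolding integral_over_def
  proof (rule exI[of _ "c * d"], rule exI[of _ "\<lambda>m m'. d * a m m' + c * b m m'"], intro conjI allI impI ballI)
    fix t y m assume z: "\<forall>i. poly (poly2 (Q i) t) (y $ i) = 0" "m \<in> exponent_box Q"
    have "poly (c * d) t * (h t y + k t y) * mono_fun m y
        = poly d t * (poly c t * h t y * mono_fun m y) + poly c t * (poly d t * k t y * mono_fun m y)"
      by (simp add: algebra_simps)
    then show "poly (c * d) t * (h t y + k t y) * mono_fun m y
        = (\<Sum>m'\<in>exponent_box Q. poly (d * a m m' + c * b m m') t * mono_fun m' y)"
      unfolding h(2)[OF z] k(2)[OF z] by (simp add: sum_distrib_left sum.distrib algebra_simps)
  qed (simp add: h k)
  show "integral_over Q (\<lambda>t y. h t y * k t y)"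
    unfolding integral_over_def
  proof (rule exI[of _ "c * d"], rule exI[of _ "\<lambda>m m'. \<Sum>l\<in>exponent_box Q. a m l * b l m'"], intro conjI allI impI ballI)
    fix t y m assume z: "\<forall>i. poly (poly2 (Q i) t) (y $ i) = 0" "m \<in> exponent_box Q"
    have "poly (c * d) t * (h t y * k t y) * mono_fun m y = (poly d t * k t y) * (poly c t * h t y * mono_fun m y)"
      by (simp add: mult_ac)
    also have "\<dots> = (\<Sum>l\<in>exponent_box Q. poly (a m l) t * (poly d t * k t y * mono_fun l y))"
      unfolding h(2)[OF z] by (simp add: sum_distrib_left mult_ac)
    also have "\<dots> = (\<Sum>l\<in>exponent_box Q. \<Sum>m'\<in>exponent_box Q. poly (a m l * b l m') t * mono_fun m' y)"
      by (intro sum.cong refl) (subst k(2)[OF z(1)], assumption, simp add: sum_distrib_left mult.assoc)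
    also have "\<dots> = (\<Sum>m'\<in>exponent_box Q. poly (\<Sum>l\<in>exponent_box Q. a m l * b l m') t * mono_fun m' y)"
      by (subst sum.swap) (simp add: poly_sum sum_distrib_right)
    finally show "poly (c * d) t * (h t y * k t y) * mono_fun m y
        = (\<Sum>m'\<in>exponent_box Q. poly (\<Sum>l\<in>exponent_box Q. a m l * b l m') t * mono_fun m' y)" .
  qed (simp add: h k)
qed

text \<open>Multiplication by \<open>y $ j\<close> raises one exponent; when this leaves the box,
  the equation of \<open>Q j\<close> rewrites the top power, with the leading coefficient as
  denominator.\<close>

lemma integral_over_coordinate:
  assumes Q: "Q j \<noteq> 0"
  shows "integral_over Q (\<lambda>t y. y $ j)"
proof -
  define d where "d = degree (Q j)"
  define c where "c = coeff (Q j) d"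
  \<comment> \<open>The companion matrix of \<open>Q j\<close>, scaled by its leading
    coefficient.\<close>
  define b where "b n k = (if Suc n < d then (if k = Suc n then c else 0) else - coeff (Q j) k)" for n k
  have shift: "poly c t * y $ j * y $ j ^ n = (\<Sum>k<d. poly (b n k) t * y $ j ^ k)"
    if z: "poly (poly2 (Q j) t) (y $ j) = 0" and n: "n < d" for t n and y :: "real ^ 'a"
  proof (cases "Suc n < d")
    case True
    then show ?thesis by (simp add: b_def if_distrib[of "\<lambda>p. poly p t * _"] sum.delta cong: if_cong)
  next
    case False
    with n have n': "Suc n = d" by simp
    have "degree (poly2 (Q j) t) \<le> d" by (rule degree_le) (simp add: coeff_poly2 coeff_eq_0 d_def)
    then have "poly (poly2 (Q j) t) (y $ j) = (\<Sum>k\<le>d. coeff (poly2 (Q j) t) k * y $ j ^ k)"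
      unfolding poly_altdef by (intro sum.mono_neutral_left) (auto simp: coeff_eq_0)
    then have "0 = (\<Sum>k\<le>d. coeff (poly2 (Q j) t) k * y $ j ^ k)" using z by simp
    also have "\<dots> = poly c t * y $ j ^ d + (\<Sum>k<d. poly (coeff (Q j) k) t * y $ j ^ k)"
      by (simp add: lessThan_Suc_atMost[symmetric] coeff_poly2 c_def)
    finally have "poly c t * y $ j ^ d = (\<Sum>k<d. - (poly (coeff (Q j) k) t * y $ j ^ k))"
      by (simp add: sum_negf)
    then show ?thesis using n' False by (auto simp: b_def)
  qed
  have split: "mono_fun (m(j := k)) y = y $ j ^ k * (\<Prod>i\<in>UNIV - {j}. y $ i ^ m i)" for m k and y :: "real ^ 'a"
    unfolding mono_fun_def by (subst prod.remove[of _ j]) (auto intro: prod.cong)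
  define a where "a m m' = (if m' = m(j := m' j) then b (m j) (m' j) else 0)" for m m' :: "'a \<Rightarrow> nat"
  show ?thesis
    unfolding integral_over_def
  proof (rule exI[of _ c], rule exI[of _ a], intro conjI allI impI ballI)
    fix t and y :: "real ^ 'a" and m assume z: "\<forall>i. poly (poly2 (Q i) t) (y $ i) = 0" and m: "m \<in> exponent_box Q"
    have *: "{m' \<in> exponent_box Q. m' = m(j := m' j)} = (\<lambda>k. m(j := k)) ` {..<d}"
      using m by (auto simp: exponent_box_def d_def image_iff split: if_splits)
    have "(\<Sum>m'\<in>exponent_box Q. poly (a m m') t * mono_fun m' y)
        = (\<Sum>m'\<in>{m' \<in> exponent_box Q. m' = m(j := m' j)}. poly (b (m j) (m' j)) t * mono_fun m' y)"
      by (rule sum.mono_neutral_cong_right[OF finite_exponent_box]) (auto simp: a_def)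
    also have "\<dots> = (\<Sum>k<d. poly (b (m j) k) t * mono_fun (m(j := k)) y)"
      unfolding * by (subst sum.reindex) (auto simp: inj_on_def dest: fun_upd_eqD)
    also have "\<dots> = (\<Sum>k<d. poly (b (m j) k) t * y $ j ^ k) * (\<Prod>i\<in>UNIV - {j}. y $ i ^ m i)"
      by (simp add: split sum_distrib_right mult.assoc)
    also have "\<dots> = poly c t * y $ j * y $ j ^ m j * (\<Prod>i\<in>UNIV - {j}. y $ i ^ m i)"
      using shift[of t y "m j"] z m by (simp add: exponent_box_def d_def)
    also have "\<dots> = poly c t * y $ j * mono_fun m y" using split[of m "m j" y] by simp
    finally show "poly c t * y $ j * mono_fun m y = (\<Sum>m'\<in>exponent_box Q. poly (a m m') t * mono_fun m' y)" by simp
  qed (use Q in \<open>simp add: c_def d_def\<close>)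
qed

lemma integral_over_peval:
  assumes Q: "\<And>i. Q i \<noteq> 0"
  shows "integral_over Q (\<lambda>t y. peval q y)"
proof (induction q rule: mpoly_induct)
qed (use integral_over_poly[of Q "[:_:]"] integral_over_add_mult[of Q "\<lambda>t. peval _" "\<lambda>t. peval _"]
  in \<open>auto simp: integral_over_coordinate Q peval_add peval_mult\<close>)

text \<open>Along a branch, H = c h is a root of R(t, y) = y^k R1(t, y), where R1(t, 0) has no zeros
  for small t > 0. So H vanishes exactly where R1(t, H) does not, and its zero set is both closed
  and open in \<open>J\<close>.\<close>

lemma zero_or_nonzero_along_branch:
  assumes Q: "\<And>i. 0 < degree (Q i)" and int: "integral_over Q h"
  shows "\<exists>\<delta>>0. \<forall>J \<gamma>. connected J \<longrightarrow> J \<subseteq> {0<..<\<delta>} \<longrightarrow> continuous_on J (\<lambda>t. h t (\<gamma> t)) \<longrightarrow>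
    (\<forall>t\<in>J. \<forall>i. poly (poly2 (Q i) t) (\<gamma> t $ i) = 0) \<longrightarrow>
    (\<forall>t\<in>J. h t (\<gamma> t) = 0) \<or> (\<forall>t\<in>J. h t (\<gamma> t) \<noteq> 0)"
proof -
  obtain c a where c: "c \<noteq> 0" and a: "\<And>t y m. (\<forall>i. poly (poly2 (Q i) t) (y $ i) = 0) \<Longrightarrow> m \<in> exponent_box Q \<Longrightarrow>
      poly c t * h t y * mono_fun m y = (\<Sum>m'\<in>exponent_box Q. poly (a m m') t * mono_fun m' y)"
    by (rule integral_overE[OF int]) (rule that; (assumption | iprover))
  obtain R where R: "R \<noteq> 0" "\<forall>t k v. (\<exists>m\<in>exponent_box Q. v m \<noteq> 0) \<longrightarrow>
    (\<forall>m\<in>exponent_box Q. k * v m = (\<Sum>m'\<in>exponent_box Q. poly (a m m') t * v m')) \<longrightarrow> poly (poly2 R t) k = 0"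
    using eigenvalue_relation[OF finite_exponent_box, of Q a] by (elim exE conjE)
  have root: "poly (poly2 R t) (poly c t * h t y) = 0" if "\<forall>i. poly (poly2 (Q i) t) (y $ i) = 0" for t y
  proof (rule R(2)[rule_format, of "\<lambda>m. mono_fun m y"])
    \<comment> \<open>The constant monomial has value 1 and lies in the box, because all degrees are
      positive.\<close>
    show "\<exists>m\<in>exponent_box Q. mono_fun m y \<noteq> 0"
      by (rule bexI[of _ "\<lambda>_. 0"]) (use Q in \<open>auto simp: mono_fun_def exponent_box_def\<close>)
  qed (use a that in blast)
  obtain R1 where R1: "R = [:0, 1:] ^ order 0 R * R1" "\<not> [:0, 1:] dvd R1"
    using order_decomp[OF R(1), of 0] by auto
  have "poly R1 0 \<noteq> 0" using R1(2) by (simp add: poly_eq_0_iff_dvd)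
  from eventually_poly_nonzero[OF this] eventually_poly_nonzero[OF c]
  have "eventually (\<lambda>t. poly (poly R1 0) t \<noteq> 0 \<and> poly c t \<noteq> 0) (at_right 0)" by eventually_elim simp
  then obtain \<delta> where \<delta>: "\<delta> > 0" "\<And>t. 0 < t \<Longrightarrow> t < \<delta> \<Longrightarrow> poly (poly R1 0) t \<noteq> 0 \<and> poly c t \<noteq> 0"
    unfolding eventually_at_right_field by auto
  have "(\<forall>t\<in>J. h t (\<gamma> t) = 0) \<or> (\<forall>t\<in>J. h t (\<gamma> t) \<noteq> 0)"
    if conn: "connected J" and J: "J \<subseteq> {0<..<\<delta>}" and cont: "continuous_on J (\<lambda>t. h t (\<gamma> t))"
      and br: "\<forall>t\<in>J. \<forall>i. poly (poly2 (Q i) t) (\<gamma> t $ i) = 0" for J \<gamma>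
  proof -
    define H where "H t = poly c t * h t (\<gamma> t)" for t
    have cH: "continuous_on J H" unfolding H_def by (intro continuous_intros cont)
    have "continuous_on J (\<lambda>t. (\<lambda>p. poly (poly2 R1 (fst p)) (snd p)) (t, H t))"
      by (rule continuous_on_compose2[OF continuous_on_poly2[of UNIV]]) (intro continuous_on_Pair continuous_on_id cH, simp)
    then have cR: "continuous_on J (\<lambda>t. poly (poly2 R1 t) (H t))" by simp
    have val: "H t ^ order 0 R * poly (poly2 R1 t) (H t) = 0" if "t \<in> J" for t
    proof -
      have "poly (poly2 R t) (H t) = 0" unfolding H_def using root br that by blast
      moreover have "poly2 [:0, 1 :: real poly:] t = [:0, 1:]" by (simp add: poly2_pCons)
      ultimately show ?thesis
        by (subst (asm) R1(1)) (simp add: poly2_mult poly2_hom.hom_power)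
    qed
    have at0: "poly (poly2 R1 t) 0 = poly (poly R1 0) t" for t by (simp add: poly_0_coeff_0 coeff_poly2)
    have iff: "H t \<noteq> 0 \<longleftrightarrow> poly (poly2 R1 t) (H t) = 0" if t: "t \<in> J" for t
    proof
      assume "H t \<noteq> 0" then show "poly (poly2 R1 t) (H t) = 0" using val[OF t] by simp
    next
      assume "poly (poly2 R1 t) (H t) = 0"
      then show "H t \<noteq> 0" using \<delta>(2)[of t] J t at0[of t] by auto
    qed
    have "closedin (top_of_set J) {t \<in> J. H t = 0}"
      by (rule continuous_closedin_preimage_constant[OF cH])
    moreover have "closedin (top_of_set J) {t \<in> J. poly (poly2 R1 t) (H t) = 0}"
      by (rule continuous_closedin_preimage_constant[OF cR])
    then have "openin (top_of_set J) (J - {t \<in> J. poly (poly2 R1 t) (H t) = 0})" by (simp add: openin_diff)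
    moreover have "J - {t \<in> J. poly (poly2 R1 t) (H t) = 0} = {t \<in> J. H t = 0}" using iff by auto
    ultimately have "{t \<in> J. H t = 0} = {} \<or> {t \<in> J. H t = 0} = J"
      using conn unfolding connected_clopen by auto
    moreover have "H t = 0 \<longleftrightarrow> h t (\<gamma> t) = 0" if "t \<in> J" for t
      using \<delta>(2)[of t] J that by (auto simp: H_def)
    ultimately show ?thesis by blast
  qed
  with \<delta>(1) show ?thesis by blast
qed

section \<open>The variety near the point as a union of branches\<close>

definition sqdist_poly :: "real ^ 'n \<Rightarrow> ('n::finite, real) mpoly" where
  "sqdist_poly a = (\<Sum>i\<in>UNIV. (Var i - Const (a $ i)) * (Var i - Const (a $ i)))"

lemma peval_sqdist_poly: "peval (sqdist_poly a) x = (norm (x - a))\<^sup>2"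
  unfolding sqdist_poly_def
  by (simp only: peval_sum peval_mult peval_diff peval_Var peval_Const)
    (simp add: norm_eq_sqrt_inner inner_vec_def power2_eq_square sum_nonneg)

lemma eventually_all_at_right:
  fixes P :: "'b::finite \<Rightarrow> real \<Rightarrow> bool"
  assumes "\<And>i. eventually (P i) (at_right 0)"
  shows "\<exists>\<delta>>0. \<forall>t. 0 < t \<longrightarrow> t < \<delta> \<longrightarrow> (\<forall>i. P i t)"
  using eventually_all_finite[of "\<lambda>t i. P i t" "at_right 0"] assms
  unfolding eventually_at_right_field by blast

text \<open>The curve through \<open>x0\<close> is assembled from implicit branches in the single
  coordinates, so it could leave \<open>V\<close>. The defining polynomials vanish at
  \<open>x0\<close>, and the dichotomy along branches then keeps the curve inside. Conversely, the
  coordinates of points of \<open>V\<close> near \<open>x0\<close> are roots of the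
  \<open>Q i\<close>, and uniqueness of the implicit branches puts these points on the
  curve.\<close>

lemma exists_local_branches:
  fixes a :: "real ^ 'n::finite" and V :: "(real ^ 'n) set"
  assumes rel: "\<And>i. \<exists>P. P \<noteq> 0 \<and> (\<forall>x\<in>V. poly (poly2 P ((norm (x - a))\<^sup>2)) (x $ i) = 0)"
    and B: "finite B" and R0: "R0 > 0" and VB: "V \<inter> cball a R0 = V_R B \<inter> cball a R0"
  shows "\<exists>R>0. \<forall>x0\<in>V. 0 < norm (x0 - a) \<longrightarrow> norm (x0 - a) < R \<longrightarrow>
    (\<exists>\<eta> W D. \<eta> > 0 \<and> open W \<and> x0 \<in> W \<and>
      (\<forall>t\<in>{(norm (x0 - a))\<^sup>2 - \<eta><..<(norm (x0 - a))\<^sup>2 + \<eta>}. D 0 t \<in> V \<inter> W \<and> (norm (D 0 t - a))\<^sup>2 = t \<and>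
        (\<forall>k :: nat. (D k has_vector_derivative D (Suc k) t) (at t))) \<and>
      (\<forall>x\<in>V \<inter> W. x = D 0 ((norm (x - a))\<^sup>2)))"
proof -
  let ?T = "\<lambda>x. (norm (x - a))\<^sup>2"
  obtain P where P: "\<And>i. P i \<noteq> 0" "\<And>i x. x \<in> V \<Longrightarrow> poly (poly2 (P i) (?T x)) (x $ i) = 0"
    using rel by metis
  define good where "good i q t \<longleftrightarrow> (\<forall>y. (poly (poly2 (P i) t) y = 0 \<longrightarrow> poly (poly2 q t) y = 0) \<and>
    (poly (poly2 q t) y = 0 \<longrightarrow> poly (poly2 (pderiv q) t) y \<noteq> 0))" for i q t
  have "\<exists>q. q \<noteq> 0 \<and> eventually (good i q) (at_right 0)" for i
    unfolding good_def by (rule exists_squarefree_part[OF P(1)])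
  then obtain Q where Q: "\<And>i. Q i \<noteq> 0" "\<And>i. eventually (good i (Q i)) (at_right 0)" by metis
  obtain \<delta>0 where \<delta>0: "\<delta>0 > 0" "\<And>t i. 0 < t \<Longrightarrow> t < \<delta>0 \<Longrightarrow> good i (Q i) t"
    using eventually_all_at_right[of "\<lambda>i. good i (Q i)", OF Q(2)] by metis
  \<comment> \<open>An additional factor y makes the degree positive even if \<open>Q i\<close> is
    constant in y.\<close>
  define Q' where "Q' i = pCons 0 (Q i)" for i
  have Q': "0 < degree (Q' i)" "Q' i \<noteq> 0" for i using Q(1) by (auto simp: Q'_def)
  have Q'0: "poly (poly2 (Q' i) t) y = 0" if "poly (poly2 (Q i) t) y = 0" for i t y
    using that by (simp add: Q'_def poly2_pCons)
  define dich where "dich h \<delta> \<longleftrightarrow> (\<forall>J \<gamma>. connected J \<longrightarrow> J \<subseteq> {0<..<\<delta>} \<longrightarrow> continuous_on J (\<lambda>t. h t (\<gamma> t)) \<longrightarrow>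
    (\<forall>t\<in>J. \<forall>i. poly (poly2 (Q' i) t) (\<gamma> t $ i) = 0) \<longrightarrow>
    (\<forall>t\<in>J. h t (\<gamma> t) = 0) \<or> (\<forall>t\<in>J. h t (\<gamma> t) \<noteq> 0))" for h :: "real \<Rightarrow> real ^ 'n \<Rightarrow> real" and \<delta>
  have "\<exists>\<delta>>0. dich h \<delta>" if "integral_over Q' h" for h
    unfolding dich_def by (rule zero_or_nonzero_along_branch[OF Q'(1) that])
  note ex = this
  have "\<forall>q. \<exists>\<delta>>0. dich (\<lambda>t. peval q) \<delta>" using ex[OF integral_over_peval[of Q', OF Q'(2)]] by blast
  then obtain dq where dq: "\<And>q. dq q > 0" "\<And>q. dich (\<lambda>t. peval q) (dq q)" by metis
  \<comment> \<open>The function |y - a|^2 - t; where it vanishes, the parameter is the squared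
    distance.\<close>
  have "integral_over Q' (\<lambda>t y. peval (sqdist_poly a) y + poly [:0, -1:] t)"
    by (intro integral_over_add_mult integral_over_peval integral_over_poly Q')
  from ex[OF this] obtain \<delta>1 where \<delta>1: "\<delta>1 > 0" "dich (\<lambda>t y. peval (sqdist_poly a) y + poly [:0, -1:] t) \<delta>1" by blast
  \<comment> \<open>A bound for the squared distance, so the radius becomes \<open>sqrt m\<close>; a
    positive minimum, because \<open>B\<close> is finite.\<close>
  define m where "m = Min (insert \<delta>0 (insert \<delta>1 (insert (R0\<^sup>2) (dq ` B))))"
  have fin: "finite (insert \<delta>0 (insert \<delta>1 (insert (R0\<^sup>2) (dq ` B))))" using B by simp
  have m: "m > 0" "m \<le> \<delta>0" "m \<le> \<delta>1" "m \<le> R0\<^sup>2" "\<And>q. q \<in> B \<Longrightarrow> m \<le> dq q"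
    using fin \<delta>0(1) \<delta>1(1) R0 dq(1) Min_le[OF fin] unfolding m_def by (auto simp del: Min_insert)
  have dichD: "\<forall>t\<in>J. h t (\<gamma> t) = 0"
    if h: "dich h \<delta>" "m \<le> \<delta>" and J: "connected J" "J \<subseteq> {0<..<m}" "continuous_on J (\<lambda>t. h t (\<gamma> t))"
      and br: "\<forall>t\<in>J. \<forall>i. poly (poly2 (Q i) t) (\<gamma> t $ i) = 0" and t0: "t0 \<in> J" "h t0 (\<gamma> t0) = 0" for h \<delta> J \<gamma> t0
  proof -
    have "J \<subseteq> {0<..<\<delta>}" using J(2) h(2) by force
    then have "(\<forall>t\<in>J. h t (\<gamma> t) = 0) \<or> (\<forall>t\<in>J. h t (\<gamma> t) \<noteq> 0)"
      using h(1) J(1,3) br Q'0 unfolding dich_def by blast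
    then show ?thesis using t0 by blast
  qed
  have main: "\<exists>\<eta> W D. \<eta> > 0 \<and> open W \<and> x0 \<in> W \<and>
      (\<forall>t\<in>{?T x0 - \<eta><..<?T x0 + \<eta>}. D 0 t \<in> V \<inter> W \<and> ?T (D 0 t) = t \<and>
        (\<forall>k :: nat. (D k has_vector_derivative D (Suc k) t) (at t))) \<and>
      (\<forall>x\<in>V \<inter> W. x = D 0 (?T x))" if x0: "x0 \<in> V" "0 < norm (x0 - a)" "norm (x0 - a) < sqrt m" for x0
  proof -
    define t0 where "t0 = ?T x0"
    have t0: "0 < t0" "t0 < m" using x0(2,3) m(1) real_less_rsqrt[of "norm (x0 - a)" m] by (auto simp: t0_def real_sqrt_less_iff dest: power_strict_mono[of _ _ 2])
    have QV: "poly (poly2 (Q i) (?T x)) (x $ i) = 0" "poly (poly2 (pderiv (Q i)) (?T x)) (x $ i) \<noteq> 0"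
      if "x \<in> V" "0 < ?T x" "?T x < m" for x i
      using P(2)[OF that(1), of i] \<delta>0(2)[of "?T x" i] that(2,3) m(2) by (auto simp: good_def)
    define local_branch where "local_branch i \<eta> W \<gamma> D \<longleftrightarrow> \<eta> > 0 \<and> open W \<and> (t0, x0 $ i) \<in> W \<and> D 0 = \<gamma> \<and>
      (\<forall>t\<in>{t0 - \<eta><..<t0 + \<eta>}. (t, \<gamma> t) \<in> W \<and> poly (poly2 (Q i) t) (\<gamma> t) = 0 \<and>
        (\<forall>k. (D k has_real_derivative D (Suc k) t) (at t)) \<and>
        (\<forall>y. (t, y) \<in> W \<longrightarrow> poly (poly2 (Q i) t) y = 0 \<longrightarrow> y = \<gamma> t))" for i \<eta> W \<gamma> and D :: "nat \<Rightarrow> real \<Rightarrow> real"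
    have "\<exists>\<eta> W \<gamma> D. local_branch i \<eta> W \<gamma> D" for i
      unfolding local_branch_def by (rule implicit_branch) (use QV[OF x0(1)] t0 in \<open>auto simp: t0_def\<close>)
    then obtain e U g d where br: "\<And>i. local_branch i (e i) (U i) (g i) (d i)" by metis
    have e: "e i > 0" and U: "open (U i)" "(t0, x0 $ i) \<in> U i" and d0: "d i 0 = g i"
      and loc: "\<forall>t\<in>{t0 - e i<..<t0 + e i}. (t, g i t) \<in> U i \<and> poly (poly2 (Q i) t) (g i t) = 0 \<and>
        (\<forall>k. (d i k has_real_derivative d i (Suc k) t) (at t)) \<and>
        (\<forall>y. (t, y) \<in> U i \<longrightarrow> poly (poly2 (Q i) t) y = 0 \<longrightarrow> y = g i t)" for i
      using br[of i, unfolded local_branch_def] by - (elim conjE, assumption)+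
    define \<eta> where "\<eta> = Min (insert t0 (insert (m - t0) (range e)))"
    have \<eta>: "\<eta> > 0" "\<eta> \<le> t0" "\<eta> \<le> m - t0" "\<And>i. \<eta> \<le> e i"
      unfolding \<eta>_def using e t0 by (auto intro!: Min_le simp del: Min_insert)
    define J where "J = {t0 - \<eta><..<t0 + \<eta>}"
    have J: "connected J" "J \<subseteq> {0<..<m}" "t0 \<in> J" "open J" using \<eta> by (auto simp: J_def)
    have loc': "(t, g i t) \<in> U i" "poly (poly2 (Q i) t) (g i t) = 0"
      "(d i k has_real_derivative d i (Suc k) t) (at t)"
      "(t, y) \<in> U i \<Longrightarrow> poly (poly2 (Q i) t) y = 0 \<Longrightarrow> y = g i t" if "t \<in> J" for t i k y
      using loc[of i] that \<eta>(4)[of i] by (auto simp: J_def)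
    define D :: "nat \<Rightarrow> real \<Rightarrow> real ^ 'n" where "D k t = (\<chi> i. d i k t)" for k t
    have D0: "D 0 t $ i = g i t" for t i by (simp add: D_def d0)
    have dD: "(D k has_vector_derivative D (Suc k) t) (at t)" if "t \<in> J" for k t
    proof -
      have "((\<lambda>t. d i k t) has_derivative (\<lambda>h. h * d i (Suc k) t)) (at t)" for i
        using loc'(3)[OF that] by (simp add: has_field_derivative_def mult_commute_abs)
      then show ?thesis
        unfolding has_vector_derivative_def by (intro has_derivative_vecI) (simp add: D_def)
    qed
    have contD: "continuous_on J (D 0)"
      by (intro continuous_at_imp_continuous_on ballI has_vector_derivative_continuous[OF dD])
    have x0D: "D 0 t0 = x0"
      unfolding Finite_Cartesian_Product.vec_eq_iff D0
      using loc'(4)[OF J(3) U(2)] QV(1)[OF x0(1)] t0 by (auto simp: t0_def)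
    have br: "\<forall>t\<in>J. \<forall>i. poly (poly2 (Q i) t) (D 0 t $ i) = 0" using loc'(2) by (simp add: D0)
    \<comment> \<open>The function vanishes at \<open>t0\<close>, where the curve passes through
      \<open>x0\<close>, hence on all of \<open>J\<close>.\<close>
    have "\<forall>t\<in>J. peval (sqdist_poly a) (D 0 t) + poly [:0, -1:] t = 0"
      by (rule dichD[OF \<delta>1(2) m(3) J(1,2) _ br J(3)])
        (auto simp: peval_sqdist_poly x0D x0D[unfolded t0_def] t0_def intro!: continuous_intros contD)
    then have T: "?T (D 0 t) = t" if "t \<in> J" for t using that by (auto simp: peval_sqdist_poly)
    have inR0: "x \<in> cball a R0" if "?T x < m" for x
    proof -
      have "(norm (x - a))\<^sup>2 \<le> R0\<^sup>2" using that m(4) by simp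
      then have "norm (x - a) \<le> R0" using R0 power2_le_imp_le by (meson less_imp_le)
      then show ?thesis by (simp only: cball_eq)
    qed
    have "\<forall>t\<in>J. peval q (D 0 t) = 0" if q: "q \<in> B" for q
    proof (rule dichD[OF dq(2) m(5)[OF q] J(1,2) _ br J(3)])
      show "continuous_on J (\<lambda>t. peval q (D 0 t))"
        by (rule continuous_peval[OF contD])
      have "x0 \<in> V_R B \<inter> cball a R0" unfolding VB[symmetric] using x0(1) inR0[of x0] t0(2) unfolding t0_def by blast
      then show "peval q (D 0 t0) = 0" using q by (simp add: x0D zero_set_def)
    qed
    then have "D 0 t \<in> V_R B" if "t \<in> J" for t using that unfolding zero_set_def by blast
    moreover have "D 0 t \<in> cball a R0" if "t \<in> J" for t
      using inR0[of "D 0 t"] T[OF that] subsetD[OF J(2) that] by simp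
    ultimately have DV: "D 0 t \<in> V" if "t \<in> J" for t using VB that by blast
    \<comment> \<open>The uniqueness regions of the implicit branches, pulled back along the map
      from x to its squared distance and one coordinate.\<close>
    define W where "W = {x. ?T x \<in> J} \<inter> (\<Inter>i. {x. (?T x, x $ i) \<in> U i})"
    have cT: "continuous_on UNIV ?T" by (intro continuous_intros)
    have "open W" unfolding W_def
    proof (intro open_Int open_INT ballI)
      show "open {x. ?T x \<in> J}" using continuous_on_open_vimage[of UNIV ?T] cT J(4) by (auto simp: vimage_def)
      fix i
      have "continuous_on UNIV (\<lambda>x. (?T x, x $ i))" by (intro continuous_intros)
      then show "open {x. (?T x, x $ i) \<in> U i}" using continuous_on_open_vimage[of UNIV "\<lambda>x. (?T x, x $ i)"] U(1) by (auto simp: vimage_def)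
    qed simp
    moreover have "x0 \<in> W" using J(3) U(2) by (auto simp: W_def t0_def)
    moreover have "D 0 t \<in> V \<inter> W \<and> ?T (D 0 t) = t \<and> (\<forall>k. (D k has_vector_derivative D (Suc k) t) (at t))" if "t \<in> J" for t
      using DV[OF that] T[OF that] dD[OF that] loc'(1)[OF that] that by (auto simp: W_def D0)
    moreover have "x = D 0 (?T x)" if x: "x \<in> V \<inter> W" for x
      unfolding Finite_Cartesian_Product.vec_eq_iff D0
    proof
      fix i
      have tJ: "?T x \<in> J" using x by (simp add: W_def)
      show "x $ i = g i (?T x)"
        by (rule loc'(4)[OF tJ]) (use x tJ J(2) QV(1)[of x i] in \<open>auto simp: W_def\<close>)
    qed
    ultimately show ?thesis unfolding t0_def[symmetric]
      by (intro exI[of _ \<eta>] exI[of _ W] exI[of _ D] conjI ballI \<eta>(1)) (auto simp only: J_def)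
  qed
  show ?thesis
  proof (rule exI[of _ "sqrt m"], intro conjI ballI impI)
    show "0 < sqrt m" using m(1) by simp
  qed (rule main)
qed

text \<open>By \<open>exists_local_branches\<close> the variety is locally a curve parametrized by
  the squared distance itself: an affine change of this parameter gives charts, and the squared
  distance has no critical point.\<close>

lemma exists_step3_radius:
  fixes a :: "real ^ 'n::finite"
  assumes rel: "\<And>i. \<exists>P. P \<noteq> 0 \<and> (\<forall>x\<in>V_R I. poly (poly2 P ((norm (x - a))\<^sup>2)) (x $ i) = 0)"
    and B: "finite B" and R0: "R0 > 0" and VB: "V_R I \<inter> cball a R0 = V_R B \<inter> cball a R0"
  shows "\<exists>R. step3_radius I a R"
proof -
  let ?T = "\<lambda>x. (norm (x - a))\<^sup>2"
  let ?V = "V_R I :: (real ^ 'n) set"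
  obtain R where R: "R > 0" and branches: "\<forall>x0\<in>?V. 0 < norm (x0 - a) \<longrightarrow> norm (x0 - a) < R \<longrightarrow>
    (\<exists>\<eta> W D. \<eta> > 0 \<and> open W \<and> x0 \<in> W \<and>
      (\<forall>t\<in>{?T x0 - \<eta><..<?T x0 + \<eta>}. D 0 t \<in> ?V \<inter> W \<and> ?T (D 0 t) = t \<and>
        (\<forall>k :: nat. (D k has_vector_derivative D (Suc k) t) (at t))) \<and>
      (\<forall>x\<in>?V \<inter> W. x = D 0 (?T x)))"
    using exists_local_branches[OF rel B R0 VB] by (elim exE conjE)
  \<comment> \<open>Half of \<open>R\<close>, so that branches through points of the sphere of
    radius \<rho> extend beyond it; boundary points then arise only from the cut by the
    ball.\<close>
  define \<rho> where "\<rho> = R / 2"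
  have \<rho>: "\<rho> > 0" "\<rho> < R" using R by (auto simp: \<rho>_def)
  define M where "M = ?V \<inter> cball a \<rho> - {a}"
  have cT: "continuous_on U ?T" for U by (intro continuous_intros)
  have M: "x \<in> M \<longleftrightarrow> x \<in> ?V \<and> 0 < ?T x \<and> ?T x \<le> \<rho>\<^sup>2" for x
    unfolding M_def using \<rho>(1) by (auto simp: dist_norm norm_minus_commute abs_le_square_iff[symmetric])
  have dT: "(?T has_derivative (\<lambda>h. 2 * ((x - a) \<bullet> h))) (at x within U)" for x :: "real ^ 'n" and U
    unfolding power2_norm_eq_inner by (auto intro!: derivative_eq_intros simp: inner_commute)
  have "((\<exists>\<phi>. curve_chart M x0 {-1<..<1} \<phi>) \<or> (x0 \<in> sphere a \<rho> \<and> (\<exists>\<phi>. curve_chart M x0 {0..<1} \<phi>))) \<and>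
    \<not> critical_point M ?T x0" if x0: "x0 \<in> M" for x0
  proof -
    define t0 where "t0 = ?T x0"
    have x0': "x0 \<in> ?V" "0 < t0" "t0 \<le> \<rho>\<^sup>2" using x0 M by (auto simp: t0_def)
    have nx0: "0 < norm (x0 - a)" "norm (x0 - a) \<le> \<rho>" using x0' \<rho>(1) power2_le_imp_le[of "norm (x0 - a)" \<rho>] by (auto simp: t0_def)
    have "\<exists>\<eta> W D. \<eta> > 0 \<and> open W \<and> x0 \<in> W \<and>
      (\<forall>t\<in>{t0 - \<eta><..<t0 + \<eta>}. D 0 t \<in> ?V \<inter> W \<and> ?T (D 0 t) = t \<and>
        (\<forall>k :: nat. (D k has_vector_derivative D (Suc k) t) (at t))) \<and>
      (\<forall>x\<in>?V \<inter> W. x = D 0 (?T x))"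
      unfolding t0_def using branches[rule_format, OF x0'(1) nx0(1) le_less_trans[OF nx0(2) \<rho>(2)]] .
    then obtain \<eta> W D where \<eta>: "\<eta> > 0" and W: "open W" "x0 \<in> W"
      and D: "\<forall>t\<in>{t0 - \<eta><..<t0 + \<eta>}. D 0 t \<in> ?V \<inter> W \<and> ?T (D 0 t) = t \<and>
        (\<forall>k :: nat. (D k has_vector_derivative D (Suc k) t) (at t))"
      and uniq: "\<forall>x\<in>?V \<inter> W. x = D 0 (?T x)" by (elim exE conjE)
    let ?J = "{t0 - \<eta><..<t0 + \<eta>}"
    have DV: "D 0 t \<in> ?V" "D 0 t \<in> W" and DT: "?T (D 0 t) = t" and dD: "(D k has_vector_derivative D (Suc k) t) (at t)"
      if "t \<in> ?J" for t k using D that by blast+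
    have D1: "D 1 t \<noteq> 0" if t: "t \<in> ?J" for t
    proof
      assume 0: "D 1 t = 0"
      have "(D 0 has_derivative (\<lambda>h. h *\<^sub>R D 1 t)) (at t)" using dD[OF t, of 0] by (simp add: has_vector_derivative_def)
      from has_derivative_compose[OF this dT] have "((\<lambda>t. ?T (D 0 t)) has_derivative (\<lambda>h. 0)) (at t)"
        by (simp add: 0[unfolded One_nat_def])
      moreover have "((\<lambda>t. ?T (D 0 t)) has_derivative (\<lambda>h. h)) (at t)"
        by (rule has_derivative_transform_within_open[OF has_derivative_ident open_greaterThanLessThan t]) (use DT in auto)
      ultimately have "(\<lambda>h :: real. 0) = (\<lambda>h. h)" by (rule has_derivative_unique)
      then show False by (metis zero_neq_one)
    qed
    \<comment> \<open>Open and half-open charts are treated together. The bounds on \<open>c\<close>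
      keep the parameter \<open>t0 + c * s\<close> positive and in the domain of the branch.\<close>
    have chart: "curve_chart M x0 J (\<lambda>s. D 0 (t0 + c * s))"
      if J: "J \<subseteq> {-1<..<1}" "0 \<in> J" "\<And>s. \<bar>s\<bar> < 1 \<Longrightarrow> s \<in> J \<longleftrightarrow> t0 + c * s \<le> \<rho>\<^sup>2" and c: "c \<noteq> 0" "\<bar>c\<bar> \<le> \<eta>" "\<bar>c\<bar> \<le> t0" for J c
    proof -
      have s1: "\<bar>s\<bar> < 1" if "s \<in> J" for s using subsetD[OF J(1) that] by (simp add: abs_less_iff)
      have cs: "\<bar>c * s\<bar> < \<bar>c\<bar>" if "s \<in> J" for s
        using s1[OF that] c(1) by (simp add: abs_mult)
      have tJ: "t0 + c * s \<in> ?J" "0 < t0 + c * s" if "s \<in> J" for s using cs[OF that] c by (auto simp: abs_if split: if_splits)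
      define U where "U = W \<inter> {x. \<bar>?T x - t0\<bar> < \<bar>c\<bar>}"
      have "open {x. \<bar>?T x - t0\<bar> < \<bar>c\<bar>}" by (intro open_Collect_less continuous_intros)
      then have "open U" using W(1) by (simp add: U_def open_Int)
      moreover have "homeomorphism J (M \<inter> U) (\<lambda>s. D 0 (t0 + c * s)) (\<lambda>x. (?T x - t0) / c)"
      proof (rule homeomorphismI)
        have "continuous_on ?J (D 0)" by (intro continuous_at_imp_continuous_on ballI has_vector_derivative_continuous[OF dD])
        then show "continuous_on J (\<lambda>s. D 0 (t0 + c * s))"
          by (rule continuous_on_compose2) (use tJ in \<open>auto intro!: continuous_intros\<close>)
        show "continuous_on (M \<inter> U) (\<lambda>x. (?T x - t0) / c)" by (intro continuous_intros ballI c(1))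
        show "(\<lambda>s. D 0 (t0 + c * s)) ` J \<subseteq> M \<inter> U"
        proof
          fix x assume "x \<in> (\<lambda>s. D 0 (t0 + c * s)) ` J"
          then obtain s where s: "s \<in> J" "x = D 0 (t0 + c * s)" by blast
          have "t0 + c * s \<le> \<rho>\<^sup>2" using J(3)[OF s1] s(1) by blast
          then show "x \<in> M \<inter> U" using s tJ[OF s(1)] cs[OF s(1)] DV DT[OF tJ(1)[OF s(1)]] by (simp add: M U_def)
        qed
        have inverse: "(?T x - t0) / c \<in> J \<and> D 0 (t0 + c * ((?T x - t0) / c)) = x" if x: "x \<in> M \<inter> U" for x
        proof -
          have "t0 + c * ((?T x - t0) / c) = ?T x" using c(1) by simp
          moreover have "\<bar>(?T x - t0) / c\<bar> < 1" using x c(1) by (simp add: U_def)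
          moreover have "?T x \<le> \<rho>\<^sup>2" "x \<in> ?V \<inter> W" using x M by (auto simp: U_def)
          ultimately show ?thesis using J(3)[of "(?T x - t0) / c"] uniq by (metis (no_types))
        qed
        then show "(\<lambda>x. (?T x - t0) / c) ` (M \<inter> U) \<subseteq> J" "\<And>x. x \<in> M \<inter> U \<Longrightarrow> D 0 (t0 + c * ((?T x - t0) / c)) = x" by blast+
        show "(?T (D 0 (t0 + c * s)) - t0) / c = s" if "s \<in> J" for s
          using DT[OF tJ(1)[OF that]] c(1) by simp
      qed
      moreover have "\<exists>E :: nat \<Rightarrow> real \<Rightarrow> real ^ 'n. E 0 = (\<lambda>s. D 0 (t0 + c * s)) \<and>
        (\<forall>k. \<forall>t\<in>J. (E k has_vector_derivative E (Suc k) t) (at t within J)) \<and> (\<forall>t\<in>J. E 1 t \<noteq> 0)"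
      proof (rule exI[of _ "\<lambda>k s. c ^ k *\<^sub>R D k (t0 + c * s)"], intro conjI allI ballI)
        fix k s assume s: "s \<in> J"
        have "((\<lambda>s. t0 + c * s) has_real_derivative c) (at s within J)" by (auto intro!: derivative_eq_intros)
        moreover have "(D k has_vector_derivative D (Suc k) (t0 + c * s)) (at (t0 + c * s) within (\<lambda>s. t0 + c * s) ` J)"
          using dD[OF tJ(1)[OF s]] by (rule has_vector_derivative_at_within)
        ultimately have "((D k \<circ> (\<lambda>s. t0 + c * s)) has_vector_derivative c *\<^sub>R D (Suc k) (t0 + c * s)) (at s within J)"
          by (intro vector_diff_chain_within) (simp add: has_real_derivative_iff_has_vector_derivative)
        then have "((\<lambda>s. c ^ k *\<^sub>R D k (t0 + c * s)) has_vector_derivative c ^ k *\<^sub>R c *\<^sub>R D (Suc k) (t0 + c * s)) (at s within J)"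
          unfolding o_def by (rule bounded_linear.has_vector_derivative[OF bounded_linear_scaleR_right])
        then show "((\<lambda>s. c ^ k *\<^sub>R D k (t0 + c * s)) has_vector_derivative c ^ Suc k *\<^sub>R D (Suc k) (t0 + c * s)) (at s within J)"
          by (simp add: mult.commute)
      next
        fix s assume "s \<in> J"
        then show "c ^ 1 *\<^sub>R D 1 (t0 + c * s) \<noteq> 0" using D1[OF tJ(1)] c(1) by simp
      qed simp
      moreover have "D 0 (t0 + c * 0) = x0" using uniq[rule_format, of x0] x0'(1) W(2) by (simp add: t0_def)
      ultimately show ?thesis unfolding curve_chart_def using J(2) by blast
    qed
    have "(\<exists>\<phi>. curve_chart M x0 {-1<..<1} \<phi>) \<or> (x0 \<in> sphere a \<rho> \<and> (\<exists>\<phi>. curve_chart M x0 {0..<1} \<phi>))"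
    proof (cases "t0 = \<rho>\<^sup>2")
      case True
      \<comment> \<open>Negative, so that the half-open chart runs from the sphere inwards.\<close>
      define c where "c = - min \<eta> t0"
      have c: "c < 0" "\<bar>c\<bar> \<le> \<eta>" "\<bar>c\<bar> \<le> t0" using \<eta> x0'(2) by (auto simp: c_def)
      have "curve_chart M x0 {0..<1} (\<lambda>s. D 0 (t0 + c * s))"
        by (rule chart) (use c True in \<open>auto simp: mult_le_0_iff\<close>)
      moreover have "norm (x0 - a) = \<rho>" using True \<rho>(1) by (simp add: t0_def)
      then have "x0 \<in> sphere a \<rho>" by (simp only: sphere_eq)
      ultimately show ?thesis by blast
    next
      case False
      \<comment> \<open>The bound by the distance of \<open>t0\<close> to the end of the range keeps
        the open chart inside the ball.\<close>
      define c where "c = min \<eta> (min t0 (\<rho>\<^sup>2 - t0))"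
      have c: "c > 0" "c \<le> \<eta>" "c \<le> t0" "c \<le> \<rho>\<^sup>2 - t0" using False x0' \<eta> by (auto simp: c_def)
      have "c * s \<le> c" if "\<bar>s\<bar> < 1" for s using that c(1) by auto
      then have "t0 + c * s \<le> \<rho>\<^sup>2" if "\<bar>s\<bar> < 1" for s using that c(4) by (smt (verit))
      then have "curve_chart M x0 {-1<..<1} (\<lambda>s. D 0 (t0 + c * s))"
        by (intro chart) (use c in auto)
      then show ?thesis by blast
    qed
    \<comment> \<open>A critical point may be witnessed by any chart. Near 0 a chart equals the
      branch evaluated at its squared distance, so a vanishing derivative of the latter would make
      its velocity vanish.\<close>
    moreover have "\<not> critical_point M ?T x0"
    proof
      assume "critical_point M ?T x0"
      then obtain J \<phi> where J: "J = {-1<..<1} \<or> J = {0..<1}" and ch: "curve_chart M x0 J \<phi>"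
        and crit: "((\<lambda>t. ?T (\<phi> t)) has_real_derivative 0) (at 0 within J)"
        unfolding critical_point_def by blast
      obtain U \<psi> E where *: "0 \<in> J" "\<phi> 0 = x0" "homeomorphism J (M \<inter> U) \<phi> \<psi>" "E 0 = \<phi>"
        "\<forall>k :: nat. \<forall>t\<in>J. (E k has_vector_derivative E (Suc k) t) (at t within J)" "\<forall>t\<in>J. E 1 t \<noteq> 0"
        using ch unfolding curve_chart_def by blast
      have dE: "(\<phi> has_vector_derivative E 1 0) (at 0 within J)" using *(1,4,5) by fastforce
      have inM: "\<phi> s \<in> M" if "s \<in> J" for s using *(3) that unfolding homeomorphism_def by blast
      have "((\<phi>) \<longlongrightarrow> x0) (at 0 within J)"
        using has_vector_derivative_continuous[OF dE] *(2) by (simp add: continuous_within)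
      then have "eventually (\<lambda>s. \<phi> s \<in> W) (at 0 within J)" using W by (rule topological_tendstoD)
      then have ev: "eventually (\<lambda>s. D 0 (?T (\<phi> s)) = \<phi> s) (at 0 within J)"
        using uniq inM M by (auto simp: eventually_at_filter elim!: eventually_mono)
      have t0J: "t0 \<in> ?J" using \<eta> by simp
      have "(D 0 has_vector_derivative D 1 t0) (at (?T (\<phi> 0)) within (\<lambda>s. ?T (\<phi> s)) ` J)"
        using dD[OF t0J, of 0] by (auto simp: *(2) t0_def intro: has_vector_derivative_at_within)
      from vector_diff_chain_within[OF crit[unfolded has_real_derivative_iff_has_vector_derivative] this]
      have "((\<lambda>s. D 0 (?T (\<phi> s))) has_vector_derivative 0) (at 0 within J)" by (simp add: o_def)
      then have "(\<phi> has_vector_derivative 0) (at 0 within J)"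
        unfolding has_vector_derivative_def
        by (rule has_derivative_transform_eventually[OF _ ev]) (use uniq x0' W *(1,2) in auto)
      moreover have "at 0 within J \<noteq> bot"
        using J by (auto simp: trivial_limit_within islimpt_Ico at_within_open)
      ultimately have "E 1 0 = 0" using vector_derivative_unique_within dE by blast
      then show False using *(1,6) by blast
    qed
    ultimately show ?thesis by blast
  qed
  then have "step3_radius I a \<rho>" unfolding step3_radius_def smooth_curve_def M_def[symmetric] using \<rho>(1) by blast
  then show ?thesis ..
qed

subsection \<open>The ideal of the first step\<close>

lemma zero_set_of_real: "(\<chi> i. complex_of_real (x $ i)) \<in> V_C I \<longleftrightarrow> x \<in> V_R I"
  by (simp add: zero_set_def peval_of_real)

lemma closed_V_R: "closed (V_R I)"
proof -
  have "V_R I = (\<Inter>p\<in>I. {x. peval p x = 0})" by (auto simp: zero_set_def)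
  moreover have "closed {x :: real ^ 'a. peval p x = 0}" for p
    by (intro closed_Collect_eq continuous_peval continuous_on_id continuous_on_const)
  ultimately show ?thesis by (simp add: closed_INT)
qed

text \<open>The closure behind \<open>ideal_G\<close> is taken over the complex numbers; embedding
  the real points carries the first inclusion over.\<close>

lemma V_R_ideal_G:
  "V_R (ideal_Gamma f gs xs) - V_R (ideal_Sigma f gs) \<subseteq> V_R (ideal_G f gs xs)"
  "V_R (ideal_G f gs xs) \<subseteq> V_R (ideal_Gamma f gs xs)"
proof -
  let ?W = "V_C (ideal_Gamma f gs xs) - V_C (ideal_Sigma f gs)"
  have sub: "?W \<subseteq> zariski_closure ?W"
    by (auto simp: zariski_closure_def vanishing_ideal_def zero_set_def)
  show "V_R (ideal_Gamma f gs xs) - V_R (ideal_Sigma f gs) \<subseteq> V_R (ideal_G f gs xs)"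
  proof
    fix x :: "real ^ 'a"
    assume "x \<in> V_R (ideal_Gamma f gs xs) - V_R (ideal_Sigma f gs)"
    then have "(\<chi> i. complex_of_real (x $ i)) \<in> ?W" by (simp add: zero_set_of_real)
    with sub have "(\<chi> i. complex_of_real (x $ i)) \<in> V_C (ideal_G f gs xs)"
      unfolding ideal_G_def vanishing_ideal_def zero_set_def[of "{p. _ p}"] by blast
    then show "x \<in> V_R (ideal_G f gs xs)" by (simp only: zero_set_of_real)
  qed
  have "ideal_Gamma f gs xs \<subseteq> ideal_G f gs xs"
    unfolding ideal_G_def zariski_closure_def vanishing_ideal_def zero_set_def by blast
  then show "V_R (ideal_G f gs xs) \<subseteq> V_R (ideal_Gamma f gs xs)" unfolding zero_set_def by blast
qed

lemma subspace_vanishing_ideal: "mpoly_module.subspace (vanishing_ideal V)"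
  unfolding mpoly_module.subspace_def vanishing_ideal_def by (simp add: peval_add peval_mult)

lemma subspace_step1_ideal: "mpoly_module.subspace (step1_ideal f gs xs)"
  unfolding step1_ideal_def ideal_Gamma_def ideal_G_def ideal_gen_def
  by (simp add: subspace_vanishing_ideal mpoly_module.subspace_span)

context kkt_point
begin

lemma tangency_points_in_V_R_G:
  assumes R: "step2_radius f gs xs R"
  shows "tangency_set f gs xs \<inter> cball xs R - {xs} \<subseteq> V_R (ideal_G f gs xs)"
proof -
  have "V_R (ideal_Sigma f gs) \<inter> cball xs R = {xs}" using R by (simp add: step2_radius_def)
  then show ?thesis using V_R_ideal_G(1)[of f gs xs] unfolding tangency_set_eq by blast
qed

lemma exists_V_R_G_point:
  assumes R: "step2_radius f gs xs R" and \<rho>: "0 < \<rho>" "\<rho> < R"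
  shows "\<exists>x\<in>V_R (ideal_G f gs xs). norm (x - xs) = \<rho>"
proof -
  obtain x where x: "x \<in> tangency_set f gs xs" "x \<in> sphere xs \<rho>" using extrema_on_sphere(1)[OF R \<rho>] by blast
  then have n: "norm (x - xs) = \<rho>" by (simp only: sphere_eq)
  then have "x \<noteq> xs" using \<rho>(1) by auto
  moreover have "x \<in> cball xs R" using n \<rho>(2) by (simp only: cball_eq)
  ultimately show ?thesis using tangency_points_in_V_R_G[OF R] x(1) n by blast
qed

text \<open>\<open>xs\<close> is a limit of points of Gamma off Sigma on small spheres, and real
  zero sets are closed.\<close>

lemma xs_in_V_R_G: "xs \<in> V_R (ideal_G f gs xs)"
proof -
  obtain R where R: "step2_radius f gs xs R" using step2_radius_exists by blast
  then have R0: "R > 0" by (simp add: step2_radius_def)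
  have "\<exists>y\<in>V_R (ideal_G f gs xs). dist y xs < e" if e: "e > 0" for e
  proof -
    have "0 < min (e / 2) (R / 2)" "min (e / 2) (R / 2) < R" using e R0 by (auto simp: min_def)
    from exists_V_R_G_point[OF R this] obtain x where "x \<in> V_R (ideal_G f gs xs)" "norm (x - xs) = min (e / 2) (R / 2)"
      by blast
    then show ?thesis using e by (intro bexI[of _ x]) (auto simp: dist_norm)
  qed
  then have "xs \<in> closure (V_R (ideal_G f gs xs))" by (simp add: closure_approachable)
  then show ?thesis by (simp add: closed_V_R)
qed

text \<open>Every sphere of small radius meets the set.\<close>

lemma infinite_V_R_G: "infinite (V_R (ideal_G f gs xs))"
proof
  obtain R where R: "step2_radius f gs xs R" using step2_radius_exists by blast
  then have R0: "R > 0" by (simp add: step2_radius_def)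
  assume "finite (V_R (ideal_G f gs xs))"
  then have "finite ((\<lambda>x. norm (x - xs)) ` V_R (ideal_G f gs xs))" by (rule finite_imageI)
  moreover have "{0<..<R} \<subseteq> (\<lambda>x. norm (x - xs)) ` V_R (ideal_G f gs xs)"
  proof
    fix \<rho> assume "\<rho> \<in> {0<..<R}"
    then show "\<rho> \<in> (\<lambda>x. norm (x - xs)) ` V_R (ideal_G f gs xs)" using exists_V_R_G_point[OF R, of \<rho>] by auto
  qed
  ultimately show False using infinite_Ioo[OF R0] finite_subset by blast
qed

text \<open>Supplies \<open>agree\<close> for either choice of the ideal: inside the radius only
  \<open>xs\<close> lies on Sigma, and \<open>xs\<close> itself belongs to the closure.\<close>

lemma V_R_step1_ideal:
  assumes R: "step2_radius f gs xs R"
  shows "V_R (step1_ideal f gs xs) \<inter> cball xs R = tangency_set f gs xs \<inter> cball xs R"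
proof (cases "has_hilbert_dim (ideal_Gamma f gs xs) 1")
  case True
  then show ?thesis by (simp add: step1_ideal_def tangency_set_eq)
next
  case False
  then show ?thesis using tangency_points_in_V_R_G[OF R] xs_in_V_R_G V_R_ideal_G(2)[of f gs xs] ideal_set_members(3)
    unfolding step1_ideal_def tangency_set_eq by auto
qed

lemma step3_radius_exists:
  assumes s1: "step1_success f gs xs"
  shows "\<exists>R. step3_radius (step1_ideal f gs xs) xs R"
proof -
  let ?I = "step1_ideal f gs xs"
  have "has_hilbert_dim ?I 1" using s1 by (auto simp: step1_success_def step1_ideal_def)
  then obtain C where C: "\<And>s. card (std_upto ?I s) \<le> C * (s + 1)"
    using hilbert_dim_1_imp_linear_bound[OF subspace_step1_ideal] by blast
  have rel: "\<exists>P. P \<noteq> 0 \<and> (\<forall>x\<in>V_R ?I. poly (poly2 P ((norm (x - xs))\<^sup>2)) (x $ i) = 0)" for i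
    using exists_relation[OF subspace_step1_ideal C, of "sqdist_poly xs" "Var i"] by (simp add: peval_sqdist_poly)
  \<comment> \<open>The generators of \<open>ideal_Gamma\<close> serve for \<open>ideal_G\<close> as
    well, because the two real zero sets agree inside the radius of Step 2.\<close>
  define B where "B = (if length gs = CARD('n) - 1 then set gs
    else set gs \<union> maximal_minors (pgrad f # map pgrad gs @ [pdiff xs]))"
  have "finite B" by (simp add: B_def finite_maximal_minors)
  have "ideal_Gamma f gs xs = ideal_gen B" by (simp add: ideal_Gamma_def B_def)
  then have T: "tangency_set f gs xs = V_R B" by (simp only: tangency_set_eq zero_set_ideal_gen)
  obtain R where R: "step2_radius f gs xs R" using step2_radius_exists by blast
  then have "R > 0" by (simp add: step2_radius_def)
  then show ?thesis by (rule exists_step3_radius[OF rel \<open>finite B\<close>]) (use V_R_step1_ideal[OF R] T in simp)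
qed

lemma algorithm_correct:
  assumes "step2_radius f gs xs R1" "step3_radius (step1_ideal f gs xs) xs R2" "0 < r" "r < min R1 R2"
  shows "\<exists>fmin fmax t. is_min_value (peval f) (tangency_set f gs xs \<inter> sphere xs r) fmin \<and>
      is_max_value (peval f) (tangency_set f gs xs \<inter> sphere xs r) fmax \<and>
      step5 fmin fmax (peval f xs) = Some t \<and> (\<forall>t'. has_type f gs xs t' \<longleftrightarrow> t' = t)"
    and "faithful_radius f gs xs r" "condition_C f gs xs r"
proof -
  interpret admissible_radii f gs xs "step1_ideal f gs xs" R1 R2 r
    by unfold_locales (use assms V_R_step1_ideal in auto)
  show "\<exists>fmin fmax t. is_min_value (peval f) (tangency_set f gs xs \<inter> sphere xs r) fmin \<and>
      is_max_value (peval f) (tangency_set f gs xs \<inter> sphere xs r) fmax \<and>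
      step5 fmin fmax (peval f xs) = Some t \<and> (\<forall>t'. has_type f gs xs t' \<longleftrightarrow> t' = t)"
    "faithful_radius f gs xs r" "condition_C f gs xs r"
    by (rule type_from_sphere faithful condition_C_holds)+
qed

end

subsection \<open>Linear changes of coordinates\<close>

lemma grad_linear_subst: "grad (linear_subst A p) x = Finite_Cartesian_Product.transpose A *v grad p (A *v x)"
  by (simp add: Finite_Cartesian_Product.vec_eq_iff grad_def pgrad_def partial_deriv_linear_subst
      matrix_vector_mult_def Finite_Cartesian_Product.transpose_def peval_linear_subst_real)

lemma vec_dep_iff_sum: "vec_dep vs \<longleftrightarrow> (\<exists>c. (\<exists>j<length vs. c j \<noteq> 0) \<and> (\<Sum>j<length vs. c j *\<^sub>R vs ! j) = 0)"
  for vs :: "(real ^ 'n::finite) list"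
  unfolding vec_dep_def col_dep_def Finite_Cartesian_Product.vec_eq_iff by (auto simp: sum_component)

lemma matrix_vector_mult_lincomb: "B *v (\<Sum>j\<in>J. c j *\<^sub>R v j) = (\<Sum>j\<in>J. c j *\<^sub>R (B *v v j))"
  for B :: "real ^ 'n ^ 'm::finite"
  by (simp add: linear_sum[OF matrix_vector_mul_linear] matrix_vector_mult_scaleR)

lemma vec_dep_matrix_image:
  fixes B :: "real ^ 'n ^ 'n::finite"
  assumes "invertible B"
  shows "vec_dep (map ((*v) B) vs) \<longleftrightarrow> vec_dep vs"
proof -
  have inj: "B *v u = 0 \<longleftrightarrow> u = 0" for u
    using assms by (metis matrix_left_invertible_ker invertible_def matrix_vector_mult_0_right)
  have "(\<Sum>j<length vs. c j *\<^sub>R map ((*v) B) vs ! j) = B *v (\<Sum>j<length vs. c j *\<^sub>R vs ! j)" for c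
    by (simp add: matrix_vector_mult_lincomb)
  then show ?thesis by (simp add: vec_dep_iff_sum inj)
qed

context kkt_point
begin

context
  fixes A :: "real ^ 'n ^ 'n"
  assumes A: "invertible A"
begin

abbreviation "fA \<equiv> linear_subst A f"
abbreviation "gA \<equiv> map (linear_subst A) gs"
abbreviation "xA \<equiv> matrix_inv A *v xs"

lemma A_inv: "A *v (matrix_inv A *v x) = x" "matrix_inv A *v (A *v x) = x"
proof -
  have "A ** matrix_inv A = Finite_Cartesian_Product.mat 1 \<and> matrix_inv A ** A = Finite_Cartesian_Product.mat 1"
    unfolding matrix_inv_def by (rule someI_ex) (use A in \<open>simp add: invertible_def\<close>)
  then show "A *v (matrix_inv A *v x) = x" "matrix_inv A *v (A *v x) = x"
    by (simp_all add: matrix_vector_mul_assoc)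
qed

lemma A_eq_iff: "A *v x = y \<longleftrightarrow> x = matrix_inv A *v y"
  using A_inv by metis

lemma continuous_matrix: "continuous_on U ((*v) B)" for B :: "real ^ 'n ^ 'n"
  by (intro linear_continuous_on matrix_vector_mul_bounded_linear)

lemma isolated_transfer: "xA isolated_in {x. A *v x \<in> S} \<longleftrightarrow> xs isolated_in S"
proof
  assume "xs isolated_in S"
  then obtain T where T: "xs \<in> S" "open T" "T \<inter> S = {xs}" unfolding isolated_in_def by blast
  have "open ((*v) A -` T)" using continuous_on_open_vimage[of UNIV "(*v) A"] continuous_matrix T(2) by auto
  moreover have "(*v) A -` T \<inter> {x. A *v x \<in> S} = {xA}" using T(3) A_eq_iff by auto
  ultimately show "xA isolated_in {x. A *v x \<in> S}" unfolding isolated_in_def using T(1) A_inv by auto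
next
  assume "xA isolated_in {x. A *v x \<in> S}"
  then obtain T where T: "xs \<in> S" "open T" "T \<inter> {x. A *v x \<in> S} = {xA}" unfolding isolated_in_def using A_inv by auto
  have "open ((*v) (matrix_inv A) -` T)" using continuous_on_open_vimage[of UNIV "(*v) (matrix_inv A)"] continuous_matrix T(2) by auto
  moreover have "(*v) (matrix_inv A) -` T \<inter> S = {xs}"
  proof -
    have "y \<in> (*v) (matrix_inv A) -` T \<inter> S \<longleftrightarrow> matrix_inv A *v y \<in> T \<inter> {x. A *v x \<in> S}" for y by (simp add: A_inv)
    then have "y \<in> (*v) (matrix_inv A) -` T \<inter> S \<longleftrightarrow> matrix_inv A *v y = xA" for y unfolding T(3) by simp
    moreover have "matrix_inv A *v y = xA \<longleftrightarrow> y = xs" for y using A_inv(1) by metis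
    ultimately show ?thesis by blast
  qed
  ultimately show "xs isolated_in S" unfolding isolated_in_def using T(1) by blast
qed

lemma feasible_set_transfer: "feasible_set gA = {x. A *v x \<in> feasible_set gs}"
  by (simp add: feasible_set_def peval_linear_subst_real)

lemma kkt_set_transfer: "kkt_set fA gA = {x. A *v x \<in> kkt_set f gs}"
proof -
  let ?B = "Finite_Cartesian_Product.transpose A"
  have inj: "?B *v u = ?B *v v \<longleftrightarrow> u = v" for u v
    using transpose_invertible[of A] A by (metis inj_matrix_vector_mult inj_eq)
  have "(\<Sum>i<length gA. lam i *\<^sub>R grad (gA ! i) x) = ?B *v (\<Sum>i<length gs. lam i *\<^sub>R grad (gs ! i) (A *v x))" for lam x
    unfolding matrix_vector_mult_lincomb by (intro sum.cong) (simp_all add: grad_linear_subst)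
  then show ?thesis
    unfolding kkt_set_def grad_linear_subst by (simp only: feasible_set_transfer inj mem_Collect_eq)
qed

text \<open>Spheres, radii and the tangency set depend on the Euclidean metric and are not
  transported by \<open>A\<close>. The hypotheses are, so the local results apply afresh to the new
  data.\<close>

lemma kkt_point_transfer: "kkt_point fA gA xA"
proof
  show "length gA \<le> CARD('n) - 1" using few by simp
  show "xA \<in> feasible_set gA" using feasible by (simp add: feasible_set_transfer A_inv)
  show "xA isolated_in kkt_set fA gA" unfolding kkt_set_transfer isolated_transfer by (rule isolated)
  show "\<not> xA isolated_in feasible_set gA" unfolding feasible_set_transfer isolated_transfer by (rule not_isolated)
  have eq: "map (\<lambda>g. grad g xA) gA = map ((*v) (Finite_Cartesian_Product.transpose A)) (map (\<lambda>g. grad g xs) gs)"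
    by (simp add: grad_linear_subst A_inv)
  show "LICQ gA xA" using licq unfolding LICQ_iff eq vec_dep_matrix_image[OF transpose_invertible[OF A]] .
qed

text \<open>Being a minimizer or a maximizer is a local statement of one form, carried along by
  \<open>A\<close>; the third type is the joint negation of these two.\<close>

lemma has_type_transfer: "has_type fA gA xA t \<longleftrightarrow> has_type f gs xs t"
proof -
  have push: "\<exists>U. open U \<and> xs \<in> U \<and> (\<forall>x\<in>U. matrix_inv A *v x \<in> U')" if "open U'" "xA \<in> U'" for U'
    using continuous_on_open_vimage[of UNIV "(*v) (matrix_inv A)"] continuous_matrix that
    by (intro exI[of _ "(*v) (matrix_inv A) -` U'"]) auto
  have pull: "\<exists>U'. open U' \<and> xA \<in> U' \<and> (\<forall>x\<in>U'. A *v x \<in> U)" if "open U" "xs \<in> U" for U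
    using continuous_on_open_vimage[of UNIV "(*v) A"] continuous_matrix that
    by (intro exI[of _ "(*v) A -` U"]) (auto simp: A_inv)
  have loc: "(\<exists>U'. open U' \<and> xA \<in> U' \<and> (\<forall>x\<in>feasible_set gA \<inter> U'. P (A *v x))) \<longleftrightarrow>
    (\<exists>U. open U \<and> xs \<in> U \<and> (\<forall>x\<in>feasible_set gs \<inter> U. P x))" for P
  proof
    assume "\<exists>U'. open U' \<and> xA \<in> U' \<and> (\<forall>x\<in>feasible_set gA \<inter> U'. P (A *v x))"
    then obtain U' where U': "open U'" "xA \<in> U'" "\<And>x. A *v x \<in> feasible_set gs \<Longrightarrow> x \<in> U' \<Longrightarrow> P (A *v x)"
      unfolding feasible_set_transfer by blast
    obtain U where U: "open U" "xs \<in> U" "\<And>x. x \<in> U \<Longrightarrow> matrix_inv A *v x \<in> U'" using push[OF U'(1,2)] by blast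
    have "P x" if "x \<in> feasible_set gs \<inter> U" for x
      using U'(3)[of "matrix_inv A *v x"] U(3)[of x] that by (simp add: A_inv)
    with U show "\<exists>U. open U \<and> xs \<in> U \<and> (\<forall>x\<in>feasible_set gs \<inter> U. P x)" by blast
  next
    assume "\<exists>U. open U \<and> xs \<in> U \<and> (\<forall>x\<in>feasible_set gs \<inter> U. P x)"
    then obtain U where U: "open U" "xs \<in> U" "\<forall>x\<in>feasible_set gs \<inter> U. P x" by blast
    from pull[OF U(1,2)] U(3) show "\<exists>U'. open U' \<and> xA \<in> U' \<and> (\<forall>x\<in>feasible_set gA \<inter> U'. P (A *v x))"
      unfolding feasible_set_transfer by blast
  qed
  have ev: "has_type f gs xs Not_Extremum \<longleftrightarrow> \<not> has_type f gs xs Local_Minimizer \<and> \<not> has_type f gs xs Local_Maximizer"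
    for f :: "('n, real) mpoly" and gs xs
  proof -
    have "\<not> has_type f gs xs Local_Minimizer \<longleftrightarrow> (\<forall>U. open U \<and> xs \<in> U \<longrightarrow> (\<exists>u\<in>feasible_set gs \<inter> U. peval f u < peval f xs))"
      "\<not> has_type f gs xs Local_Maximizer \<longleftrightarrow> (\<forall>U. open U \<and> xs \<in> U \<longrightarrow> (\<exists>u\<in>feasible_set gs \<inter> U. peval f xs < peval f u))"
      by (simp add: not_le, blast)+
    moreover have "(\<exists>u\<in>X. \<exists>v\<in>X. P u \<and> Q v) \<longleftrightarrow> (\<exists>u\<in>X. P u) \<and> (\<exists>v\<in>X. Q v)" for X and P Q :: "real ^ 'n \<Rightarrow> bool"
      by blast
    ultimately show ?thesis by (simp only: has_type.simps(3) imp_conjR all_conj_distrib)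
  qed
  have min: "has_type fA gA xA Local_Minimizer \<longleftrightarrow> has_type f gs xs Local_Minimizer"
    using loc[of "\<lambda>x. peval f xs \<le> peval f x"] by (simp add: peval_linear_subst_real A_inv)
  have max: "has_type fA gA xA Local_Maximizer \<longleftrightarrow> has_type f gs xs Local_Maximizer"
    using loc[of "\<lambda>x. peval f x \<le> peval f xs"] by (simp add: peval_linear_subst_real A_inv)
  show ?thesis using min max ev by (cases t) (simp_all only:)
qed

end

end

subsection \<open>The generic change of coordinates\<close>

definition only_vars :: "'v set \<Rightarrow> ('v, 'a::zero) mpoly \<Rightarrow> bool" where
  "only_vars S p \<longleftrightarrow> (\<forall>m\<in>Poly_Mapping.keys p. \<forall>k. k \<notin> S \<longrightarrow> expo m k = 0)"

lemma only_vars_Const: "only_vars S (Const c)"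
  by (simp add: only_vars_def Const_def)

lemma only_vars_Var: "i \<in> S \<Longrightarrow> only_vars S (Var i)"
  by (auto simp: only_vars_def Var_def lookup_single when_def)

lemma only_vars_add: "only_vars S p \<Longrightarrow> only_vars S q \<Longrightarrow> only_vars S (p + q)"
  for p q :: "('v, 'a::comm_ring_1) mpoly"
  unfolding only_vars_def using Poly_Mapping.keys_add[of p q] by blast

lemma only_vars_mult:
  fixes p q :: "('v, 'a::comm_ring_1) mpoly"
  assumes "only_vars S p" "only_vars S q" shows "only_vars S (p * q)"
  unfolding only_vars_def
proof (intro ballI allI impI)
  fix m k assume m: "m \<in> Poly_Mapping.keys (p * q)" and k: "k \<notin> S"
  obtain a b where "m = a + b" "a \<in> Poly_Mapping.keys p" "b \<in> Poly_Mapping.keys q" using keys_mult[of p q] m by blast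
  with assms k show "expo m k = 0" by (simp add: only_vars_def lookup_add)
qed

lemma only_vars_eval_with_Const:
  fixes p :: "('w::finite, real) mpoly" and q :: "'w \<Rightarrow> ('v::finite, real) mpoly"
  assumes "\<And>w. only_vars S (q w)"
  shows "only_vars S (eval_with Const p q)"
  by (induction p rule: mpoly_induct)
    (auto simp: Const_hom.eval_with_add Const_hom.eval_with_mult assms only_vars_Const only_vars_add only_vars_mult)

text \<open>The matrix variables are set to \<open>M\<close>, all others to the entries of the fixed
  real point \<open>w0\<close>: what remains of a polynomial is a condition on
  \<open>M\<close>.\<close>

definition substitute_matrix ::
    "real ^ ((('n + 'n) + ('n \<times> 'n)) option) \<Rightarrow> complex ^ 'n ^ 'n \<Rightarrow> complex ^ ((('n + 'n) + ('n \<times> 'n :: finite)) option)" where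
  "substitute_matrix w0 M = (\<chi> w. case w of Some (Inr (a, b)) \<Rightarrow> M $ a $ b | _ \<Rightarrow> of_real (w0 $ w))"

text \<open>The product of the finitely many specialised polynomials is a single polynomial in the
  entries of \<open>M\<close>.\<close>

lemma zariski_open_substitute_matrix:
  assumes "finite Q"
  shows "complex_zariski_open {M. \<forall>p\<in>Q. peval p (substitute_matrix w0 M) \<noteq> 0}"
proof -
  interpret ch: comm_semiring_hom "\<lambda>r. Const (complex_of_real r)"
    by unfold_locales (simp_all add: Const_hom.hom_add Const_hom.hom_mult)
  interpret ih: comm_semiring_hom "\<lambda>z :: complex. z" by unfold_locales auto
  define \<phi> :: "(('a + 'a) + ('a \<times> 'a)) option \<Rightarrow> ('a \<times> 'a, complex) mpoly" where
    "\<phi> w = (case w of Some (Inr ab) \<Rightarrow> Var ab | _ \<Rightarrow> Const (of_real (w0 $ w)))" for w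
  have \<phi>: "eval_with (\<lambda>z. z) (\<phi> w) (\<lambda>(i, j). M $ i $ j) = substitute_matrix w0 M $ w" for w and M :: "complex ^ 'a ^ 'a"
    by (auto simp: \<phi>_def substitute_matrix_def split: option.split sum.split)
  have "eval_with (\<lambda>z. z) (eval_with (\<lambda>r. Const (complex_of_real r)) p \<phi>) (\<lambda>(i, j). M $ i $ j) = peval p (substitute_matrix w0 M)" for p M
    by (induction p rule: mpoly_induct)
      (simp_all add: ch.eval_with_add ch.eval_with_mult ih.eval_with_add ih.eval_with_mult peval_add peval_mult \<phi>)
  then have "eval_with (\<lambda>z. z) (\<Prod>p\<in>Q. eval_with (\<lambda>r. Const (complex_of_real r)) p \<phi>) (\<lambda>(i, j). M $ i $ j)
      = (\<Prod>p\<in>Q. peval p (substitute_matrix w0 M))" for M by (simp only: ih.eval_with_prod)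
  then have "{M. \<forall>p\<in>Q. peval p (substitute_matrix w0 M) \<noteq> 0} =
      {M. \<exists>P\<in>{\<Prod>p\<in>Q. eval_with (\<lambda>r. Const (complex_of_real r)) p \<phi>}. eval_with (\<lambda>z. z) P (\<lambda>(i, j). M $ i $ j) \<noteq> 0}"
    by (simp only: bex_simps prod_zero_iff[OF assms] bex_empty simp_thms)
  then show ?thesis unfolding complex_zariski_open_def id_def by blast
qed

lemma det_of_complexify: "Determinants.det (complexify A) = of_real (Determinants.det A)"
proof -
  have "complex_of_real (of_int (sign p)) = of_int (sign p)" for p :: "'a \<Rightarrow> 'a" by simp
  then show ?thesis
    unfolding Determinants.det_def by (simp only: complexify_def vec_lambda_beta of_real_sum of_real_mult of_real_prod)
qed

text \<open>Invertibility of the matrix becomes the nonvanishing of one more polynomial in the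
  variables of the relations.\<close>

definition det_poly :: "((('n + 'n) + ('n \<times> 'n :: finite)) option, real) mpoly" where
  "det_poly = Determinants.det (\<chi> a b. Var (Some (Inr (a, b))))"

lemma peval_det_poly:
  "peval (det_poly :: ((('n + 'n) + ('n \<times> 'n :: finite)) option, real) mpoly) w = Determinants.det (\<chi> a b :: 'n. w $ Some (Inr (a, b)))"
proof -
  have "peval (of_int (sign p)) w = of_int (sign p)" for p :: "'n \<Rightarrow> 'n" by (simp add: sign_def peval_uminus)
  then show ?thesis by (simp add: det_poly_def Determinants.det_def peval_sum peval_mult peval_prod)
qed

lemma det_poly_nonzero: "(det_poly :: ((('n + 'n) + ('n \<times> 'n :: finite)) option, real) mpoly) \<noteq> 0"
proof
  assume 0: "(det_poly :: ((('n + 'n) + ('n \<times> 'n)) option, real) mpoly) = 0"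
  define w :: "real ^ ((('n + 'n) + ('n \<times> 'n)) option)" where "w = (\<chi> v. case v of Some (Inr (a, b)) \<Rightarrow> if a = b then 1 else 0 | _ \<Rightarrow> 0)"
  have "(\<chi> a b :: 'n. w $ Some (Inr (a, b))) = Finite_Cartesian_Product.mat 1" by (simp add: w_def Finite_Cartesian_Product.mat_def)
  then show False using peval_det_poly[of w] 0 by simp
qed

lemma pgrad_at_linear_subst:
  "pgrad_at (linear_subst A p) x = Finite_Cartesian_Product.transpose (complexify A) *v pgrad_at p (complexify A *v x)"
proof -
  have eq: "(\<chi> i. \<Sum>j\<in>UNIV. of_real (A $ i $ j) * x $ j) = complexify A *v x"
    by (simp add: matrix_vector_mult_def complexify_def)
  have "pgrad_at (linear_subst A p) x = (\<chi> i. \<Sum>k\<in>UNIV. of_real (A $ k $ i) * peval (partial_deriv k p) (complexify A *v x))"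
    unfolding pgrad_at_def partial_deriv_linear_subst eq ..
  also have "\<dots> = Finite_Cartesian_Product.transpose (complexify A) *v pgrad_at p (complexify A *v x)"
    unfolding matrix_vector_mult_def[of "Finite_Cartesian_Product.transpose _"]
    by (simp only: pgrad_at_def Finite_Cartesian_Product.transpose_def vec_lambda_beta complexify_def)
  finally show ?thesis .
qed

context kkt_point
begin

text \<open>Off Sigma the gradients of the new data are independent, so on Gamma the difference of
  \<open>x\<close> and the new KKT point is a combination of them. They are images of the old
  gradients under the transpose of \<open>A\<close>; applying \<open>A\<close> gives the equations
  of \<open>kkt_map_x\<close>. The combination is nonzero, because otherwise \<open>x\<close> would
  be the KKT point itself, which lies on Sigma.\<close>

lemma kkt_relation:
  assumes e: "inj_on e {..<Suc (length gs)}"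
    and F: "\<forall>x c A b. invertible A \<and>
      \<not> col_dep (\<lambda>k i. peval (partial_deriv i ((f # gs) ! Suc k)) (A *v x)) (length (f # gs) - 1) \<and>
      grad_comb (f # gs) e (A *v x) c \<noteq> 0 \<and> fst (kkt_map_x (f # gs) e xs (x, c, A)) = 0 \<and>
      (\<forall>a. a \<noteq> e 0 \<longrightarrow> snd (kkt_map_x (f # gs) e xs (x, c, A)) $ a = 0) \<longrightarrow>
      peval F (kkt_vals i j (e 0) b (x, c, A)) = 0"
    and A: "invertible A" "invertible (complexify A)"
    and x: "x \<in> V_C (ideal_Gamma (fA A) (gA A) (xA A)) - V_C (ideal_Sigma (fA A) (gA A))"
  shows "\<exists>c. \<forall>b. peval F (kkt_vals i j (e 0) b (x, c, complexify A)) = 0"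
proof -
  let ?ps = "f # gs" and ?M = "complexify A" and ?B = "Finite_Cartesian_Product.transpose (complexify A)"
  let ?xA = "\<chi> i. complex_of_real (xA A $ i)"
  let ?vs = "map (\<lambda>p. pgrad_at p x) (fA A # gA A)"
  have feas: "feasible_in (gA A) x" and dep: "vec_dep (?vs @ [x - ?xA])" and indep: "\<not> vec_dep ?vs"
    using x by (auto simp: zero_set_ideals)
  have vs: "?vs ! k = ?B *v pgrad_at (?ps ! k) (?M *v x)" if "k < Suc (length gs)" for k
    using that by (cases k) (simp_all add: pgrad_at_linear_subst)
  have len: "length ?vs = Suc (length gs)" by simp
  obtain c where c: "\<And>i. (x - ?xA) $ i = (\<Sum>k<Suc (length gs). c k * ?vs ! k $ i)"
    using dep unfolding vec_dep_rotate1 vec_dep_Cons[OF indep] len by blast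
  \<comment> \<open>The coefficients at the places \<open>e k\<close> and 0 elsewhere, as the second
    component of \<open>kkt_map\<close> demands.\<close>
  define c' where "c' = (\<chi> a. if a \<in> e ` {..<Suc (length gs)} then c (the_inv_into {..<Suc (length gs)} e a) else 0)"
  have c'e: "c' $ e k = c k" if "k < Suc (length gs)" for k
    using that by (simp add: c'_def the_inv_into_f_f[OF e])
  define q where "q = grad_comb ?ps e (?M *v x) c'"
  have q: "q = (\<Sum>k<Suc (length gs). c k *s pgrad_at (?ps ! k) (?M *v x))"
    unfolding q_def grad_comb_def by (rule sum.cong) (simp_all add: c'e)
  have xq: "x - ?xA = ?B *v q"
  proof -
    have "?B *v q = (\<Sum>k<Suc (length gs). c k *s (?B *v pgrad_at (?ps ! k) (?M *v x)))"
      unfolding q by (simp only: vec.linear_sum[OF matrix_vector_mul_linear_gen] vector_scalar_commute)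
    also have "\<dots> = (\<Sum>k<Suc (length gs). c k *s ?vs ! k)" by (rule sum.cong) (simp_all only: vs lessThan_iff)
    also have "\<dots> = x - ?xA" by (simp only: Finite_Cartesian_Product.vec_eq_iff c sum_component vector_smult_component simp_thms)
    finally show ?thesis by simp
  qed
  have MxA: "?M *v ?xA = (\<chi> i. of_real (xs $ i))"
  proof -
    have "?M *v ?xA = (\<chi> i. complex_of_real ((A *v xA A) $ i))"
      by (simp add: Finite_Cartesian_Product.vec_eq_iff matrix_vector_mult_def complexify_def)
    then show ?thesis by (simp add: A_inv[OF A(1)])
  qed
  have "?M *v x - (\<chi> i. of_real (xs $ i)) = ?M *v (?B *v q)"
    unfolding xq[symmetric] matrix_vector_mult_diff_distrib MxA ..
  then have "fst (kkt_map_x ?ps e xs (x, c', ?M)) = 0" by (simp add: kkt_map_x_def kkt_map_def q_def)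
  moreover have "snd (kkt_map_x ?ps e xs (x, c', ?M)) $ a = 0" if a: "a \<noteq> e 0" for a
  proof (cases "a \<in> e ` {1..<length ?ps}")
    case True
    then obtain k where k: "k \<in> {1..<Suc (length gs)}" "a = e k" by auto
    then have inv: "the_inv_into {..<Suc (length gs)} e a = k" using the_inv_into_f_f[OF e] by simp
    have "gs ! (k - 1) \<in> set gs" using k(1) by (intro nth_mem) auto
    then have "peval (gs ! (k - 1)) (?M *v x) = 0" using feas by (simp add: feasible_in_def peval_linear_subst_complex)
    then show ?thesis using True inv k(1) by (simp add: kkt_map_x_def kkt_map_def nth_Cons')
  next
    case False
    have "a \<notin> e ` {..<Suc (length gs)}"
    proof
      assume "a \<in> e ` {..<Suc (length gs)}"
      then obtain k where k: "k < Suc (length gs)" "a = e k" by blast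
      then show False using a False by (cases k) auto
    qed
    then have "c' $ a = 0" by (simp add: c'_def)
    with False show ?thesis by (simp add: kkt_map_x_def kkt_map_def)
  qed
  moreover have "q \<noteq> 0"
  proof
    assume "q = 0"
    then have "x = ?xA" using xq by simp
    moreover have "?xA \<in> V_C (ideal_Sigma (fA A) (gA A))"
      unfolding zero_set_of_real by (rule kkt_point.ideal_set_members(1)[OF kkt_point_transfer[OF A(1)]])
    ultimately show False using x by blast
  qed
  moreover have "\<not> col_dep (\<lambda>k i. peval (partial_deriv i (?ps ! Suc k)) (?M *v x)) (length ?ps - 1)"
  proof
    assume "col_dep (\<lambda>k i. peval (partial_deriv i (?ps ! Suc k)) (?M *v x)) (length ?ps - 1)"
    then obtain d k where d: "k < length gs" "d k \<noteq> 0"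
      "\<And>i. (\<Sum>k<length gs. d k * peval (partial_deriv i (gs ! k)) (?M *v x)) = 0" by (auto simp: col_dep_def)
    have "(\<Sum>k<length gs. d k * tl ?vs ! k $ i) = 0" for i
    proof -
      have "(\<Sum>k<length gs. d k * tl ?vs ! k $ i)
        = (\<Sum>k<length gs. \<Sum>l\<in>UNIV. ?B $ i $ l * (d k * peval (partial_deriv l (gs ! k)) (?M *v x)))"
      proof (rule sum.cong)
        fix k assume "k \<in> {..<length gs}"
        then have "tl ?vs ! k = ?B *v pgrad_at (gs ! k) (?M *v x)" using vs[of "Suc k"] by simp
        then have "tl ?vs ! k $ i = (\<Sum>l\<in>UNIV. ?B $ i $ l * peval (partial_deriv l (gs ! k)) (?M *v x))"
          by (simp only: matrix_vector_mult_def[of ?B] pgrad_at_def vec_lambda_beta)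
        then show "d k * tl ?vs ! k $ i = (\<Sum>l\<in>UNIV. ?B $ i $ l * (d k * peval (partial_deriv l (gs ! k)) (?M *v x)))"
          by (simp only: sum_distrib_left mult.left_commute)
      qed simp
      also have "\<dots> = 0" by (subst sum.swap) (simp add: sum_distrib_left[symmetric] d(3))
      finally show ?thesis .
    qed
    then have "vec_dep (tl ?vs)" using d(1,2) unfolding vec_dep_def col_dep_def by auto
    then show False using indep vec_dep_ConsI[of "tl ?vs"] by simp
  qed
  ultimately show ?thesis using F A(2) unfolding q_def by blast
qed

text \<open>With the entries of \<open>A\<close> in the matrix slots and constants from
  \<open>w0\<close> in the equation slots, the relation \<open>F i j\<close> becomes a polynomial in
  \<open>x $ i\<close> and \<open>x $ j\<close>. It vanishes on Gamma off Sigma, hence lies in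
  \<open>ideal_G\<close>, and the choice of \<open>E\<close> makes it nonzero.\<close>

lemma step1_success_generic:
  "\<exists>E. complex_zariski_open E \<and> E \<noteq> {} \<and> (\<forall>M\<in>E. invertible M) \<and>
    (\<forall>A. complexify A \<in> E \<longrightarrow> step1_success (fA A) (gA A) (xA A))"
proof -
  have "card {..<Suc (length gs)} \<le> CARD('n)" using few zero_less_card_finite[where 'a = 'n] unfolding card_lessThan by linarith
  then obtain e :: "nat \<Rightarrow> 'n" where e: "inj_on e {..<Suc (length gs)}"
    using card_le_inj[of "{..<Suc (length gs)}" "UNIV :: 'n set"] by auto
  define good where "good i j F \<longleftrightarrow> (\<forall>x c A b. invertible A \<and>
      \<not> col_dep (\<lambda>k i. peval (partial_deriv i ((f # gs) ! Suc k)) (A *v x)) (length (f # gs) - 1) \<and>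
      grad_comb (f # gs) e (A *v x) c \<noteq> 0 \<and> fst (kkt_map_x (f # gs) e xs (x, c, A)) = 0 \<and>
      (\<forall>a. a \<noteq> e 0 \<longrightarrow> snd (kkt_map_x (f # gs) e xs (x, c, A)) $ a = 0) \<longrightarrow>
      peval F (kkt_vals i j (e 0) b (x, c, A)) = 0)" for i j and F :: "((('n + 'n) + ('n \<times> 'n)) option, real) mpoly"
  have "\<exists>F. F \<noteq> 0 \<and> good i j F" for i j
    unfolding good_def by (rule relation_on_kkt_family) (use e in simp_all)
  then obtain F where F: "\<And>i j. F i j \<noteq> 0" "\<And>i j. good i j (F i j)" by metis
  define Q where "Q = insert det_poly ((\<lambda>(i, j). F i j) ` UNIV)"
  have Q: "finite Q" "0 \<notin> Q" using F(1) det_poly_nonzero by (auto simp: Q_def)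
  \<comment> \<open>\<open>w0\<close> serves twice: its matrix entries form an element of
    \<open>E\<close>, and entries outside the matrix slots are the constants substituted
    later.\<close>
  obtain w0 where w0: "\<forall>p\<in>Q. peval p (w0 :: real ^ _) \<noteq> 0" using exists_common_nonvanishing[OF Q] by blast
  define E where "E = {M. \<forall>p\<in>Q. peval p (substitute_matrix w0 M) \<noteq> 0}"
  have "complex_zariski_open E" unfolding E_def by (rule zariski_open_substitute_matrix[OF Q(1)])
  moreover have "E \<noteq> {}"
  proof -
    have "substitute_matrix w0 (\<chi> a b. complex_of_real (w0 $ Some (Inr (a, b)))) = (\<chi> w. of_real (w0 $ w))"
      by (auto simp: substitute_matrix_def Finite_Cartesian_Product.vec_eq_iff split: option.split sum.split)
    then have "(\<chi> a b. complex_of_real (w0 $ Some (Inr (a, b)))) \<in> E" using w0 by (simp add: E_def peval_of_real)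
    then show ?thesis by blast
  qed
  moreover have inv: "invertible M" if "M \<in> E" for M
  proof -
    have "peval det_poly (substitute_matrix w0 M) \<noteq> 0" using that by (simp add: E_def Q_def)
    moreover have "(\<chi> a b. substitute_matrix w0 M $ Some (Inr (a, b))) = M"
      by (simp add: substitute_matrix_def Finite_Cartesian_Product.vec_eq_iff)
    ultimately show ?thesis by (simp add: peval_det_poly invertible_det_nz)
  qed
  moreover have "step1_success (fA A) (gA A) (xA A)" if AE: "complexify A \<in> E" for A
  proof -
    have Ainv: "invertible A" using inv[OF AE] by (simp add: invertible_det_nz det_of_complexify)
    interpret tr: kkt_point "fA A" "gA A" "xA A" by (rule kkt_point_transfer[OF Ainv])
    have sub: "mpoly_module.subspace (ideal_G (fA A) (gA A) (xA A))"
      unfolding ideal_G_def by (rule subspace_vanishing_ideal)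
    have "has_hilbert_dim (ideal_G (fA A) (gA A) (xA A)) 1"
    proof (rule has_hilbert_dim_1I[OF sub])
      show "infinite (std_monoms (ideal_G (fA A) (gA A) (xA A)))"
        by (rule infinite_std_monoms[OF sub tr.infinite_V_R_G])
      fix i j :: 'n assume ij: "i \<noteq> j"
      define \<phi> :: "(('n + 'n) + ('n \<times> 'n)) option \<Rightarrow> ('n, real) mpoly" where
        "\<phi> w = (case w of None \<Rightarrow> Var j | Some (Inl (Inl a)) \<Rightarrow> Const (w0 $ w)
          | Some (Inl (Inr a)) \<Rightarrow> if a = e 0 then Var i else Const (w0 $ w) | Some (Inr (a, b)) \<Rightarrow> Const (A $ a $ b))" for w
      define p where "p = eval_with Const (F i j) \<phi>"
      define b where "b = ((\<chi> a. complex_of_real (w0 $ Some (Inl (Inl a)))) :: complex ^ 'n, (\<chi> a. complex_of_real (w0 $ Some (Inl (Inr a)))) :: complex ^ 'n)"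
      have p: "peval p x = peval (F i j) (kkt_vals i j (e 0) b (x, c, complexify A))" for x c
      proof -
        have "(\<chi> w. peval (\<phi> w) x) = kkt_vals i j (e 0) b (x, c, complexify A)"
          by (auto simp: \<phi>_def kkt_vals_def b_def complexify_def Finite_Cartesian_Product.vec_eq_iff split: option.split sum.split)
        then show ?thesis by (simp add: p_def peval_subst)
      qed
      have "only_vars {i, j} (\<phi> w)" for w
        by (auto simp: \<phi>_def only_vars_Const only_vars_Var split: option.split sum.split)
      then have "only_vars {i, j} p" unfolding p_def by (rule only_vars_eval_with_Const)
      then have keys: "\<forall>m\<in>Poly_Mapping.keys p. \<forall>k. k \<noteq> i \<longrightarrow> k \<noteq> j \<longrightarrow> expo m k = 0" by (simp add: only_vars_def)
      have "p \<noteq> 0"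
      proof
        assume "p = 0"
        \<comment> \<open>At this point \<open>kkt_vals\<close> reproduces \<open>w0\<close> with
          the matrix entries replaced by those of \<open>A\<close>, where \<open>F i j\<close> does
          not vanish. The coordinates \<open>i\<close> and \<open>j\<close> can be prescribed
          separately because they differ.\<close>
        define x :: "complex ^ 'n" where "x = (\<chi> k. if k = i then of_real (w0 $ Some (Inl (Inr (e 0)))) else of_real (w0 $ None))"
        have "kkt_vals i j (e 0) b (x, 0, complexify A) = substitute_matrix w0 (complexify A)"
          using ij by (auto simp: kkt_vals_def substitute_matrix_def b_def x_def Finite_Cartesian_Product.vec_eq_iff split: option.split sum.split)
        then have "peval (F i j) (substitute_matrix w0 (complexify A)) = 0" using p[of x 0] \<open>p = 0\<close> by simp
        then show False using AE by (auto simp: E_def Q_def)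
      qed
      moreover have "peval p x = 0" if x: "x \<in> V_C (ideal_Gamma (fA A) (gA A) (xA A)) - V_C (ideal_Sigma (fA A) (gA A))" for x
      proof -
        obtain c where c: "\<forall>b. peval (F i j) (kkt_vals i j (e 0) b (x, c, complexify A)) = 0"
          using kkt_relation[OF e F(2)[of i j, unfolded good_def] Ainv inv[OF AE] x] by (elim exE)
        then show ?thesis using c[rule_format, of b] p[of x c] by simp
      qed
      then have "p \<in> ideal_G (fA A) (gA A) (xA A)"
        unfolding ideal_G_def zariski_closure_def vanishing_ideal_def zero_set_def by blast
      ultimately show "\<exists>p\<in>ideal_G (fA A) (gA A) (xA A). p \<noteq> 0 \<and>
          (\<forall>m\<in>Poly_Mapping.keys p. \<forall>k. k \<noteq> i \<longrightarrow> k \<noteq> j \<longrightarrow> expo m k = 0)"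
        using keys by blast
    qed
    then show ?thesis by (simp add: step1_success_def)
  qed
  ultimately show ?thesis by blast
qed

end

theorem theorem5p2:
  fixes f :: "('n::finite, real) mpoly"
    and gs :: "('n, real) mpoly list"
    and xs :: "real ^ 'n"
  assumes "length gs \<le> CARD('n) - 1"
    and "xs \<in> feasible_set gs"
    and "xs isolated_in (kkt_set f gs)"
    and "\<not> xs isolated_in (feasible_set gs)"
    and "LICQ gs xs"
  shows
    "(\<exists>E :: (complex ^ 'n ^ 'n) set.
        complex_zariski_open E \<and> E \<noteq> {} \<and> (\<forall>M\<in>E. invertible M) \<and>
        (\<forall>A :: real ^ 'n ^ 'n. complexify A \<in> E \<longrightarrow>
           step1_success (linear_subst A f) (map (linear_subst A) gs) (matrix_inv A *v xs)))
     \<and>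
     (\<forall>(A :: real ^ 'n ^ 'n) fA gA xA I.
        invertible A \<and>
        fA = linear_subst A f \<and> gA = map (linear_subst A) gs \<and> xA = matrix_inv A *v xs \<and>
        step1_success fA gA xA \<and> I = step1_ideal fA gA xA \<longrightarrow>
        (\<exists>R1. step2_radius fA gA xA R1) \<and>
        (\<exists>R2. step3_radius I xA R2) \<and>
        (\<forall>R1 R2 r.
           step2_radius fA gA xA R1 \<and> step3_radius I xA R2 \<and> 0 < r \<and> r < min R1 R2 \<longrightarrow>
           (\<exists>fmin fmax t.
              is_min_value (peval fA) (tangency_set fA gA xA \<inter> sphere xA r) fmin \<and>
              is_max_value (peval fA) (tangency_set fA gA xA \<inter> sphere xA r) fmax \<and>
              step5 fmin fmax (peval fA xA) = Some t \<and>
              (\<forall>t'. has_type f gs xs t' \<longleftrightarrow> t' = t)) \<and>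
           faithful_radius fA gA xA r \<and>
           condition_C fA gA xA r))"
proof (intro conjI allI impI)
  interpret kkt_point f gs xs by unfold_locales (rule assms)+
  show "\<exists>E. complex_zariski_open E \<and> E \<noteq> {} \<and> (\<forall>M\<in>E. invertible M) \<and>
      (\<forall>A. complexify A \<in> E \<longrightarrow>
         step1_success (linear_subst A f) (map (linear_subst A) gs) (matrix_inv A *v xs))"
    by (rule step1_success_generic)
  fix A :: "real ^ 'n ^ 'n" and fA gA xA I
  assume H: "invertible A \<and> fA = linear_subst A f \<and> gA = map (linear_subst A) gs \<and>
    xA = matrix_inv A *v xs \<and> step1_success fA gA xA \<and> I = step1_ideal fA gA xA"
  then interpret tr: kkt_point fA gA xA using kkt_point_transfer by blast
  show "\<exists>R1. step2_radius fA gA xA R1" by (rule tr.step2_radius_exists)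
  show "\<exists>R2. step3_radius I xA R2" using H tr.step3_radius_exists by blast
  fix R1 R2 r
  assume R: "step2_radius fA gA xA R1 \<and> step3_radius I xA R2 \<and> 0 < r \<and> r < min R1 R2"
  then have R': "step2_radius fA gA xA R1" "step3_radius (step1_ideal fA gA xA) xA R2" "0 < r" "r < min R1 R2"
    using H by blast+
  have "has_type fA gA xA t \<longleftrightarrow> has_type f gs xs t" for t
    using H has_type_transfer by blast
  then show "\<exists>fmin fmax t. is_min_value (peval fA) (tangency_set fA gA xA \<inter> sphere xA r) fmin \<and>
      is_max_value (peval fA) (tangency_set fA gA xA \<inter> sphere xA r) fmax \<and>
      step5 fmin fmax (peval fA xA) = Some t \<and> (\<forall>t'. has_type f gs xs t' \<longleftrightarrow> t' = t)"
    using tr.algorithm_correct(1)[OF R'] by simp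
  show "faithful_radius fA gA xA r" "condition_C fA gA xA r"
    by (rule tr.algorithm_correct(2,3)[OF R'])+
qed

end
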